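(* Let $r\ge 2$ be an integer and let $\{a_k\}_{k\ge 1}$ be a deterministic real sequence. Put $A_n:=\sum_{k=1}^n a_k^2$, and suppose that $A_n\to\infty$ as $n\to\infty$ and that $a_n^2=O(A_n^{1-\delta})$ as $n\to\infty$ for some $\delta\in(0,1]$. Let $f_{r,a}$, $V_n$ and $m(h)$ be as defined in the context. Then there exists a probability measure $\nu$ on $(\mathbb{T}^1\times[0,1),\ \mathcal{B}(\mathbb{T}^1)\otimes\mathcal{B}([0,1)))$ such that on the resulting probability space there are defined a random variable $U$ uniformly distributed over $\mathbb{T}^1$ and a standard Brownian motion $\{B(t):t\ge 0\}$ satisfying, for each $\lambda<\delta/32$, $$f_{r,a}(U+h)-f_{r,a}(U)=h\cdot B\bigl(V_{m(h)}\bigr)+o\bigl(h\cdot V_{m(h)}^{\frac12-\lambda}\bigr)\quad\text{as } h\to 0,\ \nu\text{-a.s.}$$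
   Context: $d(x)$ denotes the distance from $x\in\mathbb{R}$ to its nearest integer. For an integer $r\ge2$ and a real sequence $\{a_k\}$, the Takagi--van der Waerden class function is $$f_{r,a}(x):=\sum_{k=1}^\infty \frac{a_k}{r^{k-1}}\,d(r^{k-1}x).$$ (The assumptions $A_n\to\infty$ and $a_n^2=O(A_n^{1-\delta})$ imply $\sum_k |a_k| r^{-(k-1)}<\infty$, so the series converges uniformly and $f_{r,a}$ is continuous.) Since $d$ is $1$-periodic, $f_{r,a}$ is regarded as a function on $\mathbb{T}^1:=\mathbb{R}/\mathbb{Z}$, equipped with the Lebesgue measure $\mu$. $\mathcal{B}(X)$ denotes the Borel $\sigma$-field of $X$. Let $\psi_k(x):=r^{-(k-1)}d(r^{k-1}x)$, let $\psi_k^+(x)$ be the right-hand derivative of $\psi_k$ at $x$, and let $w_n(x):=\sum_{k=1}^n a_k\psi_k^+(x)$ for $x\in[0,1)$. Set $V_n:=\int_0^1 (w_n(x))^2\,\mu(dx)$. For $|h|\in(0,1)$ put $m(h):=\lfloor\log_r(1/|h|)\rfloor$. *)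

theory Defs
  imports "HOL-Probability.Probability" "HOL-Library.Landau_Symbols"
begin

section \<open>The one-dimensional torus\<close>

text \<open>The quotient group of the reals by the integers, with the quotient topology, so that
  \<open>borel :: torus measure\<close> is its Borel sigma-field.\<close>

quotient_type torus = real / "\<lambda>x y :: real. x - y \<in> \<int>"
  morphisms rep_torus to_torus
proof (rule equivpI)
  show "reflp (\<lambda>x y :: real. x - y \<in> \<int>)"
    by (simp add: reflp_def)
  show "symp (\<lambda>x y :: real. x - y \<in> \<int>)"
    by (auto simp: symp_def) (metis Ints_minus minus_diff_eq)
  show "transp (\<lambda>x y :: real. x - y \<in> \<int>)"
    by (auto simp: transp_def) (metis Ints_add diff_add_cancel add_diff_eq)
qed

instantiation torus :: ab_group_add
begin

lift_definition zero_torus :: torus is "0 :: real" .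

lift_definition plus_torus :: "torus \<Rightarrow> torus \<Rightarrow> torus" is "(+) :: real \<Rightarrow> real \<Rightarrow> real"
  by (metis Ints_add add_diff_add)

lift_definition minus_torus :: "torus \<Rightarrow> torus \<Rightarrow> torus" is "(-) :: real \<Rightarrow> real \<Rightarrow> real"
proof -
  fix x x' y y' :: real
  assume "x - x' \<in> \<int>" "y - y' \<in> \<int>"
  hence "(x - x') - (y - y') \<in> \<int>" by (rule Ints_diff)
  thus "x - y - (x' - y') \<in> \<int>" by (simp add: algebra_simps)
qed

lift_definition uminus_torus :: "torus \<Rightarrow> torus" is "uminus :: real \<Rightarrow> real"
proof -
  fix x x' :: real
  assume "x - x' \<in> \<int>"
  hence "- (x - x') \<in> \<int>" by (rule Ints_minus)
  thus "- x - - x' \<in> \<int>" by simp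
qed

instance
  by standard (transfer; simp)+

end

instantiation torus :: topological_space
begin

definition open_torus :: "torus set \<Rightarrow> bool" where
  "open_torus S \<longleftrightarrow> open (to_torus -` S)"

instance
proof
  show "open (UNIV :: torus set)"
    by (simp add: open_torus_def)
  show "open (S \<inter> T)" if "open S" "open T" for S T :: "torus set"
    using that by (simp add: open_torus_def open_Int)
  show "open (\<Union>K)" if "\<forall>S\<in>K. open S" for K :: "torus set set"
    using that by (auto simp: open_torus_def vimage_Union intro!: open_UN)
qed

end

text \<open>Lebesgue measure on the torus, which is also its uniform distribution.\<close>

definition torus_measure :: "torus measure" where
  "torus_measure = distr (restrict_space lborel {0..<1}) borel to_torus"


section \<open>Takagi--van der Waerden class functions\<close>

definition dist_int :: "real \<Rightarrow> real" where
  "dist_int x = \<bar>x - of_int (round x)\<bar>"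

text \<open>Coefficient sequences are indexed from 1; the value \<open>a 0\<close> is never used.  In the series
  below the summation index is shifted, \<open>k\<close> standing for the index minus 1.\<close>

definition takagi_real :: "nat \<Rightarrow> (nat \<Rightarrow> real) \<Rightarrow> real \<Rightarrow> real" where
  "takagi_real r a x = (\<Sum>k. a (Suc k) / real r ^ k * dist_int (real r ^ k * x))"

lemma dist_int_cong:
  assumes "x - y \<in> \<int>"
  shows "dist_int x = dist_int y"
proof -
  from assms obtain n :: int where "x - y = of_int n"
    by (auto elim: Ints_cases)
  hence x: "x = y + of_int n"
    by simp
  have "round (y + of_int n) = round y + n"
    unfolding round_def by linarith
  thus ?thesis
    by (simp add: dist_int_def x)
qed

lift_definition takagi :: "nat \<Rightarrow> (nat \<Rightarrow> real) \<Rightarrow> torus \<Rightarrow> real" is takagi_real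
proof -
  fix r :: nat and a :: "nat \<Rightarrow> real" and x y :: real
  assume xy: "x - y \<in> \<int>"
  have "dist_int (real r ^ k * x) = dist_int (real r ^ k * y)" for k
  proof (rule dist_int_cong)
    have "real r ^ k * (x - y) \<in> \<int>"
      using xy by (intro Ints_mult Ints_power Ints_of_nat)
    thus "real r ^ k * x - real r ^ k * y \<in> \<int>"
      by (simp add: algebra_simps)
  qed
  thus "takagi_real r a x = takagi_real r a y"
    by (simp add: takagi_real_def)
qed

definition sum_sq :: "(nat \<Rightarrow> real) \<Rightarrow> nat \<Rightarrow> real" where
  "sum_sq a n = (\<Sum>k=1..n. (a k)\<^sup>2)"

definition psi :: "nat \<Rightarrow> nat \<Rightarrow> real \<Rightarrow> real" where
  "psi r k x = dist_int (real r ^ (k - 1) * x) / real r ^ (k - 1)"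

definition psi_right_deriv :: "nat \<Rightarrow> nat \<Rightarrow> real \<Rightarrow> real" where
  "psi_right_deriv r k x = vector_derivative (psi r k) (at_right x)"

definition takagi_w :: "nat \<Rightarrow> (nat \<Rightarrow> real) \<Rightarrow> nat \<Rightarrow> real \<Rightarrow> real" where
  "takagi_w r a n x = (\<Sum>k=1..n. a k * psi_right_deriv r k x)"

definition takagi_V :: "nat \<Rightarrow> (nat \<Rightarrow> real) \<Rightarrow> nat \<Rightarrow> real" where
  "takagi_V r a n = (LBINT x:{0..<1}. (takagi_w r a n x)\<^sup>2)"

text \<open>Only meaningful for \<open>0 < \<bar>h\<bar> < 1\<close>, where the floor is nonnegative.\<close>

definition log_scale :: "nat \<Rightarrow> real \<Rightarrow> nat" where
  "log_scale r h = nat \<lfloor>log (real r) (1 / \<bar>h\<bar>)\<rfloor>"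


section \<open>Brownian motion\<close>

text \<open>The time set is \<open>{0..}\<close>; values of \<open>B\<close> at negative times are irrelevant.\<close>

definition standard_brownian_motion :: "'a measure \<Rightarrow> (real \<Rightarrow> 'a \<Rightarrow> real) \<Rightarrow> bool" where
  "standard_brownian_motion M B \<longleftrightarrow>
     prob_space M \<and>
     (\<forall>t\<ge>0. B t \<in> borel_measurable M) \<and>
     (AE \<omega> in M. B 0 \<omega> = 0) \<and>
     (\<forall>t :: nat \<Rightarrow> real. 0 \<le> t 0 \<longrightarrow> mono t \<longrightarrow>
        (\<forall>n. prob_space.indep_vars M (\<lambda>_. borel)
               (\<lambda>i \<omega>. B (t (Suc i)) \<omega> - B (t i) \<omega>) {..<n})) \<and>
     (\<forall>s t. 0 \<le> s \<longrightarrow> s < t \<longrightarrow>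
        distributed M lborel (\<lambda>\<omega>. B t \<omega> - B s \<omega>) (normal_density 0 (sqrt (t - s)))) \<and>
     (AE \<omega> in M. continuous_on {0..} (\<lambda>t. B t \<omega>))"

end

theory Submission
  imports Defs
begin

text \<open>
  The right-hand derivatives \<open>w\<^sub>m(U)\<close> are weighted sums of the signs \<open>e\<^sub>i = \<plusminus>1\<close> recording in which half of
  the unit interval the fractional part of \<open>r\<^sup>i U\<close> lies; given the past, the mean of \<open>e\<^sub>i\<^sub>+\<^sub>1\<close> is
  \<open>\<rho> e\<^sub>i\<close> with \<open>\<rho> \<le> 1/3\<close>. An increment of \<open>f\<close> over \<open>h\<close> is \<open>h w\<^sub>m(U)\<close> up to those indices whose kink is
  close to \<open>U\<close>, and these are rare.

  The indices are cut into blocks at which the variance passes \<open>j powr (8/\<delta>)\<close>. A Lindeberg type argument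
  bounds the transport distance of each block sum from a normal variable, and the monotone rearrangement of the uniform
  variable attains this distance. Conversely, independent uniform variables, one for each block, are concatenated
  digit by digit into a single uniform point \<open>U\<close>, whose block sums differ from the original ones only through carries
  near the end of a block. The coupling errors are independent and centred, so the Rademacher--Menshov inequality
  controls their partial sums; a chaining inequality controls the fluctuation inside a block, and the
  Schauder expansion of the Brownian path controls that of \<open>B\<close>.
\<close>

section \<open>Independence through joint characteristic functions\<close>

text \<open>The range of \<open>l\<close> comes from the oscillation inside a block. With p =
  8/\<delta> and block ends at times j^p, the tolerated error at block j is j^(p/2 - p*l), and l <
  \<delta>/32 keeps this exponent above p/2 - 1/4. Both paths move by about j^((p-1)/2) within a
  block; fourth moments of order j^(2p-2) are compared with j^(4 (p/2 - 1/4)) = j^(2p-1), and the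
  quotient j^(-1) is exactly the borderline of summability. The coupling errors have mean squares of
  order j^(p - 16/9), which leaves room for the logarithms lost in their maximal inequality. The
  obstacle is that one point of the torus must serve all blocks at once while the normal increments
  stay independent. The construction therefore starts from the Gaussian coefficients: each block
  derives its uniform variable from the Gaussian increment over that block, and the point is
  assembled from these. On the prescribed sample space only the interval coordinate carries
  randomness; it encodes the whole Gaussian family. A second difficulty is that the variance need
  not increase with the index, so that an index of block j can have a variance below the time at
  which the block begins.\<close>

lemma (in prob_space) char_tilt_nonneg:
  fixes Z X :: "'a \<Rightarrow> real" and N :: "real measure"
  assumes Z[measurable]: "Z \<in> borel_measurable M" and X[measurable]: "X \<in> borel_measurable M"
    and Zb: "\<And>\<omega>. 0 \<le> Z \<omega>" "\<And>\<omega>. Z \<omega> \<le> K"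
    and N: "real_distribution N"
    and ch: "\<And>s. (CLINT \<omega>|M. complex_of_real (Z \<omega>) * iexp (s * X \<omega>)) = of_real (expectation Z) * char N s"
    and B[measurable]: "B \<in> sets borel"
  shows "expectation (\<lambda>\<omega>. Z \<omega> * indicator B (X \<omega>)) = expectation Z * measure N B"
proof -
  have intZ: "integrable M Z"
    by (rule integrable_const_bound[of _ K]) (use Zb in auto)
  show ?thesis
  proof (cases "expectation Z = 0")
    case True
    have "AE \<omega> in M. Z \<omega> = 0"
      using integral_nonneg_eq_0_iff_AE[OF intZ] Zb True by auto
    then have "AE \<omega> in M. Z \<omega> * indicator B (X \<omega>) = 0" by auto
    then have "expectation (\<lambda>\<omega>. Z \<omega> * indicator B (X \<omega>)) = expectation (\<lambda>\<omega>. 0)"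
      by (intro integral_cong_AE) auto
    then show ?thesis using True by simp
  next
    case False
    define c where "c = expectation Z"
    have c0: "c > 0" using False Zb by (auto simp: c_def less_le intro!: integral_nonneg)
    \<comment> \<open>Reweighting the probability by Z / c turns the hypothesis into a statement
      about the law of X alone, to which one-dimensional uniqueness applies.\<close>
    define Q where "Q = density M (\<lambda>\<omega>. ennreal (Z \<omega> / c))"
    have eQ: "emeasure Q (space Q) = 1"
    proof -
      have "emeasure Q (space Q) = (\<integral>\<^sup>+\<omega>. ennreal (Z \<omega> / c) \<partial>M)"
        unfolding Q_def by (subst emeasure_density) (auto intro!: nn_integral_cong)
      also have "\<dots> = ennreal (expectation (\<lambda>\<omega>. Z \<omega> / c))"
        using intZ Zb c0 by (intro nn_integral_eq_integral) auto
      also have "\<dots> = 1" using c0 by (simp add: c_def[symmetric])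
      finally show ?thesis .
    qed
    interpret Q: prob_space Q by (rule prob_spaceI) (rule eQ)
    have [measurable]: "X \<in> borel_measurable Q" "X \<in> Q \<rightarrow>\<^sub>M borel" by (auto simp: Q_def)
    have rd: "real_distribution (distr Q borel X)"
      by (intro Q.real_distribution_distr) auto
    have "char (distr Q borel X) s = char N s" for s
    proof -
      have "char (distr Q borel X) s = (CLINT \<omega>|Q. iexp (s * X \<omega>))"
        unfolding char_def by (subst integral_distr) auto
      also have "\<dots> = (CLINT \<omega>|M. (Z \<omega> / c) *\<^sub>R iexp (s * X \<omega>))"
        unfolding Q_def using Zb c0 by (subst integral_density) auto
      also have "\<dots> = (CLINT \<omega>|M. (complex_of_real (Z \<omega>) * iexp (s * X \<omega>)) / of_real c)"
        by (intro Bochner_Integration.integral_cong) (auto simp: scaleR_conv_of_real)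
      also have "\<dots> = char N s"
        using c0 by (simp add: ch c_def[symmetric] del: of_real_mult)
      finally show ?thesis .
    qed
    then have eq: "distr Q borel X = N"
      by (intro Levy_uniqueness rd N) auto
    have "measure N B = measure (distr Q borel X) B" by (simp add: eq)
    also have "\<dots> = (LINT \<omega>|Q. indicator B (X \<omega>))"
      by (subst measure_distr) (auto simp: indicator_vimage[symmetric] simp flip: indicator_inter_arith
         intro!: Bochner_Integration.integral_cong split: split_indicator)
    also have "\<dots> = (LINT \<omega>|M. (Z \<omega> / c) *\<^sub>R indicator B (X \<omega>))"
      unfolding Q_def using Zb c0 by (subst integral_density) auto
    also have "\<dots> = expectation (\<lambda>\<omega>. Z \<omega> * indicator B (X \<omega>)) / c"
      by (subst Bochner_Integration.integral_divide_zero[symmetric])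
        (auto intro!: Bochner_Integration.integral_cong)
    finally show ?thesis using c0 by (simp add: c_def)
  qed
qed

text \<open>Adding the constant K makes Re Z a nonnegative weight, and this constant is why the law
  of X itself enters as \<open>cX\<close>. The real part is half the sum of Z and its conjugate;
  conjugation turns the hypothesis at -s into one at s, since \<open>char N\<close> at -s is the
  conjugate of its value at s.\<close>

lemma (in prob_space) char_tilt_re:
  fixes Z :: "'a \<Rightarrow> complex" and X :: "'a \<Rightarrow> real" and N :: "real measure"
  assumes Z[measurable]: "Z \<in> borel_measurable M" and X[measurable]: "X \<in> borel_measurable M"
    and Zb: "\<And>\<omega>. norm (Z \<omega>) \<le> K"
    and N: "real_distribution N"
    and cX: "\<And>s. (CLINT \<omega>|M. iexp (s * X \<omega>)) = char N s"
    and ch: "\<And>s. (CLINT \<omega>|M. Z \<omega> * iexp (s * X \<omega>)) = (CLINT \<omega>|M. Z \<omega>) * char N s"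
    and B[measurable]: "B \<in> sets borel"
  shows "expectation (\<lambda>\<omega>. Re (Z \<omega>) * indicator B (X \<omega>)) = Re (CLINT \<omega>|M. Z \<omega>) * measure N B"
proof -
  interpret N: real_distribution N by (rule N)
  have iZ: "integrable M Z" by (rule integrable_const_bound[of _ K]) (use Zb in auto)
  have iZe: "integrable M (\<lambda>\<omega>. Z \<omega> * iexp (s * X \<omega>))" for s
    by (rule integrable_const_bound[of _ K]) (use Zb in \<open>auto simp: norm_mult\<close>)
  have ie: "integrable M (\<lambda>\<omega>. iexp (s * X \<omega>))" for s
    by (rule integrable_const_bound[of _ 1]) auto
  have iR: "integrable M (\<lambda>\<omega>. Re (Z \<omega>))" using iZ by (rule integrable_Re)
  have RZ: "\<bar>Re (Z \<omega>)\<bar> \<le> K" for \<omega> using Zb[of \<omega>] abs_Re_le_cmod order_trans by blast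
  define W where "W \<omega> = K + Re (Z \<omega>)" for \<omega>
  have iW: "integrable M W" unfolding W_def using iR by auto
  have EW: "expectation W = K + Re (CLINT \<omega>|M. Z \<omega>)"
    unfolding W_def using iR iZ by (subst Bochner_Integration.integral_add) (auto simp: prob_space)
  have cn: "cnj (char N (-s)) = char N s" for s
    proof -
    have "cnj (iexp ((- s) * x)) = iexp (s * x)" for x by (simp add: exp_cnj)
    then show ?thesis using Bochner_Integration.integral_cnj[of N "\<lambda>x. iexp ((- s) * x)"] unfolding char_def by (simp only:)
  qed
  define e where "e s \<omega> = iexp (s * X \<omega>)" for s \<omega>
  note ch' = ch[folded e_def] and cX' = cX[folded e_def] and iZe' = iZe[folded e_def] and ie' = ie[folded e_def]
  have ce: "cnj (e (- s) \<omega>) = e s \<omega>" for s \<omega> by (simp add: e_def exp_cnj)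
  have "(CLINT \<omega>|M. complex_of_real (W \<omega>) * iexp (s * X \<omega>)) = of_real (expectation W) * char N s" for s
  proof -
    have *: "complex_of_real (W \<omega>) * iexp (s * X \<omega>)
       = of_real K * e s \<omega> + (Z \<omega> * e s \<omega> + cnj (Z \<omega> * e (-s) \<omega>)) / 2" for \<omega>
    proof -
      have "cnj (Z \<omega> * e (-s) \<omega>) = cnj (Z \<omega>) * e s \<omega>" by (simp add: ce)
      moreover have "complex_of_real (Re (Z \<omega>)) = (Z \<omega> + cnj (Z \<omega>)) / 2"
        by (simp add: complex_add_cnj)
      ultimately show ?thesis unfolding W_def of_real_add e_def[symmetric]
        by (simp only: distrib_right add_divide_distrib times_divide_eq_left)
    qed
    have "(CLINT \<omega>|M. complex_of_real (W \<omega>) * iexp (s * X \<omega>)) =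
      of_real K * char N s + ((CLINT \<omega>|M. Z \<omega>) * char N s + cnj ((CLINT \<omega>|M. Z \<omega>) * char N (-s))) / 2"
      unfolding * using iZe'[of s] iZe'[of "-s"] ie'[of s]
      by (subst Bochner_Integration.integral_add)
         (auto simp: cX' ch' Bochner_Integration.integral_add integrable_cnj simp del: complex_cnj_mult)
    also have "\<dots> = (of_real K + ((CLINT \<omega>|M. Z \<omega>) + cnj (CLINT \<omega>|M. Z \<omega>)) / 2) * char N s"
      by (simp add: cn field_simps)
    also have "\<dots> = of_real (expectation W) * char N s"
      by (simp add: EW complex_add_cnj)
    finally show ?thesis .
  qed
  note hW = this
  have Wm: "W \<in> borel_measurable M" unfolding W_def by measurable
  have 1: "expectation (\<lambda>\<omega>. W \<omega> * indicator B (X \<omega>)) = expectation W * measure N B"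
    
  proof (intro char_tilt_nonneg[where K="2*K"] N B X)
    show "0 \<le> W \<omega>" "W \<omega> \<le> 2 * K" for \<omega> using RZ[of \<omega>] by (auto simp: W_def)
  qed (fact hW Wm)+
  have 2: "expectation (\<lambda>\<omega>. 1 * indicator B (X \<omega>)) = expectation (\<lambda>\<omega>. 1) * measure N B"
    by (rule char_tilt_nonneg[where K=1]) (auto simp: N cX[simplified] prob_space)
  have "expectation (\<lambda>\<omega>. W \<omega> * indicator B (X \<omega>)) =
      K * expectation (\<lambda>\<omega>. indicator B (X \<omega>)) + expectation (\<lambda>\<omega>. Re (Z \<omega>) * indicator B (X \<omega>))"
  proof -
    have "integrable M (\<lambda>\<omega>. Re (Z \<omega>) * indicator B (X \<omega>))"
      by (rule integrable_const_bound[of _ K]) (use RZ in \<open>auto simp: indicator_def\<close>, metis RZ abs_ge_zero order_trans)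
    moreover have "integrable M (\<lambda>\<omega>. K * (indicator B (X \<omega>) :: real))"
      by (rule integrable_const_bound[of _ "\<bar>K\<bar>"]) (auto simp: indicator_def)
    ultimately show ?thesis unfolding W_def by (simp add: distrib_right)
  qed
  with 1 2 show ?thesis by (simp add: EW prob_space algebra_simps)
qed

text \<open>The imaginary part of Z is the real part of -i Z, so the real case is applied
  twice.\<close>

lemma (in prob_space) char_tilt:
  fixes Z :: "'a \<Rightarrow> complex" and X :: "'a \<Rightarrow> real" and N :: "real measure"
  assumes Z[measurable]: "Z \<in> borel_measurable M" and X[measurable]: "X \<in> borel_measurable M"
    and Zb: "\<And>\<omega>. norm (Z \<omega>) \<le> K"
    and N: "real_distribution N"
    and cX: "\<And>s. (CLINT \<omega>|M. iexp (s * X \<omega>)) = char N s"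
    and ch: "\<And>s. (CLINT \<omega>|M. Z \<omega> * iexp (s * X \<omega>)) = (CLINT \<omega>|M. Z \<omega>) * char N s"
    and B[measurable]: "B \<in> sets borel"
  shows "(CLINT \<omega>|M. Z \<omega> * indicator B (X \<omega>)) = (CLINT \<omega>|M. Z \<omega>) * of_real (measure N B)"
proof -
  have i: "integrable M (\<lambda>\<omega>. Z \<omega> * indicator B (X \<omega>))"
    by (rule integrable_const_bound[of _ K]) (use Zb in \<open>auto simp: indicator_def\<close>, metis Zb norm_ge_zero order_trans)
  have r: "expectation (\<lambda>\<omega>. Re (Z \<omega>) * indicator B (X \<omega>)) = Re (CLINT \<omega>|M. Z \<omega>) * measure N B"
    by (rule char_tilt_re[OF Z X Zb N cX ch B])
  have "expectation (\<lambda>\<omega>. Re (- \<i> * Z \<omega>) * indicator B (X \<omega>)) = Re (CLINT \<omega>|M. - \<i> * Z \<omega>) * measure N B"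
  proof (rule char_tilt_re[where K=K])
    show "(CLINT \<omega>|M. - \<i> * Z \<omega> * iexp (s * X \<omega>)) = (CLINT \<omega>|M. - \<i> * Z \<omega>) * char N s" for s
      using ch[of s] by (simp add: mult.assoc)
  qed (use Zb N cX in \<open>auto simp: norm_mult\<close>)
  then have im: "expectation (\<lambda>\<omega>. Im (Z \<omega>) * indicator B (X \<omega>)) = Im (CLINT \<omega>|M. Z \<omega>) * measure N B"
    by simp
  show ?thesis
  proof (rule complex_eqI)
    have e: "Re (Z \<omega> * indicator B (X \<omega>)) = Re (Z \<omega>) * indicator B (X \<omega>)"
            "Im (Z \<omega> * indicator B (X \<omega>)) = Im (Z \<omega>) * indicator B (X \<omega>)" for \<omega>
      by (auto simp: indicator_def)
    show "Re (CLINT \<omega>|M. Z \<omega> * indicator B (X \<omega>)) = Re ((CLINT \<omega>|M. Z \<omega>) * of_real (measure N B))"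
      using r unfolding integral_Re[OF i, symmetric] e by simp
    show "Im (CLINT \<omega>|M. Z \<omega> * indicator B (X \<omega>)) = Im ((CLINT \<omega>|M. Z \<omega>) * of_real (measure N B))"
      using im unfolding integral_Im[OF i, symmetric] e by simp
  qed
qed

text \<open>Uniqueness is used only in dimension one: the exponential factors are exchanged for
  indicators one variable at a time, each exchange being an instance of \<open>char_tilt\<close>
  whose Z collects all other factors.\<close>

lemma (in prob_space) indep_vars_joint_char:
  fixes X :: "nat \<Rightarrow> 'a \<Rightarrow> real" and N :: "nat \<Rightarrow> real measure"
  assumes X[measurable]: "\<And>i. i < n \<Longrightarrow> X i \<in> borel_measurable M"
    and N: "\<And>i. i < n \<Longrightarrow> real_distribution (N i)"
    and ch: "\<And>\<theta>. (CLINT \<omega>|M. iexp (\<Sum>i<n. \<theta> i * X i \<omega>)) = (\<Prod>i<n. char (N i) (\<theta> i))"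
  shows "indep_vars (\<lambda>_. borel) X {..<n}" and "\<And>i. i < n \<Longrightarrow> distr M borel (X i) = N i"
proof -
  have N0: "char (N i) 0 = 1" if "i < n" for i
    using N[OF that] by (rule real_distribution.char_zero)
  have cX: "(CLINT \<omega>|M. iexp (s * X k \<omega>)) = char (N k) s" if k: "k < n" for k s
  proof -
    have "(\<Sum>i<n. (if i = k then s else 0) * X i \<omega>) = s * X k \<omega>" for \<omega>
      using k by (subst sum.remove[of _ k]) auto
    moreover have "(\<Prod>i<n. char (N i) (if i = k then s else 0)) = char (N k) s"
      using k N0 by (subst prod.remove[of _ k]) (auto intro!: prod.neutral)
    ultimately show ?thesis using ch[of "\<lambda>i. if i = k then s else 0"] by simp
  qed
  show dN: "distr M borel (X i) = N i" if "i < n" for i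
  proof (rule Levy_uniqueness)
    show "real_distribution (distr M borel (X i))" using that by (intro real_distribution_distr) auto
    show "char (distr M borel (X i)) = char (N i)"
      using cX[OF that] that by (auto simp: char_def integral_distr fun_eq_iff)
  qed (rule N[OF that])
  \<comment> \<open>The first k variables already carry indicators, the others still exponentials.
    The frequencies stay arbitrary in the induction because the next exchange needs the k-th one to
    vary freely.\<close>
  have step: "(CLINT \<omega>|M. (\<Prod>i<k. indicator (B i) (X i \<omega>)) * iexp (\<Sum>i=k..<n. \<theta> i * X i \<omega>))
        = (\<Prod>i<k. of_real (measure (N i) (B i))) * (\<Prod>i=k..<n. char (N i) (\<theta> i))"
    if "k \<le> n" "\<And>i. i < n \<Longrightarrow> B i \<in> sets borel" for k B \<theta>
    using that(1)
  proof (induction k arbitrary: \<theta>)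
    case 0
    then show ?case using ch[of \<theta>] by (simp add: lessThan_atLeast0)
  next
    case (Suc k)
    then have k: "k < n" by simp
    note [measurable] = that(2)
    define Z where "Z \<omega> = (\<Prod>i<k. indicator (B i) (X i \<omega>)) * iexp (\<Sum>i=Suc k..<n. \<theta> i * X i \<omega>)" for \<omega>
    have s: "(\<Prod>i<k. indicator (B i) (X i \<omega>)) * iexp (\<Sum>i=k..<n. (\<theta>(k:=s)) i * X i \<omega>) = Z \<omega> * iexp (s * X k \<omega>)" for s \<omega>
    proof -
      have "(\<Sum>i=k..<n. (\<theta>(k:=s)) i * X i \<omega>) = s * X k \<omega> + (\<Sum>i=Suc k..<n. \<theta> i * X i \<omega>)"
        using k by (subst sum.atLeast_Suc_lessThan) (auto intro!: sum.cong)
      then show ?thesis by (simp add: Z_def exp_add distrib_left)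
    qed
    have p: "(\<Prod>i=k..<n. char (N i) ((\<theta>(k:=s)) i)) = char (N k) s * (\<Prod>i=Suc k..<n. char (N i) (\<theta> i))" for s
      using k by (subst prod.atLeast_Suc_lessThan) (auto intro!: prod.cong)
    have E: "(CLINT \<omega>|M. Z \<omega> * iexp (s * X k \<omega>))
       = (\<Prod>i<k. of_real (measure (N i) (B i))) * (char (N k) s * (\<Prod>i=Suc k..<n. char (N i) (\<theta> i)))" for s
      using Suc.IH[of "\<theta>(k:=s)"] k unfolding s p by simp
    have E0: "(CLINT \<omega>|M. Z \<omega>) = (\<Prod>i<k. of_real (measure (N i) (B i))) * (\<Prod>i=Suc k..<n. char (N i) (\<theta> i))"
      using E[of 0] N0[OF k] by simp
    have [measurable]: "Z \<in> borel_measurable M"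
    proof -
      have "(\<lambda>\<omega>. \<Prod>i<k. indicator (B i) (X i \<omega>) :: complex) \<in> borel_measurable M"
        using k by (intro borel_measurable_prod) auto
      moreover have "(\<lambda>\<omega>. \<Sum>i=Suc k..<n. \<theta> i * X i \<omega>) \<in> borel_measurable M"
        by (intro borel_measurable_sum) auto
      ultimately show ?thesis unfolding Z_def by measurable
    qed
    have "(CLINT \<omega>|M. Z \<omega> * indicator (B k) (X k \<omega>)) = (CLINT \<omega>|M. Z \<omega>) * of_real (measure (N k) (B k))"
    proof (rule char_tilt[where K=1])
      show "norm (Z \<omega>) \<le> 1" for \<omega>
        unfolding Z_def norm_mult by (auto simp: prod_norm[symmetric] indicator_def intro!: prod_le_1)
    qed (use k N cX E E0 that in \<open>auto simp: mult_ac\<close>)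
    moreover have "Z \<omega> * indicator (B k) (X k \<omega>) =
      (\<Prod>i<Suc k. indicator (B i) (X i \<omega>)) * iexp (\<Sum>i=Suc k..<n. \<theta> i * X i \<omega>)" for \<omega>
      by (simp add: Z_def mult_ac)
    ultimately show ?case by (simp add: E0 mult_ac)
  qed
  show "indep_vars (\<lambda>_. borel) X {..<n}"
  proof (cases "n = 0")
    case True then show ?thesis by (auto simp: indep_vars_def indep_sets_def)
  next
    case False
    show ?thesis
    proof (rule iffD2[OF indep_vars_finite[where E="\<lambda>_. sets borel"]], goal_cases)
      case 8
      show ?case
      proof safe
      fix A :: "nat \<Rightarrow> real set" assume A: "A \<in> {..<n} \<rightarrow> sets borel"
      then have [measurable]: "i < n \<Longrightarrow> A i \<in> sets borel" for i by auto
      have "complex_of_real (prob (\<Inter>j\<in>{..<n}. X j -` A j \<inter> space M))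
         = (CLINT \<omega>|M. (\<Prod>i<n. indicator (A i) (X i \<omega>)))"
      proof -
        have m: "(\<Inter>j\<in>{..<n}. X j -` A j \<inter> space M) \<in> events"
          using False by (intro sets.finite_INT) auto
        have "(\<Prod>i<n. indicator (A i) (X i \<omega>)) = complex_of_real (indicator (\<Inter>j\<in>{..<n}. X j -` A j \<inter> space M) \<omega>)"
          if "\<omega> \<in> space M" for \<omega>
          using that False by (auto simp: indicator_def prod_zero_iff split: if_splits)
        then have "(CLINT \<omega>|M. (\<Prod>i<n. indicator (A i) (X i \<omega>))) = (CLINT \<omega>|M. complex_of_real (indicator (\<Inter>j\<in>{..<n}. X j -` A j \<inter> space M) \<omega>))"
          by (intro Bochner_Integration.integral_cong) auto
        then show ?thesis using m by simp
      qed
      also have "\<dots> = (\<Prod>i<n. of_real (measure (N i) (A i)))"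
        using step[of n A "\<lambda>_. 0"] A by auto
      also have "\<dots> = of_real (\<Prod>j<n. prob (X j -` A j \<inter> space M))"
        by (simp add: dN[symmetric] measure_distr)
      finally show "prob (\<Inter>j\<in>{..<n}. X j -` A j \<inter> space M) = (\<Prod>j\<in>{..<n}. prob (X j -` A j \<inter> space M))"
        by (simp only: of_real_eq_iff)
      qed
    qed (use False sets.sigma_sets_eq[of "borel :: real measure", symmetric] sets.Int_stable in auto)
  qed
qed

section \<open>Brownian motion from independent normal variables\<close>

text \<open>Hoelder's inequality with exponents 4 and 4/3, obtained from Cauchy-Schwarz applied
  twice. With geometric weights a sum over scales costs only a constant factor.\<close>

lemma weighted_power_mean_4:
  fixes x w :: "'i \<Rightarrow> real"
  assumes fin: "finite I" and w: "\<And>i. i \<in> I \<Longrightarrow> w i > 0"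
  shows "(\<Sum>i\<in>I. x i) ^ 4 \<le> (\<Sum>i\<in>I. w i) ^ 3 * (\<Sum>i\<in>I. x i ^ 4 / w i ^ 3)"
proof -
  have cs: "(\<Sum>i\<in>I. y i)\<^sup>2 \<le> (\<Sum>i\<in>I. w i) * (\<Sum>i\<in>I. (y i)\<^sup>2 / w i)" for y :: "'i \<Rightarrow> real"
  proof -
    have "(\<Sum>i\<in>I. y i) = (\<Sum>i\<in>I. sqrt (w i) * (y i / sqrt (w i)))"
      using w by (intro sum.cong) (auto simp: less_imp_neq[symmetric])
    then have "(\<Sum>i\<in>I. y i)\<^sup>2 \<le> (\<Sum>i\<in>I. (sqrt (w i))\<^sup>2) * (\<Sum>i\<in>I. (y i / sqrt (w i))\<^sup>2)"
      using Cauchy_Schwarz_ineq_sum[of "\<lambda>i. sqrt (w i)" "\<lambda>i. y i / sqrt (w i)" I] by simp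
    also have "\<dots> = (\<Sum>i\<in>I. w i) * (\<Sum>i\<in>I. (y i)\<^sup>2 / w i)"
      using w by (intro arg_cong2[where f="(*)"] sum.cong) (auto simp: power_divide less_imp_le)
    finally show ?thesis .
  qed
  have W: "(\<Sum>i\<in>I. w i) \<ge> 0" using w by (intro sum_nonneg) (auto intro: less_imp_le)
  have "(\<Sum>i\<in>I. x i) ^ 4 = ((\<Sum>i\<in>I. x i)\<^sup>2)\<^sup>2" by simp
  also have "\<dots> \<le> ((\<Sum>i\<in>I. w i) * (\<Sum>i\<in>I. (x i)\<^sup>2 / w i))\<^sup>2"
    by (intro power_mono cs) auto
  also have "\<dots> = (\<Sum>i\<in>I. w i)\<^sup>2 * (\<Sum>i\<in>I. (x i)\<^sup>2 / w i)\<^sup>2" by (simp add: power_mult_distrib)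
  also have "\<dots> \<le> (\<Sum>i\<in>I. w i)\<^sup>2 * ((\<Sum>i\<in>I. w i) * (\<Sum>i\<in>I. ((x i)\<^sup>2 / w i)\<^sup>2 / w i))"
    by (intro mult_left_mono cs) auto
  also have "\<dots> = (\<Sum>i\<in>I. w i) ^ 3 * (\<Sum>i\<in>I. x i ^ 4 / w i ^ 3)"
    by (simp add: power_divide power2_eq_square power3_eq_cube power4_eq_xxxx mult_ac)
  finally show ?thesis .
qed

section \<open>Haar-Schauder functions and the covariance of Brownian motion\<close>

definition clamp01 :: "real \<Rightarrow> real" where "clamp01 s = max 0 (min 1 s)"

definition tent :: "real \<Rightarrow> real" where "tent s = min (clamp01 s) (1 - clamp01 s)"

text \<open>Primitives of the Haar functions of the unit interval, continued by constants outside
  it. Level 0 is the linear function; truncated subtraction gives it exactly one index, as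
  \<open>2 ^ (0 - 1) = 1\<close>.\<close>

definition schauder :: "nat \<Rightarrow> nat \<Rightarrow> real \<Rightarrow> real" where
  "schauder l i s = (if l = 0 then clamp01 s else (1 / sqrt 2) ^ (l - 1) * tent (2 ^ (l - 1) * s - real i))"

text \<open>Covariance of the Brownian bridge on the unit interval, extended by zero.\<close>

definition bridge_cov :: "real \<Rightarrow> real \<Rightarrow> real" where
  "bridge_cov s t = min (clamp01 s) (clamp01 t) - clamp01 s * clamp01 t"

lemma clamp01_bounds: "0 \<le> clamp01 s" "clamp01 s \<le> 1" by (auto simp: clamp01_def)

lemma tent_bounds: "0 \<le> tent s" "tent s \<le> 1" using clamp01_bounds[of s] by (auto simp: tent_def)

lemma tent_eq_0: "s \<le> 0 \<or> 1 \<le> s \<Longrightarrow> tent s = 0" by (auto simp: tent_def clamp01_def)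

lemma continuous_clamp01 [continuous_intros]: "continuous_on A f \<Longrightarrow> continuous_on A (\<lambda>x. clamp01 (f x))"
  unfolding clamp01_def by (intro continuous_intros)

lemma continuous_schauder: "continuous_on UNIV (schauder l i)"
  unfolding schauder_def[abs_def] tent_def by (cases "l = 0") (auto intro!: continuous_intros)

text \<open>Levy's midpoint construction: a bridge is the interpolation of its midpoint value plus
  two independent bridges on the halves, each of half the variance. Once the positions of s and t
  relative to 0, 1/2 and 1 are fixed, only elementary algebra is left.\<close>

lemma bridge_cov_rec:
  "bridge_cov s t = tent s * tent t + (bridge_cov (2 * s) (2 * t) + bridge_cov (2 * s - 1) (2 * t - 1)) / 2"
proof -
  define u v u1 v1 u2 v2 where d: "u = clamp01 s" "v = clamp01 t" "u1 = clamp01 (2 * s)" "v1 = clamp01 (2 * t)"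
    "u2 = clamp01 (2 * s - 1)" "v2 = clamp01 (2 * t - 1)"
  have *: "clamp01 x = 0 \<and> clamp01 (2 * x) = 0 \<and> clamp01 (2 * x - 1) = 0
     \<or> clamp01 x = 1 \<and> clamp01 (2 * x) = 1 \<and> clamp01 (2 * x - 1) = 1
     \<or> 0 \<le> clamp01 x \<and> clamp01 x \<le> 1/2 \<and> clamp01 (2 * x) = 2 * clamp01 x \<and> clamp01 (2 * x - 1) = 0
     \<or> 1/2 \<le> clamp01 x \<and> clamp01 x \<le> 1 \<and> clamp01 (2 * x) = 1 \<and> clamp01 (2 * x - 1) = 2 * clamp01 x - 1" for x
  proof -
    consider "x \<le> 0" | "0 \<le> x" "x \<le> 1/2" | "1/2 \<le> x" "x \<le> 1" | "1 \<le> x" by linarith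
    then show ?thesis unfolding clamp01_def by cases simp_all
  qed
  note S = *[of s, folded d] and T = *[of t, folded d]
  define w w1 w2 where w: "w = min u v" "w1 = min u1 v1" "w2 = min u2 v2"
  define a b where ab: "a = min u (1 - u)" "b = min v (1 - v)"
  have vb: "0 \<le> v" "v \<le> 1" "0 \<le> v1" "v1 \<le> 1" "0 \<le> v2" "v2 \<le> 1" by (auto simp: d clamp01_bounds)
  have "w - u * v = a * b + (w1 - u1 * v1 + (w2 - u2 * v2)) / 2"
    using S
  proof (elim disjE conjE)
    assume u: "u = 0" "u1 = 0" "u2 = 0"
    have "a = 0" "w = 0" "w1 = 0" "w2 = 0" using u vb by (simp_all add: w ab min_def)
    then show ?thesis using u by simp
  next
    assume u: "u = 1" "u1 = 1" "u2 = 1"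
    have "a = 0" "w = v" "w1 = v1" "w2 = v2" using u vb by (simp_all add: w ab min_def)
    then show ?thesis using u by simp
  next
    assume u: "0 \<le> u" "u \<le> 1/2" "u1 = 2 * u" "u2 = 0"
    have au: "a = u" "w2 = 0" using u vb by (simp_all add: w ab min_def)
    show ?thesis using T
    proof (elim disjE conjE)
      assume v: "0 \<le> v" "v \<le> 1/2" "v1 = 2 * v" "v2 = 0"
      have b: "b = v" "w1 = 2 * w" using u v by (simp_all add: w ab min_def)
      show ?thesis unfolding b au u(3,4) v(3,4) by (simp add: field_simps)
    next
      assume v: "1/2 \<le> v" "v \<le> 1" "v1 = 1" "v2 = 2 * v - 1"
      have b: "b = 1 - v" "w1 = 2 * u" "w = u" using u v by (simp_all add: w ab min_def)
      show ?thesis unfolding b au u(3,4) v(3,4) by (simp add: field_simps)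
    qed (use u au in \<open>simp_all add: w ab min_def\<close>)
  next
    assume u: "1/2 \<le> u" "u \<le> 1" "u1 = 1" "u2 = 2 * u - 1"
    have au: "a = 1 - u" "w1 = v1" using u vb by (simp_all add: w ab min_def)
    show ?thesis using T
    proof (elim disjE conjE)
      assume v: "0 \<le> v" "v \<le> 1/2" "v1 = 2 * v" "v2 = 0"
      have b: "b = v" "w2 = 0" "w = v" using u v by (simp_all add: w ab min_def)
      show ?thesis unfolding b au u(3,4) v(3,4) by (simp add: field_simps)
    next
      assume v: "1/2 \<le> v" "v \<le> 1" "v1 = 1" "v2 = 2 * v - 1"
      have b: "b = 1 - v" "w2 = 2 * w - 1" using u v by (simp_all add: w ab min_def)
      show ?thesis unfolding b au u(3,4) v(3,4) by (simp add: field_simps)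
    qed (use u au in \<open>simp_all add: w ab min_def\<close>)
  qed
  then show ?thesis by (simp add: bridge_cov_def tent_def d w ab)
qed

lemma bridge_cov_eq_0: "\<not> (0 < s \<and> s < 1) \<Longrightarrow> bridge_cov s t = 0"
  using clamp01_bounds[of t] by (auto simp: bridge_cov_def clamp01_def not_less)

lemma bridge_cov_bounds: "0 \<le> bridge_cov s t" "bridge_cov s t \<le> 1"
proof -
  have u: "0 \<le> clamp01 s" "clamp01 s \<le> 1" "0 \<le> clamp01 t" "clamp01 t \<le> 1" by (auto simp: clamp01_bounds)
  have "clamp01 s * clamp01 t \<le> clamp01 s" "clamp01 s * clamp01 t \<le> clamp01 t"
    using u mult_left_mono[of "clamp01 t" 1 "clamp01 s"] mult_right_mono[of "clamp01 s" 1 "clamp01 t"] by auto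
  moreover have "0 \<le> clamp01 s * clamp01 t" using u by simp
  ultimately show "0 \<le> bridge_cov s t" "bridge_cov s t \<le> 1" using u unfolding bridge_cov_def by linarith+
qed

text \<open>Open unit intervals that start at distinct integers are disjoint, so at most one
  translate of f is nonzero at x.\<close>

lemma sum_single_int:
  fixes f :: "real \<Rightarrow> real"
  assumes f: "\<And>y. \<not> (0 < y \<and> y < 1) \<Longrightarrow> f y = 0"
  shows "(\<Sum>i<n. g i * f (x - real i)) = 0 \<or> (\<exists>k<n. (\<Sum>i<n. g i * f (x - real i)) = g k * f (x - real k))"
proof (cases "\<exists>k<n. 0 < x - real k \<and> x - real k < 1")
  case True
  then obtain k where k: "k < n" "0 < x - real k" "x - real k < 1" by blast
  have "f (x - real i) = 0" if "i \<noteq> k" for i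
  proof (rule f)
    have "real i + 1 \<le> real k \<or> real k + 1 \<le> real i" using that by linarith
    then show "\<not> (0 < x - real i \<and> x - real i < 1)" using k by linarith
  qed
  then have "(\<Sum>i<n. g i * f (x - real i)) = g k * f (x - real k)"
    using k by (subst sum.remove[of _ k]) (auto intro!: sum.neutral)
  with k show ?thesis by blast
next
  case False
  then have "(\<Sum>i<n. g i * f (x - real i)) = 0" by (intro sum.neutral) (auto intro!: f)
  then show ?thesis by blast
qed

text \<open>Iteration of \<open>bridge_cov_rec\<close>: what the levels up to n miss of the
  covariance of Brownian motion is the covariance of independent bridges on the 2^n dyadic
  intervals.\<close>

lemma schauder_cov:
  "(\<Sum>l\<le>n. \<Sum>i<2 ^ (l - 1). schauder l i s * schauder l i t) =
   min (clamp01 s) (clamp01 t) - (1/2) ^ n * (\<Sum>i<2^n. bridge_cov (2 ^ n * s - real i) (2 ^ n * t - real i))"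
proof (induction n)
  case 0
  then show ?case by (simp add: schauder_def bridge_cov_def)
next
  case (Suc n)
  have sp: "(\<Sum>i<2 ^ Suc n. f i) = (\<Sum>i<2^n. f (2 * i) + f (2 * i + 1))" for f :: "nat \<Rightarrow> real"
  proof -
    have "{..<2 ^ Suc n} = (\<lambda>i. 2 * i) ` {..<2 ^ n} \<union> (\<lambda>i. 2 * i + 1) ` {..<(2::nat) ^ n}"
    proof (intro set_eqI iffI)
      fix x assume "x \<in> {..<(2::nat) ^ Suc n}"
      then show "x \<in> (\<lambda>i. 2 * i) ` {..<2 ^ n} \<union> (\<lambda>i. 2 * i + 1) ` {..<(2::nat) ^ n}"
        by (cases "even x") (auto elim!: evenE oddE)
    qed auto
    moreover have "(\<lambda>i. 2 * i) ` {..<2 ^ n} \<inter> (\<lambda>i. 2 * i + 1) ` {..<(2::nat) ^ n} = {}"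
      by (auto, presburger)
    ultimately have "(\<Sum>i<2 ^ Suc n. f i) = sum f ((\<lambda>i. 2 * i) ` {..<2 ^ n}) + sum f ((\<lambda>i. 2 * i + 1) ` {..<2 ^ n})"
      by (simp add: sum.union_disjoint del: power_Suc)
    then show ?thesis by (simp add: sum.reindex inj_on_def sum.distrib)
  qed
  have sq: "(1 / sqrt 2) ^ n * (1 / sqrt 2) ^ n = (1 / 2 :: real) ^ n"
    by (simp flip: power_mult_distrib)
  have "(\<Sum>l\<le>Suc n. \<Sum>i<2 ^ (l - 1). schauder l i s * schauder l i t)
     = min (clamp01 s) (clamp01 t) - (1/2) ^ n * (\<Sum>i<2^n. bridge_cov (2 ^ n * s - real i) (2 ^ n * t - real i))
       + (\<Sum>i<2^n. schauder (Suc n) i s * schauder (Suc n) i t)"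
    using Suc.IH by simp
  also have "(\<Sum>i<2^n. schauder (Suc n) i s * schauder (Suc n) i t)
     = (1/2) ^ n * (\<Sum>i<2^n. tent (2 ^ n * s - real i) * tent (2 ^ n * t - real i))"
  proof -
    have "schauder (Suc n) i s * schauder (Suc n) i t
      = ((1 / sqrt 2) ^ n * (1 / sqrt 2) ^ n) * (tent (2 ^ n * s - real i) * tent (2 ^ n * t - real i))" for i
      by (simp add: schauder_def)
    then show ?thesis unfolding sq sum_distrib_left by simp
  qed
  also have "min (clamp01 s) (clamp01 t) - (1/2) ^ n * (\<Sum>i<2^n. bridge_cov (2 ^ n * s - real i) (2 ^ n * t - real i))
       + (1/2) ^ n * (\<Sum>i<2^n. tent (2 ^ n * s - real i) * tent (2 ^ n * t - real i))
     = min (clamp01 s) (clamp01 t) - (1/2) ^ n * (\<Sum>i<2^n.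
         (bridge_cov (2 * (2 ^ n * s - real i)) (2 * (2 ^ n * t - real i)) +
          bridge_cov (2 * (2 ^ n * s - real i) - 1) (2 * (2 ^ n * t - real i) - 1)) / 2)"
  proof -
    have "(\<Sum>i<2^n. bridge_cov (2 ^ n * s - real i) (2 ^ n * t - real i)) =
       (\<Sum>i<2^n. tent (2 ^ n * s - real i) * tent (2 ^ n * t - real i)) + (\<Sum>i<2^n.
         (bridge_cov (2 * (2 ^ n * s - real i)) (2 * (2 ^ n * t - real i)) +
          bridge_cov (2 * (2 ^ n * s - real i) - 1) (2 * (2 ^ n * t - real i) - 1)) / 2)"
      unfolding sum.distrib[symmetric] by (rule sum.cong[OF refl], rule bridge_cov_rec)
    then show ?thesis by (simp only: ring_distribs)
  qed
  also have "(\<Sum>i<2^n.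
         (bridge_cov (2 * (2 ^ n * s - real i)) (2 * (2 ^ n * t - real i)) +
          bridge_cov (2 * (2 ^ n * s - real i) - 1) (2 * (2 ^ n * t - real i) - 1)) / 2)
     = (1/2) * (\<Sum>i<2 ^ Suc n. bridge_cov (2 ^ Suc n * s - real i) (2 ^ Suc n * t - real i))"
    unfolding sp sum_distrib_left by (intro sum.cong) (simp_all add: right_diff_distrib diff_diff_eq add.commute mult.assoc)
  finally show ?case by simp
qed

lemma schauder_cov_bound:
  "\<bar>(\<Sum>l\<le>n. \<Sum>i<2 ^ (l - 1). schauder l i s * schauder l i t) - min (clamp01 s) (clamp01 t)\<bar> \<le> (1/2) ^ n"
proof -
  let ?S = "\<Sum>i<2^n. bridge_cov (2 ^ n * s - real i) (2 ^ n * t - real i)"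
  have "?S \<le> 1"
  proof -
    have "?S \<le> (\<Sum>i<2^n. (if 0 < 2 ^ n * s - real i \<and> 2 ^ n * s - real i < 1 then 1 else 0))"
      by (intro sum_mono) (use bridge_cov_bounds bridge_cov_eq_0 in auto)
    also have "\<dots> \<le> 1"
    proof -
      define \<phi> :: "real \<Rightarrow> real" where "\<phi> y = (if 0 < y \<and> y < 1 then 1 else 0)" for y
      have "(\<Sum>i<2^n. 1 * \<phi> (2 ^ n * s - real i)) = 0 \<or> (\<exists>k<2^n. (\<Sum>i<2^n. 1 * \<phi> (2 ^ n * s - real i)) = 1 * \<phi> (2 ^ n * s - real k))"
        by (rule sum_single_int) (simp add: \<phi>_def)
      moreover have "\<phi> y \<le> 1" for y by (simp add: \<phi>_def)
      ultimately have "(\<Sum>i<2^n. \<phi> (2 ^ n * s - real i)) \<le> 1" by fastforce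
      then show ?thesis by (simp add: \<phi>_def)
    qed
    finally show ?thesis .
  qed
  moreover have "?S \<ge> 0" by (intro sum_nonneg bridge_cov_bounds)
  ultimately have "\<bar>(1/2) ^ n * ?S\<bar> \<le> (1/2) ^ n" by (simp add: abs_mult mult_left_le)
  then show ?thesis unfolding schauder_cov by simp
qed

text \<open>The tents of one level do not overlap, so a single term survives at s. Replacing it by
  the sum over all i makes the bound independent of s, as a maximal estimate requires.\<close>

lemma schauder_level_bound:
  "(\<Sum>i<2 ^ (l - 1). y i * schauder l i s) ^ 4 \<le> (1/4) ^ (l - 1) * (\<Sum>i<2 ^ (l - 1). y i ^ 4)"
proof (cases "l = 0")
  case True
  have "clamp01 s ^ 4 \<le> 1" using clamp01_bounds by (simp add: power_le_one)
  then show ?thesis using True by (simp add: schauder_def power_mult_distrib mult_left_le)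
next
  case False
  have p: "((1 / sqrt 2) ^ k) ^ 4 = (1/4 :: real) ^ k" for k
  proof -
    have "((1 / sqrt 2) ^ k) ^ 4 = (((1 / sqrt 2)\<^sup>2)\<^sup>2 :: real) ^ k" by (simp add: power_mult[symmetric] mult.commute)
    also have "((1 / sqrt 2)\<^sup>2)\<^sup>2 = (1/4 :: real)" by (simp add: power_divide)
    finally show ?thesis .
  qed
  have nn: "0 \<le> (1/4 :: real) ^ (l - 1) * (\<Sum>i<2 ^ (l - 1). y i ^ 4)"
    by (intro mult_nonneg_nonneg sum_nonneg) auto
  have e: "(\<Sum>i<2 ^ (l - 1). y i * schauder l i s) = (1 / sqrt 2) ^ (l - 1) * (\<Sum>i<2 ^ (l - 1). y i * tent (2 ^ (l - 1) * s - real i))"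
    using False by (simp add: schauder_def sum_distrib_left mult_ac)
  let ?S = "\<Sum>i<2 ^ (l - 1). y i * tent (2 ^ (l - 1) * s - real i)"
  have "?S = 0 \<or> (\<exists>k<2 ^ (l - 1). ?S = y k * tent (2 ^ (l - 1) * s - real k))"
    by (rule sum_single_int) (auto intro!: tent_eq_0)
  then consider "?S = 0" | k where "k < 2 ^ (l - 1)" "?S = y k * tent (2 ^ (l - 1) * s - real k)"
    by blast
  then show ?thesis
  proof cases
    case 1 then show ?thesis unfolding e using nn by simp
  next
    case (2 k)
    have "(y k * tent (2 ^ (l - 1) * s - real k)) ^ 4 \<le> y k ^ 4"
      using tent_bounds[of "2 ^ (l - 1) * s - real k"] by (simp add: power_mult_distrib mult_left_le power_le_one)
    also have "\<dots> \<le> (\<Sum>i<2 ^ (l - 1). y i ^ 4)" using 2 by (intro member_le_sum) auto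
    finally show ?thesis unfolding e 2(2) power_mult_distrib p by (intro mult_left_mono) (auto simp: power_mult_distrib)
  qed
qed

section \<open>Almost sure convergence and random Schauder series\<close>

lemma AE_summable_integral:
  fixes X :: "nat \<Rightarrow> 'a \<Rightarrow> real"
  assumes i: "\<And>n. integrable M (X n)" and nn: "\<And>n \<omega>. 0 \<le> X n \<omega>" and s: "summable (\<lambda>n. integral\<^sup>L M (X n))"
  shows "AE \<omega> in M. summable (\<lambda>n. X n \<omega>)"
    and "integrable M (\<lambda>\<omega>. \<Sum>n. X n \<omega>)"
    and "(LINT \<omega>|M. (\<Sum>n. X n \<omega>)) = (\<Sum>n. integral\<^sup>L M (X n))"
proof -
  have [measurable]: "X n \<in> borel_measurable M" for n using i by auto
  have "(\<integral>\<^sup>+\<omega>. (\<Sum>n. ennreal (X n \<omega>)) \<partial>M) = (\<Sum>n. \<integral>\<^sup>+\<omega>. ennreal (X n \<omega>) \<partial>M)"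
    by (rule nn_integral_suminf) auto
  also have "\<dots> = (\<Sum>n. ennreal (integral\<^sup>L M (X n)))"
    by (intro suminf_cong nn_integral_eq_integral i) (simp add: nn)
  also have "\<dots> = ennreal (\<Sum>n. integral\<^sup>L M (X n))"
    by (intro suminf_ennreal2 s) (simp add: nn)
  finally have "(\<integral>\<^sup>+\<omega>. (\<Sum>n. ennreal (X n \<omega>)) \<partial>M) \<noteq> \<infinity>" by simp
  then have "AE \<omega> in M. (\<Sum>n. ennreal (X n \<omega>)) \<noteq> \<infinity>"
    by (intro nn_integral_noteq_infinite) auto
  then show AE: "AE \<omega> in M. summable (\<lambda>n. X n \<omega>)"
    by eventually_elim (auto intro!: summable_suminf_not_top nn)
  then have AE': "AE \<omega> in M. summable (\<lambda>n. norm (X n \<omega>))" by (simp add: nn)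
  have s': "summable (\<lambda>n. LINT \<omega>|M. norm (X n \<omega>))" using s by (simp add: nn)
  show "integrable M (\<lambda>\<omega>. \<Sum>n. X n \<omega>)" by (rule integrable_suminf[OF i AE' s'])
  show "(LINT \<omega>|M. (\<Sum>n. X n \<omega>)) = (\<Sum>n. integral\<^sup>L M (X n))" by (rule integral_suminf[OF i AE' s'])
qed

text \<open>The Borel-Cantelli argument in the form used repeatedly below: summable expectations
  give convergence along the whole sequence, without exceptional events to be named.\<close>

lemma AE_tendsto_0_of_summable_integral:
  fixes X :: "nat \<Rightarrow> 'a \<Rightarrow> real"
  assumes "\<And>n. integrable M (X n)" "\<And>n \<omega>. 0 \<le> X n \<omega>" "summable (\<lambda>n. integral\<^sup>L M (X n))"
  shows "AE \<omega> in M. (\<lambda>n. X n \<omega>) \<longlonglongrightarrow> 0"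
  using AE_summable_integral(1)[OF assms] by eventually_elim (rule summable_LIMSEQ_zero)

text \<open>The index (j, l, i) stands for block, Schauder level and position within the level. The
  coefficient at (j, 0, 0) is the normalised increment over block j; it alone is coupled with the
  digits.\<close>

locale gaussian_family = prob_space M for M :: "'a measure" +
  fixes G :: "nat \<times> nat \<times> nat \<Rightarrow> 'a \<Rightarrow> real"
  assumes indep_G: "indep_vars (\<lambda>_. borel) G UNIV"
    and distr_G: "\<And>x. distr M borel (G x) = std_normal_distribution"
begin

lemma measurable_G[measurable]: "G x \<in> borel_measurable M"
  using indep_G unfolding indep_vars_def by blast

lemma char_linear_combination:
  assumes "finite F"
  shows "(CLINT \<omega>|M. iexp (\<Sum>x\<in>F. c x * G x \<omega>)) = of_real (exp (- (\<Sum>x\<in>F. (c x)\<^sup>2) / 2))"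
proof -
  have ind: "indep_vars (\<lambda>_. borel) (\<lambda>x \<omega>. c x * G x \<omega>) F"
    by (rule indep_vars_compose2[where X=G and M'="\<lambda>_. borel"])
      (auto intro: indep_vars_subset[OF indep_G])
  have one: "char (distr M borel (\<lambda>\<omega>. c x * G x \<omega>)) 1 = of_real (exp (- (c x)\<^sup>2 / 2))" for x
  proof -
    have "char (distr M borel (\<lambda>\<omega>. c x * G x \<omega>)) 1 = char (distr M borel (G x)) (c x)"
      by (simp add: char_def integral_distr)
    then show ?thesis unfolding distr_G char_std_normal_distribution by simp
  qed
  have "(CLINT \<omega>|M. iexp (\<Sum>x\<in>F. c x * G x \<omega>)) = char (distr M borel (\<lambda>\<omega>. \<Sum>x\<in>F. c x * G x \<omega>)) 1"
    by (simp add: char_def integral_distr)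
  also have "\<dots> = (\<Prod>x\<in>F. char (distr M borel (\<lambda>\<omega>. c x * G x \<omega>)) 1)" by (rule char_distr_sum[OF ind])
  also have "\<dots> = of_real (\<Prod>x\<in>F. exp (- (c x)\<^sup>2 / 2))" by (simp add: one)
  also have "(\<Prod>x\<in>F. exp (- (c x)\<^sup>2 / 2)) = exp (- (\<Sum>x\<in>F. (c x)\<^sup>2) / 2)"
    using assms by (simp add: exp_sum[symmetric] sum_negf sum_divide_distrib)
  finally show ?thesis .
qed

lemma integral_G: "f \<in> borel_measurable borel \<Longrightarrow> expectation (\<lambda>\<omega>. f (G x \<omega>)) = (LINT y|std_normal_distribution. f y)" for f :: "real \<Rightarrow> real"
  unfolding distr_G[of x, symmetric] by (subst integral_distr) auto

lemma integrable_G: "f \<in> borel_measurable borel \<Longrightarrow> integrable M (\<lambda>\<omega>. f (G x \<omega>)) \<longleftrightarrow> integrable std_normal_distribution f" for f :: "real \<Rightarrow> real"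
  unfolding distr_G[of x, symmetric] by (subst integrable_distr_eq) auto

lemma moment4_G: "integrable M (\<lambda>\<omega>. G x \<omega> ^ 4)" "expectation (\<lambda>\<omega>. G x \<omega> ^ 4) = 3"
proof -
  show "integrable M (\<lambda>\<omega>. G x \<omega> ^ 4)"
    by (subst integrable_G) (auto intro: integrable_std_normal_distribution_moment)
  show "expectation (\<lambda>\<omega>. G x \<omega> ^ 4) = 3"
    using std_normal_distribution_even_moments(1)[of 2] by (subst integral_G) (auto simp: fact_numeral)
qed

text \<open>The factor \<open>(10/9) ^ (3 * l)\<close> is the inverse cube of the weight
  \<open>(9/10) ^ l\<close> in \<open>weighted_power_mean_4\<close>. From level 1 on the
  expectations have ratio \<open>(10/9) ^ 3 / 2 = 500/729\<close>, so they remain summable.\<close>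

definition level_moment :: "nat \<Rightarrow> nat \<Rightarrow> 'a \<Rightarrow> real" where
  "level_moment j l \<omega> = (10/9) ^ (3 * l) * ((1/4) ^ (l - 1) * (\<Sum>i<2 ^ (l - 1). G (j, l, i) \<omega> ^ 4))"

definition bridge_moment :: "nat \<Rightarrow> 'a \<Rightarrow> real" where
  "bridge_moment j \<omega> = (\<Sum>l. level_moment j l \<omega>)"

definition level_path :: "nat \<Rightarrow> nat \<Rightarrow> 'a \<Rightarrow> real \<Rightarrow> real" where
  "level_path j l \<omega> s = (\<Sum>i<2 ^ (l - 1). G (j, l, i) \<omega> * schauder l i s)"

definition unit_path :: "nat \<Rightarrow> 'a \<Rightarrow> real \<Rightarrow> real" where
  "unit_path j \<omega> s = (\<Sum>l. level_path j l \<omega> s)"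

lemma level_moment_nonneg: "0 \<le> level_moment j l \<omega>"
  unfolding level_moment_def by (intro mult_nonneg_nonneg sum_nonneg) auto

lemma level_moment_integral:
  "integrable M (level_moment j l)" "expectation (level_moment j l) = (10/9) ^ (3 * l) * ((1/4) ^ (l - 1) * (3 * 2 ^ (l - 1)))"
proof -
  have i: "integrable M (\<lambda>\<omega>. \<Sum>i<2 ^ (l - 1). G (j, l, i) \<omega> ^ 4)"
    by (intro Bochner_Integration.integrable_sum moment4_G)
  show "integrable M (level_moment j l)" unfolding level_moment_def[abs_def] by (intro integrable_mult_right i)
  have "expectation (\<lambda>\<omega>. \<Sum>i<2 ^ (l - 1). G (j, l, i) \<omega> ^ 4) = 3 * 2 ^ (l - 1)"
    by (subst Bochner_Integration.integral_sum) (auto simp: moment4_G)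
  then show "expectation (level_moment j l) = (10/9) ^ (3 * l) * ((1/4) ^ (l - 1) * (3 * 2 ^ (l - 1)))"
    unfolding level_moment_def[abs_def] by (simp only: integral_mult_right_zero)
qed

lemma level_moment_summable: "summable (\<lambda>l. expectation (level_moment j l))"
proof (rule summable_comparison_test'[of "\<lambda>l. 6 * (500/729) ^ l" 0])
  show "summable (\<lambda>l. 6 * (500/729 :: real) ^ l)" by (intro summable_mult summable_geometric) auto
  fix l :: nat
  have "(10/9 :: real) ^ (3 * l) * ((1/4) ^ (l - 1) * (3 * 2 ^ (l - 1))) \<le> 6 * (500/729) ^ l"
  proof (cases l)
    case (Suc k)
    have "(1/4 :: real) ^ k * 2 ^ k = (1/2) ^ k" by (simp flip: power_mult_distrib)
    moreover have "(10/9 :: real) ^ (3 * l) * (1/2)^l = (500/729) ^ l"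
      by (simp add: power_mult flip: power_mult_distrib) (simp add: power_divide)
    ultimately show ?thesis using Suc by (simp add: mult_ac)
  qed simp
  then show "norm (expectation (level_moment j l)) \<le> 6 * (500/729) ^ l"
    unfolding level_moment_integral by simp
qed

definition moment_const :: real where
  "moment_const = (\<Sum>l. (10/9) ^ (3 * l) * ((1/4) ^ (l - 1) * (3 * 2 ^ (l - 1))))"

lemma bridge_moment_integral:
  "integrable M (bridge_moment j)" "expectation (bridge_moment j) = moment_const"
proof -
  have *: "(\<Sum>l. expectation (level_moment j l)) = moment_const"
    unfolding moment_const_def level_moment_integral(2) ..
  show "integrable M (bridge_moment j)" "expectation (bridge_moment j) = moment_const"
    unfolding bridge_moment_def[abs_def] *[symmetric]
    by (rule AE_summable_integral(2,3)[OF level_moment_integral(1) level_moment_nonneg level_moment_summable])+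
qed

text \<open>The event of full measure on which all path estimates below hold simultaneously.\<close>

definition regular :: "'a \<Rightarrow> bool" where
  "regular \<omega> \<longleftrightarrow> (\<forall>j. summable (\<lambda>l. level_moment j l \<omega>))"

lemma AE_regular: "AE \<omega> in M. regular \<omega>"
  unfolding regular_def AE_all_countable
  using AE_summable_integral(1)[OF level_moment_integral(1) level_moment_nonneg level_moment_summable] by auto

lemma bridge_moment_nonneg: "regular \<omega> \<Longrightarrow> 0 \<le> bridge_moment j \<omega>"
  unfolding bridge_moment_def regular_def by (intro suminf_nonneg level_moment_nonneg) auto

lemma level_path_bound: "(10/9) ^ (3 * l) * level_path j l \<omega> s ^ 4 \<le> level_moment j l \<omega>"
  unfolding level_moment_def level_path_def by (intro mult_left_mono schauder_level_bound) auto

text \<open>The weights \<open>(9/10) ^ l\<close> have total at most 10, which gives the factor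
  10^3. The bound depends neither on n nor on s.\<close>

lemma sum_level_path_bound:
  assumes "regular \<omega>"
  shows "(\<Sum>l<n. level_path j l \<omega> s) ^ 4 \<le> 1000 * bridge_moment j \<omega>"
proof -
  have "(\<Sum>l<n. level_path j l \<omega> s) ^ 4 \<le> (\<Sum>l<n. (9/10) ^ l) ^ 3 * (\<Sum>l<n. level_path j l \<omega> s ^ 4 / ((9/10) ^ l) ^ 3)"
    by (rule weighted_power_mean_4) auto
  also have "\<dots> \<le> 10 ^ 3 * bridge_moment j \<omega>"
  proof (intro mult_mono power_mono)
    show "(\<Sum>l<n. (9/10) ^ l) \<le> (10 :: real)" by (simp add: sum_gp_strict)
    have "(\<Sum>l<n. level_path j l \<omega> s ^ 4 / ((9/10) ^ l) ^ 3) = (\<Sum>l<n. (10/9) ^ (3 * l) * level_path j l \<omega> s ^ 4)"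
      by (intro sum.cong) (auto simp: power_mult[symmetric] power_divide mult.commute)
    also have "\<dots> \<le> (\<Sum>l<n. level_moment j l \<omega>)" by (intro sum_mono level_path_bound)
    also have "\<dots> \<le> bridge_moment j \<omega>"
      unfolding bridge_moment_def using assms by (intro sum_le_suminf) (auto simp: regular_def level_moment_nonneg)
    finally show "(\<Sum>l<n. level_path j l \<omega> s ^ 4 / ((9/10) ^ l) ^ 3) \<le> bridge_moment j \<omega>" .
  qed (auto intro!: sum_nonneg)
  finally show ?thesis by simp
qed

lemma level_path_geometric:
  assumes "regular \<omega>"
  shows "\<bar>level_path j l \<omega> s\<bar> \<le> max 1 (bridge_moment j \<omega>) * (93/100) ^ l"
proof -
  let ?K = "max 1 (bridge_moment j \<omega>)"
  have "level_moment j l \<omega> \<le> bridge_moment j \<omega>"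
    unfolding bridge_moment_def using assms sum_le_suminf[of "\<lambda>l. level_moment j l \<omega>" "{l}"]
    by (auto simp: regular_def level_moment_nonneg)
  then have "(10/9) ^ (3 * l) * level_path j l \<omega> s ^ 4 \<le> bridge_moment j \<omega>"
    using level_path_bound[of l j \<omega> s] by linarith
  then have "level_path j l \<omega> s ^ 4 \<le> bridge_moment j \<omega> * (9/10) ^ (3 * l)"
    by (simp add: power_divide field_simps)
  \<comment> \<open>The maximum with 1 gives K <= K^4, and 93/100 is chosen so that
    \<open>(9/10) ^ 3 <= (93/100) ^ 4\<close>.\<close>
  also have "\<dots> \<le> ?K ^ 4 * ((93/100) ^ l) ^ 4"
  proof (intro mult_mono)
    have "?K * 1 \<le> ?K * ?K ^ 3" by (intro mult_left_mono one_le_power) auto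
    then show "bridge_moment j \<omega> \<le> ?K ^ 4" by (simp add: power4_eq_xxxx power3_eq_cube mult_ac)
    have "(9/10 :: real) ^ (3 * l) = ((9/10)^3) ^ l" by (simp add: power_mult)
    also have "\<dots> \<le> ((93/100)^4) ^ l" by (intro power_mono) (auto simp: power_divide)
    also have "\<dots> = ((93/100) ^ l) ^ 4" by (simp add: power_mult[symmetric] mult.commute)
    finally show "(9/10 :: real) ^ (3 * l) \<le> ((93/100) ^ l) ^ 4" .
  qed auto
  also have "\<dots> = (?K * (93/100) ^ l) ^ 4" by (simp add: power_mult_distrib)
  finally have "\<bar>level_path j l \<omega> s\<bar> ^ 4 \<le> (?K * (93/100) ^ l) ^ 4" by simp
  then show ?thesis by (rule power_le_imp_le_base[of _ 3, simplified]) auto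
qed

lemma unit_path_summable:
  assumes "regular \<omega>"
  shows "summable (\<lambda>l. level_path j l \<omega> s)"
  by (rule summable_comparison_test'[of "\<lambda>l. max 1 (bridge_moment j \<omega>) * (93/100) ^ l" 0])
    (use level_path_geometric[OF assms] in \<open>auto intro!: summable_mult summable_geometric\<close>)

lemma unit_path_bound:
  assumes "regular \<omega>"
  shows "unit_path j \<omega> s ^ 4 \<le> 1000 * bridge_moment j \<omega>"
proof (rule LIMSEQ_le_const2)
  show "(\<lambda>n. (\<Sum>l<n. level_path j l \<omega> s) ^ 4) \<longlonglongrightarrow> unit_path j \<omega> s ^ 4"
    unfolding unit_path_def by (intro tendsto_power summable_LIMSEQ unit_path_summable assms)
qed (use sum_level_path_bound[OF assms] in auto)

lemma unit_path_continuous: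
  assumes "regular \<omega>"
  shows "continuous_on UNIV (unit_path j \<omega>)"
proof (rule uniform_limit_theorem)
  show "uniform_limit UNIV (\<lambda>n s. \<Sum>l<n. level_path j l \<omega> s) (unit_path j \<omega>) sequentially"
    unfolding unit_path_def[abs_def]
    by (rule Weierstrass_m_test[of _ _ "\<lambda>l. max 1 (bridge_moment j \<omega>) * (93/100) ^ l"])
      (use level_path_geometric[OF assms] in \<open>auto intro!: summable_mult summable_geometric\<close>)
  show "\<forall>\<^sub>F n in sequentially. continuous_on UNIV (\<lambda>s. \<Sum>l<n. level_path j l \<omega> s)"
    unfolding level_path_def
    by (intro always_eventually allI continuous_on_sum continuous_on_mult continuous_on_const continuous_schauder)
qed simp

lemma unit_path_measurable[measurable]: "(\<lambda>\<omega>. unit_path j \<omega> s) \<in> borel_measurable M"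
  unfolding unit_path_def level_path_def by measurable

lemma unit_path_eq_0: "s \<le> 0 \<Longrightarrow> unit_path j \<omega> s = 0"
proof -
  assume s: "s \<le> 0"
  have "schauder l i s = 0" for l i
  proof -
    have "2 ^ (l - 1) * s \<le> 0" using s by (intro mult_nonneg_nonpos) auto
    then have "2 ^ (l - 1) * s - real i \<le> 0" by simp
    then show ?thesis using s by (auto simp: schauder_def clamp01_def tent_eq_0)
  qed
  then show ?thesis by (simp add: unit_path_def level_path_def)
qed

lemma unit_path_eq_end: "s \<ge> 1 \<Longrightarrow> unit_path j \<omega> s = G (j, 0, 0) \<omega>"
proof -
  assume s: "s \<ge> 1"
  have "schauder l i s = 0" if "i < 2 ^ (l - 1)" "l > 0" for l i
  proof -
    have "real i + 1 \<le> 2 ^ (l - 1)" using that by (metis Suc_leI of_nat_Suc of_nat_le_iff of_nat_numeral of_nat_power add.commute)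
    also have "\<dots> \<le> 2 ^ (l - 1) * s" using s by simp
    finally have "2 ^ (l - 1) * s - real i \<ge> 1" by simp
    then show ?thesis using that by (auto simp: schauder_def tent_eq_0)
  qed
  then have "level_path j l \<omega> s = (if l = 0 then G (j, 0, 0) \<omega> else 0)" for l
    using s by (auto simp: level_path_def schauder_def clamp01_def intro!: sum.neutral)
  then show ?thesis using suminf_finite[of "{0}" "\<lambda>l. level_path j l \<omega> s"] by (simp add: unit_path_def)
qed

end

section \<open>Brownian motion assembled along a clock\<close>

locale gaussian_clock = gaussian_family +
  fixes T :: "nat \<Rightarrow> real"
  assumes T_0: "T 0 = 0" and T_mono: "strict_mono T" and T_top: "filterlim T at_top sequentially"
begin

definition \<Delta> :: "nat \<Rightarrow> real" where "\<Delta> j = T (Suc j) - T j"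

lemma \<Delta>_pos: "0 < \<Delta> j" using T_mono by (simp add: \<Delta>_def strict_mono_Suc_iff)

text \<open>The unit path of a block vanishes before the block and keeps its final value after it.
  At a fixed time only finitely many terms are nonzero, so the sum over blocks needs no convergence
  argument.\<close>

definition brown :: "real \<Rightarrow> 'a \<Rightarrow> real" where
  "brown t \<omega> = (\<Sum>j. sqrt (\<Delta> j) * unit_path j \<omega> ((t - T j) / \<Delta> j))"

lemma T_le_iff: "T i \<le> T j \<longleftrightarrow> i \<le> j" using T_mono by (simp add: strict_mono_less_eq)

lemma brown_eq_sum: "t \<le> T J \<Longrightarrow> brown t \<omega> = (\<Sum>j<J. sqrt (\<Delta> j) * unit_path j \<omega> ((t - T j) / \<Delta> j))"
  unfolding brown_def
proof (rule suminf_finite)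
  fix j assume t: "t \<le> T J" and "j \<notin> {..<J}"
  then have "T J \<le> T j" by (simp add: T_le_iff)
  then have "(t - T j) / \<Delta> j \<le> 0" using t \<Delta>_pos[of j] by (simp add: divide_le_0_iff)
  then show "sqrt (\<Delta> j) * unit_path j \<omega> ((t - T j) / \<Delta> j) = 0" by (simp add: unit_path_eq_0)
qed simp

lemma ex_T_ge: "\<exists>J. t \<le> T J"
proof -
  have "eventually (\<lambda>j. t \<le> T j) sequentially" using T_top by (simp add: filterlim_at_top)
  then show ?thesis by (auto simp: eventually_sequentially)
qed

lemma brown_measurable[measurable]: "brown t \<in> borel_measurable M"
  unfolding brown_def[abs_def] by measurable

lemma brown_0: "brown 0 \<omega> = 0"
  using brown_eq_sum[of 0 0] T_0 by simp

lemma brown_block: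
  assumes "T j \<le> t" "t \<le> T (Suc j)"
  shows "brown t \<omega> = (\<Sum>i<j. sqrt (\<Delta> i) * G (i, 0, 0) \<omega>) + sqrt (\<Delta> j) * unit_path j \<omega> ((t - T j) / \<Delta> j)"
proof -
  have "unit_path i \<omega> ((t - T i) / \<Delta> i) = G (i, 0, 0) \<omega>" if "i < j" for i
  proof (rule unit_path_eq_end)
    have "T (Suc i) \<le> T j" using that by (simp add: T_le_iff)
    then have "\<Delta> i \<le> t - T i" using assms by (simp add: \<Delta>_def)
    then show "1 \<le> (t - T i) / \<Delta> i" using \<Delta>_pos[of i] by simp
  qed
  then show ?thesis unfolding brown_eq_sum[OF assms(2)] by simp
qed

lemma brown_T: "brown (T j) \<omega> = (\<Sum>i<j. sqrt (\<Delta> i) * G (i, 0, 0) \<omega>)"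
  using brown_block[of j "T j" \<omega>] T_le_iff[of j "Suc j"] by (simp add: unit_path_eq_0)

text \<open>Brownian scaling: a block of length \<Delta> stretches the unit path by
  \<open>sqrt \<Delta>\<close>, whose fourth power is \<open>\<Delta>\<^sup>2\<close>.\<close>

lemma brown_oscillation:
  assumes "regular \<omega>" "T j \<le> t" "t \<le> T (Suc j)"
  shows "(brown t \<omega> - brown (T j) \<omega>) ^ 4 \<le> 1000 * (\<Delta> j)\<^sup>2 * bridge_moment j \<omega>"
proof -
  have "(brown t \<omega> - brown (T j) \<omega>) ^ 4 = (sqrt (\<Delta> j)) ^ 4 * unit_path j \<omega> ((t - T j) / \<Delta> j) ^ 4"
    using brown_block[OF assms(2,3)] by (simp add: brown_T power_mult_distrib)
  also have "(sqrt (\<Delta> j)) ^ 4 = ((sqrt (\<Delta> j))\<^sup>2)\<^sup>2" by (simp only: power_mult[symmetric]) simp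
  also have "\<dots> = (\<Delta> j)\<^sup>2" using \<Delta>_pos[of j] by simp
  finally show ?thesis using mult_left_mono[OF unit_path_bound[OF assms(1), of j "(t - T j) / \<Delta> j"], of "(\<Delta> j)\<^sup>2"]
    by (simp add: mult_ac)
qed

lemma brown_continuous:
  assumes "regular \<omega>"
  shows "continuous_on {0..} (\<lambda>t. brown t \<omega>)"
proof (rule continuous_at_imp_continuous_on, safe)
  fix t :: real
  obtain J where J: "t + 1 \<le> T J" using ex_T_ge by blast
  have "continuous_on {..<T J} (\<lambda>t. \<Sum>j<J. sqrt (\<Delta> j) * unit_path j \<omega> ((t - T j) / \<Delta> j))"
  proof (intro continuous_on_sum continuous_on_mult continuous_on_const)
    fix j
    show "continuous_on {..<T J} (\<lambda>t. unit_path j \<omega> ((t - T j) / \<Delta> j))"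
      by (rule continuous_on_compose2[OF unit_path_continuous[OF assms]]) (use \<Delta>_pos[of j] in \<open>auto intro!: continuous_intros\<close>)
  qed
  then have "continuous_on {..<T J} (\<lambda>t. brown t \<omega>)"
    by (rule continuous_on_eq) (rule brown_eq_sum[symmetric], simp)
  then show "isCont (\<lambda>t. brown t \<omega>) t"
    using J by (simp add: continuous_on_eq_continuous_at)
qed

definition coeff :: "real \<Rightarrow> nat \<times> nat \<times> nat \<Rightarrow> real" where
  "coeff t x = (case x of (j, l, i) \<Rightarrow> sqrt (\<Delta> j) * schauder l i ((t - T j) / \<Delta> j))"

definition indices :: "nat \<Rightarrow> nat \<Rightarrow> (nat \<times> nat \<times> nat) set" where
  "indices J n = Sigma {..<J} (\<lambda>j. Sigma {..n} (\<lambda>l. {..<2 ^ (l - 1)}))"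

lemma finite_indices: "finite (indices J n)" by (auto simp: indices_def)

lemma sum_indices: "(\<Sum>x\<in>indices J n. f x) = (\<Sum>j<J. \<Sum>l\<le>n. \<Sum>i<2 ^ (l - 1). f (j, l, i))" for f :: "_ \<Rightarrow> real"
proof -
  have "(\<Sum>j<J. \<Sum>l\<le>n. \<Sum>i<2 ^ (l - 1). f (j, l, i)) = (\<Sum>j<J. \<Sum>y\<in>Sigma {..n} (\<lambda>l. {..<2 ^ (l - 1)}). f (j, y))"
    by (rule sum.cong[OF refl], subst sum.Sigma) (auto simp: split_def)
  also have "\<dots> = (\<Sum>x\<in>indices J n. f x)"
    unfolding indices_def by (subst sum.Sigma) (auto simp: split_def)
  finally show ?thesis ..
qed

text \<open>Truncation at level n turns the path into a finite linear combination of the Gaussian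
  coefficients, whose characteristic function is explicit.\<close>

lemma brown_limit:
  assumes "regular \<omega>" "t \<le> T J"
  shows "(\<lambda>n. \<Sum>x\<in>indices J n. coeff t x * G x \<omega>) \<longlonglongrightarrow> brown t \<omega>"
proof -
  have "(\<Sum>x\<in>indices J n. coeff t x * G x \<omega>) = (\<Sum>j<J. sqrt (\<Delta> j) * (\<Sum>l\<le>n. level_path j l \<omega> ((t - T j) / \<Delta> j)))" for n
    unfolding sum_indices coeff_def level_path_def by (simp add: sum_distrib_left mult_ac)
  moreover have "(\<lambda>n. \<Sum>j<J. sqrt (\<Delta> j) * (\<Sum>l\<le>n. level_path j l \<omega> ((t - T j) / \<Delta> j))) \<longlonglongrightarrow> brown t \<omega>"
    unfolding brown_eq_sum[OF assms(2)] unit_path_def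
    by (intro tendsto_sum tendsto_mult tendsto_const summable_LIMSEQ' unit_path_summable assms)
  ultimately show ?thesis by simp
qed

lemma coeff_cov:
  assumes "0 \<le> s" "s \<le> T J" "0 \<le> t" "t \<le> T J"
  shows "(\<lambda>n. \<Sum>x\<in>indices J n. coeff s x * coeff t x) \<longlonglongrightarrow> min s t"
proof -
  let ?K = "\<lambda>n j. \<Sum>l\<le>n. \<Sum>i<2 ^ (l - 1). schauder l i ((s - T j) / \<Delta> j) * schauder l i ((t - T j) / \<Delta> j)"
  have "(\<Sum>x\<in>indices J n. coeff s x * coeff t x) = (\<Sum>j<J. \<Delta> j * ?K n j)" for n
  proof -
    have "coeff s (j, l, i) * coeff t (j, l, i) = \<Delta> j * (schauder l i ((s - T j) / \<Delta> j) * schauder l i ((t - T j) / \<Delta> j))" for j l i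
    proof -
      have "sqrt (\<Delta> j) * sqrt (\<Delta> j) = \<Delta> j" using \<Delta>_pos[of j] by simp
      then show ?thesis unfolding coeff_def by (simp add: mult_ac)
    qed
    then show ?thesis unfolding sum_indices by (simp add: sum_distrib_left)
  qed
  moreover have "(\<lambda>n. \<Sum>j<J. \<Delta> j * ?K n j) \<longlonglongrightarrow> (\<Sum>j<J. \<Delta> j * min (clamp01 ((s - T j) / \<Delta> j)) (clamp01 ((t - T j) / \<Delta> j)))"
  proof (intro tendsto_sum tendsto_mult tendsto_const)
    fix j
    have "(\<lambda>n. ?K n j - min (clamp01 ((s - T j) / \<Delta> j)) (clamp01 ((t - T j) / \<Delta> j))) \<longlonglongrightarrow> 0"
    proof (rule Lim_null_comparison[of _ "\<lambda>n. (1/2) ^ n"])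
      show "\<forall>\<^sub>F n in sequentially. norm (?K n j - min (clamp01 ((s - T j) / \<Delta> j)) (clamp01 ((t - T j) / \<Delta> j))) \<le> (1/2) ^ n"
        using schauder_cov_bound by (intro always_eventually allI) (simp only: real_norm_def)
    qed (auto intro!: LIMSEQ_realpow_zero)
    then show "(\<lambda>n. ?K n j) \<longlonglongrightarrow> min (clamp01 ((s - T j) / \<Delta> j)) (clamp01 ((t - T j) / \<Delta> j))"
      by (simp add: LIM_zero_iff)
  qed
  moreover have "(\<Sum>j<J. \<Delta> j * min (clamp01 ((s - T j) / \<Delta> j)) (clamp01 ((t - T j) / \<Delta> j))) = min s t"
  proof -
    have "\<Delta> j * min (clamp01 ((s - T j) / \<Delta> j)) (clamp01 ((t - T j) / \<Delta> j)) = min (min s t) (T (Suc j)) - min (min s t) (T j)" for j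
    proof -
      \<comment> \<open>The product is the length of the part of the block that lies before u; these
        lengths telescope over the blocks.\<close>
      have c: "\<Delta> j * clamp01 ((u - T j) / \<Delta> j) = min u (T (Suc j)) - min u (T j)" for u
      proof -
        consider "u \<le> T j" | "T j \<le> u" "u \<le> T (Suc j)" | "T (Suc j) \<le> u" by linarith
        then show ?thesis
        proof cases
          case 1 then have "(u - T j) / \<Delta> j \<le> 0" using \<Delta>_pos[of j] by (simp add: divide_le_0_iff)
          then show ?thesis using 1 \<Delta>_pos[of j] by (auto simp: clamp01_def \<Delta>_def)
        next
          case 2 then have "0 \<le> (u - T j) / \<Delta> j" "(u - T j) / \<Delta> j \<le> 1" using \<Delta>_pos[of j] by (auto simp: \<Delta>_def)
          then show ?thesis using 2 \<Delta>_pos[of j] by (auto simp: clamp01_def)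
        next
          case 3 then have "1 \<le> (u - T j) / \<Delta> j" using \<Delta>_pos[of j] by (auto simp: \<Delta>_def)
          then show ?thesis using 3 \<Delta>_pos[of j] by (auto simp: clamp01_def \<Delta>_def)
        qed
      qed
      have "\<Delta> j * min (clamp01 ((s - T j) / \<Delta> j)) (clamp01 ((t - T j) / \<Delta> j)) =
         min (min s (T (Suc j)) - min s (T j)) (min t (T (Suc j)) - min t (T j))"
        using \<Delta>_pos[of j] by (simp add: min_mult_distrib_left c)
      also have "\<dots> = min (min s t) (T (Suc j)) - min (min s t) (T j)"
        using \<Delta>_pos[of j] unfolding \<Delta>_def by (auto simp: min_def)
      finally show ?thesis .
    qed
    then have "(\<Sum>j<J. \<Delta> j * min (clamp01 ((s - T j) / \<Delta> j)) (clamp01 ((t - T j) / \<Delta> j))) = min (min s t) (T J) - min (min s t) (T 0)"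
      using sum_lessThan_telescope[of "\<lambda>j. min (min s t) (T j)" J] by simp
    then show ?thesis using assms T_0 by auto
  qed
  ultimately show ?thesis by simp
qed

text \<open>Dominated convergence along the truncations reduces the claim to the limit of a
  quadratic form in the coefficients, which \<open>coeff_cov\<close> computes.\<close>

lemma brown_increments_char:
  assumes t0: "0 \<le> t 0" and tm: "mono t"
  shows "(CLINT \<omega>|M. iexp (\<Sum>i<n. \<theta> i * (brown (t (Suc i)) \<omega> - brown (t i) \<omega>)))
     = of_real (exp (- (\<Sum>i<n. (\<theta> i)\<^sup>2 * (t (Suc i) - t i)) / 2))"
proof -
  obtain J where J: "t n \<le> T J" using ex_T_ge by blast
  have tb: "0 \<le> t i" "i \<le> n \<Longrightarrow> t i \<le> T J" for i
    using monoD[OF tm, of 0 i] monoD[OF tm, of i n] t0 J by auto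
  define d where "d m x = (\<Sum>i<n. \<theta> i * (coeff (t (Suc i)) x - coeff (t i) x))" for m :: nat and x
  define Y where "Y m \<omega> = (\<Sum>x\<in>indices J m. d m x * G x \<omega>)" for m \<omega>
  have Y: "Y m \<omega> = (\<Sum>i<n. \<theta> i * ((\<Sum>x\<in>indices J m. coeff (t (Suc i)) x * G x \<omega>) - (\<Sum>x\<in>indices J m. coeff (t i) x * G x \<omega>)))" for m \<omega>
    unfolding Y_def d_def sum_distrib_right
    by (subst sum.swap) (simp add: sum_subtractf[symmetric] sum_distrib_left algebra_simps)
  have Ym[measurable]: "Y m \<in> borel_measurable M" for m unfolding Y_def[abs_def] by measurable
  have lim: "(\<lambda>m. CLINT \<omega>|M. iexp (Y m \<omega>)) \<longlonglongrightarrow> (CLINT \<omega>|M. iexp (\<Sum>i<n. \<theta> i * (brown (t (Suc i)) \<omega> - brown (t i) \<omega>)))"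
  proof (rule integral_dominated_convergence[where w="\<lambda>_. 1"])
    show "AE \<omega> in M. (\<lambda>m. iexp (Y m \<omega>)) \<longlonglongrightarrow> iexp (\<Sum>i<n. \<theta> i * (brown (t (Suc i)) \<omega> - brown (t i) \<omega>))"
      using AE_regular
    proof eventually_elim
      case (elim \<omega>)
      have "(\<lambda>m. Y m \<omega>) \<longlonglongrightarrow> (\<Sum>i<n. \<theta> i * (brown (t (Suc i)) \<omega> - brown (t i) \<omega>))"
        unfolding Y by (intro tendsto_sum tendsto_mult tendsto_const tendsto_diff brown_limit elim tb) auto
      then show ?case by (intro tendsto_exp tendsto_mult tendsto_const tendsto_of_real)
    qed
  qed auto
  have "(\<lambda>m. CLINT \<omega>|M. iexp (Y m \<omega>)) \<longlonglongrightarrow> of_real (exp (- (\<Sum>i<n. (\<theta> i)\<^sup>2 * (t (Suc i) - t i)) / 2))"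
  proof -
    have e: "(CLINT \<omega>|M. iexp (Y m \<omega>)) = of_real (exp (- (\<Sum>x\<in>indices J m. (d m x)\<^sup>2) / 2))" for m
      unfolding Y_def by (rule char_linear_combination[OF finite_indices])
    let ?C = "\<lambda>m s u. \<Sum>x\<in>indices J m. coeff s x * coeff u x"
    have sq: "(\<Sum>x\<in>indices J m. (d m x)\<^sup>2) = (\<Sum>i<n. \<Sum>k<n. \<theta> i * \<theta> k *
        (?C m (t (Suc i)) (t (Suc k)) - ?C m (t (Suc i)) (t k) - (?C m (t i) (t (Suc k)) - ?C m (t i) (t k))))" for m
    proof -
      have "(\<Sum>x\<in>indices J m. (d m x)\<^sup>2) = (\<Sum>x\<in>indices J m. \<Sum>i<n. \<Sum>k<n.
         \<theta> i * \<theta> k * ((coeff (t (Suc i)) x - coeff (t i) x) * (coeff (t (Suc k)) x - coeff (t k) x)))"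
        unfolding d_def power2_eq_square sum_product by (simp add: mult_ac)
      also have "\<dots> = (\<Sum>i<n. \<Sum>k<n. \<Sum>x\<in>indices J m.
         \<theta> i * \<theta> k * ((coeff (t (Suc i)) x - coeff (t i) x) * (coeff (t (Suc k)) x - coeff (t k) x)))"
        by (subst sum.swap, rule sum.cong[OF refl], rule sum.swap)
      finally show ?thesis
        by (simp add: sum_distrib_left sum_subtractf sum.distrib algebra_simps)
    qed
    have "(\<lambda>m. \<Sum>x\<in>indices J m. (d m x)\<^sup>2) \<longlonglongrightarrow> (\<Sum>i<n. \<Sum>k<n. \<theta> i * \<theta> k *
        (min (t (Suc i)) (t (Suc k)) - min (t (Suc i)) (t k) - (min (t i) (t (Suc k)) - min (t i) (t k))))"
      unfolding sq by (intro tendsto_sum tendsto_mult tendsto_const tendsto_diff coeff_cov tb) auto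
    also have "(\<Sum>i<n. \<Sum>k<n. \<theta> i * \<theta> k *
        (min (t (Suc i)) (t (Suc k)) - min (t (Suc i)) (t k) - (min (t i) (t (Suc k)) - min (t i) (t k))))
        = (\<Sum>i<n. \<Sum>k<n. if k = i then (\<theta> i)\<^sup>2 * (t (Suc i) - t i) else 0)"
    proof (intro sum.cong refl)
      fix i k
      have m: "x \<le> y \<Longrightarrow> t x \<le> t y" for x y using tm by (rule monoD)
      \<comment> \<open>For distinct i and k the time intervals do not overlap, and monotonicity of
        t makes the four minima cancel.\<close>
      consider "i = k" | "Suc i \<le> k" | "Suc k \<le> i" by linarith
      then show "\<theta> i * \<theta> k * (min (t (Suc i)) (t (Suc k)) - min (t (Suc i)) (t k) - (min (t i) (t (Suc k)) - min (t i) (t k)))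
         = (if k = i then (\<theta> i)\<^sup>2 * (t (Suc i) - t i) else 0)"
      proof cases
        case 1 then show ?thesis using m[of i "Suc i"] by (simp add: power2_eq_square)
      next
        case 2 then show ?thesis using m[of "Suc i" k] m[of i "Suc i"] m[of k "Suc k"] by (simp add: min_def)
      next
        case 3 then show ?thesis using m[of "Suc k" i] m[of i "Suc i"] m[of k "Suc k"] by (simp add: min_def)
      qed
    qed
    also have "\<dots> = (\<Sum>i<n. (\<theta> i)\<^sup>2 * (t (Suc i) - t i))" by simp
    finally show ?thesis unfolding e
      by (intro tendsto_of_real tendsto_exp tendsto_divide tendsto_minus tendsto_const) auto
  qed
  with lim show ?thesis by (rule LIMSEQ_unique)
qed

theorem standard_brownian_motion_brown: "standard_brownian_motion M brown"
proof -
  \<comment> \<open>An image law and not a density, because repeated times in a monotone sequence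
    give variance 0.\<close>
  define N where "N \<tau> = distr std_normal_distribution borel (\<lambda>x. sqrt \<tau> * x)" for \<tau>
  interpret S: real_distribution std_normal_distribution by (rule real_dist_normal_dist)
  have rN: "real_distribution (N \<tau>)" for \<tau> unfolding N_def by (intro S.real_distribution_distr) auto
  have cN: "char (N \<tau>) \<theta> = of_real (exp (- (\<theta>\<^sup>2 * \<tau>) / 2))" if "\<tau> \<ge> 0" for \<tau> \<theta>
  proof -
    have "char (N \<tau>) \<theta> = char std_normal_distribution (\<theta> * sqrt \<tau>)"
      unfolding N_def char_def by (subst integral_distr) (auto simp: mult_ac)
    then show ?thesis using that unfolding char_std_normal_distribution by (simp add: power_mult_distrib)
  qed
  have inc: "prob_space.indep_vars M (\<lambda>_. borel) (\<lambda>i \<omega>. brown (t (Suc i)) \<omega> - brown (t i) \<omega>) {..<n}"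
       "\<And>i. i < n \<Longrightarrow> distr M borel (\<lambda>\<omega>. brown (t (Suc i)) \<omega> - brown (t i) \<omega>) = N (t (Suc i) - t i)"
    if t: "0 \<le> t 0" "mono t" for t n
  proof -
    have p: "(CLINT \<omega>|M. iexp (\<Sum>i<n. \<theta> i * (brown (t (Suc i)) \<omega> - brown (t i) \<omega>))) = (\<Prod>i<n. char (N (t (Suc i) - t i)) (\<theta> i))" for \<theta>
    proof -
      have "char (N (t (Suc i) - t i)) (\<theta> i) = of_real (exp (- ((\<theta> i)\<^sup>2 * (t (Suc i) - t i)) / 2))" for i
        using monoD[OF t(2), of i "Suc i"] by (intro cN) auto
      then show ?thesis unfolding brown_increments_char[OF t]
        by (simp add: exp_sum[symmetric] sum_negf sum_divide_distrib flip: of_real_prod)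
    qed
    show "prob_space.indep_vars M (\<lambda>_. borel) (\<lambda>i \<omega>. brown (t (Suc i)) \<omega> - brown (t i) \<omega>) {..<n}"
       "\<And>i. i < n \<Longrightarrow> distr M borel (\<lambda>\<omega>. brown (t (Suc i)) \<omega> - brown (t i) \<omega>) = N (t (Suc i) - t i)"
      using indep_vars_joint_char[where X="\<lambda>i \<omega>. brown (t (Suc i)) \<omega> - brown (t i) \<omega>" and N="\<lambda>i. N (t (Suc i) - t i)" and n=n, OF _ rN p]
      by auto
  qed
  have "distributed M lborel (\<lambda>\<omega>. brown t \<omega> - brown s \<omega>) (normal_density 0 (sqrt (t - s)))" if "0 \<le> s" "s < t" for s t
  proof -
    define u where "u i = (if i = 0 then s else t)" for i :: nat
    have "mono u" using that by (auto simp: u_def mono_def)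
    then have "distr M borel (\<lambda>\<omega>. brown t \<omega> - brown s \<omega>) = N (t - s)"
      using inc(2)[of u 0 1] that by (simp add: u_def)
    moreover have "distributed std_normal_distribution lborel (\<lambda>x. 0 + sqrt (t - s) * x) (normal_density (0 + sqrt (t - s) * 0) (\<bar>sqrt (t - s)\<bar> * 1))"
      using that by (intro S.normal_density_affine) (auto simp: distributed_def distr_id2)
    then have "N (t - s) = density lborel (normal_density 0 (sqrt (t - s)))"
      using that unfolding N_def distributed_def by (auto cong: distr_cong simp: distr_cong[OF refl sets_lborel])
    ultimately show ?thesis
      unfolding distributed_def by (auto simp: distr_cong[OF refl sets_lborel])
  qed
  then show ?thesis
    unfolding standard_brownian_motion_def
    using inc prob_space_axioms AE_regular by (auto simp: brown_0 intro: brown_continuous elim: AE_mp)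
qed

end

section \<open>A Gaussian family on the prescribed sample space\<close>

definition bin_digit :: "nat \<Rightarrow> real \<Rightarrow> real" where
  "bin_digit n y = of_int (\<lfloor>2 ^ Suc n * y\<rfloor> - 2 * \<lfloor>2 ^ n * y\<rfloor>)"

definition tern_digit :: "nat \<Rightarrow> real \<Rightarrow> real" where
  "tern_digit n y = of_int (\<lfloor>3 ^ Suc n * y\<rfloor> - 3 * \<lfloor>3 ^ n * y\<rfloor>)"

lemma bin_digit_cases: "bin_digit n y = 0 \<or> bin_digit n y = 1"
proof -
  have "\<lfloor>2 * (2 ^ n * y)\<rfloor> - 2 * \<lfloor>2 ^ n * y\<rfloor> \<in> {0, 1}" by (simp, linarith)
  then show ?thesis unfolding bin_digit_def power_Suc mult.assoc by auto
qed

lemma bin_digit_sums: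
  assumes "0 \<le> y" "y < 1"
  shows "(\<lambda>n. bin_digit n y / 2 ^ Suc n) sums y"
proof -
  have "(\<Sum>i<n. bin_digit i y / 2 ^ Suc i) = of_int \<lfloor>2 ^ n * y\<rfloor> / 2 ^ n" for n
  proof (induction n)
    case 0
    then show ?case using assms floor_eq_iff[of y 0] by simp
  next
    case (Suc n)
    then show ?case by (simp add: bin_digit_def field_simps)
  qed
  moreover have "(\<lambda>n. of_int \<lfloor>2 ^ n * y\<rfloor> / 2 ^ n) \<longlonglongrightarrow> y"
  proof (rule LIM_zero_cancel, rule Lim_null_comparison[of _ "\<lambda>n. (1/2) ^ n"])
    show "\<forall>\<^sub>F n in sequentially. norm (of_int \<lfloor>2 ^ n * y\<rfloor> / 2 ^ n - y) \<le> (1/2) ^ n"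
    proof (intro always_eventually allI)
      fix n :: nat
      have "of_int \<lfloor>2 ^ n * y\<rfloor> / 2 ^ n - y = (of_int \<lfloor>2 ^ n * y\<rfloor> - 2 ^ n * y) / 2 ^ n" by (simp add: field_simps)
      moreover have "\<bar>of_int \<lfloor>2 ^ n * y\<rfloor> - 2 ^ n * y\<bar> \<le> 1" by linarith
      ultimately show "norm (of_int \<lfloor>2 ^ n * y\<rfloor> / 2 ^ n - y) \<le> (1/2) ^ n"
        by (simp add: abs_divide power_divide divide_right_mono)
    qed
  qed (auto intro!: LIMSEQ_realpow_zero)
  ultimately show ?thesis by (simp add: sums_def)
qed

text \<open>Digits 0 and 1 in base 3 leave a tail of at most 1/2 at every position, so the floor
  recovers each digit without ambiguity. In base 2 the tail could reach 1.\<close>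

lemma tern_digit_suminf:
  assumes b: "\<And>n. b n = 0 \<or> b n = (1::real)"
  shows "tern_digit k (\<Sum>n. b n / 3 ^ Suc n) = b k" "0 \<le> (\<Sum>n. b n / 3 ^ Suc n)" "(\<Sum>n. b n / 3 ^ Suc n) < 1"
proof -
  have b01: "0 \<le> b n" "b n \<le> 1" for n using b[of n] by auto
  have geo: "(\<lambda>n. 1 / 3 ^ Suc n) sums (1/2 :: real)"
    using sums_mult[OF geometric_sums[of "1/3 :: real"], of "1/3"] by (simp add: power_divide)
  have sm: "summable (\<lambda>n. b (n + m) / 3 ^ Suc n)" for m
    by (rule summable_comparison_test'[OF sums_summable[OF geo], of 0]) (use b01 in \<open>auto simp: divide_right_mono\<close>)
  have tl: "0 \<le> (\<Sum>n. b (n + m) / 3 ^ Suc n)" "(\<Sum>n. b (n + m) / 3 ^ Suc n) \<le> 1/2" for m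
  proof -
    show "0 \<le> (\<Sum>n. b (n + m) / 3 ^ Suc n)" by (rule suminf_nonneg[OF sm]) (use b01 in auto)
    have "(\<Sum>n. b (n + m) / 3 ^ Suc n) \<le> (\<Sum>n. 1 / 3 ^ Suc n)"
      by (rule suminf_le[OF _ sm sums_summable[OF geo]]) (use b01 in \<open>auto simp: divide_right_mono\<close>)
    then show "(\<Sum>n. b (n + m) / 3 ^ Suc n) \<le> 1/2" using sums_unique[OF geo] by simp
  qed
  define x where "x = (\<Sum>n. b n / 3 ^ Suc n)"
  have x: "3 ^ m * x = (\<Sum>n<m. b n * 3 ^ (m - Suc n)) + (\<Sum>n. b (n + m) / 3 ^ Suc n)" for m
  proof -
    have "x = (\<Sum>n. b (n + m) / 3 ^ Suc (n + m)) + (\<Sum>n<m. b n / 3 ^ Suc n)"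
      unfolding x_def using sm[of 0] by (subst suminf_split_initial_segment[where k=m]) simp_all
    also have "(\<Sum>n. b (n + m) / 3 ^ Suc (n + m)) = (\<Sum>n. b (n + m) / 3 ^ Suc n) / 3 ^ m"
      by (subst suminf_divide[OF sm, symmetric]) (simp add: power_add mult.assoc)
    finally have "3 ^ m * x = (\<Sum>n. b (n + m) / 3 ^ Suc n) + (\<Sum>n<m. 3 ^ m * (b n / 3 ^ Suc n))"
      by (simp add: distrib_left sum_distrib_left)
    also have "(\<Sum>n<m. 3 ^ m * (b n / 3 ^ Suc n)) = (\<Sum>n<m. b n * 3 ^ (m - Suc n))"
      by (intro sum.cong refl) (simp add: power_diff)
    finally show ?thesis by simp
  qed
  define I where "I m = (\<Sum>n<m. \<lfloor>b n\<rfloor> * 3 ^ (m - Suc n))" for m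
  have bI: "of_int \<lfloor>b n\<rfloor> = b n" for n using b[of n] by auto
  have fl: "\<lfloor>3 ^ m * x\<rfloor> = I m" for m
  proof (rule floor_unique)
    have "of_int (I m) = (\<Sum>n<m. b n * 3 ^ (m - Suc n))" unfolding I_def by (simp add: bI)
    then show "of_int (I m) \<le> 3 ^ m * x" "3 ^ m * x < of_int (I m) + 1" using x[of m] tl[of m] by auto
  qed
  have "I (Suc k) = 3 * I k + \<lfloor>b k\<rfloor>"
  proof -
    have "(\<Sum>n<k. \<lfloor>b n\<rfloor> * 3 ^ (Suc k - Suc n)) = 3 * I k"
      unfolding I_def sum_distrib_left by (intro sum.cong refl) (simp add: Suc_diff_Suc[symmetric])
    then show ?thesis unfolding I_def by simp
  qed
  then show "tern_digit k (\<Sum>n. b n / 3 ^ Suc n) = b k"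
    unfolding x_def[symmetric] tern_digit_def fl by (simp add: bI)
  show "0 \<le> (\<Sum>n. b n / 3 ^ Suc n)" "(\<Sum>n. b n / 3 ^ Suc n) < 1" using tl[of 0] by auto
qed

definition squash :: "real \<Rightarrow> real" where "squash x = 1 / 2 + arctan x / pi"

lemma squash_bounds: "0 < squash x" "squash x < 1"
  using arctan_lbound[of x] arctan_ubound[of x] pi_gt_zero by (auto simp: squash_def field_simps)

lemma tan_squash: "tan (pi * (squash x - 1 / 2)) = x"
  by (simp add: squash_def tan_arctan)

text \<open>The coordinates are squeezed into (0, 1) and their binary digits interleaved into one
  ternary number. What matters is measurability and that \<open>decode\<close> is a measurable left
  inverse.\<close>

definition encode :: "('i::countable \<Rightarrow> real) \<Rightarrow> real" where
  "encode w = (\<Sum>k. (case from_nat k of (x, n) \<Rightarrow> bin_digit n (squash (w x))) / 3 ^ Suc k)"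

definition decode :: "real \<Rightarrow> 'i::countable \<Rightarrow> real" where
  "decode y x = tan (pi * ((\<Sum>n. tern_digit (to_nat (x, n)) y / 2 ^ Suc n) - 1 / 2))"

lemma encode_bounds: "encode w \<in> {0..<1}"
  unfolding encode_def using tern_digit_suminf(2,3)[of "\<lambda>k. case from_nat k of (x, n) \<Rightarrow> bin_digit n (squash (w x))"] bin_digit_cases
  by (auto simp: split_def)

lemma decode_encode: "decode (encode w) = w"
proof
  fix x
  have "tern_digit (to_nat (x, n)) (encode w) = bin_digit n (squash (w x))" for n
    unfolding encode_def by (subst tern_digit_suminf(1)) (auto simp: split_def bin_digit_cases)
  then have "(\<Sum>n. tern_digit (to_nat (x, n)) (encode w) / 2 ^ Suc n) = squash (w x)"
    using bin_digit_sums[of "squash (w x)"] squash_bounds[of "w x"] by (simp add: sums_iff)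
  then show "decode (encode w) x = w x" unfolding decode_def by (simp add: tan_squash)
qed

lemma measurable_encode[measurable]: "encode \<in> borel_measurable (PiM UNIV (\<lambda>_::'i::countable. borel))"
  unfolding encode_def[abs_def] split_def bin_digit_def squash_def by measurable

lemma measurable_decode[measurable]: "(\<lambda>y. decode y x) \<in> borel_measurable borel"
  unfolding decode_def tern_digit_def tan_def by measurable

text \<open>The product of countably many normal laws is transported to the interval coordinate by
  \<open>encode\<close> and read back by \<open>decode\<close>. The torus coordinate is frozen at 0,
  since the uniform variable will be a function of the Gaussian family.\<close>

theorem ex_gaussian_family:
  "\<exists>\<nu> :: (torus \<times> real) measure. \<exists>G :: nat \<times> nat \<times> nat \<Rightarrow> torus \<times> real \<Rightarrow> real.
    sets \<nu> = sets ((borel :: torus measure) \<Otimes>\<^sub>M restrict_space (borel :: real measure) {0..<1}) \<and> gaussian_family \<nu> G"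
proof -
  let ?S = "std_normal_distribution"
  let ?K = "(borel :: torus measure) \<Otimes>\<^sub>M restrict_space (borel :: real measure) {0..<1}"
  interpret S: prob_space ?S by (rule prob_space_normal_density) simp
  interpret P: product_prob_space "\<lambda>_ :: nat \<times> nat \<times> nat. ?S" UNIV ..
  define \<Omega> where "\<Omega> = PiM UNIV (\<lambda>_ :: nat \<times> nat \<times> nat. ?S)"
  have s\<Omega>: "sets \<Omega> = sets (PiM UNIV (\<lambda>_. borel))" unfolding \<Omega>_def by (intro sets_PiM_cong) auto
  define E where "E w = ((0 :: torus), encode w)" for w :: "nat \<times> nat \<times> nat \<Rightarrow> real"
  have E[measurable]: "E \<in> \<Omega> \<rightarrow>\<^sub>M ?K"
  proof -
    have "encode \<in> \<Omega> \<rightarrow>\<^sub>M restrict_space borel {0..<1}"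
      by (intro measurable_restrict_space2 funcsetI encode_bounds) (simp add: measurable_cong_sets[OF s\<Omega> refl])
    then show ?thesis unfolding E_def by simp
  qed
  define \<nu> where "\<nu> = distr \<Omega> ?K E"
  define G where "G x w = decode (snd w) x" for x :: "nat \<times> nat \<times> nat" and w :: "torus \<times> real"
  have Gm: "G x \<in> ?K \<rightarrow>\<^sub>M borel" for x
    unfolding G_def by (rule measurable_compose[OF measurable_snd]) (intro measurable_restrict_space1 measurable_decode)
  have GE: "G x (E w) = w x" for x w by (simp add: G_def E_def decode_encode)
  have p\<Omega>: "prob_space \<Omega>" unfolding \<Omega>_def by (rule P.prob_space_axioms)
  have p\<nu>: "prob_space \<nu>" unfolding \<nu>_def by (rule prob_space.prob_space_distr[OF p\<Omega> E])
  have Gm': "G x \<in> \<nu> \<rightarrow>\<^sub>M borel" for x using Gm by (simp add: \<nu>_def)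
  have d: "distr \<nu> borel (G x) = ?S" for x
  proof -
    have "distr \<nu> borel (G x) = distr \<Omega> borel (\<lambda>w. w x)"
      unfolding \<nu>_def by (subst distr_distr[OF Gm E]) (simp add: comp_def GE)
    also have "\<dots> = distr \<Omega> ?S (\<lambda>w. w x)" by (rule distr_cong) auto
    also have "\<dots> = ?S" unfolding \<Omega>_def by (rule P.PiM_component) simp
    finally show ?thesis .
  qed
  have "prob_space.indep_vars \<nu> (\<lambda>_. borel) G UNIV"
  proof (subst prob_space.indep_vars_iff_distr_eq_PiM'[OF p\<nu>])
    have *: "(\<lambda>x. \<lambda>i\<in>UNIV. G i x) \<in> ?K \<rightarrow>\<^sub>M PiM UNIV (\<lambda>_. borel)"
      by (intro measurable_restrict Gm)
    have "distr \<nu> (PiM UNIV (\<lambda>_. borel)) (\<lambda>x. \<lambda>i\<in>UNIV. G i x) = distr \<Omega> (PiM UNIV (\<lambda>_. borel)) (\<lambda>w. w)"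
      unfolding \<nu>_def by (subst distr_distr[OF * E]) (simp add: comp_def GE restrict_UNIV)
    also have "\<dots> = \<Omega>" using s\<Omega> by (intro distr_id2) simp
    finally show "distr \<nu> (PiM UNIV (\<lambda>_. borel)) (\<lambda>x. \<lambda>i\<in>UNIV. G i x) = PiM UNIV (\<lambda>i. distr \<nu> borel (G i))"
      unfolding d \<Omega>_def .
  qed (use Gm' in auto)
  then have "gaussian_family \<nu> G"
    using p\<nu> d by (auto simp: gaussian_family_def gaussian_family_axioms_def)
  moreover have "sets \<nu> = sets ?K" by (simp add: \<nu>_def)
  ultimately show ?thesis by blast
qed

section \<open>Signed digits of a uniform variable\<close>

text \<open>Kept as a law on the whole line, so that Borel functions of a real variable need no
  restriction of their domain.\<close>

definition unif :: "real measure" where "unif = density lborel (indicator {0..<1})"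

lemma sets_unif[simp, measurable_cong]: "sets unif = sets borel" by (simp add: unif_def)

lemma space_unif[simp]: "space unif = UNIV" by (simp add: unif_def)

lemma nn_integral_unif: "f \<in> borel_measurable borel \<Longrightarrow> (\<integral>\<^sup>+x. f x \<partial>unif) = (\<integral>\<^sup>+x. f x * indicator {0..<1} x \<partial>lborel)"
  unfolding unif_def by (subst nn_integral_density) (auto simp: mult.commute)

lemma prob_space_unif: "prob_space unif"
proof
  have "emeasure unif (space unif) = (\<integral>\<^sup>+x. 1 \<partial>unif)" by simp
  also have "\<dots> = 1" by (subst nn_integral_unif) auto
  finally show "emeasure unif (space unif) = 1" .
qed

interpretation unif: prob_space unif by (rule prob_space_unif)

lemma AE_unif: "AE x in unif. 0 \<le> x \<and> x < 1"
  unfolding unif_def by (subst AE_density) (auto simp: indicator_def)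

text \<open>Conditioning on the first base-N digit: on each of the N cells an affine substitution
  makes the remainder uniform again.\<close>

lemma nn_integral_unif_split:
  fixes f :: "real \<Rightarrow> ennreal"
  assumes f[measurable]: "f \<in> borel_measurable borel" and N: "N > 0"
  shows "(\<integral>\<^sup>+x. f x \<partial>unif) = (\<Sum>c<N. \<integral>\<^sup>+y. f ((real c + y) / N) \<partial>unif) * ennreal (1 / N)"
proof -
  have ind: "indicator {0..<1} x = (\<Sum>c<N. indicator {real c / N ..< (real c + 1) / N} x :: ennreal)" for x :: real
  proof -
    have i: "x \<in> {real c / N ..< (real c + 1) / N} \<longleftrightarrow> \<lfloor>N * x\<rfloor> = int c" for c
      using N by (auto simp: field_simps floor_eq_iff)
    have eq: "(\<Sum>c<N. indicator {real c / N ..< (real c + 1) / N} x :: ennreal) = (\<Sum>c<N. if \<lfloor>N * x\<rfloor> = int c then 1 else 0)"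
      by (intro sum.cong refl) (simp only: indicator_def i of_bool_def)
    show ?thesis
    proof (cases "x \<in> {0..<1}")
      case True
      then have "0 \<le> N * x" "N * x < N" using N by auto
      then have k: "0 \<le> \<lfloor>N * x\<rfloor>" "\<lfloor>N * x\<rfloor> < N" by (auto simp: floor_less_iff)
      have "(\<Sum>c<N. if \<lfloor>N * x\<rfloor> = int c then 1 else (0::ennreal)) = (\<Sum>c<N. if c = nat \<lfloor>N * x\<rfloor> then 1 else 0)"
        using k by (intro sum.cong refl) auto
      also have "\<dots> = 1" using k by (simp, linarith)
      finally show ?thesis using True eq by simp
    next
      case False
      have "\<lfloor>N * x\<rfloor> \<noteq> int c" if "c < N" for c
      proof
        assume "\<lfloor>N * x\<rfloor> = int c"
        then have "x \<in> {real c / N ..< (real c + 1) / N}" using i by simp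
        then have "0 \<le> x" "x < 1"
        proof -
          assume x: "x \<in> {real c / N ..< (real c + 1) / N}"
          have "(real c + 1) / N \<le> 1" using that N by simp
          moreover have "0 \<le> real c / N" by simp
          ultimately show "0 \<le> x" "x < 1" using x order_trans[of 0 "real c / N" x] less_le_trans[of x "(real c + 1) / N" 1]
            unfolding atLeastLessThan_iff by blast+
        qed
        then show False using False by auto
      qed
      then show ?thesis using False eq by simp
    qed
  qed
  have "(\<integral>\<^sup>+x. f x \<partial>unif) = (\<integral>\<^sup>+x. (\<Sum>c<N. f x * indicator {real c / N ..< (real c + 1) / N} x) \<partial>lborel)"
    unfolding nn_integral_unif[OF f]
    by (rule nn_integral_cong) (simp only: sum_distrib_left[symmetric] ind[symmetric])
  also have "\<dots> = (\<Sum>c<N. \<integral>\<^sup>+x. f x * indicator {real c / N ..< (real c + 1) / N} x \<partial>lborel)"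
    by (rule nn_integral_sum) auto
  also have "\<dots> = (\<Sum>c<N. ennreal (1 / N) * (\<integral>\<^sup>+y. f ((real c + y) / N) \<partial>unif))"
  proof (intro sum.cong refl)
    fix c
    have "(\<integral>\<^sup>+x. f x * indicator {real c / N ..< (real c + 1) / N} x \<partial>lborel) =
       ennreal \<bar>1 / N\<bar> * (\<integral>\<^sup>+y. f (real c / N + (1 / N) * y) * indicator {real c / N ..< (real c + 1) / N} (real c / N + (1 / N) * y) \<partial>lborel)"
      by (rule nn_integral_real_affine) (use N in auto)
    also have "(\<lambda>y. f (real c / N + (1 / N) * y) * indicator {real c / N ..< (real c + 1) / N} (real c / N + (1 / N) * y))
       = (\<lambda>y. f ((real c + y) / N) * indicator {0..<1} y)"
    proof
      fix y
      have "real c / N + (1 / N) * y = (real c + y) / N" by (simp add: add_divide_distrib)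
      moreover have "(real c + y) / N \<in> {real c / N ..< (real c + 1) / N} \<longleftrightarrow> y \<in> {0..<1}"
        using N by (simp add: divide_le_cancel divide_less_cancel)
      ultimately show "f (real c / N + (1 / N) * y) * indicator {real c / N ..< (real c + 1) / N} (real c / N + (1 / N) * y)
        = f ((real c + y) / N) * indicator {0..<1} y"
        by (simp only: indicator_def)
    qed
    finally show "(\<integral>\<^sup>+x. f x * indicator {real c / N ..< (real c + 1) / N} x \<partial>lborel) = ennreal (1 / N) * (\<integral>\<^sup>+y. f ((real c + y) / N) \<partial>unif)"
      by (simp add: nn_integral_unif)
  qed
  finally show ?thesis by (simp add: sum_distrib_left mult.commute)
qed

lemma integral_unif_split:
  fixes f :: "real \<Rightarrow> real"
  assumes f[measurable]: "f \<in> borel_measurable borel" and N: "N > 0" and b: "\<And>x. \<bar>f x\<bar> \<le> K"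
  shows "(LINT x|unif. f x) = (\<Sum>c<N. LINT y|unif. f ((real c + y) / N)) / N"
proof -
  have i: "integrable unif (\<lambda>y. f (g y))" if [measurable]: "g \<in> borel_measurable borel" for g
    by (rule unif.integrable_const_bound[of _ K]) (use b in auto)
  \<comment> \<open>Shifting by the bound K reduces the signed case to the nonnegative one.\<close>
  have nn: "0 \<le> f x + K" for x using b[of x] by (simp add: abs_le_iff)
  have 1: "(\<integral>\<^sup>+y. ennreal (f (g y) + K) \<partial>unif) = ennreal ((LINT y|unif. f (g y)) + K)"
    if [measurable]: "g \<in> borel_measurable borel" for g
    using i[of g] nn unif.prob_space by (subst nn_integral_eq_integral) auto
  have nn1: "0 \<le> (LINT y|unif. f (g y)) + K" if [measurable]: "g \<in> borel_measurable borel" for g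
  proof -
    have "0 \<le> (LINT y|unif. f (g y) + K)" by (intro Bochner_Integration.integral_nonneg nn)
    then show ?thesis using i[of g] unif.prob_space by simp
  qed
  have "ennreal ((LINT x|unif. f x) + K) = (\<Sum>c<N. ennreal ((LINT y|unif. f ((real c + y) / N)) + K)) * ennreal (1 / N)"
    using nn_integral_unif_split[of "\<lambda>x. ennreal (f x + K)" N] N 1[of "\<lambda>x. x"] 1[of "\<lambda>y. (real c + y) / N" for c] by simp
  also have "\<dots> = ennreal ((\<Sum>c<N. ((LINT y|unif. f ((real c + y) / N)) + K)) * (1 / N))"
  proof -
    have nn2: "0 \<le> (LINT y|unif. f ((real c + y) / N)) + K" for c by (rule nn1) simp
    show ?thesis
      by (subst sum_ennreal, rule nn2) (rule ennreal_mult[symmetric], auto intro!: sum_nonneg nn2)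
  qed
  finally have "(LINT x|unif. f x) + K = (\<Sum>c<N. ((LINT y|unif. f ((real c + y) / N)) + K)) * (1 / N)"
    using nn1[of "\<lambda>y. (real c + y) / N" for c] nn1[of "\<lambda>x. x"] by (subst (asm) ennreal_inj) (auto intro!: sum_nonneg divide_nonneg_nonneg)
  then show ?thesis using N by (simp add: sum.distrib field_simps)
qed

definition pm1 :: "int \<Rightarrow> real" where "pm1 k = (if even k then 1 else -1)"

lemma pm1_add: "pm1 (a + b) = pm1 a * pm1 b" by (auto simp: pm1_def)
lemma pm1_sq[simp]: "pm1 a * pm1 a = 1" "(pm1 a)\<^sup>2 = 1" by (auto simp: pm1_def)
lemma abs_pm1[simp]: "\<bar>pm1 a\<bar> = 1" by (auto simp: pm1_def)

section \<open>The signed digits as a Markov chain\<close>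

locale radix =
  fixes r :: nat
  assumes r_ge_2: "2 \<le> r"
begin

text \<open>Half cells are recorded, because the slope of \<open>dist_int\<close> changes at
  half-integers as well as at integers. The parity of the index gives the right-hand slope of
  \<open>dist_int\<close> at r^n x.\<close>

definition cell :: "nat \<Rightarrow> real \<Rightarrow> int" where "cell n x = \<lfloor>2 * real r ^ n * x\<rfloor>"

definition sgn_digit :: "nat \<Rightarrow> real \<Rightarrow> real" where "sgn_digit n x = pm1 (cell n x)"

text \<open>Mean of the alternating sign over r consecutive half cells, up to the sign of the first
  one: an even r cancels completely, an odd r leaves one term out of r.\<close>

definition \<rho> :: real where "\<rho> = (if even r then 0 else 1 / r)"

text \<open>Measurability with respect to the first n half-cell partitions, stated as invariance.
  Testing against such functions takes the place of conditional expectations.\<close>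

definition past :: "nat \<Rightarrow> (real \<Rightarrow> real) \<Rightarrow> bool" where
  "past n f \<longleftrightarrow> (\<forall>x y. (\<forall>k<n. cell k x = cell k y) \<longrightarrow> f x = f y)"

lemma r_pos[simp]: "0 < r" "r \<noteq> 0" using r_ge_2 by auto

lemma \<rho>_bounds: "0 \<le> \<rho>" "\<rho> \<le> 1/3"
proof -
  show "0 \<le> \<rho>" by (simp add: \<rho>_def)
  show "\<rho> \<le> 1/3"
  proof (cases "even r")
    case False
    then have "3 \<le> r" using r_ge_2 by (cases "r = 2") auto
    then show ?thesis using False by (simp add: \<rho>_def field_simps)
  qed (simp add: \<rho>_def)
qed

lemma sgn_digit_sq[simp]: "sgn_digit n x * sgn_digit n x = 1" "(sgn_digit n x)\<^sup>2 = 1" "\<bar>sgn_digit n x\<bar> = 1"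
  by (auto simp: sgn_digit_def)

lemma measurable_cell[measurable]: "cell n \<in> borel \<rightarrow>\<^sub>M count_space UNIV" unfolding cell_def by measurable

lemma measurable_sgn_digit[measurable]: "sgn_digit n \<in> borel_measurable borel"
  unfolding sgn_digit_def[abs_def] pm1_def by measurable

text \<open>Integer division by r forgets the last digit. The partitions are therefore nested, and
  the finest of them determines the earlier ones.\<close>

lemma cell_div: "cell n x = cell (Suc n) x div int r"
proof -
  have "\<lfloor>(real r * (2 * real r ^ n * x)) / real_of_int (int r)\<rfloor> = \<lfloor>real r * (2 * real r ^ n * x)\<rfloor> div int r"
    by (rule floor_divide_real_eq_div) simp
  then show ?thesis by (simp add: cell_def mult_ac)
qed

lemma cell_eq_mono: "cell n x = cell n y \<Longrightarrow> k \<le> n \<Longrightarrow> cell k x = cell k y"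
proof (induction n)
  case (Suc n)
  have "cell n x = cell n y" using Suc.prems(1) cell_div[of n x] cell_div[of n y] by simp
  then show ?case using Suc by (cases "k = Suc n") auto
qed simp

lemma past_Suc: "past (Suc n) f \<longleftrightarrow> (\<forall>x y. cell n x = cell n y \<longrightarrow> f x = f y)"
proof (intro iffI allI impI)
  fix x y assume "past (Suc n) f" "cell n x = cell n y"
  then show "f x = f y" unfolding past_def by (auto intro: cell_eq_mono simp: less_Suc_eq_le)
next
  assume "\<forall>x y. cell n x = cell n y \<longrightarrow> f x = f y"
  then show "past (Suc n) f" unfolding past_def by blast
qed

lemma past_mono: "past m f \<Longrightarrow> m \<le> n \<Longrightarrow> past n f"
proof -
  assume f: "past m f" and mn: "m \<le> n"
  show ?thesis unfolding past_def
  proof (intro allI impI)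
    fix x y assume "\<forall>k<n. cell k x = cell k y"
    then have "\<forall>k<m. cell k x = cell k y" using mn by simp
    then show "f x = f y" using f unfolding past_def by blast
  qed
qed

lemma past_const: "past n (\<lambda>_. c)" by (simp add: past_def)

lemma past_comp: "past n f \<Longrightarrow> past n (\<lambda>x. h (f x))"
  unfolding past_def by (intro allI impI arg_cong[where f=h]) blast

lemma past_comp2: "past n f \<Longrightarrow> past n g \<Longrightarrow> past n (\<lambda>x. h (f x) (g x))"
  unfolding past_def by (intro allI impI arg_cong2[where f=h]) blast+

lemma past_sgn_digit: "k < n \<Longrightarrow> past n (sgn_digit k)" unfolding past_def sgn_digit_def by simp

lemma past_sum: "(\<And>i. i \<in> I \<Longrightarrow> past n (f i)) \<Longrightarrow> past n (\<lambda>x. \<Sum>i\<in>I. f i x)"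
  unfolding past_def by (intro allI impI sum.cong refl) blast

lemma cell_rep: "cell n (of_int k / (2 * real r ^ n)) = k" by (simp add: cell_def)

lemma past_rep: "past (Suc n) f \<Longrightarrow> f x = f (of_int (cell n x) / (2 * real r ^ n))"
proof -
  assume "past (Suc n) f"
  moreover have "cell n x = cell n (of_int (cell n x) / (2 * real r ^ n))" by (simp only: cell_rep)
  ultimately show ?thesis unfolding past_Suc by blast
qed

lemma past_measurable: "past n f \<Longrightarrow> f \<in> borel_measurable borel"
proof -
  assume "past n f"
  then have "past (Suc n) f" by (rule past_mono) simp
  define g where "g x = (\<lambda>k. f (of_int k / (2 * real r ^ n))) (cell n x)" for x
  have fg: "f = g"
  proof
    show "f x = g x" for x unfolding g_def by (rule past_rep) fact
  qed
  have "g \<in> borel_measurable borel" unfolding g_def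
    by (rule measurable_compose[OF measurable_cell]) simp
  then show ?thesis by (simp only: fg)
qed

lemma cell_range: "0 \<le> x \<Longrightarrow> x < 1 \<Longrightarrow> cell n x \<in> {0..<2 * int r ^ n}"
proof -
  assume x: "0 \<le> x" "x < 1"
  have "2 * real r ^ n * x < 2 * real r ^ n * 1" using x by (intro mult_strict_left_mono) auto
  then show ?thesis using x by (auto simp: cell_def floor_less_iff)
qed

text \<open>Only finitely many half cells meet the unit interval, so finitely many values occur
  there.\<close>

lemma past_bounded: "past n f \<Longrightarrow> \<exists>K. \<forall>x. 0 \<le> x \<longrightarrow> x < 1 \<longrightarrow> \<bar>f x\<bar> \<le> K"
proof -
  assume "past n f"
  then have f: "past (Suc n) f" by (rule past_mono) simp
  have "\<bar>f x\<bar> \<le> (\<Sum>k\<in>{0..<2 * int r ^ n}. \<bar>f (of_int k / (2 * real r ^ n))\<bar>)" if "0 \<le> x" "x < 1" for x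
    unfolding past_rep[OF f, of x] using cell_range[OF that, of n] by (intro member_le_sum) auto
  then show ?thesis by blast
qed

lemma past_integrable: "past n f \<Longrightarrow> integrable unif f"
proof -
  assume p: "past n f"
  obtain K where K: "\<And>x. 0 \<le> x \<Longrightarrow> x < 1 \<Longrightarrow> \<bar>f x\<bar> \<le> K" using past_bounded[OF p] by blast
  show ?thesis
    by (rule unif.integrable_const_bound[of _ K]) (use AE_unif K past_measurable[OF p] in \<open>auto elim!: AE_mp\<close>)
qed

lemma integral_pm1: "(LINT y|unif. pm1 \<lfloor>real r * y\<rfloor>) = (if even r then 0 else 1 / r)"
proof -
  have [measurable]: "(\<lambda>y. pm1 \<lfloor>real r * y\<rfloor>) \<in> borel_measurable borel" unfolding pm1_def by measurable
  have "(LINT y|unif. pm1 \<lfloor>real r * y\<rfloor>) = (\<Sum>c<r. LINT y|unif. pm1 \<lfloor>real r * ((real c + y) / r)\<rfloor>) / r"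
    by (rule integral_unif_split[where K=1]) auto
  also have "\<dots> = (\<Sum>c<r. pm1 (int c)) / r"
  proof (intro arg_cong2[where f="(/)"] sum.cong refl)
    fix c
    show "(LINT y|unif. pm1 \<lfloor>real r * ((real c + y) / r)\<rfloor>) = pm1 c"
  proof -
    have "(LINT y|unif. pm1 \<lfloor>real r * ((real c + y) / r)\<rfloor>) = (LINT y|unif. pm1 c)"
    proof (rule integral_cong_AE)
      show "AE y in unif. pm1 \<lfloor>real r * ((real c + y) / r)\<rfloor> = pm1 c"
        using AE_unif by eventually_elim (auto simp: floor_eq_iff intro!: arg_cong[where f=pm1])
    qed (auto simp: pm1_def)
    then show ?thesis using unif.prob_space by simp
    qed
  qed
  also have "(\<Sum>c<r. pm1 (int c)) = (if even r then 0 else 1)" by (induction r) (auto simp: pm1_def)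
  finally show ?thesis by auto
qed

text \<open>On the half cell with index c the function f is constant, and the next half cell has
  index r c + floor (r y) with y uniform. If r is odd, r c has the parity of c and the floor
  contributes the mean sign 1/r; if r is even, the floor alone has mean sign 0.\<close>

lemma markov_sgn_digit:
  assumes "past (Suc n) f"
  shows "(LINT x|unif. f x * sgn_digit (Suc n) x) = \<rho> * (LINT x|unif. f x * sgn_digit n x)"
proof -
  define N where "N = 2 * r ^ n"
  have N: "N > 0" "real N = 2 * real r ^ n" by (auto simp: N_def)
  obtain K where K: "\<And>x. 0 \<le> x \<Longrightarrow> x < 1 \<Longrightarrow> \<bar>f x\<bar> \<le> K" using past_bounded[OF assms] by blast
  \<comment> \<open>Outside the unit interval f may be unbounded; cutting it off gives the global
    bound that \<open>integral_unif_split\<close> asks for.\<close>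
  define f' where "f' x = f x * indicator {0..<1} x" for x
  have [measurable]: "f \<in> borel_measurable borel" by (rule past_measurable[OF assms])
  have [measurable]: "f' \<in> borel_measurable borel" unfolding f'_def by measurable
  have K': "\<bar>f' x\<bar> \<le> max K 0" for x using K[of x] by (auto simp: f'_def indicator_def)
  have ff: "(LINT x|unif. f x * sgn_digit k x) = (LINT x|unif. f' x * sgn_digit k x)" for k
    by (rule integral_cong_AE) (use AE_unif in \<open>auto simp: f'_def elim!: AE_mp\<close>)
  have sp: "(LINT x|unif. f' x * sgn_digit k x) = (\<Sum>c<N. LINT y|unif. f' ((real c + y) / N) * sgn_digit k ((real c + y) / N)) / N" for k
    by (rule integral_unif_split[where K="max K 0"]) (use N K' in \<open>auto simp: abs_mult\<close>)
  have c0: "cell n ((real c + y) / N) = int c" if "0 \<le> y" "y < 1" for c y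
    using that N unfolding cell_def by (simp add: floor_eq_iff)
  have c1: "cell (Suc n) ((real c + y) / N) = int r * int c + \<lfloor>real r * y\<rfloor>" for c y
  proof -
    have "2 * real r ^ Suc n * ((real c + y) / N) = real_of_int (int r * int c) + real r * y"
      unfolding N(2) by (simp add: field_simps)
    then show ?thesis unfolding cell_def by (simp only: floor_add_int[symmetric] add.commute)
  qed
  have f0: "f' ((real c + y) / N) = f (real c / N)" if "0 \<le> y" "y < 1" "c < N" for c y
  proof -
    have "(real c + y) / N < 1" 
    proof -
      have "real (Suc c) \<le> real N" using that by (intro of_nat_mono) simp
      then have "real c + y < real N" using that by simp
      then show ?thesis using N(1) by simp
    qed
    then have "f' ((real c + y) / N) = f ((real c + y) / N)" using that by (simp add: f'_def)
    also have "\<dots> = f (real c / N)"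
      using assms c0[OF that(1,2), of c] c0[of 0 c] unfolding past_Suc by auto
    finally show ?thesis .
  qed
  have e: "(LINT y|unif. f' ((real c + y) / N) * sgn_digit n ((real c + y) / N)) = f (real c / N) * pm1 c" if "c < N" for c
  proof -
    have "(LINT y|unif. f' ((real c + y) / N) * sgn_digit n ((real c + y) / N)) = (LINT y|unif. f (real c / N) * pm1 c)"
    proof (rule integral_cong_AE)
      show "AE y in unif. f' ((real c + y) / N) * sgn_digit n ((real c + y) / N) = f (real c / N) * pm1 c"
        using AE_unif by eventually_elim (simp add: f0 that sgn_digit_def c0)
    qed auto
    then show ?thesis using unif.prob_space by simp
  qed
  have e1: "(LINT y|unif. f' ((real c + y) / N) * sgn_digit (Suc n) ((real c + y) / N)) = f (real c / N) * pm1 c * \<rho>" if "c < N" for c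
  proof -
    have "(LINT y|unif. f' ((real c + y) / N) * sgn_digit (Suc n) ((real c + y) / N)) = (LINT y|unif. (f (real c / N) * pm1 (int r * int c)) * pm1 \<lfloor>real r * y\<rfloor>)"
    proof (rule integral_cong_AE)
      show "AE y in unif. f' ((real c + y) / N) * sgn_digit (Suc n) ((real c + y) / N) = (f (real c / N) * pm1 (int r * int c)) * pm1 \<lfloor>real r * y\<rfloor>"
        using AE_unif by eventually_elim (simp add: f0 that sgn_digit_def c1 pm1_add)
    qed (auto simp: pm1_def)
    also have "\<dots> = (f (real c / N) * pm1 (int r * int c)) * (if even r then 0 else 1 / r)"
      by (simp only: integral_mult_right_zero integral_pm1)
    also have "\<dots> = f (real c / N) * pm1 c * \<rho>" by (auto simp: \<rho>_def pm1_def)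
    finally show ?thesis .
  qed
  show ?thesis unfolding ff sp by (simp add: e e1 sum_distrib_left sum_divide_distrib mult_ac)
qed

lemma integral_sgn_digit_0: "(LINT x|unif. sgn_digit 0 x) = 0"
proof -
  have "(LINT x|unif. sgn_digit 0 x) = (\<Sum>c<2. LINT y|unif. sgn_digit 0 ((real c + y) / real 2)) / real 2"
    by (rule integral_unif_split[where K=1]) auto
  also have "\<dots> = (\<Sum>c<(2::nat). pm1 (int c)) / real 2"
  proof (intro arg_cong2[where f="(/)"] sum.cong refl)
    fix c
    show "(LINT y|unif. sgn_digit 0 ((real c + y) / real 2)) = pm1 c"
  proof -
    have "(LINT y|unif. sgn_digit 0 ((real c + y) / real 2)) = (LINT y|unif. pm1 c)"
    proof (rule integral_cong_AE)
      show "AE y in unif. sgn_digit 0 ((real c + y) / real 2) = pm1 c"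
        using AE_unif by eventually_elim (auto simp: sgn_digit_def cell_def floor_eq_iff intro!: arg_cong[where f=pm1])
    qed auto
    then show ?thesis using unif.prob_space by simp
    qed
  qed
  finally show ?thesis by (simp add: pm1_def numeral_2_eq_2)
qed

text \<open>Splitting into 2 r^i cells shows that 2 r^i x is again uniform modulo 1. Hence the
  bound, one s for each end of the unit interval, does not depend on i.\<close>

lemma near_integer_prob:
  assumes "0 \<le> s"
  shows "(LINT x|unif. indicator {y. dist_int y \<le> s} (2 * real r ^ i * x)) \<le> 2 * s"
proof -
  have [measurable]: "{y. dist_int y \<le> s} \<in> sets borel" unfolding dist_int_def round_def by measurable
  define N where "N = 2 * r ^ i"
  have N: "N > 0" "real N = 2 * real r ^ i" by (auto simp: N_def)
  have dc: "dist_int (real c + y) = dist_int y" for c y by (rule dist_int_cong) simp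
  have "(LINT x|unif. indicator {y. dist_int y \<le> s} (2 * real r ^ i * x))
     = (\<Sum>c<N. LINT y|unif. indicator {y. dist_int y \<le> s} (2 * real r ^ i * ((real c + y) / N))) / N"
    by (rule integral_unif_split[where K=1]) (use N in auto)
  also have "\<dots> = (\<Sum>c<N. LINT y|unif. indicator {y. dist_int y \<le> s} y) / N"
    using N by (simp add: N(2)[symmetric] dc indicator_def)
  also have "\<dots> = (LINT y|unif. indicator {y. dist_int y \<le> s} y)" using N by simp
  also have "\<dots> \<le> (LINT y|unif. indicator ({0..s} \<union> {1-s..1}) y)"
  proof (rule integral_mono_AE)
    show "AE y in unif. indicator {y. dist_int y \<le> s} y \<le> (indicator ({0..s} \<union> {1-s..1}) y :: real)"
      using AE_unif
    proof eventually_elim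
      case (elim y)
      have "round y = 0 \<or> round y = 1" using elim unfolding round_def by linarith
      then show ?case using elim by (auto simp: indicator_def dist_int_def)
    qed
  qed (auto intro!: unif.integrable_const_bound[of _ 1])
  also have "\<dots> = measure unif ({0..s} \<union> {1-s..1})" by simp
  also have "\<dots> \<le> measure unif {0..s} + measure unif {1-s..1}" by (rule measure_subadditive) auto
  also have "\<dots> \<le> s + s"
  proof -
    have m: "measure unif {a..b} \<le> b - a" if "a \<le> b" for a b :: real
    proof -
      have "emeasure unif {a..b} = (\<integral>\<^sup>+x. indicator {a..b} x * indicator {0..<1} x \<partial>lborel)"
        using nn_integral_unif[of "indicator {a..b}"] by simp
      also have "\<dots> \<le> (\<integral>\<^sup>+x. indicator {a..b} x \<partial>lborel)" by (intro nn_integral_mono) (auto simp: indicator_def)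
      finally have "emeasure unif {a..b} \<le> ennreal (b - a)" using that by simp
      then show ?thesis using that by (simp add: unif.emeasure_eq_measure)
    qed
    show ?thesis using m[of 0 s] m[of "1-s" 1] assms by simp
  qed
  finally show ?thesis by simp
qed

end

section \<open>Gaussian averaging and Lindeberg's replacement\<close>

definition taylor2 :: "real \<Rightarrow> (real \<Rightarrow> real) \<Rightarrow> (real \<Rightarrow> real) \<Rightarrow> (real \<Rightarrow> real) \<Rightarrow> real \<Rightarrow> bool" where
  "taylor2 C F A B K \<longleftrightarrow> F \<in> borel_measurable borel \<and> A \<in> borel_measurable borel \<and> B \<in> borel_measurable borel \<and>
     (\<forall>s. \<bar>F s\<bar> \<le> K * (1 + \<bar>s\<bar>) \<and> \<bar>A s\<bar> \<le> K \<and> \<bar>B s\<bar> \<le> K) \<and>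
     (\<forall>s x. \<bar>F (s + x) - F s - A s * x - B s * x\<^sup>2 / 2\<bar> \<le> C * \<bar>x\<bar> ^ 3)"

abbreviation stdn :: "real measure" where "stdn \<equiv> std_normal_distribution"

interpretation stdn: real_distribution stdn by (rule real_dist_normal_dist)

definition gauss_avg :: "real \<Rightarrow> (real \<Rightarrow> real) \<Rightarrow> real \<Rightarrow> real" where
  "gauss_avg q F s = (LINT z|stdn. F (s + sqrt q * z))"

lemma stdn_moments:
  "integrable stdn (\<lambda>z. z)" "(LINT z|stdn. z) = 0"
  "integrable stdn (\<lambda>z. z\<^sup>2)" "(LINT z|stdn. z\<^sup>2) = 1"
  "integrable stdn (\<lambda>z. \<bar>z\<bar> ^ 3)" "(LINT z|stdn. \<bar>z\<bar> ^ 3) \<le> 2"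
  "integrable stdn (\<lambda>z. \<bar>z\<bar>)" "(LINT z|stdn. \<bar>z\<bar>) \<le> 1"
  "integrable stdn (\<lambda>z. z ^ 4)" "(LINT z|stdn. z ^ 4) = 3"
proof -
  have s: "sqrt (2 / pi) \<le> 1" using pi_gt3 by (simp add: real_sqrt_le_1_iff)
  show i1: "integrable stdn (\<lambda>z. z)" using integrable_std_normal_distribution_moment[of 1] by simp
  show "(LINT z|stdn. z) = 0" using integral_std_normal_distribution_moment_odd[of 1] by simp
  show "integrable stdn (\<lambda>z. z\<^sup>2)" by (rule integrable_std_normal_distribution_moment)
  show "(LINT z|stdn. z\<^sup>2) = 1" using std_normal_distribution_even_moments(1)[of 1] by (simp add: fact_numeral)
  have "integrable stdn (\<lambda>z. z ^ 3)" by (rule integrable_std_normal_distribution_moment)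
  then have "integrable stdn (\<lambda>z. \<bar>z ^ 3\<bar>)" by (rule integrable_abs)
  then show "integrable stdn (\<lambda>z. \<bar>z\<bar> ^ 3)" by (simp add: power_abs)
  show "(LINT z|stdn. \<bar>z\<bar> ^ 3) \<le> 2" using std_normal_distribution_odd_moments_abs[of 1] s by simp
  show "integrable stdn (\<lambda>z. \<bar>z\<bar>)" using i1 by (rule integrable_abs)
  show "(LINT z|stdn. \<bar>z\<bar>) \<le> 1" using std_normal_distribution_odd_moments_abs[of 0] s by simp
  show "integrable stdn (\<lambda>z. z ^ 4)" by (rule integrable_std_normal_distribution_moment)
  show "(LINT z|stdn. z ^ 4) = 3" using std_normal_distribution_even_moments(1)[of 2] by (simp add: fact_numeral)
qed

lemma integrable_growth:
  assumes [measurable]: "F \<in> borel_measurable borel" and "\<And>s. \<bar>F s\<bar> \<le> K * (1 + \<bar>s\<bar>)"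
  shows "integrable stdn (\<lambda>z. F (s + c * z))"
proof (rule Bochner_Integration.integrable_bound)
  show "integrable stdn (\<lambda>z. K * (1 + (\<bar>s\<bar> + \<bar>c\<bar> * \<bar>z\<bar>)))"
    using stdn_moments(7) by auto
  have K: "0 \<le> K" using assms(2)[of 0] by simp
  show "AE z in stdn. norm (F (s + c * z)) \<le> norm (K * (1 + (\<bar>s\<bar> + \<bar>c\<bar> * \<bar>z\<bar>)))"
  proof (rule AE_I2)
    fix z
    have "\<bar>F (s + c * z)\<bar> \<le> K * (1 + \<bar>s + c * z\<bar>)" by (rule assms)
    also have "\<dots> \<le> K * (1 + (\<bar>s\<bar> + \<bar>c\<bar> * \<bar>z\<bar>))"
      using K by (intro mult_left_mono add_left_mono) (auto simp: abs_mult[symmetric])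
    finally show "norm (F (s + c * z)) \<le> norm (K * (1 + (\<bar>s\<bar> + \<bar>c\<bar> * \<bar>z\<bar>)))" by simp
  qed
qed simp

lemma gauss_avg_measurable[measurable]:
  assumes [measurable]: "F \<in> borel_measurable borel"
  shows "gauss_avg q F \<in> borel_measurable borel"
  unfolding gauss_avg_def[abs_def] by measurable

lemma gauss_avg_0: "gauss_avg 0 F s = F s"
  unfolding gauss_avg_def using stdn.prob_space by simp

text \<open>Semigroup property of the heat kernel: a sum of independent normal variables is
  identified by its characteristic function. Variance 0 has to be allowed, as it occurs for an empty
  sum.\<close>

lemma gauss_avg_add:
  assumes F[measurable]: "F \<in> borel_measurable borel" and gr: "\<And>s. \<bar>F s\<bar> \<le> K * (1 + \<bar>s\<bar>)"
    and q: "0 \<le> p" "0 \<le> q"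
  shows "gauss_avg p (gauss_avg q F) s = gauss_avg (p + q) F s"
proof -
  interpret P: pair_prob_space stdn stdn ..
  define N where "N \<tau> = distr stdn borel (\<lambda>x. sqrt \<tau> * x)" for \<tau>
  have rN: "real_distribution (N \<tau>)" for \<tau> unfolding N_def by (intro stdn.real_distribution_distr) auto
  have cN: "char (N \<tau>) \<theta> = of_real (exp (- (\<theta>\<^sup>2 * \<tau>) / 2))" if "\<tau> \<ge> 0" for \<tau> \<theta>
  proof -
    have "char (N \<tau>) \<theta> = char stdn (\<theta> * sqrt \<tau>)"
      unfolding N_def char_def by (subst integral_distr) (auto simp: mult_ac)
    then show ?thesis using that unfolding char_std_normal_distribution by (simp add: power_mult_distrib)
  qed
  let ?P = "stdn \<Otimes>\<^sub>M stdn"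
  let ?X = "\<lambda>w. sqrt p * fst w" and ?Y = "\<lambda>w. sqrt q * snd w"
  have dX: "distr ?P borel ?X = N p"
  proof -
    have "distr ?P borel ?X = distr (distr ?P stdn fst) borel (\<lambda>x. sqrt p * x)"
      by (subst distr_distr) (auto simp: comp_def)
    also have "distr ?P stdn fst = stdn" by (rule stdn.distr_pair_fst)
    finally show ?thesis by (simp add: N_def)
  qed
  have sw: "distr ?P stdn snd = stdn"
  proof (rule measure_eqI)
    fix A assume "A \<in> sets (distr ?P stdn snd)"
    then have A: "A \<in> sets stdn" by simp
    have "emeasure (distr ?P stdn snd) A = emeasure ?P (space stdn \<times> A)"
      using A by (subst emeasure_distr) (auto simp: space_pair_measure intro!: arg_cong[where f="emeasure ?P"])
    also have "\<dots> = emeasure stdn A" using A stdn.emeasure_space_1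
      by (subst stdn.emeasure_pair_measure_Times) auto
    finally show "emeasure (distr ?P stdn snd) A = emeasure stdn A" .
  qed simp
  have dY: "distr ?P borel ?Y = N q"
  proof -
    have "distr ?P borel ?Y = distr (distr ?P stdn snd) borel (\<lambda>x. sqrt q * x)"
      by (subst distr_distr) (auto simp: comp_def)
    then show ?thesis by (simp add: N_def sw)
  qed
  have ind0: "P.indep_var stdn fst stdn snd"
    by (subst P.indep_var_distribution_eq) (simp add: stdn.distr_pair_fst sw distr_id2)
  have ind: "P.indep_var borel ?X borel ?Y"
    using P.indep_var_compose[OF ind0, of "\<lambda>x. sqrt p * x" borel "\<lambda>x. sqrt q * x" borel] by (simp add: comp_def)
  have dS: "distr ?P borel (\<lambda>w. ?X w + ?Y w) = N (p + q)"
  proof (rule Levy_uniqueness[OF _ rN])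
    show "real_distribution (distr ?P borel (\<lambda>w. ?X w + ?Y w))" by (intro P.real_distribution_distr) auto
    show "char (distr ?P borel (\<lambda>w. ?X w + ?Y w)) = char (N (p + q))"
    proof
      fix \<theta>
      show "char (distr ?P borel (\<lambda>w. ?X w + ?Y w)) \<theta> = char (N (p + q)) \<theta>"
        unfolding P.char_distr_add[OF ind] dX dY using q
        by (simp add: cN ring_distribs add_divide_distrib diff_divide_distrib flip: of_real_mult exp_add)
    qed
  qed
  have i: "integrable ?P (\<lambda>w. F (s + (?X w + ?Y w)))"
  proof -
    have "integrable (N (p + q)) (\<lambda>u. F (s + u))"
      unfolding N_def by (subst integrable_distr_eq) (auto intro!: integrable_growth[OF F gr])
    then show ?thesis unfolding dS[symmetric] by (subst (asm) integrable_distr_eq) auto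
  qed
  have "gauss_avg p (gauss_avg q F) s = (LINT x|stdn. LINT y|stdn. F (s + (sqrt p * x + sqrt q * y)))"
    unfolding gauss_avg_def by (simp add: add.assoc)
  also have "\<dots> = (LINT w|?P. F (s + (?X w + ?Y w)))"
    using P.integral_fst'[OF i] by simp
  also have "\<dots> = (LINT u|distr ?P borel (\<lambda>w. ?X w + ?Y w). F (s + u))"
    by (subst integral_distr) auto
  also have "\<dots> = gauss_avg (p + q) F s"
    unfolding dS unfolding N_def gauss_avg_def by (subst integral_distr) auto
  finally show ?thesis .
qed

text \<open>A and B stand for the first two derivatives, but only the cubic remainder bound is
  demanded of them; averaging therefore needs no differentiation under the integral and keeps C. The
  constant K serves integrability only and may grow, here with E|z| <= 1.\<close>

lemma taylor2_gauss_avg: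
  assumes T: "taylor2 C F A B K" and q: "0 \<le> q"
  shows "\<exists>K'. taylor2 C (gauss_avg q F) (gauss_avg q A) (gauss_avg q B) K'"
proof -
  have [measurable]: "F \<in> borel_measurable borel" "A \<in> borel_measurable borel" "B \<in> borel_measurable borel"
    and gF: "\<And>s. \<bar>F s\<bar> \<le> K * (1 + \<bar>s\<bar>)" and gA: "\<And>s. \<bar>A s\<bar> \<le> K" and gB: "\<And>s. \<bar>B s\<bar> \<le> K"
    and tay: "\<And>s x. \<bar>F (s + x) - F s - A s * x - B s * x\<^sup>2 / 2\<bar> \<le> C * \<bar>x\<bar> ^ 3"
    using T by (auto simp: taylor2_def)
  have K: "0 \<le> K" using gA[of 0] by simp
  have iF: "integrable stdn (\<lambda>z. F (s + c * z))" for s c by (rule integrable_growth[OF _ gF]) auto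
  have iA: "integrable stdn (\<lambda>z. A (s + c * z))" for s c by (rule stdn.integrable_const_bound[of _ K]) (use gA in auto)
  have iB: "integrable stdn (\<lambda>z. B (s + c * z))" for s c by (rule stdn.integrable_const_bound[of _ K]) (use gB in auto)
  define K' where "K' = K * (2 + sqrt q)"
  have KK': "K \<le> K'" using mult_left_mono[of 1 "2 + sqrt q" K] K q by (auto simp: K'_def)
  have "\<bar>gauss_avg q F s\<bar> \<le> K' * (1 + \<bar>s\<bar>)" for s
  proof -
    have "\<bar>gauss_avg q F s\<bar> \<le> (LINT z|stdn. \<bar>F (s + sqrt q * z)\<bar>)" unfolding gauss_avg_def by (rule integral_abs_bound)
    also have "\<dots> \<le> (LINT z|stdn. K * (1 + \<bar>s\<bar> + sqrt q * \<bar>z\<bar>))"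
    proof (rule integral_mono)
      show "integrable stdn (\<lambda>z. K * (1 + \<bar>s\<bar> + sqrt q * \<bar>z\<bar>))" using stdn_moments(7) by auto
      fix z
      have "\<bar>F (s + sqrt q * z)\<bar> \<le> K * (1 + \<bar>s + sqrt q * z\<bar>)" by (rule gF)
      also have "\<dots> \<le> K * (1 + \<bar>s\<bar> + sqrt q * \<bar>z\<bar>)"
      proof (intro mult_left_mono K)
        have "\<bar>s + sqrt q * z\<bar> \<le> \<bar>s\<bar> + sqrt q * \<bar>z\<bar>" using abs_triangle_ineq[of s "sqrt q * z"] q by (simp add: abs_mult)
        then show "1 + \<bar>s + sqrt q * z\<bar> \<le> 1 + \<bar>s\<bar> + sqrt q * \<bar>z\<bar>" by simp
      qed
      finally show "\<bar>F (s + sqrt q * z)\<bar> \<le> K * (1 + \<bar>s\<bar> + sqrt q * \<bar>z\<bar>)" .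
    qed (intro integrable_abs iF)
    also have "\<dots> = K * (1 + \<bar>s\<bar> + sqrt q * (LINT z|stdn. \<bar>z\<bar>))"
      using stdn_moments(7) stdn.prob_space by simp
    also have "\<dots> \<le> K * (1 + \<bar>s\<bar> + sqrt q * 1)"
      using K stdn_moments(8) q by (intro mult_left_mono add_left_mono) auto
    also have "\<dots> \<le> K' * (1 + \<bar>s\<bar>)"
    proof -
      have "1 + \<bar>s\<bar> + sqrt q * 1 \<le> (2 + sqrt q) * (1 + \<bar>s\<bar>)" using q by (simp add: algebra_simps)
      then show ?thesis unfolding K'_def using mult_left_mono[OF _ K] by (simp only: mult.assoc)
    qed
    finally show ?thesis .
  qed
  moreover have "\<bar>gauss_avg q H s\<bar> \<le> K'" if H: "\<And>s. \<bar>H s\<bar> \<le> K" "H \<in> borel_measurable borel" for H s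
  proof -
    note [measurable] = H(2)
    have "\<bar>gauss_avg q H s\<bar> \<le> (LINT z|stdn. \<bar>H (s + sqrt q * z)\<bar>)" unfolding gauss_avg_def by (rule integral_abs_bound)
    also have "\<dots> \<le> (LINT z|stdn. K)"
      by (rule integral_mono) (use H in \<open>auto intro!: stdn.integrable_const_bound[of _ K]\<close>)
    also have "\<dots> = K" using stdn.prob_space by simp
    finally show ?thesis using KK' by simp
  qed
  moreover have "\<bar>gauss_avg q F (s + x) - gauss_avg q F s - gauss_avg q A s * x - gauss_avg q B s * x\<^sup>2 / 2\<bar> \<le> C * \<bar>x\<bar> ^ 3" for s x
  proof -
    let ?h = "\<lambda>z. F ((s + sqrt q * z) + x) - F (s + sqrt q * z) - A (s + sqrt q * z) * x - B (s + sqrt q * z) * x\<^sup>2 / 2"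
    have iFx: "integrable stdn (\<lambda>z. F ((s + sqrt q * z) + x))" using iF[of "s + x" "sqrt q"] by (simp add: add_ac)
    have i3: "integrable stdn (\<lambda>z. B (s + sqrt q * z) * x\<^sup>2 / 2)"
      using integrable_mult_left[of "x\<^sup>2 / 2" stdn "\<lambda>z. B (s + sqrt q * z)"] iB[of s "sqrt q"] by simp
    have i2: "integrable stdn (\<lambda>z. A (s + sqrt q * z) * x)"
      using integrable_mult_left[of x stdn "\<lambda>z. A (s + sqrt q * z)"] iA[of s "sqrt q"] by simp
    have "(LINT z|stdn. ?h z) = (LINT z|stdn. F ((s + sqrt q * z) + x)) - (LINT z|stdn. F (s + sqrt q * z))
        - (LINT z|stdn. A (s + sqrt q * z) * x) - (LINT z|stdn. B (s + sqrt q * z) * x\<^sup>2 / 2)"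
      by (simp only: Bochner_Integration.integral_diff Bochner_Integration.integrable_diff iFx iF i2 i3)
    moreover have "(LINT z|stdn. F ((s + sqrt q * z) + x)) = gauss_avg q F (s + x)" by (simp add: gauss_avg_def add_ac)
    moreover have "(LINT z|stdn. A (s + sqrt q * z) * x) = gauss_avg q A s * x" unfolding gauss_avg_def by (rule integral_mult_left_zero)
    moreover have "(LINT z|stdn. B (s + sqrt q * z) * x\<^sup>2 / 2) = gauss_avg q B s * x\<^sup>2 / 2"
      using integral_mult_left_zero[of stdn "\<lambda>z. B (s + sqrt q * z)" "x\<^sup>2 / 2"] unfolding gauss_avg_def by simp
    ultimately
    have e: "gauss_avg q F (s + x) - gauss_avg q F s - gauss_avg q A s * x - gauss_avg q B s * x\<^sup>2 / 2 = (LINT z|stdn. ?h z)"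
      unfolding gauss_avg_def by linarith
    have "\<bar>LINT z|stdn. ?h z\<bar> \<le> (LINT z|stdn. \<bar>?h z\<bar>)" by (rule integral_abs_bound)
    also have "\<dots> \<le> (LINT z|stdn. C * \<bar>x\<bar> ^ 3)"
    proof (rule integral_mono)
      show "integrable stdn (\<lambda>z. \<bar>?h z\<bar>)"
        by (rule integrable_abs[OF Bochner_Integration.integrable_diff[OF Bochner_Integration.integrable_diff[OF
              Bochner_Integration.integrable_diff[OF iFx iF[of s "sqrt q"]] i2] i3]])
      show "\<bar>?h z\<bar> \<le> C * \<bar>x\<bar> ^ 3" for z by (rule tay[of "s + sqrt q * z" x])
    qed (rule stdn.integrable_const)
    also have "\<dots> = C * \<bar>x\<bar> ^ 3" using stdn.prob_space by simp
    finally show ?thesis by (simp only: e)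
  qed
  ultimately have "taylor2 C (gauss_avg q F) (gauss_avg q A) (gauss_avg q B) K'"
    unfolding taylor2_def using gA gB by auto
  then show ?thesis by blast
qed

text \<open>The first-order term has mean 0, the second-order term gives B q / 2, and the third
  absolute moment of a standard normal variable is at most 2.\<close>

lemma gauss_avg_step:
  assumes T: "taylor2 C F A B K" and q: "0 \<le> q"
  shows "\<bar>gauss_avg q F s - F s - B s * q / 2\<bar> \<le> 2 * C * sqrt q ^ 3"
proof -
  have [measurable]: "F \<in> borel_measurable borel"
    and gF: "\<And>s. \<bar>F s\<bar> \<le> K * (1 + \<bar>s\<bar>)"
    and tay: "\<And>s x. \<bar>F (s + x) - F s - A s * x - B s * x\<^sup>2 / 2\<bar> \<le> C * \<bar>x\<bar> ^ 3"
    using T by (auto simp: taylor2_def)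
  have C: "0 \<le> C" using tay[of 0 1] by (auto intro: order_trans[OF abs_ge_zero])
  have iF: "integrable stdn (\<lambda>z. F (s + sqrt q * z))" by (rule integrable_growth[OF _ gF]) auto
  let ?h = "\<lambda>z. F (s + sqrt q * z) - F s - A s * (sqrt q * z) - B s * (sqrt q * z)\<^sup>2 / 2"
  have i2: "integrable stdn (\<lambda>z. B s * (sqrt q * z)\<^sup>2 / 2)" unfolding power_mult_distrib using stdn_moments(3) by auto
  have i1: "integrable stdn (\<lambda>z. A s * (sqrt q * z))" using stdn_moments(1) by auto
  have "(LINT z|stdn. B s * (sqrt q * z)\<^sup>2 / 2) = B s * q / 2"
    unfolding power_mult_distrib using stdn_moments(3,4) q by simp
  moreover have "(LINT z|stdn. A s * (sqrt q * z)) = 0" using stdn_moments(1,2) by simp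
  moreover have "(LINT z|stdn. F s) = F s" using stdn.prob_space by simp
  moreover have "(LINT z|stdn. ?h z) = (LINT z|stdn. F (s + sqrt q * z)) - (LINT z|stdn. F s)
      - (LINT z|stdn. A s * (sqrt q * z)) - (LINT z|stdn. B s * (sqrt q * z)\<^sup>2 / 2)"
    using iF i1 i2 by (simp only: Bochner_Integration.integral_diff Bochner_Integration.integrable_diff stdn.integrable_const)
  ultimately have e: "gauss_avg q F s - F s - B s * q / 2 = (LINT z|stdn. ?h z)"
    unfolding gauss_avg_def by linarith
  have "\<bar>LINT z|stdn. ?h z\<bar> \<le> (LINT z|stdn. \<bar>?h z\<bar>)" by (rule integral_abs_bound)
  also have "\<dots> \<le> (LINT z|stdn. C * sqrt q ^ 3 * \<bar>z\<bar> ^ 3)"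
  proof (rule integral_mono)
    show "integrable stdn (\<lambda>z. \<bar>?h z\<bar>)" using iF i1 i2 by (intro integrable_abs) auto
    show "integrable stdn (\<lambda>z. C * sqrt q ^ 3 * \<bar>z\<bar> ^ 3)" using stdn_moments(5) by auto
    show "\<bar>?h z\<bar> \<le> C * sqrt q ^ 3 * \<bar>z\<bar> ^ 3" for z
      using tay[of s "sqrt q * z"] q by (simp add: abs_mult power_mult_distrib mult_ac)
  qed
  also have "\<dots> = C * sqrt q ^ 3 * (LINT z|stdn. \<bar>z\<bar> ^ 3)" by simp
  also have "\<dots> \<le> C * sqrt q ^ 3 * 2" using C q stdn_moments(6) by (intro mult_left_mono) auto
  finally show ?thesis unfolding e by linarith
qed

context radix
begin

text \<open>Martingale differences of the sign chain: by \<open>markov_sgn_digit\<close>, \<rho>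
  times the previous sign is the conditional mean of the next one.\<close>

definition incr :: "nat \<Rightarrow> real \<Rightarrow> real" where
  "incr i x = (case i of 0 \<Rightarrow> sgn_digit 0 x | Suc k \<Rightarrow> sgn_digit (Suc k) x - \<rho> * sgn_digit k x)"

definition incr_var :: "nat \<Rightarrow> real" where "incr_var i = (if i = 0 then 1 else 1 - \<rho>\<^sup>2)"

lemma incr_var_bounds: "8/9 \<le> incr_var i" "0 \<le> incr_var i" "incr_var i \<le> 1"
proof -
  have "\<rho>\<^sup>2 \<le> (1/3)\<^sup>2" using \<rho>_bounds by (intro power_mono) auto
  then show "8/9 \<le> incr_var i" "0 \<le> incr_var i" "incr_var i \<le> 1" by (auto simp: incr_var_def power2_eq_square)
qed

lemma abs_incr_le: "\<bar>incr i x\<bar> \<le> 2"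
proof (cases i)
  case (Suc k)
  have "\<bar>incr i x\<bar> \<le> \<bar>sgn_digit (Suc k) x\<bar> + \<bar>\<rho> * sgn_digit k x\<bar>" unfolding Suc incr_def nat.case by (rule abs_triangle_ineq4)
  then show ?thesis using \<rho>_bounds by (simp add: abs_mult)
qed (simp add: incr_def)

lemma past_incr: "i < n \<Longrightarrow> past n (incr i)"
proof (cases i)
  case (Suc k)
  assume "i < n"
  then have k: "Suc k < n" "k < n" unfolding Suc by auto
  show ?thesis unfolding Suc incr_def nat.case
    by (rule past_comp2[where h="\<lambda>a b. a - \<rho> * b", OF past_sgn_digit past_sgn_digit, OF k])
qed (simp add: incr_def[abs_def] past_sgn_digit)

lemma past_mult: "past n f \<Longrightarrow> past n g \<Longrightarrow> past n (\<lambda>x. f x * g x)"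
  by (rule past_comp2[where h="(*)"])

lemma past_0: "past 0 f \<Longrightarrow> \<exists>c. f = (\<lambda>_. c)"
  unfolding past_def by (intro exI[of _ "f 0"]) auto

lemma incr_orthogonal:
  assumes p: "past i f"
  shows "(LINT x|unif. f x * incr i x) = 0"
proof (cases i)
  case 0
  then obtain c where "f = (\<lambda>_. c)" using past_0 p by blast
  then show ?thesis using 0 integral_sgn_digit_0 by (simp add: incr_def)
next
  case (Suc k)
  have i: "integrable unif (\<lambda>x. f x * sgn_digit (Suc k) x)" "integrable unif (\<lambda>x. f x * sgn_digit k x)"
    using p unfolding Suc by (auto intro!: past_integrable[of "Suc (Suc k)"] past_mult past_sgn_digit elim: past_mono)
  have "(LINT x|unif. f x * incr i x) = (LINT x|unif. f x * sgn_digit (Suc k) x - \<rho> * (f x * sgn_digit k x))"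
    unfolding Suc incr_def by (simp add: algebra_simps)
  also have "\<dots> = (LINT x|unif. f x * sgn_digit (Suc k) x) - \<rho> * (LINT x|unif. f x * sgn_digit k x)"
    using i by simp
  finally show ?thesis using markov_sgn_digit[of k f] p Suc by simp
qed

text \<open>Signs square to 1, so the square of an increment is affine in the product of two
  consecutive signs, whose conditional mean is \<rho>. The conditional variance
  \<open>1 + \<rho>\<^sup>2 - 2 * \<rho> * \<rho>\<close> is thus deterministic, and a normal
  variable can match it exactly.\<close>

lemma incr_square:
  assumes p: "past i f"
  shows "(LINT x|unif. f x * (incr i x)\<^sup>2) = incr_var i * (LINT x|unif. f x)"
proof (cases i)
  case 0
  then show ?thesis by (simp add: incr_def incr_var_def)
next
  case (Suc k)
  have p': "past (Suc k) (\<lambda>x. f x * sgn_digit k x)" using p Suc by (auto intro!: past_mult past_sgn_digit)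
  have i: "integrable unif (\<lambda>x. (f x * sgn_digit k x) * sgn_digit (Suc k) x)" "integrable unif f"
    using p p' unfolding Suc by (auto intro!: past_integrable[of "Suc (Suc k)"] past_mult past_sgn_digit elim: past_mono)
  have sq: "(incr i x)\<^sup>2 = (1 + \<rho>\<^sup>2) - 2 * \<rho> * (sgn_digit k x * sgn_digit (Suc k) x)" for x
  proof -
    have "(incr i x)\<^sup>2 = (sgn_digit (Suc k) x)\<^sup>2 + \<rho>\<^sup>2 * (sgn_digit k x)\<^sup>2 - 2 * \<rho> * (sgn_digit k x * sgn_digit (Suc k) x)"
      unfolding Suc incr_def nat.case by (simp only: power2_diff power_mult_distrib) (simp only: mult_ac)
    then show ?thesis by simp
  qed
  have "(LINT x|unif. f x * (incr i x)\<^sup>2) = (LINT x|unif. (1 + \<rho>\<^sup>2) * f x - 2 * \<rho> * ((f x * sgn_digit k x) * sgn_digit (Suc k) x))"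
    unfolding sq by (simp add: algebra_simps)
  also have "\<dots> = (1 + \<rho>\<^sup>2) * (LINT x|unif. f x) - 2 * \<rho> * (LINT x|unif. (f x * sgn_digit k x) * sgn_digit (Suc k) x)"
    using i by simp
  also have "(LINT x|unif. (f x * sgn_digit k x) * sgn_digit (Suc k) x) = \<rho> * (LINT x|unif. f x)"
    unfolding markov_sgn_digit[OF p'] by (simp add: mult.assoc)
  finally show ?thesis by (simp add: Suc incr_var_def algebra_simps power2_eq_square)
qed

definition mart :: "(nat \<Rightarrow> real) \<Rightarrow> nat \<Rightarrow> real \<Rightarrow> real" where
  "mart g n x = (\<Sum>i<n. g i * incr i x)"

lemma past_mart: "past n (mart g n)"
proof -
  have "past n (\<lambda>x. \<Sum>i<n. g i * incr i x)"
    by (intro past_sum past_comp[where h="\<lambda>y. g i * y" for i] past_incr) auto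
  then show ?thesis unfolding mart_def[abs_def] .
qed

lemma mart_variance: "(LINT x|unif. (mart g n x)\<^sup>2) = (\<Sum>i<n. (g i)\<^sup>2 * incr_var i)"
proof (induction n)
  case 0
  then show ?case by (simp add: mart_def)
next
  case (Suc n)
  have p: "past n (mart g n)" by (rule past_mart)
  have i: "integrable unif (\<lambda>x. (mart g n x)\<^sup>2)" "integrable unif (\<lambda>x. mart g n x * incr n x)" "integrable unif (\<lambda>x. (incr n x)\<^sup>2)"
    using p by (auto intro!: past_integrable[of "Suc n"] past_mult past_comp[where h="\<lambda>y. y\<^sup>2"] past_incr elim: past_mono)
  have "(mart g (Suc n) x)\<^sup>2 = (mart g n x)\<^sup>2 + 2 * g n * (mart g n x * incr n x) + (g n)\<^sup>2 * (incr n x)\<^sup>2" for x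
    by (simp add: mart_def power2_eq_square algebra_simps)
  then have "(LINT x|unif. (mart g (Suc n) x)\<^sup>2) = (LINT x|unif. (mart g n x)\<^sup>2)
     + 2 * g n * (LINT x|unif. mart g n x * incr n x) + (g n)\<^sup>2 * (LINT x|unif. (incr n x)\<^sup>2)"
    using i by simp
  also have "(LINT x|unif. mart g n x * incr n x) = 0" by (rule incr_orthogonal[OF p])
  also have "(LINT x|unif. (incr n x)\<^sup>2) = incr_var n" using incr_square[OF past_const[of n 1]] unif.prob_space by simp
  finally show ?case using Suc.IH by simp
qed

lemma mart_mean: "(LINT x|unif. mart g n x) = 0"
proof -
  have "(LINT x|unif. g i * incr i x) = 0" for i using incr_orthogonal[OF past_const[of i "g i"]] by simp
  moreover have "integrable unif (\<lambda>x. g i * incr i x)" for i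
    by (intro integrable_mult_right past_integrable[of "Suc i"] past_incr) simp
  ultimately show ?thesis unfolding mart_def
    by (simp only: Bochner_Integration.integral_sum sum.neutral_const)
qed

text \<open>Induction over the last increment: the term with the cube of the past vanishes by
  orthogonality and the mixed squares are evaluated by \<open>incr_square\<close>. The constant is
  \<open>48 = 3 * 2 ^ 4\<close>, since increments are bounded by 2.\<close>

lemma mart_moment4: "(LINT x|unif. mart g n x ^ 4) \<le> 48 * (\<Sum>i<n. (g i)\<^sup>2)\<^sup>2"
proof (induction n)
  case 0
  then show ?case by (simp add: mart_def)
next
  case (Suc n)
  define m where "m = mart g n"
  define D where "D = incr n"
  define c where "c = g n"
  define S where "S = (\<Sum>i<n. (g i)\<^sup>2)"
  have S: "0 \<le> S" unfolding S_def by (intro sum_nonneg) auto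
  have p: "past n m" unfolding m_def by (rule past_mart)
  have p2: "past n (\<lambda>x. (m x)\<^sup>2)" "past n (\<lambda>x. (m x)^3)" "past n (\<lambda>x. (m x)^4)"
    using p by (auto intro: past_comp[where h="\<lambda>y. y\<^sup>2"] past_comp[where h="\<lambda>y. y^3"] past_comp[where h="\<lambda>y. y^4"])
  have pD: "past (Suc n) (\<lambda>x. D x)" "past (Suc n) (\<lambda>x. (D x)\<^sup>2)"
    unfolding D_def by (auto intro!: past_incr past_comp[where h="\<lambda>y. y\<^sup>2"])
  have i: "integrable unif (\<lambda>x. m x ^ 4)" "integrable unif (\<lambda>x. m x ^ 3 * D x)" "integrable unif (\<lambda>x. (m x)\<^sup>2 * (D x)\<^sup>2)"
    "integrable unif (\<lambda>x. (m x)\<^sup>2)"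
    using p2 pD by (auto intro!: past_integrable[of "Suc n"] past_mult elim: past_mono)
  have pt: "(mart g (Suc n) x) ^ 4 \<le> m x ^ 4 + 4 * c * (m x ^ 3 * D x) + 8 * c\<^sup>2 * ((m x)\<^sup>2 * (D x)\<^sup>2) + 48 * c ^ 4" for x
  proof -
    define u where "u = c * D x"
    have s: "mart g (Suc n) x = m x + u" by (simp add: mart_def m_def u_def c_def D_def)
    have "(m x + u) ^ 4 = m x ^ 4 + 4 * (m x ^ 3 * u) + 6 * ((m x)\<^sup>2 * u\<^sup>2) + 4 * (m x * u ^ 3) + u ^ 4"
      by (simp add: power4_eq_xxxx power3_eq_cube power2_eq_square algebra_simps)
    \<comment> \<open>The term cubic in u has no vanishing mean; it is traded for its two even
      neighbours.\<close>
    moreover have "4 * (m x * u ^ 3) \<le> 2 * ((m x)\<^sup>2 * u\<^sup>2) + 2 * u ^ 4"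
    proof -
      have "0 \<le> 2 * ((m x - u) * u)\<^sup>2" by simp
      then show ?thesis by (simp add: power4_eq_xxxx power3_eq_cube power2_eq_square algebra_simps)
    qed
    moreover have "3 * u ^ 4 \<le> 48 * c ^ 4"
    proof -
      have "D x ^ 4 \<le> 2 ^ 4" using abs_incr_le[of n x] power_mono[of "\<bar>D x\<bar>" 2 4] by (simp add: D_def)
      then have "c ^ 4 * D x ^ 4 \<le> c ^ 4 * 16" by (intro mult_left_mono) auto
      then show ?thesis by (simp add: u_def power_mult_distrib)
    qed
    ultimately have "(m x + u) ^ 4 \<le> m x ^ 4 + 4 * (m x ^ 3 * u) + 8 * ((m x)\<^sup>2 * u\<^sup>2) + 48 * c ^ 4" by linarith
    then show ?thesis unfolding s by (simp add: u_def power_mult_distrib mult_ac)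
  qed
  have "(LINT x|unif. mart g (Suc n) x ^ 4) \<le> (LINT x|unif. m x ^ 4 + 4 * c * (m x ^ 3 * D x) + 8 * c\<^sup>2 * ((m x)\<^sup>2 * (D x)\<^sup>2) + 48 * c ^ 4)"
  proof (rule integral_mono)
    show "integrable unif (\<lambda>x. mart g (Suc n) x ^ 4)"
      by (rule past_integrable[of "Suc n"]) (rule past_comp[where h="\<lambda>y. y^4"], rule past_mart)
  qed (use i pt in auto)
  also have "\<dots> = (LINT x|unif. m x ^ 4) + 4 * c * (LINT x|unif. m x ^ 3 * D x) + 8 * c\<^sup>2 * (LINT x|unif. (m x)\<^sup>2 * (D x)\<^sup>2) + 48 * c ^ 4"
    using i unif.prob_space by simp
  also have "(LINT x|unif. m x ^ 3 * D x) = 0" unfolding D_def by (rule incr_orthogonal[OF p2(2)])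
  also have "(LINT x|unif. (m x)\<^sup>2 * (D x)\<^sup>2) = incr_var n * (LINT x|unif. (m x)\<^sup>2)" unfolding D_def by (rule incr_square[OF p2(1)])
  also have "8 * c\<^sup>2 * (incr_var n * (LINT x|unif. (m x)\<^sup>2)) \<le> 8 * c\<^sup>2 * S"
  proof (intro mult_left_mono)
    have v: "(LINT x|unif. (m x)\<^sup>2) \<le> S"
      unfolding m_def mart_variance S_def by (intro sum_mono mult_left_le) (use incr_var_bounds in auto)
    then show "incr_var n * (LINT x|unif. (m x)\<^sup>2) \<le> S"
      using incr_var_bounds[of n] S mult_mono[of "incr_var n" 1 "LINT x|unif. (m x)\<^sup>2" S] by simp
  qed auto
  also have "(LINT x|unif. m x ^ 4) \<le> 48 * S\<^sup>2" using Suc.IH unfolding m_def S_def .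
  finally have "(LINT x|unif. mart g (Suc n) x ^ 4) \<le> 48 * S\<^sup>2 + 8 * c\<^sup>2 * S + 48 * c ^ 4" by simp
  also have "\<dots> \<le> 48 * (S + c\<^sup>2)\<^sup>2"
    using S by (simp add: power2_eq_square power4_eq_xxxx algebra_simps)
  finally show ?case by (simp add: S_def c_def)
qed

text \<open>The last increment is exchanged for a normal variable of the same variance:
  orthogonality kills the A terms and the B terms agree, which leaves 8 C from increments bounded by
  2 and 2 C from the normal side. The normal variable is then absorbed into the test function as
  \<open>gauss_avg q F\<close>, hence F, A, B and K are arbitrary in the induction.\<close>

lemma lindeberg:
  assumes "taylor2 C F A B K"
  shows "\<bar>(LINT x|unif. F (mart g n x)) - gauss_avg (\<Sum>i<n. (g i)\<^sup>2 * incr_var i) F 0\<bar> \<le> 10 * C * (\<Sum>i<n. \<bar>g i\<bar> ^ 3)"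
  using assms
proof (induction n arbitrary: F A B K)
  case 0
  then show ?case using unif.prob_space by (simp add: mart_def gauss_avg_0)
next
  case (Suc n)
  define m where "m = mart g n"
  define D where "D = incr n"
  define c where "c = g n"
  define q where "q = c\<^sup>2 * incr_var n"
  have q0: "0 \<le> q" using incr_var_bounds[of n] by (simp add: q_def)
  have [measurable]: "F \<in> borel_measurable borel" "A \<in> borel_measurable borel" "B \<in> borel_measurable borel"
    and gF: "\<And>s. \<bar>F s\<bar> \<le> K * (1 + \<bar>s\<bar>)"
    and tay: "\<And>s x. \<bar>F (s + x) - F s - A s * x - B s * x\<^sup>2 / 2\<bar> \<le> C * \<bar>x\<bar> ^ 3"
    using Suc.prems by (auto simp: taylor2_def)
  have C: "0 \<le> C" using tay[of 0 1] by (auto intro: order_trans[OF abs_ge_zero])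
  obtain K' where T': "taylor2 C (gauss_avg q F) (gauss_avg q A) (gauss_avg q B) K'" using taylor2_gauss_avg[OF Suc.prems q0] by blast
  have p: "past n m" unfolding m_def by (rule past_mart)
  have pF: "past n (\<lambda>x. F (m x))" and pA: "past n (\<lambda>x. A (m x) * c)" and pB: "past n (\<lambda>x. B (m x) * c\<^sup>2 / 2)"
    and pG: "past n (\<lambda>x. gauss_avg q F (m x))"
    using p by (auto intro: past_comp[where h=F] past_comp[where h="\<lambda>y. A y * c"] past_comp[where h="\<lambda>y. B y * c\<^sup>2 / 2"]
      past_comp[where h="gauss_avg q F"])
  have pD: "past (Suc n) D" "past (Suc n) (\<lambda>x. (D x)\<^sup>2)"
    unfolding D_def by (auto intro!: past_incr past_comp[where h="\<lambda>y. y\<^sup>2"])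
  have S: "mart g (Suc n) x = m x + c * D x" for x by (simp add: mart_def m_def c_def D_def)
  have iS: "integrable unif (\<lambda>x. F (m x + c * D x))"
    unfolding S[symmetric] by (rule past_integrable[of "Suc n"]) (rule past_comp[where h=F], rule past_mart)
  have iF: "integrable unif (\<lambda>x. F (m x))" by (rule past_integrable[OF pF])
  have iA: "integrable unif (\<lambda>x. A (m x) * c * D x)"
    by (rule past_integrable[of "Suc n"], rule past_mult) (auto intro: past_mono[OF pA] pD)
  have iB: "integrable unif (\<lambda>x. B (m x) * c\<^sup>2 / 2 * (D x)\<^sup>2)"
    by (rule past_integrable[of "Suc n"], rule past_mult) (auto intro: past_mono[OF pB] pD)
  have iB0: "integrable unif (\<lambda>x. B (m x) * c\<^sup>2 / 2)" by (rule past_integrable[OF pB])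
  have iG: "integrable unif (\<lambda>x. gauss_avg q F (m x))" by (rule past_integrable[OF pG])
  have A0: "(LINT x|unif. A (m x) * c * D x) = 0" unfolding D_def by (rule incr_orthogonal[OF pA])
  have B0: "(LINT x|unif. B (m x) * c\<^sup>2 / 2 * (D x)\<^sup>2) = (LINT x|unif. B (m x) * c\<^sup>2 / 2) * incr_var n"
    unfolding D_def using incr_square[OF pB] by simp
  let ?h = "\<lambda>x. F (m x + c * D x) - F (m x) - A (m x) * c * D x - B (m x) * c\<^sup>2 / 2 * (D x)\<^sup>2"
  have e1: "(LINT x|unif. ?h x) = (LINT x|unif. F (m x + c * D x)) - (LINT x|unif. F (m x)) - (LINT x|unif. B (m x) * c\<^sup>2 / 2) * incr_var n"
    using A0 B0 by (simp only: Bochner_Integration.integral_diff Bochner_Integration.integrable_diff iS iF iA iB)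
  have b1: "\<bar>LINT x|unif. ?h x\<bar> \<le> 8 * C * \<bar>c\<bar> ^ 3"
  proof -
    have "\<bar>LINT x|unif. ?h x\<bar> \<le> (LINT x|unif. \<bar>?h x\<bar>)" by (rule integral_abs_bound)
    also have "\<dots> \<le> (LINT x|unif. 8 * C * \<bar>c\<bar> ^ 3)"
    proof (rule integral_mono)
      show "integrable unif (\<lambda>x. \<bar>?h x\<bar>)"
        by (rule integrable_abs[OF Bochner_Integration.integrable_diff[OF Bochner_Integration.integrable_diff[OF
              Bochner_Integration.integrable_diff[OF iS iF] iA] iB]])
      fix x
      have "\<bar>D x\<bar> ^ 3 \<le> 2 ^ 3" unfolding D_def by (intro power_mono abs_incr_le) auto
      then have "C * (\<bar>c\<bar> ^ 3 * \<bar>D x\<bar> ^ 3) \<le> C * (\<bar>c\<bar> ^ 3 * 8)" using C by (intro mult_left_mono) auto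
      moreover have "\<bar>?h x\<bar> \<le> C * (\<bar>c\<bar> ^ 3 * \<bar>D x\<bar> ^ 3)"
        using tay[of "m x" "c * D x"] by (simp add: abs_mult power_mult_distrib mult_ac)
      ultimately show "\<bar>?h x\<bar> \<le> 8 * C * \<bar>c\<bar> ^ 3" by (simp add: mult_ac)
    qed simp
    finally show ?thesis using unif.prob_space by simp
  qed
  let ?k = "\<lambda>x. gauss_avg q F (m x) - F (m x) - B (m x) * c\<^sup>2 / 2 * incr_var n"
  have e2: "(LINT x|unif. ?k x) = (LINT x|unif. gauss_avg q F (m x)) - (LINT x|unif. F (m x)) - (LINT x|unif. B (m x) * c\<^sup>2 / 2) * incr_var n"
    using iG iF iB0 by (simp only: Bochner_Integration.integral_diff Bochner_Integration.integrable_diff integrable_mult_left integral_mult_left_zero)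
  have b2: "\<bar>LINT x|unif. ?k x\<bar> \<le> 2 * C * \<bar>c\<bar> ^ 3"
  proof -
    have "\<bar>LINT x|unif. ?k x\<bar> \<le> (LINT x|unif. \<bar>?k x\<bar>)" by (rule integral_abs_bound)
    also have "\<dots> \<le> (LINT x|unif. 2 * C * \<bar>c\<bar> ^ 3)"
    proof (rule integral_mono)
      show "integrable unif (\<lambda>x. \<bar>?k x\<bar>)"
        using iG iF iB0 by (intro integrable_abs Bochner_Integration.integrable_diff integrable_mult_left)
      fix x
      have "sqrt q \<le> \<bar>c\<bar>"
      proof -
        have "q \<le> c\<^sup>2" using incr_var_bounds[of n] by (simp add: q_def mult_left_le)
        then show ?thesis using real_sqrt_le_mono by fastforce
      qed
      then have "sqrt q ^ 3 \<le> \<bar>c\<bar> ^ 3" using q0 by (intro power_mono) auto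
      then have "2 * C * sqrt q ^ 3 \<le> 2 * C * \<bar>c\<bar> ^ 3" using C by (intro mult_left_mono) auto
      moreover have "?k x = gauss_avg q F (m x) - F (m x) - B (m x) * q / 2" by (simp add: q_def)
      ultimately show "\<bar>?k x\<bar> \<le> 2 * C * \<bar>c\<bar> ^ 3" using gauss_avg_step[OF Suc.prems q0, of "m x"] by linarith
    qed simp
    finally show ?thesis using unif.prob_space by simp
  qed
  have "gauss_avg (\<Sum>i<n. (g i)\<^sup>2 * incr_var i) (gauss_avg q F) 0 = gauss_avg (\<Sum>i<Suc n. (g i)\<^sup>2 * incr_var i) F 0"
    by (subst gauss_avg_add[OF _ gF]) (use q0 incr_var_bounds in \<open>auto simp: q_def c_def intro!: sum_nonneg\<close>)
  then have "\<bar>(LINT x|unif. gauss_avg q F (m x)) - gauss_avg (\<Sum>i<Suc n. (g i)\<^sup>2 * incr_var i) F 0\<bar> \<le> 10 * C * (\<Sum>i<n. \<bar>g i\<bar> ^ 3)"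
    using Suc.IH[OF T'] by (simp add: m_def)
  moreover have "\<bar>(LINT x|unif. F (m x + c * D x)) - (LINT x|unif. gauss_avg q F (m x))\<bar> \<le> 10 * C * \<bar>c\<bar> ^ 3"
    using e1 e2 b1 b2 by linarith
  ultimately have "\<bar>(LINT x|unif. F (m x + c * D x)) - gauss_avg (\<Sum>i<Suc n. (g i)\<^sup>2 * incr_var i) F 0\<bar>
      \<le> 10 * C * (\<Sum>i<n. \<bar>g i\<bar> ^ 3) + 10 * C * \<bar>c\<bar> ^ 3" by linarith
  then show ?case unfolding S by (simp add: c_def distrib_left)
qed

end

section \<open>Digit sums as martingale sums; their variances\<close>

context radix
begin

definition digit_sum :: "(nat \<Rightarrow> real) \<Rightarrow> nat \<Rightarrow> real \<Rightarrow> real" where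
  "digit_sum \<alpha> n x = (\<Sum>i<n. \<alpha> i * sgn_digit i x)"

text \<open>Coefficient of the i-th increment in the martingale representation: a later sign at l
  depends on the sign at i through the factor \<open>\<rho> ^ (l - i)\<close> in its conditional
  mean.\<close>

definition tail_weight :: "(nat \<Rightarrow> real) \<Rightarrow> nat \<Rightarrow> nat \<Rightarrow> real" where
  "tail_weight \<alpha> L i = (\<Sum>l=i..<L. \<alpha> l * \<rho> ^ (l - i))"

definition digit_var :: "(nat \<Rightarrow> real) \<Rightarrow> nat \<Rightarrow> real" where
  "digit_var \<alpha> n = (LINT x|unif. (digit_sum \<alpha> n x)\<^sup>2)"

lemma past_digit_sum: "past n (digit_sum \<alpha> n)"
proof -
  have "past n (\<lambda>x. \<Sum>i<n. \<alpha> i * sgn_digit i x)"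
    by (intro past_sum past_comp[where h="\<lambda>y. \<alpha> i * y" for i] past_sgn_digit) auto
  then show ?thesis unfolding digit_sum_def[abs_def] .
qed

lemma measurable_digit_sum[measurable]: "digit_sum \<alpha> n \<in> borel_measurable borel"
  by (rule past_measurable[OF past_digit_sum])

lemma tail_weight_rec: "i < L \<Longrightarrow> tail_weight \<alpha> L i = \<alpha> i + \<rho> * tail_weight \<alpha> L (Suc i)"
proof -
  assume i: "i < L"
  have "(\<Sum>l=Suc i..<L. \<alpha> l * \<rho> ^ (l - i)) = \<rho> * (\<Sum>l=Suc i..<L. \<alpha> l * \<rho> ^ (l - Suc i))"
    unfolding sum_distrib_left
  proof (intro sum.cong refl)
    fix l assume "l \<in> {Suc i..<L}"
    then have "l - i = Suc (l - Suc i)" by auto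
    then show "\<alpha> l * \<rho> ^ (l - i) = \<rho> * (\<alpha> l * \<rho> ^ (l - Suc i))" by simp
  qed
  then show ?thesis using i unfolding tail_weight_def by (simp add: sum.atLeast_Suc_lessThan)
qed

lemma tail_weight_end: "tail_weight \<alpha> L L = 0" by (simp add: tail_weight_def)

lemma digit_sum_eq_mart: "digit_sum \<alpha> L x = mart (tail_weight \<alpha> L) L x"
proof -
  \<comment> \<open>The second summand is the conditional mean of the terms still to come, so the
    left side is the Doob martingale of the full digit sum. At n = L nothing remains.\<close>
  have "digit_sum \<alpha> n x + (case n of 0 \<Rightarrow> 0 | Suc k \<Rightarrow> \<rho> * tail_weight \<alpha> L n * sgn_digit k x) = mart (tail_weight \<alpha> L) n x"
    if "n \<le> L" for n using that
  proof (induction n)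
    case 0
    then show ?case by (simp add: digit_sum_def mart_def)
  next
    case (Suc n)
    then have "digit_sum \<alpha> n x + (case n of 0 \<Rightarrow> 0 | Suc k \<Rightarrow> \<rho> * tail_weight \<alpha> L n * sgn_digit k x) = mart (tail_weight \<alpha> L) n x" by simp
    moreover have "tail_weight \<alpha> L n = \<alpha> n + \<rho> * tail_weight \<alpha> L (Suc n)" using Suc.prems by (intro tail_weight_rec) simp
    ultimately show ?case
      unfolding digit_sum_def mart_def incr_def by (cases n) (simp_all add: algebra_simps)
  qed
  from this[of L] show ?thesis by (cases L) (simp_all add: tail_weight_end)
qed

lemma digit_var_eq: "digit_var \<alpha> L = (\<Sum>i<L. (tail_weight \<alpha> L i)\<^sup>2 * incr_var i)"
  unfolding digit_var_def digit_sum_eq_mart by (rule mart_variance)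

lemma digit_sum_mean: "(LINT x|unif. digit_sum \<alpha> L x) = 0"
  unfolding digit_sum_eq_mart by (rule mart_mean)

text \<open>Both bounds come from g i = \<alpha> i + \<rho> g (i+1) and
  \<open>\<rho>\<^sup>2 <= 1/9\<close>: squaring the sum costs a factor 2 and the shifted sum is
  reabsorbed. The actual constants 18/7 and 20/9 are rounded up to 3.\<close>

lemma tail_weight_sq_le: "(\<Sum>i<L. (tail_weight \<alpha> L i)\<^sup>2) \<le> 3 * (\<Sum>i<L. (\<alpha> i)\<^sup>2)"
  and sq_le_tail_weight: "(\<Sum>i<L. (\<alpha> i)\<^sup>2) \<le> 3 * (\<Sum>i<L. (tail_weight \<alpha> L i)\<^sup>2)"
proof -
  let ?g = "tail_weight \<alpha> L"
  have sh: "(\<Sum>i<L. (?g (Suc i))\<^sup>2) \<le> (\<Sum>i<L. (?g i)\<^sup>2)"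
  proof -
    have "(\<Sum>i<n. f (Suc i)) + f 0 = (\<Sum>i<n. f i) + f n" for f :: "nat \<Rightarrow> real" and n
      by (induction n) (simp_all add: algebra_simps)
    from this[of "\<lambda>i. (?g i)\<^sup>2" L] have "(\<Sum>i<L. (?g (Suc i))\<^sup>2) + (?g 0)\<^sup>2 = (\<Sum>i<L. (?g i)\<^sup>2)"
      by (simp add: tail_weight_end)
    moreover have "0 \<le> (?g 0)\<^sup>2" by simp
    ultimately show ?thesis by linarith
  qed
  have r2: "\<rho>\<^sup>2 \<le> 1/9" using power_mono[of \<rho> "1/3" 2] \<rho>_bounds by (simp add: power2_eq_square)
  have ab: "(a + b)\<^sup>2 \<le> 2 * a\<^sup>2 + 2 * b\<^sup>2" for a b :: real
    using sum_squares_bound[of a b] by (simp add: power2_sum)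
  have rb: "(\<Sum>i<L. (\<rho> * ?g (Suc i))\<^sup>2) \<le> (1/9) * (\<Sum>i<L. (?g i)\<^sup>2)"
  proof -
    have "(\<Sum>i<L. (\<rho> * ?g (Suc i))\<^sup>2) = \<rho>\<^sup>2 * (\<Sum>i<L. (?g (Suc i))\<^sup>2)" by (simp add: power_mult_distrib sum_distrib_left)
    also have "\<dots> \<le> (1/9) * (\<Sum>i<L. (?g i)\<^sup>2)" using r2 sh by (intro mult_mono) (auto intro!: sum_nonneg)
    finally show ?thesis .
  qed
  have "(\<Sum>i<L. (?g i)\<^sup>2) \<le> (\<Sum>i<L. 2 * (\<alpha> i)\<^sup>2 + 2 * (\<rho> * ?g (Suc i))\<^sup>2)"
    by (intro sum_mono) (use ab tail_weight_rec in auto)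
  also have "\<dots> = 2 * (\<Sum>i<L. (\<alpha> i)\<^sup>2) + 2 * (\<Sum>i<L. (\<rho> * ?g (Suc i))\<^sup>2)" by (simp add: sum.distrib sum_distrib_left)
  finally have "(\<Sum>i<L. (?g i)\<^sup>2) \<le> 2 * (\<Sum>i<L. (\<alpha> i)\<^sup>2) + 2 * (\<Sum>i<L. (\<rho> * ?g (Suc i))\<^sup>2)" .
  moreover have "0 \<le> (\<Sum>i<L. (\<alpha> i)\<^sup>2)" by (intro sum_nonneg) auto
  ultimately show "(\<Sum>i<L. (tail_weight \<alpha> L i)\<^sup>2) \<le> 3 * (\<Sum>i<L. (\<alpha> i)\<^sup>2)" using rb by linarith
  have "(\<Sum>i<L. (\<alpha> i)\<^sup>2) \<le> (\<Sum>i<L. 2 * (?g i)\<^sup>2 + 2 * (\<rho> * ?g (Suc i))\<^sup>2)"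
  proof (intro sum_mono)
    fix i assume "i \<in> {..<L}"
    then have "\<alpha> i = ?g i + - (\<rho> * ?g (Suc i))" using tail_weight_rec[of i L \<alpha>] by simp
    then show "(\<alpha> i)\<^sup>2 \<le> 2 * (?g i)\<^sup>2 + 2 * (\<rho> * ?g (Suc i))\<^sup>2" using ab[of "?g i" "- (\<rho> * ?g (Suc i))"] by simp
  qed
  also have "\<dots> = 2 * (\<Sum>i<L. (?g i)\<^sup>2) + 2 * (\<Sum>i<L. (\<rho> * ?g (Suc i))\<^sup>2)" by (simp add: sum.distrib sum_distrib_left)
  finally have "(\<Sum>i<L. (\<alpha> i)\<^sup>2) \<le> 2 * (\<Sum>i<L. (?g i)\<^sup>2) + 2 * (\<Sum>i<L. (\<rho> * ?g (Suc i))\<^sup>2)" .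
  moreover have "0 \<le> (\<Sum>i<L. (?g i)\<^sup>2)" by (intro sum_nonneg) auto
  ultimately show "(\<Sum>i<L. (\<alpha> i)\<^sup>2) \<le> 3 * (\<Sum>i<L. (tail_weight \<alpha> L i)\<^sup>2)" using rb by linarith
qed

lemma tail_weight_sq_le_var: "(\<Sum>i<L. (tail_weight \<alpha> L i)\<^sup>2) \<le> (9/8) * digit_var \<alpha> L"
  unfolding digit_var_eq sum_distrib_left
proof (intro sum_mono)
  fix i
  have "(tail_weight \<alpha> L i)\<^sup>2 * (8/9) \<le> (tail_weight \<alpha> L i)\<^sup>2 * incr_var i" by (intro mult_left_mono incr_var_bounds) auto
  then show "(tail_weight \<alpha> L i)\<^sup>2 \<le> 9/8 * ((tail_weight \<alpha> L i)\<^sup>2 * incr_var i)" by simp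
qed

lemma digit_var_ge: "(\<Sum>i<L. (\<alpha> i)\<^sup>2) \<le> 4 * digit_var \<alpha> L"
proof -
  have "digit_var \<alpha> L \<ge> 0" by (simp add: digit_var_def)
  then show ?thesis using sq_le_tail_weight[of \<alpha> L] tail_weight_sq_le_var[of \<alpha> L] by linarith
qed

lemma digit_var_le: "digit_var \<alpha> L \<le> 3 * (\<Sum>i<L. (\<alpha> i)\<^sup>2)"
proof -
  have "digit_var \<alpha> L \<le> (\<Sum>i<L. (tail_weight \<alpha> L i)\<^sup>2)"
    unfolding digit_var_eq by (intro sum_mono mult_left_le incr_var_bounds) auto
  then show ?thesis using tail_weight_sq_le[of \<alpha> L] by linarith
qed

lemma digit_sum_moment4: "(LINT x|unif. digit_sum \<alpha> L x ^ 4) \<le> 432 * (\<Sum>i<L. (\<alpha> i)\<^sup>2)\<^sup>2"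
proof -
  have "(LINT x|unif. digit_sum \<alpha> L x ^ 4) \<le> 48 * (\<Sum>i<L. (tail_weight \<alpha> L i)\<^sup>2)\<^sup>2"
    unfolding digit_sum_eq_mart by (rule mart_moment4)
  also have "\<dots> \<le> 48 * (3 * (\<Sum>i<L. (\<alpha> i)\<^sup>2))\<^sup>2"
    by (intro mult_left_mono power_mono tail_weight_sq_le) (auto intro: sum_nonneg)
  finally show ?thesis by (simp add: power_mult_distrib)
qed

lemma geometric_le: "(\<Sum>i<n. \<rho> ^ i) \<le> 3/2"
proof -
  have "(\<Sum>i<n. \<rho> ^ i) \<le> (\<Sum>i<n. (1/3) ^ i)" by (intro sum_mono power_mono) (use \<rho>_bounds in auto)
  also have "\<dots> \<le> 3/2" by (simp add: sum_gp_strict)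
  finally show ?thesis .
qed

lemma tail_weight_abs_le:
  assumes "\<And>i. i < L \<Longrightarrow> \<bar>\<alpha> i\<bar> \<le> b" "0 \<le> b"
  shows "\<bar>tail_weight \<alpha> L i\<bar> \<le> 2 * b"
proof -
  have "\<bar>tail_weight \<alpha> L i\<bar> \<le> (\<Sum>l=i..<L. \<bar>\<alpha> l * \<rho> ^ (l - i)\<bar>)" unfolding tail_weight_def by (rule sum_abs)
  also have "\<dots> \<le> (\<Sum>l=i..<L. b * \<rho> ^ (l - i))"
    using \<rho>_bounds assms by (intro sum_mono) (auto simp: abs_mult intro!: mult_right_mono)
  also have "\<dots> = b * (\<Sum>l<L - i. \<rho> ^ l)"
    unfolding sum_distrib_left by (rule sum.reindex_bij_witness[where i="\<lambda>l. l + i" and j="\<lambda>l. l - i"]) auto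
  also have "\<dots> \<le> b * (3/2)" by (intro mult_left_mono geometric_le assms)
  finally show ?thesis using assms(2) by linarith
qed

lemma sgn_digit_corr: "(LINT x|unif. sgn_digit i x * sgn_digit (i + k) x) = \<rho> ^ k"
proof (induction k)
  case 0
  then show ?case using unif.prob_space by simp
next
  case (Suc k)
  have "past (Suc (i + k)) (sgn_digit i)" by (rule past_sgn_digit) simp
  from markov_sgn_digit[OF this] show ?case using Suc by simp
qed

lemma sgn_digit_corr': "(LINT x|unif. sgn_digit i x * sgn_digit j x) = \<rho> ^ (if i \<le> j then j - i else i - j)"
  using sgn_digit_corr[of i "j - i"] sgn_digit_corr[of j "i - j"] by (auto simp: mult.commute)

lemma integrable_sgn_sgn: "integrable unif (\<lambda>x. c * (sgn_digit i x * sgn_digit j x))"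
  by (intro integrable_mult_right past_integrable[of "Suc (i + j)"] past_mult past_sgn_digit) auto

lemma integral_sum_product:
  "(LINT x|unif. (\<Sum>i<m. \<beta> i * sgn_digit (a + i) x) * (\<Sum>j<n. \<gamma> j * sgn_digit (b + j) x)) =
   (\<Sum>i<m. \<Sum>j<n. \<beta> i * \<gamma> j * (LINT x|unif. sgn_digit (a + i) x * sgn_digit (b + j) x))"
proof -
  have "(\<Sum>i<m. \<beta> i * sgn_digit (a + i) x) * (\<Sum>j<n. \<gamma> j * sgn_digit (b + j) x) =
     (\<Sum>i<m. \<Sum>j<n. \<beta> i * \<gamma> j * (sgn_digit (a + i) x * sgn_digit (b + j) x))" for x
    unfolding sum_product by (simp only: mult_ac)
  then show ?thesis
    by (simp only: Bochner_Integration.integral_sum Bochner_Integration.integrable_sum integrable_sgn_sgn integral_mult_right_zero)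
qed

text \<open>Correlations of signs depend only on the distance of their indices, so the variance is
  invariant under shifts.\<close>

lemma digit_var_shift: "(LINT x|unif. (\<Sum>i<m. \<beta> i * sgn_digit (a + i) x)\<^sup>2) = digit_var \<beta> m"
proof -
  have "(LINT x|unif. (\<Sum>i<m. \<beta> i * sgn_digit (a + i) x)\<^sup>2) = (\<Sum>i<m. \<Sum>j<m. \<beta> i * \<beta> j * \<rho> ^ (if i \<le> j then j - i else i - j))" for a
    unfolding power2_eq_square integral_sum_product sgn_digit_corr' by (intro sum.cong refl) simp
  from this[of a] this[of 0] show ?thesis by (simp add: digit_var_def digit_sum_def)
qed

lemma digit_sum_add: "digit_sum \<alpha> (a + m) x = digit_sum \<alpha> a x + (\<Sum>i<m. \<alpha> (a + i) * sgn_digit (a + i) x)"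
  unfolding digit_sum_def by (induction m) simp_all

text \<open>Correlations across the cut decay geometrically in both directions, so their total is at
  most \<open>b\<^sup>2 * (1/3) * (3/2)\<^sup>2\<close> whatever the lengths. Variances are additive
  up to this boundary term.\<close>

lemma digit_var_block:
  assumes b: "\<And>i. i < a + m \<Longrightarrow> \<bar>\<alpha> i\<bar> \<le> b"
  shows "\<bar>digit_var \<alpha> (a + m) - digit_var \<alpha> a - digit_var (\<lambda>i. \<alpha> (a + i)) m\<bar> \<le> 2 * b\<^sup>2"
proof -
  let ?D = "\<lambda>x. \<Sum>i<m. \<alpha> (a + i) * sgn_digit (a + i) x"
  have p: "past (a + m) (digit_sum \<alpha> a)" "past (a + m) ?D"
    using past_digit_sum[of a \<alpha>] by (auto intro: past_mono intro!: past_sum past_comp[where h="\<lambda>y. \<alpha> (a + i) * y" for i] past_sgn_digit)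
  have i: "integrable unif (\<lambda>x. (digit_sum \<alpha> a x)\<^sup>2)" "integrable unif (\<lambda>x. digit_sum \<alpha> a x * ?D x)" "integrable unif (\<lambda>x. (?D x)\<^sup>2)"
    by (rule past_integrable[of "a + m"], intro past_comp[where h="\<lambda>y. y\<^sup>2"] past_mult p)+
  have "digit_var \<alpha> (a + m) = (LINT x|unif. (digit_sum \<alpha> a x)\<^sup>2 + 2 * (digit_sum \<alpha> a x * ?D x) + (?D x)\<^sup>2)"
    unfolding digit_var_def digit_sum_add by (simp add: power2_sum algebra_simps)
  also have "\<dots> = digit_var \<alpha> a + 2 * (LINT x|unif. digit_sum \<alpha> a x * ?D x) + digit_var (\<lambda>i. \<alpha> (a + i)) m"
    using i by (simp add: digit_var_shift digit_var_def[of \<alpha> a])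
  finally have e: "digit_var \<alpha> (a + m) - digit_var \<alpha> a - digit_var (\<lambda>i. \<alpha> (a + i)) m = 2 * (LINT x|unif. digit_sum \<alpha> a x * ?D x)" by simp
  have c: "(LINT x|unif. digit_sum \<alpha> a x * ?D x) = (\<Sum>i<a. \<Sum>j<m. \<alpha> i * \<alpha> (a + j) * \<rho> ^ (a + j - i))"
  proof -
    have "(LINT x|unif. digit_sum \<alpha> a x * ?D x) = (\<Sum>i<a. \<Sum>j<m. \<alpha> i * \<alpha> (a + j) * (LINT x|unif. sgn_digit (0 + i) x * sgn_digit (a + j) x))"
      unfolding integral_sum_product[symmetric] digit_sum_def by simp
    also have "\<dots> = (\<Sum>i<a. \<Sum>j<m. \<alpha> i * \<alpha> (a + j) * \<rho> ^ (a + j - i))"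
      unfolding sgn_digit_corr' by (intro sum.cong refl) auto
    finally show ?thesis .
  qed
  have "\<bar>LINT x|unif. digit_sum \<alpha> a x * ?D x\<bar> \<le> (\<Sum>i<a. \<Sum>j<m. \<bar>\<alpha> i * \<alpha> (a + j) * \<rho> ^ (a + j - i)\<bar>)"
    unfolding c by (rule order_trans[OF sum_abs], rule sum_mono, rule sum_abs)
  also have "\<dots> \<le> (\<Sum>i<a. \<Sum>j<m. b * b * (\<rho> ^ (a - i) * \<rho> ^ j))"
  proof (intro sum_mono)
    fix i j assume ij: "i \<in> {..<a}" "j \<in> {..<m}"
    have "\<rho> ^ (a + j - i) = \<rho> ^ (a - i) * \<rho> ^ j" using ij by (simp flip: power_add)
    moreover have "\<bar>\<alpha> i\<bar> * \<bar>\<alpha> (a + j)\<bar> \<le> b * b" using b[of i] b[of "a + j"] ij by (intro mult_mono) auto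
    moreover have "0 \<le> \<rho> ^ (a - i) * \<rho> ^ j" using \<rho>_bounds by simp
    moreover have "\<bar>\<rho> ^ (a - i) * \<rho> ^ j\<bar> = \<rho> ^ (a - i) * \<rho> ^ j" using \<rho>_bounds by (intro abs_of_nonneg) simp
    ultimately show "\<bar>\<alpha> i * \<alpha> (a + j) * \<rho> ^ (a + j - i)\<bar> \<le> b * b * (\<rho> ^ (a - i) * \<rho> ^ j)"
      unfolding abs_mult[of "\<alpha> i * \<alpha> (a + j)"] abs_mult[of "\<alpha> i"] by (simp only: mult_right_mono)
  qed
  also have "\<dots> = b\<^sup>2 * ((\<Sum>i<a. \<rho> ^ (a - i)) * (\<Sum>j<m. \<rho> ^ j))"
    by (subst sum_product) (simp only: sum_distrib_left power2_eq_square mult_ac)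
  \<comment> \<open>Reversing the index exposes one factor \<rho>: the two sides of the cut are at
    distance at least 1.\<close>
  also have "(\<Sum>i<a. \<rho> ^ (a - i)) = \<rho> * (\<Sum>i<a. \<rho> ^ i)"
    unfolding sum_distrib_left by (rule sum.reindex_bij_witness[where i="\<lambda>i. a - Suc i" and j="\<lambda>i. a - Suc i"]) (auto simp flip: power_Suc simp: Suc_diff_Suc)
  also have "b\<^sup>2 * (\<rho> * (\<Sum>i<a. \<rho> ^ i) * (\<Sum>j<m. \<rho> ^ j)) \<le> b\<^sup>2 * (1/3 * (3/2) * (3/2))"
    using \<rho>_bounds by (intro mult_left_mono mult_mono geometric_le) (auto intro!: sum_nonneg mult_nonneg_nonneg)
  finally have "\<bar>LINT x|unif. digit_sum \<alpha> a x * ?D x\<bar> \<le> b\<^sup>2 * (3/4)" by simp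
  then show ?thesis unfolding e by (simp add: abs_mult)
qed

end

section \<open>Normal approximation of signed digit sums\<close>

lemma mvt_bound:
  fixes \<phi> :: "real \<Rightarrow> real"
  assumes d: "\<And>u. \<bar>u\<bar> \<le> \<bar>t\<bar> \<Longrightarrow> (\<phi> has_real_derivative \<phi>' u) (at u)"
    and b: "\<And>u. \<bar>u\<bar> \<le> \<bar>t\<bar> \<Longrightarrow> \<bar>\<phi>' u\<bar> \<le> c"
  shows "\<bar>\<phi> t - \<phi> 0\<bar> \<le> c * \<bar>t\<bar>"
proof -
  have "norm (\<phi> t - \<phi> 0) \<le> c * norm (t - 0)"
  proof (rule field_differentiable_bound[where S="cball 0 \<bar>t\<bar>" and f'=\<phi>'])
    fix u :: real assume "u \<in> cball 0 \<bar>t\<bar>"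
    then have "\<bar>u\<bar> \<le> \<bar>t\<bar>" by simp
    then show "(\<phi> has_field_derivative \<phi>' u) (at u within cball 0 \<bar>t\<bar>)" "norm (\<phi>' u) \<le> c"
      using d b by (auto intro: has_field_derivative_at_within)
  qed auto
  then show ?thesis by simp
qed

text \<open>The mean value inequality is applied to the remainder itself, once for each order; the
  factorials of Taylor's formula are given away.\<close>

lemma second_order_expansion:
  fixes G0 G1 G2 :: "real \<Rightarrow> real"
  assumes d2: "\<And>x. (G2 has_real_derivative G1 x) (at x)" and d1: "\<And>x. (G1 has_real_derivative G0 x) (at x)"
    and lip: "\<And>x y. \<bar>G0 x - G0 y\<bar> \<le> c * \<bar>x - y\<bar>"
  shows "\<bar>G1 (s + x) - G1 s - G0 s * x\<bar> \<le> c * \<bar>x\<bar>\<^sup>2"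
    and "\<bar>G2 (s + x) - G2 s - G1 s * x - G0 s * x\<^sup>2 / 2\<bar> \<le> c * \<bar>x\<bar> ^ 3"
proof -
  have c: "0 \<le> c" using lip[of 1 0] by (auto intro: order_trans[OF abs_ge_zero])
  have 1: "\<bar>G1 (s + x) - G1 s - G0 s * x\<bar> \<le> c * \<bar>x\<bar>\<^sup>2" for x
  proof -
    have "\<bar>(G1 (s + x) - G0 s * x) - (G1 (s + 0) - G0 s * 0)\<bar> \<le> (c * \<bar>x\<bar>) * \<bar>x\<bar>"
    proof (rule mvt_bound[where \<phi>="\<lambda>u. G1 (s + u) - G0 s * u" and \<phi>'="\<lambda>u. G0 (s + u) - G0 s"])
      fix u assume u: "\<bar>u\<bar> \<le> \<bar>x\<bar>"
      have "((\<lambda>u. G1 (s + u)) has_real_derivative G0 (s + u) * 1) (at u)"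
        by (rule DERIV_chain2[OF d1]) (auto intro!: derivative_eq_intros)
      then show "((\<lambda>u. G1 (s + u) - G0 s * u) has_real_derivative G0 (s + u) - G0 s) (at u)"
        by (auto intro!: derivative_eq_intros)
      show "\<bar>G0 (s + u) - G0 s\<bar> \<le> c * \<bar>x\<bar>" using lip[of "s + u" s] mult_left_mono[OF u c] by simp
    qed
    then show ?thesis by (simp add: power2_eq_square mult.assoc algebra_simps)
  qed
  then show "\<bar>G1 (s + x) - G1 s - G0 s * x\<bar> \<le> c * \<bar>x\<bar>\<^sup>2" .
  have "\<bar>(G2 (s + x) - G1 s * x - G0 s * x\<^sup>2 / 2) - (G2 (s + 0) - G1 s * 0 - G0 s * 0\<^sup>2 / 2)\<bar> \<le> (c * \<bar>x\<bar>\<^sup>2) * \<bar>x\<bar>"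
  proof (rule mvt_bound[where \<phi>="\<lambda>u. G2 (s + u) - G1 s * u - G0 s * u\<^sup>2 / 2" and \<phi>'="\<lambda>u. G1 (s + u) - G1 s - G0 s * u"])
    fix u assume u: "\<bar>u\<bar> \<le> \<bar>x\<bar>"
    have "((\<lambda>u. G2 (s + u)) has_real_derivative G1 (s + u) * 1) (at u)"
      by (rule DERIV_chain2[OF d2]) (auto intro!: derivative_eq_intros)
    then show "((\<lambda>u. G2 (s + u) - G1 s * u - G0 s * u\<^sup>2 / 2) has_real_derivative G1 (s + u) - G1 s - G0 s * u) (at u)"
      by (auto intro!: derivative_eq_intros)
    have "c * \<bar>u\<bar>\<^sup>2 \<le> c * \<bar>x\<bar>\<^sup>2" using u c by (intro mult_left_mono power_mono) auto
    then show "\<bar>G1 (s + u) - G1 s - G0 s * u\<bar> \<le> c * \<bar>x\<bar>\<^sup>2" using 1[of u] by linarith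
  qed
  then show "\<bar>G2 (s + x) - G2 s - G1 s * x - G0 s * x\<^sup>2 / 2\<bar> \<le> c * \<bar>x\<bar> ^ 3"
    by (simp add: power2_eq_square power3_eq_cube mult.assoc algebra_simps)
qed

lemma ex_antiderivative:
  fixes f :: "real \<Rightarrow> real"
  assumes "continuous_on UNIV f"
  shows "\<exists>F. \<forall>x. (F has_real_derivative f x) (at x)"
proof (intro exI allI)
  fix x :: real
  define a b where "a = - \<bar>x\<bar> - 1" and "b = \<bar>x\<bar> + 1"
  have "((\<lambda>u. LBINT y=ereal 0..ereal u. f y) has_vector_derivative (f x)) (at x within {a..b})"
    by (rule interval_integral_FTC2) (auto simp: a_def b_def intro: continuous_on_subset[OF assms])
  moreover have "at x within {a..b} = at x" by (rule at_within_Icc_at) (auto simp: a_def b_def)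
  ultimately show "((\<lambda>u. LBINT y=ereal 0..ereal u. f y) has_real_derivative f x) (at x)"
    by (simp add: has_real_derivative_iff_has_vector_derivative)
qed

text \<open>Averaging twice over an interval of length \<open>h\<close>, written as a second difference of a second
  antiderivative.\<close>

lemma lipschitz_smoothing:
  fixes f :: "real \<Rightarrow> real"
  assumes lip: "\<And>x y. \<bar>f x - f y\<bar> \<le> \<bar>x - y\<bar>" and h: "0 < h"
  shows "\<exists>F A B K. taylor2 (4 / h\<^sup>2) F A B K \<and> (\<forall>s. \<bar>F s - f s\<bar> \<le> 2 * h)"
proof -
  have cf: "continuous_on UNIV f"
    by (rule lipschitz_on_continuous_on[OF lipschitz_onI[of _ _ 1]]) (use lip in \<open>auto simp: dist_real_def\<close>)
  obtain F1 where F1: "\<And>x. (F1 has_real_derivative f x) (at x)" using ex_antiderivative[OF cf] by blast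
  then have cF1: "continuous_on UNIV F1" by (meson DERIV_isCont continuous_at_imp_continuous_on)
  obtain F2 where F2: "\<And>x. (F2 has_real_derivative F1 x) (at x)" using ex_antiderivative[OF cF1] by blast
  then have cF2: "continuous_on UNIV F2" by (meson DERIV_isCont continuous_at_imp_continuous_on)
  have lip1: "\<bar>f x - f y\<bar> \<le> 1 * \<bar>x - y\<bar>" for x y using lip by simp
  note ex = second_order_expansion[OF F2 F1 lip1]
  \<comment> \<open>The second difference commutes with differentiation, so \<open>dd F2\<close> has
    the derivatives \<open>dd F1\<close> and \<open>dd f\<close>. The last one is Lipschitz with
    constant \<open>4 / h\<^sup>2\<close> although f is only Lipschitz.\<close>
  define dd where "dd g s = (g (s + h) - 2 * g s + g (s - h)) / h\<^sup>2" for g :: "real \<Rightarrow> real" and s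
  have ddm: "dd g \<in> borel_measurable borel" if "continuous_on UNIV g" for g
  proof -
    have [measurable]: "g \<in> borel_measurable borel" using that by (rule borel_measurable_continuous_onI)
    show ?thesis unfolding dd_def[abs_def] by measurable
  qed
  have dd_deriv: "(dd g has_real_derivative dd g' x) (at x)" if g: "\<And>x. (g has_real_derivative g' x) (at x)" for g g' x
  proof -
    have sh: "((\<lambda>u. g (u + c)) has_real_derivative g' (x + c)) (at x)" for c
    proof -
      have "((\<lambda>u. g (u + c)) has_real_derivative g' (x + c) * 1) (at x)"
        by (rule DERIV_chain2[OF g]) (auto intro!: derivative_eq_intros)
      then show ?thesis by simp
    qed
    have "((\<lambda>u. (g (u + h) - 2 * g u + g (u + - h)) / h\<^sup>2) has_real_derivative (g' (x + h) - 2 * g' x + g' (x + - h)) / h\<^sup>2) (at x)"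
      by (intro DERIV_cdivide DERIV_add DERIV_diff DERIV_cmult sh g)
    then show ?thesis unfolding dd_def[abs_def] by simp
  qed
  have h2: "0 < h\<^sup>2" using h by simp
  have near: "\<bar>dd F2 s - f s\<bar> \<le> 2 * h" for s
  proof -
    have "\<bar>F2 (s + h) - F2 s - F1 s * h - f s * h\<^sup>2 / 2\<bar> \<le> h ^ 3" using ex(2)[of s h] h by simp
    moreover have "\<bar>F2 (s - h) - F2 s + F1 s * h - f s * h\<^sup>2 / 2\<bar> \<le> h ^ 3" using ex(2)[of s "-h"] h by simp
    ultimately have "\<bar>F2 (s + h) - 2 * F2 s + F2 (s - h) - f s * h\<^sup>2\<bar> \<le> 2 * h ^ 3" by linarith
    moreover have "dd F2 s - f s = (F2 (s + h) - 2 * F2 s + F2 (s - h) - f s * h\<^sup>2) / h\<^sup>2"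
      using h by (simp add: dd_def field_simps)
    ultimately have "\<bar>dd F2 s - f s\<bar> \<le> 2 * h ^ 3 / h\<^sup>2" using h2 by (simp add: abs_divide divide_right_mono)
    also have "\<dots> = 2 * h" using h by (simp add: power2_eq_square power3_eq_cube)
    finally show ?thesis .
  qed
  have A: "\<bar>dd F1 s\<bar> \<le> 2" for s
  proof -
    have "\<bar>F1 (s + h) - F1 s - f s * h\<bar> \<le> h\<^sup>2" using ex(1)[of s h] h by simp
    moreover have "\<bar>F1 (s - h) - F1 s + f s * h\<bar> \<le> h\<^sup>2" using ex(1)[of s "-h"] h by simp
    ultimately have "\<bar>F1 (s + h) - 2 * F1 s + F1 (s - h)\<bar> \<le> 2 * h\<^sup>2" by linarith
    then show ?thesis unfolding dd_def using h2 by (simp add: abs_divide pos_divide_le_eq)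
  qed
  have B: "\<bar>dd f s\<bar> \<le> 2 / h" for s
  proof -
    have "\<bar>f (s + h) - 2 * f s + f (s - h)\<bar> \<le> 2 * h" using lip[of "s + h" s] lip[of "s - h" s] h by linarith
    then have "\<bar>dd f s\<bar> \<le> 2 * h / h\<^sup>2" unfolding dd_def using h2 by (simp add: abs_divide divide_right_mono)
    then show ?thesis using h by (simp add: power2_eq_square)
  qed
  have Blip: "\<bar>dd f x - dd f y\<bar> \<le> (4 / h\<^sup>2) * \<bar>x - y\<bar>" for x y
  proof -
    have "dd f x - dd f y = ((f (x + h) - f (y + h)) - 2 * (f x - f y) + (f (x - h) - f (y - h))) / h\<^sup>2"
      by (simp add: dd_def field_simps add_divide_distrib diff_divide_distrib)
    moreover have "\<bar>(f (x + h) - f (y + h)) - 2 * (f x - f y) + (f (x - h) - f (y - h))\<bar> \<le> 4 * \<bar>x - y\<bar>"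
    proof -
      have "\<bar>f (x + h) - f (y + h)\<bar> \<le> \<bar>x - y\<bar>" "\<bar>f (x - h) - f (y - h)\<bar> \<le> \<bar>x - y\<bar>"
        using lip[of "x + h" "y + h"] lip[of "x - h" "y - h"] by simp_all
      moreover have "\<bar>a - 2 * b + c\<bar> \<le> 4 * d" if "\<bar>a\<bar> \<le> d" "\<bar>b\<bar> \<le> d" "\<bar>c\<bar> \<le> d" for a b c d :: real
        using that by linarith
      ultimately show ?thesis using lip[of x y] by blast
    qed
    ultimately show ?thesis using h2 by (simp add: abs_divide divide_right_mono)
  qed
  define K where "K = max (max 2 (2 / h)) (max (\<bar>f 0\<bar> + 2 * h) 1)"
  have "taylor2 (4 / h\<^sup>2) (dd F2) (dd F1) (dd f) K"
    unfolding taylor2_def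
  proof (intro conjI allI)
    fix s x
    show "\<bar>dd F2 (s + x) - dd F2 s - dd F1 s * x - dd f s * x\<^sup>2 / 2\<bar> \<le> 4 / h\<^sup>2 * \<bar>x\<bar> ^ 3"
      by (rule second_order_expansion(2)[OF dd_deriv dd_deriv Blip]) (rule F2, rule F1)
    have K1: "\<bar>f 0\<bar> + 2 * h \<le> K" "1 \<le> K" by (auto simp: K_def)
    have "\<bar>dd F2 s\<bar> \<le> \<bar>f 0\<bar> + 2 * h + 1 * \<bar>s\<bar>" using near[of s] lip[of s 0] by linarith
    also have "\<dots> \<le> K + K * \<bar>s\<bar>" by (intro add_mono mult_right_mono K1) auto
    finally show "\<bar>dd F2 s\<bar> \<le> K * (1 + \<bar>s\<bar>)" by (simp add: distrib_left)
    show "\<bar>dd F1 s\<bar> \<le> K" "\<bar>dd f s\<bar> \<le> K" using A[of s] B[of s] by (auto simp: K_def)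
  qed (auto intro: ddm cf cF1 cF2)
  then show ?thesis using near by blast
qed

text \<open>Comonotone couplings are optimal: the function \<open>f\<close> is the Kantorovich potential, so that the mean
  distance of the coupled variables is tested by a single Lipschitz function.\<close>

lemma monotone_coupling_potential:
  fixes p q :: "real \<Rightarrow> real"
  assumes p: "mono p" and q: "mono q"
  shows "\<exists>f :: real \<Rightarrow> real. (\<forall>x y. \<bar>f x - f y\<bar> \<le> \<bar>x - y\<bar>) \<and> (\<forall>v. f (p v) - f (q v) = \<bar>p v - q v\<bar>)"
proof -
  \<comment> \<open>P and N collect the gaps between the two functions, by the sign of q - p. As
    unions of open intervals they are open, hence Borel, although the index v is
    uncountable.\<close>
  define P where "P = (\<Union>v. {p v<..<q v})"
  define N where "N = (\<Union>v. {q v<..<p v})"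
  have [measurable]: "P \<in> sets borel" "N \<in> sets borel"
    unfolding P_def N_def by (auto intro!: borel_open open_UN)
  \<comment> \<open>Monotonicity enters only here: overlapping gaps of opposite kinds, at v and v',
    would force both v' < v and v < v'.\<close>
  have disj: "P \<inter> N = {}"
  proof (rule ccontr)
    assume "P \<inter> N \<noteq> {}"
    then obtain y v v' where y: "p v < y" "y < q v" "q v' < y" "y < p v'" by (auto simp: P_def N_def)
    then have "q v' < q v" "p v < p v'" by auto
    then have "v' < v" "v < v'" using monoD[OF p] monoD[OF q] by (meson not_le)+
    then show False by simp
  qed
  \<comment> \<open>The slope of the potential f: it is 1 on N and -1 on P, so f changes by the full
    distance across every gap.\<close>
  define s where "s y = indicator N y - (indicator P y :: real)" for y
  have s1: "\<bar>s y\<bar> \<le> 1" for y by (auto simp: s_def indicator_def)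
  have [measurable]: "s \<in> borel_measurable borel" unfolding s_def by measurable
  have int: "integrable lborel (\<lambda>t. s t * indicator I t)" if "I \<in> sets borel" "emeasure lborel I < \<infinity>" for I
  proof (rule Bochner_Integration.integrable_bound[of _ "indicator I :: real \<Rightarrow> real"])
    show "integrable lborel (indicator I :: real \<Rightarrow> real)" using that by (simp add: integrable_indicator_iff)
    show "AE x in lborel. norm (s x * indicator I x) \<le> norm (indicator I x :: real)"
      using s1 by (intro AE_I2) (auto simp: indicator_def)
    show "(\<lambda>t. s t * indicator I t) \<in> borel_measurable lborel" using that by measurable
  qed
  define f where "f y = (LINT t|lborel. s t * indicator {0..<y} t) - (LINT t|lborel. s t * indicator {y..<0} t)" for y
  have fab: "f b - f a = (LINT t|lborel. s t * indicator {a..<b} t)" if "a \<le> b" for a b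
  proof -
    have sum: "(LINT t|lborel. s t * indicator {x..<y} t) + (LINT t|lborel. s t * indicator {y..<z} t)
       = (LINT t|lborel. s t * indicator {x..<z} t)" if "x \<le> y" "y \<le> z" for x y z
    proof -
      have "(LINT t|lborel. s t * indicator {x..<z} t) = (LINT t|lborel. s t * indicator {x..<y} t + s t * indicator {y..<z} t)"
        using that by (intro Bochner_Integration.integral_cong) (auto simp: indicator_def)
      also have "\<dots> = (LINT t|lborel. s t * indicator {x..<y} t) + (LINT t|lborel. s t * indicator {y..<z} t)"
        by (intro Bochner_Integration.integral_add int) (auto simp: that)
      finally show ?thesis by simp
    qed
    have e: "u \<le> v \<Longrightarrow> {v..<u} = {}" for u v :: real by auto
    consider "0 \<le> a" | "a \<le> 0" "0 \<le> b" | "b \<le> 0" by linarith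
    then show ?thesis
    proof cases
      case 1 then show ?thesis using that sum[of 0 a b] by (simp add: f_def e)
    next
      case 2 then show ?thesis using that sum[of a 0 b] by (simp add: f_def e)
    next
      case 3 then show ?thesis using that sum[of a b 0] by (simp add: f_def e)
    qed
  qed
  have lint: "(LINT t|lborel. indicator {a..<b} t) = b - a" if "a \<le> b" for a b :: real using that by simp
  have lip0: "\<bar>f b - f a\<bar> \<le> b - a" if "a \<le> b" for a b
  proof -
    have "\<bar>LINT t|lborel. s t * indicator {a..<b} t\<bar> \<le> (LINT t|lborel. \<bar>s t * indicator {a..<b} t\<bar>)" by (rule integral_abs_bound)
    also have "\<dots> \<le> (LINT t|lborel. indicator {a..<b} t)"
    proof (rule integral_mono)
      show "integrable lborel (\<lambda>t. \<bar>s t * indicator {a..<b} t\<bar>)" using that by (intro integrable_abs int) auto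
      show "integrable lborel (indicator {a..<b} :: real \<Rightarrow> real)" using that by (simp add: integrable_indicator_iff)
      show "\<bar>s t * indicator {a..<b} t\<bar> \<le> indicator {a..<b} t" for t using s1[of t] by (auto simp: indicator_def)
    qed
    finally show ?thesis using that by (simp add: fab lint)
  qed
  have lip: "\<bar>f x - f y\<bar> \<le> \<bar>x - y\<bar>" for x y
    using lip0[of x y] lip0[of y x] by (cases "x \<le> y") (auto simp: abs_minus_commute)
  have const: "f b - f a = c * (b - a)" if "a \<le> b" "\<And>t. a < t \<Longrightarrow> t < b \<Longrightarrow> s t = c" for a b c
  proof -
    have "(LINT t|lborel. s t * indicator {a..<b} t) = (LINT t|lborel. c * indicator {a..<b} t)"
    proof (rule integral_cong_AE)
      have "AE t in lborel. t \<noteq> a" by (rule AE_lborel_singleton)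
      then show "AE t in lborel. s t * indicator {a..<b} t = c * indicator {a..<b} t"
        by eventually_elim (use that in \<open>auto simp: indicator_def\<close>)
    qed auto
    also have "\<dots> = c * (b - a)" using lint[OF that(1)] by simp
    finally show ?thesis using fab that by simp
  qed
  have "f (p v) - f (q v) = \<bar>p v - q v\<bar>" for v
  proof (cases "p v \<le> q v")
    case True
    have "s t = -1" if "p v < t" "t < q v" for t
    proof -
      have "t \<in> P" using that by (auto simp: P_def)
      moreover from this have "t \<notin> N" using disj by blast
      ultimately show ?thesis by (simp add: s_def)
    qed
    from const[OF True this] show ?thesis using True by simp
  next
    case False
    then have le: "q v \<le> p v" by simp
    have "s t = 1" if "q v < t" "t < p v" for t
    proof -
      have "t \<in> N" using that by (auto simp: N_def)
      moreover from this have "t \<notin> P" using disj by blast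
      ultimately show ?thesis by (simp add: s_def)
    qed
    from const[OF le this] show ?thesis using le by simp
  qed
  with lip show ?thesis by blast
qed

context radix
begin

text \<open>Smoothing on both sides costs 4 h. The middle term is \<open>lindeberg\<close> with the
  constant \<open>4 / h\<^sup>2\<close> of \<open>lipschitz_smoothing\<close> and a sum of cubes of
  at most 3 b v, whence 120 = 10 * 4 * 3. The last term moves the variance from v to
  \<Delta>.\<close>

lemma lipschitz_digit_sum_gauss:
  fixes f :: "real \<Rightarrow> real"
  assumes lip: "\<And>x y. \<bar>f x - f y\<bar> \<le> \<bar>x - y\<bar>" and h: "0 < h" and \<Delta>: "0 < \<Delta>"
    and b: "\<And>i. i < L \<Longrightarrow> \<bar>\<alpha> i\<bar> \<le> b" "0 \<le> b"
  shows "\<bar>(LINT x|unif. f (digit_sum \<alpha> L x)) - gauss_avg \<Delta> f 0\<bar>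
     \<le> 4 * h + 120 * b * digit_var \<alpha> L / h\<^sup>2 + \<bar>digit_var \<alpha> L - \<Delta>\<bar> / sqrt \<Delta>"
proof -
  define v where "v = digit_var \<alpha> L"
  have v0: "0 \<le> v" by (simp add: v_def digit_var_def)
  obtain F A B K where T: "taylor2 (4 / h\<^sup>2) F A B K" and near: "\<And>s. \<bar>F s - f s\<bar> \<le> 2 * h"
    using lipschitz_smoothing[of f h] lip h by blast
  have fm[measurable]: "f \<in> borel_measurable borel"
  proof (rule borel_measurable_continuous_onI)
    show "continuous_on UNIV f"
      by (rule lipschitz_on_continuous_on[OF lipschitz_onI[of _ _ 1]]) (use lip in \<open>auto simp: dist_real_def\<close>)
  qed
  have Fm[measurable]: "F \<in> borel_measurable borel" and gF: "\<And>s. \<bar>F s\<bar> \<le> K * (1 + \<bar>s\<bar>)" using T by (auto simp: taylor2_def)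
  have gf: "\<bar>f s\<bar> \<le> (\<bar>f 0\<bar> + 1) * (1 + \<bar>s\<bar>)" for s
  proof -
    have "\<bar>f s\<bar> \<le> \<bar>f 0\<bar> + \<bar>s\<bar>" using lip[of s 0] by simp
    moreover have "0 \<le> \<bar>f 0\<bar> * \<bar>s\<bar>" by simp
    moreover have "(\<bar>f 0\<bar> + 1) * (1 + \<bar>s\<bar>) = \<bar>f 0\<bar> + \<bar>f 0\<bar> * \<bar>s\<bar> + 1 + \<bar>s\<bar>" by (simp add: algebra_simps)
    ultimately show ?thesis by linarith
  qed
  let ?X = "digit_sum \<alpha> L"
  have i: "integrable unif (\<lambda>x. F (?X x))" "integrable unif (\<lambda>x. f (?X x))"
    by (rule past_integrable[of L], rule past_comp, rule past_digit_sum)+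
  have 1: "\<bar>(LINT x|unif. F (?X x)) - (LINT x|unif. f (?X x))\<bar> \<le> 2 * h"
  proof -
    have "(LINT x|unif. F (?X x)) - (LINT x|unif. f (?X x)) = (LINT x|unif. F (?X x) - f (?X x))" using i by simp
    moreover have "\<bar>LINT x|unif. F (?X x) - f (?X x)\<bar> \<le> (LINT x|unif. \<bar>F (?X x) - f (?X x)\<bar>)" by (rule integral_abs_bound)
    moreover have "(LINT x|unif. \<bar>F (?X x) - f (?X x)\<bar>) \<le> (LINT x|unif. 2 * h)"
      using i near by (intro integral_mono) auto
    moreover have "(LINT x|unif. 2 * h) = 2 * h" using unif.prob_space by simp
    ultimately show ?thesis by linarith
  qed
  have iN: "integrable stdn (\<lambda>z. F (0 + sqrt q * z))" "integrable stdn (\<lambda>z. f (0 + sqrt q * z))" for q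
    by (rule integrable_growth[OF Fm gF], rule integrable_growth[OF fm gf])
  have 2: "\<bar>gauss_avg q F 0 - gauss_avg q f 0\<bar> \<le> 2 * h" for q
  proof -
    have "gauss_avg q F 0 - gauss_avg q f 0 = (LINT z|stdn. F (0 + sqrt q * z) - f (0 + sqrt q * z))"
      unfolding gauss_avg_def by (simp only: Bochner_Integration.integral_diff iN)
    moreover have "\<bar>LINT z|stdn. F (0 + sqrt q * z) - f (0 + sqrt q * z)\<bar> \<le> (LINT z|stdn. \<bar>F (0 + sqrt q * z) - f (0 + sqrt q * z)\<bar>)"
      by (rule integral_abs_bound)
    moreover have "(LINT z|stdn. \<bar>F (0 + sqrt q * z) - f (0 + sqrt q * z)\<bar>) \<le> (LINT z|stdn. 2 * h)"
    proof (rule integral_mono)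
      show "integrable stdn (\<lambda>z. \<bar>F (0 + sqrt q * z) - f (0 + sqrt q * z)\<bar>)"
        by (intro integrable_abs Bochner_Integration.integrable_diff iN)
    qed (use near in auto)
    moreover have "(LINT z|stdn. 2 * h) = 2 * h" using stdn.prob_space by simp
    ultimately show ?thesis by linarith
  qed
  have 3: "\<bar>gauss_avg v f 0 - gauss_avg \<Delta> f 0\<bar> \<le> \<bar>v - \<Delta>\<bar> / sqrt \<Delta>"
  proof -
    have e1: "gauss_avg v f 0 - gauss_avg \<Delta> f 0 = (LINT z|stdn. f (0 + sqrt v * z) - f (0 + sqrt \<Delta> * z))"
      unfolding gauss_avg_def by (simp only: Bochner_Integration.integral_diff iN)
    have e2: "\<bar>LINT z|stdn. f (0 + sqrt v * z) - f (0 + sqrt \<Delta> * z)\<bar> \<le> (LINT z|stdn. \<bar>f (0 + sqrt v * z) - f (0 + sqrt \<Delta> * z)\<bar>)"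
      by (rule integral_abs_bound)
    have e3: "(LINT z|stdn. \<bar>f (0 + sqrt v * z) - f (0 + sqrt \<Delta> * z)\<bar>) \<le> (LINT z|stdn. \<bar>sqrt v - sqrt \<Delta>\<bar> * \<bar>z\<bar>)"
    proof (rule integral_mono)
      show "integrable stdn (\<lambda>z. \<bar>sqrt v - sqrt \<Delta>\<bar> * \<bar>z\<bar>)" using stdn_moments(7) by auto
      show "\<bar>f (0 + sqrt v * z) - f (0 + sqrt \<Delta> * z)\<bar> \<le> \<bar>sqrt v - sqrt \<Delta>\<bar> * \<bar>z\<bar>" for z
        using lip[of "0 + sqrt v * z" "0 + sqrt \<Delta> * z"] by (simp add: left_diff_distrib flip: abs_mult)
    qed (intro integrable_abs Bochner_Integration.integrable_diff iN)
    have e4: "(LINT z|stdn. \<bar>sqrt v - sqrt \<Delta>\<bar> * \<bar>z\<bar>) \<le> \<bar>sqrt v - sqrt \<Delta>\<bar> * 1"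
      using stdn_moments(8) by (simp only: integral_mult_right_zero) (rule mult_left_mono, auto)
    have e5: "\<bar>sqrt v - sqrt \<Delta>\<bar> \<le> \<bar>v - \<Delta>\<bar> / sqrt \<Delta>"
    proof -
      have "v - \<Delta> = (sqrt v - sqrt \<Delta>) * (sqrt v + sqrt \<Delta>)" using v0 \<Delta> by (simp add: algebra_simps)
      then have "\<bar>v - \<Delta>\<bar> = \<bar>sqrt v - sqrt \<Delta>\<bar> * (sqrt v + sqrt \<Delta>)" using v0 \<Delta> by (simp add: abs_mult)
      also have "\<dots> \<ge> \<bar>sqrt v - sqrt \<Delta>\<bar> * sqrt \<Delta>" using v0 by (intro mult_left_mono) auto
      finally show ?thesis using \<Delta> by (simp add: pos_le_divide_eq)
    qed
    show ?thesis unfolding e1 using order_trans[OF order_trans[OF e2 e3] order_trans[OF e4[unfolded mult_1_right] e5]] .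
  qed
  have 4: "\<bar>(LINT x|unif. F (?X x)) - gauss_avg v F 0\<bar> \<le> 120 * b * v / h\<^sup>2"
  proof -
    have "\<bar>(LINT x|unif. F (?X x)) - gauss_avg v F 0\<bar> \<le> 10 * (4 / h\<^sup>2) * (\<Sum>i<L. \<bar>tail_weight \<alpha> L i\<bar> ^ 3)"
      unfolding v_def digit_var_eq digit_sum_eq_mart by (rule lindeberg[OF T])
    also have "\<dots> \<le> 10 * (4 / h\<^sup>2) * (3 * b * v)"
    proof (intro mult_left_mono)
      have "(\<Sum>i<L. \<bar>tail_weight \<alpha> L i\<bar> ^ 3) \<le> (\<Sum>i<L. (2 * b) * (tail_weight \<alpha> L i)\<^sup>2)"
      proof (intro sum_mono)
        fix i
        have "\<bar>tail_weight \<alpha> L i\<bar> ^ 3 = \<bar>tail_weight \<alpha> L i\<bar> * (tail_weight \<alpha> L i)\<^sup>2"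
          by (simp add: power3_eq_cube power2_eq_square flip: abs_mult)
        then show "\<bar>tail_weight \<alpha> L i\<bar> ^ 3 \<le> (2 * b) * (tail_weight \<alpha> L i)\<^sup>2"
          using mult_right_mono[OF tail_weight_abs_le[where \<alpha>=\<alpha> and L=L and i=i, OF b], of "(tail_weight \<alpha> L i)\<^sup>2"] by simp
      qed
      also have "\<dots> = 2 * b * (\<Sum>i<L. (tail_weight \<alpha> L i)\<^sup>2)" by (simp add: sum_distrib_left)
      also have "\<dots> \<le> 2 * b * (9/8 * v)" using b(2) tail_weight_sq_le_var[where \<alpha>=\<alpha> and L=L] by (intro mult_left_mono) (auto simp: v_def)
      also have "\<dots> \<le> 3 * b * v" using b(2) v0 by simp
      finally show "(\<Sum>i<L. \<bar>tail_weight \<alpha> L i\<bar> ^ 3) \<le> 3 * b * v" .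
    qed auto
    finally show ?thesis by simp
  qed
  show ?thesis using 1 2[of v] 3 4 unfolding v_def by linarith
qed

end

section \<open>Increments of Takagi functions\<close>

lemma dist_int_nonneg: "0 \<le> dist_int x" by (simp add: dist_int_def)

lemma dist_int_le_half: "dist_int x \<le> 1/2"
  using of_int_round_abs_le[of x] by (simp add: dist_int_def abs_minus_commute)

lemma dist_int_eq_cell:
  "dist_int y = (if even \<lfloor>2 * y\<rfloor> then y - of_int \<lfloor>2 * y\<rfloor> / 2 else (of_int \<lfloor>2 * y\<rfloor> + 1) / 2 - y)"
proof -
  define c where "c = \<lfloor>2 * y\<rfloor>"
  have c: "of_int c \<le> 2 * y" "2 * y < of_int c + 1" unfolding c_def by linarith+
  show ?thesis
  proof (cases "even c")
    case True
    then obtain k where k: "c = 2 * k" by (elim evenE)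
    have "round y = k" using c unfolding k round_def by (intro floor_unique) auto
    then show ?thesis using c k by (simp add: dist_int_def c_def[symmetric])
  next
    case False
    then obtain k where k: "c = 2 * k + 1" by (elim oddE)
    have "round y = k + 1" using c unfolding k round_def by (intro floor_unique) auto
    then show ?thesis using c k by (simp add: dist_int_def c_def[symmetric])
  qed
qed

lemma dist_int_linear:
  assumes "\<lfloor>2 * (y + t)\<rfloor> = \<lfloor>2 * y\<rfloor>"
  shows "dist_int (y + t) - dist_int y = t * pm1 \<lfloor>2 * y\<rfloor>"
  using assms unfolding dist_int_eq_cell[of y] dist_int_eq_cell[of "y + t"] pm1_def by simp

lemma dist_int_lipschitz: "\<bar>dist_int x - dist_int y\<bar> \<le> \<bar>x - y\<bar>"
proof -
  have *: "dist_int x \<le> dist_int y + \<bar>x - y\<bar>" for x y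
  proof -
    have "dist_int x \<le> \<bar>x - of_int (round y)\<bar>" unfolding dist_int_def
      by (metis abs_minus_commute round_diff_minimal)
    then show ?thesis unfolding dist_int_def by linarith
  qed
  from *[of x y] *[of y x] show ?thesis by linarith
qed

lemma floor_eq_of_dist_int: "\<bar>t\<bar> < dist_int u \<Longrightarrow> \<lfloor>u + t\<rfloor> = \<lfloor>u\<rfloor>"
proof -
  assume t: "\<bar>t\<bar> < dist_int u"
  have "dist_int u \<le> \<bar>u - of_int \<lfloor>u\<rfloor>\<bar>" "dist_int u \<le> \<bar>u - of_int (\<lfloor>u\<rfloor> + 1)\<bar>" unfolding dist_int_def
    by (metis abs_minus_commute round_diff_minimal)+
  then show ?thesis using t by (intro floor_unique) linarith+
qed

text \<open>The kinks of \<open>dist_int\<close> lie where 2 y is an integer. Away from them the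
  increment is exactly linear; near them the increment and its linearisation are each at most
  |t|.\<close>

lemma dist_int_increment:
  "\<bar>dist_int (y + t) - dist_int y - t * pm1 \<lfloor>2 * y\<rfloor>\<bar> \<le> 2 * \<bar>t\<bar> * indicator {u. dist_int u \<le> 2 * \<bar>t\<bar>} (2 * y)"
proof (cases "dist_int (2 * y) \<le> 2 * \<bar>t\<bar>")
  case False
  then have "\<lfloor>2 * y + 2 * t\<rfloor> = \<lfloor>2 * y\<rfloor>" by (intro floor_eq_of_dist_int) (simp add: abs_mult)
  then have "dist_int (y + t) - dist_int y = t * pm1 \<lfloor>2 * y\<rfloor>" by (intro dist_int_linear) (simp add: distrib_left)
  then show ?thesis by simp
next
  case True
  have "\<bar>dist_int (y + t) - dist_int y\<bar> \<le> \<bar>t\<bar>" using dist_int_lipschitz[of "y + t" y] by simp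
  moreover have "\<bar>t * pm1 \<lfloor>2 * y\<rfloor>\<bar> = \<bar>t\<bar>" by (simp add: abs_mult)
  ultimately show ?thesis using True by simp
qed

context radix
begin

lemma psi_right_deriv_eq:
  assumes "1 \<le> k"
  shows "psi_right_deriv r k x = sgn_digit (k - 1) x"
proof -
  define R where "R = real r ^ (k - 1)"
  have R: "R > 0" by (simp add: R_def)
  define y where "y = R * x"
  \<comment> \<open>Distance from x to the right end of its half cell; up to there the function is
    affine.\<close>
  define \<epsilon> where "\<epsilon> = (of_int \<lfloor>2 * y\<rfloor> + 1 - 2 * y) / (2 * R)"
  have e: "\<epsilon> > 0" unfolding \<epsilon>_def using R by (intro divide_pos_pos) linarith+
  have lin: "psi r k z = psi r k x + (z - x) * sgn_digit (k - 1) x" if "x \<le> z" "z < x + \<epsilon>" for z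
  proof -
    have "2 * R * (z - x) < 2 * R * \<epsilon>" using that R by (intro mult_strict_left_mono) auto
    also have "\<dots> = of_int \<lfloor>2 * y\<rfloor> + 1 - 2 * y" unfolding \<epsilon>_def using R by simp
    finally have "2 * (y + R * (z - x)) < of_int \<lfloor>2 * y\<rfloor> + 1" by (simp add: algebra_simps)
    moreover have "0 \<le> R * (z - x)" using that R by simp
    then have "of_int \<lfloor>2 * y\<rfloor> \<le> 2 * (y + R * (z - x))" by (smt (verit) of_int_floor_le)
    ultimately have "\<lfloor>2 * (y + R * (z - x))\<rfloor> = \<lfloor>2 * y\<rfloor>" by (intro floor_unique) auto
    then have "dist_int (y + R * (z - x)) - dist_int y = R * (z - x) * pm1 \<lfloor>2 * y\<rfloor>" by (rule dist_int_linear)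
    moreover have "y + R * (z - x) = R * z" by (simp add: y_def algebra_simps)
    moreover have "pm1 \<lfloor>2 * y\<rfloor> = sgn_digit (k - 1) x" by (simp add: sgn_digit_def cell_def y_def R_def mult.assoc)
    ultimately have "dist_int (R * z) = dist_int (R * x) + R * ((z - x) * sgn_digit (k - 1) x)" by (simp add: y_def)
    then show ?thesis using R unfolding psi_def R_def[symmetric] by (simp add: add_divide_distrib)
  qed
  have "((\<lambda>z. psi r k x + (z - x) * sgn_digit (k - 1) x) has_vector_derivative sgn_digit (k - 1) x) (at x within {x..})"
    by (auto intro!: derivative_eq_intros simp: has_real_derivative_iff_has_vector_derivative[symmetric])
  then have "(psi r k has_vector_derivative sgn_digit (k - 1) x) (at x within {x..})"
  proof (rule has_vector_derivative_transform_within[where d=\<epsilon>])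
    show "0 < \<epsilon>" by (rule e)
    show "x \<in> {x..}" by simp
    show "psi r k x + (x' - x) * sgn_digit (k - 1) x = psi r k x'" if "x' \<in> {x..}" "dist x' x < \<epsilon>" for x'
      using lin[of x'] that by (simp add: dist_real_def)
  qed
  then have "(psi r k has_vector_derivative sgn_digit (k - 1) x) (at x within {x<..})"
    by (rule has_vector_derivative_within_subset) auto
  then show ?thesis unfolding psi_right_deriv_def
    by (intro vector_derivative_within) (auto simp: trivial_limit_at_right_real)
qed

lemma takagi_w_eq: "takagi_w r a n x = digit_sum (\<lambda>i. a (Suc i)) n x"
  unfolding takagi_w_def digit_sum_def
  by (rule sum.reindex_bij_witness[where i="\<lambda>i. Suc i" and j="\<lambda>k. k - 1"]) (auto simp: psi_right_deriv_eq)

lemma takagi_V_eq: "takagi_V r a n = digit_var (\<lambda>i. a (Suc i)) n"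
proof -
  have "takagi_V r a n = (LBINT x:{0..<1}. (digit_sum (\<lambda>i. a (Suc i)) n x)\<^sup>2)"
    unfolding takagi_V_def takagi_w_eq ..
  also have "\<dots> = digit_var (\<lambda>i. a (Suc i)) n"
  proof -
    have "unif = density lborel (\<lambda>x. ennreal (indicator {0..<1} x))"
      unfolding unif_def by (intro density_cong) (auto simp: indicator_def)
    then have "digit_var (\<lambda>i. a (Suc i)) n = (LINT x|density lborel (\<lambda>x. ennreal (indicator {0..<1} x)). (digit_sum (\<lambda>i. a (Suc i)) n x)\<^sup>2)"
      unfolding digit_var_def by simp
    also have "\<dots> = (LINT x|lborel. indicator {0..<1} x *\<^sub>R (digit_sum (\<lambda>i. a (Suc i)) n x)\<^sup>2)"
      by (rule integral_density) auto
    finally show ?thesis unfolding set_lebesgue_integral_def ..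
  qed
  finally show ?thesis .
qed

text \<open>Bounds the linearisation error per unit of h for all |h| <= r^(-m) at once. With m the
  length of a block it also bounds the effect of carries at the end of that block.\<close>

definition kink_sum :: "(nat \<Rightarrow> real) \<Rightarrow> nat \<Rightarrow> real \<Rightarrow> real" where
  "kink_sum \<alpha> m x = (\<Sum>i<m. 2 * \<bar>\<alpha> i\<bar> * indicator {u. dist_int u \<le> 2 * (real r ^ i / real r ^ m)} (2 * real r ^ i * x))"

text \<open>The first m terms are linearised at the scale of h; the later ones oscillate faster than
  h and are bounded by their size, since \<open>dist_int\<close> has values between 0 and
  1/2.\<close>

lemma takagi_increment:
  assumes sm: "summable (\<lambda>i. \<bar>\<alpha> i\<bar> / real r ^ i)" and h: "\<bar>h\<bar> \<le> 1 / real r ^ m"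
  shows "\<bar>(\<Sum>i. \<alpha> i / real r ^ i * dist_int (real r ^ i * (x + h))) - (\<Sum>i. \<alpha> i / real r ^ i * dist_int (real r ^ i * x))
     - h * digit_sum \<alpha> m x\<bar> \<le> \<bar>h\<bar> * kink_sum \<alpha> m x + (\<Sum>i. \<bar>\<alpha> (i + m)\<bar> / real r ^ (i + m))"
proof -
  define t where "t i = \<alpha> i / real r ^ i * (dist_int (real r ^ i * (x + h)) - dist_int (real r ^ i * x))" for i
  have s0: "summable (\<lambda>i. \<alpha> i / real r ^ i * dist_int (real r ^ i * y))" for y
  proof (rule summable_comparison_test'[OF sm, of 0])
    fix i
    have "\<bar>\<alpha> i / real r ^ i * dist_int (real r ^ i * y)\<bar> = \<bar>\<alpha> i\<bar> / real r ^ i * dist_int (real r ^ i * y)"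
      by (simp add: abs_mult dist_int_nonneg)
    also have "\<dots> \<le> \<bar>\<alpha> i\<bar> / real r ^ i * 1" using dist_int_le_half[of "real r ^ i * y"] by (intro mult_left_mono) auto
    finally show "norm (\<alpha> i / real r ^ i * dist_int (real r ^ i * y)) \<le> \<bar>\<alpha> i\<bar> / real r ^ i" by simp
  qed
  have tb: "\<bar>t i\<bar> \<le> \<bar>\<alpha> i\<bar> / real r ^ i" for i
  proof -
    have "\<bar>dist_int (real r ^ i * (x + h)) - dist_int (real r ^ i * x)\<bar> \<le> 1"
      using dist_int_nonneg[of "real r ^ i * (x + h)"] dist_int_nonneg[of "real r ^ i * x"]
        dist_int_le_half[of "real r ^ i * (x + h)"] dist_int_le_half[of "real r ^ i * x"] by linarith
    then have "\<bar>\<alpha> i\<bar> / real r ^ i * \<bar>dist_int (real r ^ i * (x + h)) - dist_int (real r ^ i * x)\<bar> \<le> \<bar>\<alpha> i\<bar> / real r ^ i * 1"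
      by (intro mult_left_mono) auto
    then show ?thesis by (simp add: t_def abs_mult)
  qed
  have st: "summable t" by (rule summable_comparison_test'[OF sm, of 0]) (use tb in auto)
  have "(\<Sum>i. \<alpha> i / real r ^ i * dist_int (real r ^ i * (x + h))) - (\<Sum>i. \<alpha> i / real r ^ i * dist_int (real r ^ i * x)) = (\<Sum>i. t i)"
    unfolding t_def right_diff_distrib by (rule suminf_diff[OF s0 s0])
  also have "\<dots> = (\<Sum>i. t (i + m)) + (\<Sum>i<m. t i)" by (rule suminf_split_initial_segment[OF st])
  finally have e: "(\<Sum>i. \<alpha> i / real r ^ i * dist_int (real r ^ i * (x + h))) - (\<Sum>i. \<alpha> i / real r ^ i * dist_int (real r ^ i * x))
     - h * digit_sum \<alpha> m x = (\<Sum>i. t (i + m)) + (\<Sum>i<m. t i - h * (\<alpha> i * sgn_digit i x))"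
    by (simp add: digit_sum_def sum_subtractf sum_distrib_left)
  have "\<bar>\<Sum>i. t (i + m)\<bar> \<le> (\<Sum>i. \<bar>\<alpha> (i + m)\<bar> / real r ^ (i + m))"
  proof -
    have sm': "summable (\<lambda>i. \<bar>\<alpha> (i + m)\<bar> / real r ^ (i + m))" using sm by (subst summable_iff_shift)
    have sa: "summable (\<lambda>i. \<bar>t (i + m)\<bar>)" by (rule summable_comparison_test'[OF sm', of 0]) (use tb in auto)
    have "\<bar>\<Sum>i. t (i + m)\<bar> \<le> (\<Sum>i. \<bar>t (i + m)\<bar>)" by (rule summable_rabs[OF sa])
    also have "\<dots> \<le> (\<Sum>i. \<bar>\<alpha> (i + m)\<bar> / real r ^ (i + m))" by (rule suminf_le[OF tb sa sm'])
    finally show ?thesis .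
  qed
  moreover have "\<bar>\<Sum>i<m. t i - h * (\<alpha> i * sgn_digit i x)\<bar> \<le> \<bar>h\<bar> * kink_sum \<alpha> m x"
  proof -
    have "\<bar>t i - h * (\<alpha> i * sgn_digit i x)\<bar> \<le> \<bar>h\<bar> * (2 * \<bar>\<alpha> i\<bar> * indicator {u. dist_int u \<le> 2 * (real r ^ i / real r ^ m)} (2 * real r ^ i * x))" for i
    proof -
      define R where "R = real r ^ i"
      have R: "R > 0" by (simp add: R_def)
      have s: "sgn_digit i x = pm1 \<lfloor>2 * (R * x)\<rfloor>" by (simp add: sgn_digit_def cell_def R_def mult.assoc)
      have "t i - h * (\<alpha> i * sgn_digit i x) = \<alpha> i / R * (dist_int (R * x + R * h) - dist_int (R * x) - (R * h) * pm1 \<lfloor>2 * (R * x)\<rfloor>)"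
        using R unfolding t_def s R_def[symmetric] by (simp add: field_simps)
      then have "\<bar>t i - h * (\<alpha> i * sgn_digit i x)\<bar> = \<bar>\<alpha> i\<bar> / R * \<bar>dist_int (R * x + R * h) - dist_int (R * x) - (R * h) * pm1 \<lfloor>2 * (R * x)\<rfloor>\<bar>"
        using R by (simp add: abs_mult)
      also have "\<dots> \<le> \<bar>\<alpha> i\<bar> / R * (2 * \<bar>R * h\<bar> * indicator {u. dist_int u \<le> 2 * \<bar>R * h\<bar>} (2 * (R * x)))"
        using R by (intro mult_left_mono dist_int_increment) auto
      also have "\<dots> = \<bar>h\<bar> * (2 * \<bar>\<alpha> i\<bar> * indicator {u. dist_int u \<le> 2 * \<bar>R * h\<bar>} (2 * R * x))"
        using R by (simp add: abs_mult mult_ac)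
      also have "\<dots> \<le> \<bar>h\<bar> * (2 * \<bar>\<alpha> i\<bar> * indicator {u. dist_int u \<le> 2 * (real r ^ i / real r ^ m)} (2 * real r ^ i * x))"
      proof -
        have "\<bar>R * h\<bar> \<le> R / real r ^ m" using mult_left_mono[OF h, of R] R by (simp add: abs_mult)
        then have "indicator {u. dist_int u \<le> 2 * \<bar>R * h\<bar>} (2 * R * x) \<le> (indicator {u. dist_int u \<le> 2 * (R / real r ^ m)} (2 * R * x) :: real)"
          by (auto simp: indicator_def)
        then show ?thesis unfolding R_def[symmetric] by (intro mult_left_mono) auto
      qed
      finally show ?thesis .
    qed
    then have "\<bar>\<Sum>i<m. t i - h * (\<alpha> i * sgn_digit i x)\<bar> \<le> (\<Sum>i<m. \<bar>h\<bar> * (2 * \<bar>\<alpha> i\<bar> * indicator {u. dist_int u \<le> 2 * (real r ^ i / real r ^ m)} (2 * real r ^ i * x)))"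
      by (intro order_trans[OF sum_abs] sum_mono)
    then show ?thesis unfolding kink_sum_def sum_distrib_left .
  qed
  ultimately show ?thesis unfolding e by linarith
qed

end

section \<open>Maximal inequalities\<close>

text \<open>Chaining over a split of the index interval into two halves of at most half the weight.\<close>

lemma moment4_maximal:
  fixes \<xi> :: "nat \<Rightarrow> 'a \<Rightarrow> real" and u :: "nat \<Rightarrow> real"
  assumes u: "\<And>k. 0 \<le> u k" and C: "0 \<le> C"
    and i4: "\<And>i j. integrable M (\<lambda>x. (\<Sum>k=i..<j. \<xi> k x) ^ 4)"
    and m4: "\<And>i j. (LINT x|M. (\<Sum>k=i..<j. \<xi> k x) ^ 4) \<le> C * (\<Sum>k=i..<j. u k)\<^sup>2"
  shows "i \<le> j \<Longrightarrow> \<exists>W. integrable M W \<and> (\<forall>x. 0 \<le> W x) \<and> (\<forall>n x. i \<le> n \<longrightarrow> n \<le> j \<longrightarrow> (\<Sum>k=i..<n. \<xi> k x) ^ 4 \<le> W x) \<and>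
     (LINT x|M. W x) \<le> 4000 * C * (\<Sum>k=i..<j. u k)\<^sup>2"
proof (induction "j - i" arbitrary: i j rule: less_induct)
  case less
  let ?S = "\<lambda>i j x. \<Sum>k=i..<j. \<xi> k x"
  let ?U = "\<lambda>i j. \<Sum>k=i..<j. u k"
  have U0: "0 \<le> ?U i j" for i j using u by (intro sum_nonneg) auto
  show ?case
  proof (cases "i = j")
    case True
    then show ?thesis by (intro exI[of _ "\<lambda>_. 0"]) auto
  next
    case False
    then have ij: "i < j" using less.prems by simp
    \<comment> \<open>The split index m is the last one with at most half of the weight to its left.
      Then at most half lies to its right as well, and the term at m itself, which may be heavy,
      belongs to neither half.\<close>
    define Q where "Q m \<longleftrightarrow> i \<le> m \<and> m < j \<and> 2 * ?U i m \<le> ?U i j" for m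
    define m where "m = (GREATEST m. Q m)"
    have "Q i" using ij U0[of i j] by (simp add: Q_def)
    then have Qm: "Q m" unfolding m_def by (rule GreatestI_nat[where b=j]) (simp add: Q_def)
    have Qmax: "k \<le> m" if "Q k" for k unfolding m_def using that by (rule Greatest_le_nat[where b=j]) (simp add: Q_def)
    have m: "i \<le> m" "m < j" "2 * ?U i m \<le> ?U i j" using Qm by (auto simp: Q_def)
    have right: "2 * ?U (Suc m) j \<le> ?U i j"
    proof (cases "Suc m = j")
      case True then show ?thesis using U0[of i j] by simp
    next
      case False
      then have "\<not> Q (Suc m)" using Qmax by fastforce
      then have "2 * ?U i (Suc m) > ?U i j" using m False by (auto simp: Q_def)
      moreover have "?U i j = ?U i (Suc m) + ?U (Suc m) j" using m by (intro sum.atLeastLessThan_concat[symmetric]) auto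
      ultimately show ?thesis by linarith
    qed
    have h1: "m - i < j - i" and h2: "j - Suc m < j - i" using m by simp_all
    obtain W1 where W1: "integrable M W1" "\<And>x. 0 \<le> W1 x" "\<And>n x. i \<le> n \<Longrightarrow> n \<le> m \<Longrightarrow> ?S i n x ^ 4 \<le> W1 x"
      "(LINT x|M. W1 x) \<le> 4000 * C * (?U i m)\<^sup>2"
      using less.hyps[OF h1 m(1)] by blast
    obtain W2 where W2: "integrable M W2" "\<And>x. 0 \<le> W2 x" "\<And>n x. Suc m \<le> n \<Longrightarrow> n \<le> j \<Longrightarrow> ?S (Suc m) n x ^ 4 \<le> W2 x"
      "(LINT x|M. W2 x) \<le> 4000 * C * (?U (Suc m) j)\<^sup>2"
      using less.hyps[OF h2] m by (auto simp: Suc_le_eq)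
    \<comment> \<open>The power mean with weights 1/10 and 9/10 gives 1000 and 1000/729, their
      inverse cubes. The recursion closes because 1000 + (1000/729) * 2 * (4000/4) is below
      4000.\<close>
    define W where "W x = 1000 * ?S i (Suc m) x ^ 4 + (1000/729) * (W1 x + W2 x)" for x
    have cvx: "(a + b) ^ 4 \<le> 1000 * a ^ 4 + (1000/729) * b ^ 4" for a b :: real
    proof -
      let ?w = "\<lambda>k::nat. if k = 0 then 1/10 else 9/10 :: real" and ?x = "\<lambda>k::nat. if k = 0 then a else b"
      have "(\<Sum>k\<in>{0, 1}. ?x k) ^ 4 \<le> (\<Sum>k\<in>{0, 1}. ?w k) ^ 3 * (\<Sum>k\<in>{0, 1}. ?x k ^ 4 / ?w k ^ 3)"
        by (rule weighted_power_mean_4) auto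
      then show ?thesis by (simp add: power_divide)
    qed
    have "integrable M W" unfolding W_def
      by (intro Bochner_Integration.integrable_add integrable_mult_right i4 W1(1) W2(1))
    moreover have "0 \<le> W x" for x unfolding W_def using W1(2)[of x] W2(2)[of x] by simp
    moreover have "?S i n x ^ 4 \<le> W x" if n: "i \<le> n" "n \<le> j" for n x
    proof (cases "n \<le> m")
      case True
      then have "?S i n x ^ 4 \<le> W1 x" using W1(3) n by simp
      also have "\<dots> \<le> (1000/729) * (W1 x + W2 x)" using W1(2)[of x] W2(2)[of x] by simp
      also have "\<dots> \<le> W x" unfolding W_def by simp
      finally show ?thesis .
    next
      case False
      then have "?S i n x = ?S i (Suc m) x + ?S (Suc m) n x"
        using m by (intro sum.atLeastLessThan_concat[symmetric]) auto
      then have "?S i n x ^ 4 \<le> 1000 * ?S i (Suc m) x ^ 4 + (1000/729) * ?S (Suc m) n x ^ 4" using cvx by simp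
      also have "\<dots> \<le> W x" unfolding W_def using W2(3)[of n x] W1(2)[of x] False n by simp
      finally show ?thesis .
    qed
    moreover have "(LINT x|M. W x) \<le> 4000 * C * (?U i j)\<^sup>2"
    proof -
      have "(LINT x|M. W x) = 1000 * (LINT x|M. ?S i (Suc m) x ^ 4) + (1000/729) * ((LINT x|M. W1 x) + (LINT x|M. W2 x))"
        unfolding W_def by (simp only: Bochner_Integration.integral_add Bochner_Integration.integrable_add
            integrable_mult_right integral_mult_right_zero i4 W1(1) W2(1))
      also have "\<dots> \<le> 1000 * (C * (?U i j)\<^sup>2) + (1000/729) * (4000 * C * (?U i j / 2)\<^sup>2 + 4000 * C * (?U i j / 2)\<^sup>2)"
      proof (intro add_mono mult_left_mono)
        have "?U i (Suc m) \<le> ?U i j" using u m by (intro sum_mono2) auto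
        then have "C * (?U i (Suc m))\<^sup>2 \<le> C * (?U i j)\<^sup>2" by (intro mult_left_mono power_mono U0 C)
        then show "(LINT x|M. ?S i (Suc m) x ^ 4) \<le> C * (?U i j)\<^sup>2" using m4[of i "Suc m"] by linarith
        have "4000 * C * (?U i m)\<^sup>2 \<le> 4000 * C * (?U i j / 2)\<^sup>2" using C U0[of i m] m(3) by (intro mult_left_mono power_mono) auto
        then show "(LINT x|M. W1 x) \<le> 4000 * C * (?U i j / 2)\<^sup>2" using W1(4) by linarith
        have "4000 * C * (?U (Suc m) j)\<^sup>2 \<le> 4000 * C * (?U i j / 2)\<^sup>2" using C U0[of "Suc m" j] right by (intro mult_left_mono power_mono) auto
        then show "(LINT x|M. W2 x) \<le> 4000 * C * (?U i j / 2)\<^sup>2" using W2(4) by linarith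
      qed auto
      also have "\<dots> \<le> 4000 * C * (?U i j)\<^sup>2"
      proof -
        have "0 \<le> C * (?U i j)\<^sup>2" using C by simp
        then show ?thesis by (simp add: power_divide)
      qed
      finally show ?thesis .
    qed
    ultimately show ?thesis by blast
  qed
qed

text \<open>The energy of the Rademacher-Menshov argument: single terms and the sums over left
  halves at all dyadic scales. An initial segment is a disjoint union of at most i + 1 such
  pieces.\<close>

primrec dyadic_energy :: "(nat \<Rightarrow> real) \<Rightarrow> nat \<Rightarrow> nat \<Rightarrow> real" where
  "dyadic_energy d 0 a = (d a)\<^sup>2"
| "dyadic_energy d (Suc i) a = dyadic_energy d i a + dyadic_energy d i (a + 2 ^ i) + (\<Sum>k=a..<a + 2 ^ i. d k)\<^sup>2"

lemma dyadic_energy_nonneg: "0 \<le> dyadic_energy d i a"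
  by (induction i arbitrary: a) auto

lemma partial_sum_le_dyadic_energy:
  "n \<le> 2 ^ i \<Longrightarrow> (\<Sum>k=a..<a + n. d k)\<^sup>2 \<le> real (Suc i) * dyadic_energy d i a"
proof (induction i arbitrary: a n)
  case 0
  then have "n = 0 \<or> n = 1" by auto
  then show ?case by auto
next
  case (Suc i)
  show ?case
  proof (cases "n \<le> 2 ^ i")
    case True
    have "(\<Sum>k=a..<a + n. d k)\<^sup>2 \<le> real (Suc i) * dyadic_energy d i a" by (rule Suc.IH[OF True])
    also have "\<dots> \<le> real (Suc (Suc i)) * dyadic_energy d (Suc i) a"
      using dyadic_energy_nonneg[of d i a] dyadic_energy_nonneg[of d i "a + 2 ^ i"] by (intro mult_mono) auto
    finally show ?thesis .
  next
    case False
    define x where "x = (\<Sum>k=a..<a + 2 ^ i. d k)"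
    define y where "y = (\<Sum>k=a + 2 ^ i..<(a + 2 ^ i) + (n - 2 ^ i). d k)"
    have s: "(\<Sum>k=a..<a + n. d k) = x + y"
      unfolding x_def y_def using False by (subst sum.atLeastLessThan_concat) auto
    have y2: "y\<^sup>2 \<le> real (Suc i) * dyadic_energy d i (a + 2 ^ i)"
      unfolding y_def by (rule Suc.IH) (use Suc.prems in auto)
    have "(x + y)\<^sup>2 \<le> (real i + 2) * x\<^sup>2 + (1 + 1 / (real i + 1)) * y\<^sup>2"
    proof -
      \<comment> \<open>The weight in (x + y)^2 <= (1 + c) x^2 + (1 + 1/c) y^2 is chosen so that (1
        + 1/c) (i + 1) = i + 2, which makes the factor grow by exactly 1 per level.\<close>
      define c where "c = real i + 1"
      have c: "c > 0" by (simp add: c_def)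
      have "0 \<le> (c * x - y)\<^sup>2 / c" using c by simp
      also have "(c * x - y)\<^sup>2 / c = c * x\<^sup>2 - 2 * x * y + y\<^sup>2 / c"
        using c by (simp add: power2_eq_square field_simps)
      finally have "2 * x * y \<le> c * x\<^sup>2 + y\<^sup>2 / c" by simp
      then show ?thesis by (simp add: power2_sum c_def algebra_simps)
    qed
    also have "(1 + 1 / (real i + 1)) * y\<^sup>2 \<le> (1 + 1 / (real i + 1)) * (real (Suc i) * dyadic_energy d i (a + 2 ^ i))"
      by (intro mult_left_mono y2) auto
    also have "(1 + 1 / (real i + 1)) * (real (Suc i) * dyadic_energy d i (a + 2 ^ i)) = (real i + 2) * dyadic_energy d i (a + 2 ^ i)"
      by (simp add: field_simps)
    also have "(real i + 2) * x\<^sup>2 + (real i + 2) * dyadic_energy d i (a + 2 ^ i) \<le> real (Suc (Suc i)) * dyadic_energy d (Suc i) a"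
      using mult_nonneg_nonneg[OF _ dyadic_energy_nonneg[of d i a], of "2 + real i"] by (simp add: x_def distrib_left add.commute)
    finally show ?thesis unfolding s by simp
  qed
qed

text \<open>By orthogonality each of the i + 1 scales contributes at most the total variance.
  Together with \<open>partial_sum_le_dyadic_energy\<close> this gives the squared logarithm of the
  Rademacher-Menshov inequality.\<close>

lemma dyadic_energy_expectation:
  fixes d :: "nat \<Rightarrow> 'a \<Rightarrow> real"
  assumes i2: "\<And>j k. integrable M (\<lambda>\<omega>. d j \<omega> * d k \<omega>)" and orth: "\<And>j k. j \<noteq> k \<Longrightarrow> (LINT \<omega>|M. d j \<omega> * d k \<omega>) = 0"
  shows "integrable M (\<lambda>\<omega>. dyadic_energy (\<lambda>j. d j \<omega>) i a)"
    and "(LINT \<omega>|M. dyadic_energy (\<lambda>j. d j \<omega>) i a) \<le> real (Suc i) * (\<Sum>k=a..<a + 2 ^ i. LINT \<omega>|M. (d k \<omega>)\<^sup>2)"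
proof -
  have sq: "(\<Sum>k\<in>I. d k \<omega>)\<^sup>2 = (\<Sum>j\<in>I. \<Sum>k\<in>I. d j \<omega> * d k \<omega>)" for I \<omega> by (simp add: power2_eq_square sum_product)
  have iS: "integrable M (\<lambda>\<omega>. (\<Sum>k\<in>I. d k \<omega>)\<^sup>2)" for I unfolding sq by (intro Bochner_Integration.integrable_sum i2)
  have eS: "(LINT \<omega>|M. (\<Sum>k\<in>I. d k \<omega>)\<^sup>2) = (\<Sum>k\<in>I. LINT \<omega>|M. (d k \<omega>)\<^sup>2)" if "finite I" for I
  proof -
    have "(LINT \<omega>|M. (\<Sum>k\<in>I. d k \<omega>)\<^sup>2) = (\<Sum>j\<in>I. \<Sum>k\<in>I. LINT \<omega>|M. d j \<omega> * d k \<omega>)"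
      unfolding sq by (simp only: Bochner_Integration.integral_sum Bochner_Integration.integrable_sum i2)
    also have "\<dots> = (\<Sum>j\<in>I. \<Sum>k\<in>I. if k = j then LINT \<omega>|M. (d j \<omega>)\<^sup>2 else 0)"
      using orth by (intro sum.cong refl) (auto simp: power2_eq_square)
    also have "\<dots> = (\<Sum>k\<in>I. LINT \<omega>|M. (d k \<omega>)\<^sup>2)" using that by simp
    finally show ?thesis .
  qed
  have i1: "integrable M (\<lambda>\<omega>. (d a \<omega>)\<^sup>2)" for a using i2[of a a] by (simp add: power2_eq_square)
  have both: "integrable M (\<lambda>\<omega>. dyadic_energy (\<lambda>j. d j \<omega>) i a) \<and>
     (LINT \<omega>|M. dyadic_energy (\<lambda>j. d j \<omega>) i a) \<le> real (Suc i) * (\<Sum>k=a..<a + 2 ^ i. LINT \<omega>|M. (d k \<omega>)\<^sup>2)" for a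
  proof (induction i arbitrary: a)
    case 0
    then show ?case using i1 by simp
  next
    case (Suc i)
    have i: "integrable M (\<lambda>\<omega>. dyadic_energy (\<lambda>j. d j \<omega>) i a)" for a using Suc.IH by blast
    have b: "(LINT \<omega>|M. dyadic_energy (\<lambda>j. d j \<omega>) i a) \<le> real (Suc i) * (\<Sum>k=a..<a + 2 ^ i. LINT \<omega>|M. (d k \<omega>)\<^sup>2)" for a using Suc.IH by blast
    let ?v = "\<lambda>k. LINT \<omega>|M. (d k \<omega>)\<^sup>2"
    have split: "(\<Sum>k=a..<a + 2 ^ Suc i. ?v k) = (\<Sum>k=a..<a + 2 ^ i. ?v k) + (\<Sum>k=a + 2 ^ i..<a + 2 ^ i + 2 ^ i. ?v k)"
      by (subst sum.atLeastLessThan_concat) (auto simp: add.assoc mult_2)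
    have nn: "0 \<le> (\<Sum>k=a + 2 ^ i..<a + 2 ^ i + 2 ^ i. ?v k)" by (intro sum_nonneg) auto
    have "(LINT \<omega>|M. dyadic_energy (\<lambda>j. d j \<omega>) (Suc i) a) =
       (LINT \<omega>|M. dyadic_energy (\<lambda>j. d j \<omega>) i a) + (LINT \<omega>|M. dyadic_energy (\<lambda>j. d j \<omega>) i (a + 2 ^ i)) + (\<Sum>k=a..<a + 2 ^ i. ?v k)"
      using i iS by (simp add: eS)
    also have "\<dots> \<le> real (Suc i) * (\<Sum>k=a..<a + 2 ^ i. ?v k) + real (Suc i) * (\<Sum>k=a + 2 ^ i..<a + 2 ^ i + 2 ^ i. ?v k) + (\<Sum>k=a..<a + 2 ^ i. ?v k)"
      using b[of a] b[of "a + 2 ^ i"] by simp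
    also have "\<dots> \<le> real (Suc (Suc i)) * (\<Sum>k=a..<a + 2 ^ Suc i. ?v k)"
      unfolding split using nn by (simp add: algebra_simps)
    finally show ?case using i iS by simp
  qed
  then show "integrable M (\<lambda>\<omega>. dyadic_energy (\<lambda>j. d j \<omega>) i a)"
    "(LINT \<omega>|M. dyadic_energy (\<lambda>j. d j \<omega>) i a) \<le> real (Suc i) * (\<Sum>k=a..<a + 2 ^ i. LINT \<omega>|M. (d k \<omega>)\<^sup>2)" by auto
qed

section \<open>Concatenation of independent uniform variables\<close>

lemma ex_sorting_bijection:
  fixes F :: "nat \<Rightarrow> real"
  shows "\<exists>\<sigma>. bij_betw \<sigma> {..<N} {..<N} \<and> (\<forall>c d. c \<le> d \<longrightarrow> d < N \<longrightarrow> F (\<sigma> c) \<le> F (\<sigma> d))"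
proof -
  define xs where "xs = sort_key F [0..<N]"
  have "bij_betw ((!) xs) {..<N} {..<N}"
    by (rule bij_betw_nth) (auto simp: xs_def)
  moreover have "F (xs ! c) \<le> F (xs ! d)" if "c \<le> d" "d < N" for c d
  proof -
    have "sorted (map F xs)" by (simp add: xs_def)
    from sorted_nth_mono[OF this, of c d] that show ?thesis by (simp add: xs_def)
  qed
  ultimately show ?thesis by blast
qed

lemma unif_eqI:
  assumes [measurable]: "X \<in> M \<rightarrow>\<^sub>M borel"
    and "\<And>A. A \<in> sets borel \<Longrightarrow> (\<integral>\<^sup>+\<omega>. indicator A (X \<omega>) \<partial>M) = (\<integral>\<^sup>+x. indicator A x \<partial>unif)"
  shows "distr M borel X = unif"
proof (rule measure_eqI)
  fix A assume "A \<in> sets (distr M borel X)"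
  then have [measurable]: "A \<in> sets borel" by simp
  have "emeasure (distr M borel X) A = (\<integral>\<^sup>+x. indicator A x \<partial>distr M borel X)" by simp
  also have "\<dots> = (\<integral>\<^sup>+\<omega>. indicator A (X \<omega>) \<partial>M)" by (subst nn_integral_distr) auto
  finally show "emeasure (distr M borel X) A = emeasure unif A" using assms(2) by simp
qed simp

text \<open>F is constant on N cells of equal length. Permuting the cells by translations preserves
  the uniform law, and sorting them by the value of F makes the composition monotone.\<close>

lemma ex_monotone_rearrangement:
  fixes F :: "real \<Rightarrow> real"
  assumes N: "0 < N" and F: "\<And>x y. \<lfloor>real N * x\<rfloor> = \<lfloor>real N * y\<rfloor> \<Longrightarrow> F x = F y"
  shows "\<exists>R. R \<in> borel_measurable borel \<and> (\<forall>v. 0 \<le> v \<longrightarrow> v < 1 \<longrightarrow> 0 \<le> R v \<and> R v < 1) \<and> distr unif borel R = unif \<and>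
     (\<forall>u v. 0 \<le> u \<longrightarrow> u \<le> v \<longrightarrow> v < 1 \<longrightarrow> F (R u) \<le> F (R v))"
proof -
  obtain \<sigma> where bij: "bij_betw \<sigma> {..<N} {..<N}" and mono: "\<And>c d. c \<le> d \<Longrightarrow> d < N \<Longrightarrow> F (real (\<sigma> c) / N) \<le> F (real (\<sigma> d) / N)"
    using ex_sorting_bijection[of N "\<lambda>c. F (real c / N)"] by blast
  define R where "R v = (real (\<sigma> (nat \<lfloor>N * v\<rfloor>)) + (N * v - of_int \<lfloor>N * v\<rfloor>)) / N" for v :: real
  have Rm[measurable]: "R \<in> borel_measurable borel"
  proof -
    have [measurable]: "(\<lambda>v. real (\<sigma> (nat \<lfloor>real N * v\<rfloor>))) \<in> borel_measurable borel"
      by (rule measurable_compose[of "\<lambda>v. \<lfloor>real N * v\<rfloor>" _ "count_space UNIV"]) auto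
    show ?thesis unfolding R_def by measurable
  qed
  have cell: "nat \<lfloor>N * v\<rfloor> < N" if "0 \<le> v" "v < 1" for v :: real
  proof -
    have "N * v < N" using that N by simp
    then show ?thesis using that N by (simp add: nat_less_iff floor_less_iff)
  qed
  have \<sigma>: "\<sigma> c < N" if "c < N" for c using bij that by (auto simp: bij_betw_def)
  have R01: "0 \<le> R v" "R v < 1" if "0 \<le> v" "v < 1" for v :: real
  proof -
    have "real (Suc (\<sigma> (nat \<lfloor>N * v\<rfloor>))) \<le> real N" using \<sigma>[OF cell[OF that]] by (intro of_nat_mono) simp
    moreover have "0 \<le> N * v - of_int \<lfloor>N * v\<rfloor>" "N * v - of_int \<lfloor>N * v\<rfloor> < 1" by linarith+
    ultimately show "0 \<le> R v" "R v < 1" using N by (simp_all add: R_def)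
  qed
  have FR: "F (R v) = F (real (\<sigma> (nat \<lfloor>N * v\<rfloor>)) / N)" for v :: real
  proof (rule F)
    have "real N * R v = real (\<sigma> (nat \<lfloor>N * v\<rfloor>)) + (N * v - of_int \<lfloor>N * v\<rfloor>)" using N by (simp add: R_def)
    moreover have "0 \<le> N * v - of_int \<lfloor>N * v\<rfloor>" "N * v - of_int \<lfloor>N * v\<rfloor> < 1" by linarith+
    ultimately have "\<lfloor>real N * R v\<rfloor> = int (\<sigma> (nat \<lfloor>N * v\<rfloor>))" by (intro floor_unique) auto
    then show "\<lfloor>real N * R v\<rfloor> = \<lfloor>real N * (real (\<sigma> (nat \<lfloor>N * v\<rfloor>)) / N)\<rfloor>" using N by simp
  qed
  have "distr unif borel R = unif"
  proof (rule unif_eqI)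
    fix A :: "real set" assume [measurable]: "A \<in> sets borel"
    have "(\<integral>\<^sup>+v. indicator A (R v) \<partial>unif) = (\<Sum>c<N. \<integral>\<^sup>+y. indicator A (R ((real c + y) / N)) \<partial>unif) * ennreal (1 / N)"
      by (rule nn_integral_unif_split) (use N in auto)
    also have "(\<Sum>c<N. \<integral>\<^sup>+y. indicator A (R ((real c + y) / N)) \<partial>unif) = (\<Sum>c<N. \<integral>\<^sup>+y. indicator A ((real (\<sigma> c) + y) / N) \<partial>unif)"
    proof (intro sum.cong refl nn_integral_cong_AE)
      fix c
      show "AE y in unif. indicator A (R ((real c + y) / N)) = (indicator A ((real (\<sigma> c) + y) / N) :: ennreal)"
        using AE_unif
      proof eventually_elim
        case (elim y)
        have "real N * ((real c + y) / N) = real c + y" using N by simp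
        moreover have "\<lfloor>real c + y\<rfloor> = int c" using elim by (intro floor_unique) auto
        ultimately have "R ((real c + y) / N) = (real (\<sigma> c) + y) / N" unfolding R_def by simp
        then show ?case by simp
      qed
    qed
    also have "\<dots> = (\<Sum>c<N. \<integral>\<^sup>+y. indicator A ((real c + y) / N) \<partial>unif)"
      using sum.reindex_bij_betw[OF bij, of "\<lambda>c. \<integral>\<^sup>+y. indicator A ((real c + y) / N) \<partial>unif"] .
    also have "\<dots> * ennreal (1 / N) = (\<integral>\<^sup>+x. indicator A x \<partial>unif)"
      by (rule nn_integral_unif_split[symmetric]) (use N in auto)
    finally show "(\<integral>\<^sup>+v. indicator A (R v) \<partial>unif) = (\<integral>\<^sup>+x. indicator A x \<partial>unif)" .
  qed simp
  moreover have "F (R u) \<le> F (R v)" if "0 \<le> u" "u \<le> v" "v < 1" for u v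
    unfolding FR
  proof (rule mono)
    have "\<lfloor>N * u\<rfloor> \<le> \<lfloor>N * v\<rfloor>" using that by (intro floor_mono mult_left_mono) auto
    then show "nat \<lfloor>N * u\<rfloor> \<le> nat \<lfloor>N * v\<rfloor>" by simp
    show "nat \<lfloor>N * v\<rfloor> < N" using that by (intro cell) auto
  qed
  ultimately show ?thesis using R01 Rm by (intro exI[of _ R] conjI allI impI) auto
qed

lemma cdf_unif: "cdf unif t = max 0 (min 1 t)"
proof -
  have "emeasure unif {..t} = (\<integral>\<^sup>+x. indicator {..t} x * indicator {0..<1} x \<partial>lborel)"
    using nn_integral_unif[of "indicator {..t}"] by simp
  also have "\<dots> = emeasure lborel ({..t} \<inter> {0..<1})"
  proof -
    have "(\<integral>\<^sup>+x. indicator {..t} x * indicator {0..<1} x \<partial>lborel) = (\<integral>\<^sup>+x. indicator ({..t} \<inter> {0..<1}) x \<partial>lborel)"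
      by (simp only: indicator_inter_arith)
    then show ?thesis by simp
  qed
  also have "\<dots> = ennreal (max 0 (min 1 t))"
  proof -
    consider "t < 0" | "0 \<le> t" "t < 1" | "1 \<le> t" by linarith
    then show ?thesis
    proof cases
      case 1
      then have "{..t} \<inter> {0..<1} = {}" by auto
      then show ?thesis using 1 by simp
    next
      case 2
      then have "{..t} \<inter> {0..<1} = {0..t}" by auto
      then show ?thesis using 2 by simp
    next
      case 3
      then have "{..t} \<inter> {0..<1} = {0..<1}" by auto
      then show ?thesis using 3 by simp
    qed
  qed
  finally have "ennreal (measure unif {..t}) = ennreal (max 0 (min 1 t))" by (simp only: unif.emeasure_eq_measure)
  then have "measure unif {..t} = max 0 (min 1 t)" by (subst (asm) ennreal_inj) auto
  then show ?thesis by (simp add: cdf_def)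
qed

lemma real_distribution_unif: "real_distribution unif"
  using prob_space_unif by (simp add: real_distribution_def real_distribution_axioms_def)

lemma normal_cdf_uniform:
  shows "mono (cdf stdn)" "0 < cdf stdn x" "cdf stdn x < 1" "cdf stdn \<in> borel_measurable borel" "distr stdn borel (cdf stdn) = unif"
proof -
  let ?\<Phi> = "cdf stdn"
  \<comment> \<open>A positive density makes the distribution function strictly increasing, so its
    sublevel sets at levels strictly between 0 and 1 are half-lines.\<close>
  have pos: "measure stdn A > 0" if A: "A \<in> sets borel" "emeasure lborel A \<noteq> 0" for A
  proof (rule ccontr)
    assume "\<not> measure stdn A > 0"
    then have "measure stdn A = 0" using measure_nonneg[of stdn A] by linarith
    then have "emeasure stdn A = 0" by (simp add: stdn.emeasure_eq_measure)
    then have "A \<in> null_sets stdn" using A by (auto simp: null_sets_def)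
    then have "AE x in lborel. x \<in> A \<longrightarrow> ennreal (std_normal_density x) = 0"
      by (subst (asm) null_sets_density_iff) auto
    moreover have "ennreal (std_normal_density x) \<noteq> 0" for x
      using normal_density_pos[of 1 0 x] by (simp add: ennreal_eq_0_iff not_le)
    ultimately have "AE x in lborel. x \<notin> A" by simp
    then have "emeasure lborel A = 0" using A by (intro AE_iff_measurable[THEN iffD1, rotated 2]) auto
    then show False using A by simp
  qed
  have strict: "?\<Phi> x < ?\<Phi> y" if "x < y" for x y
  proof -
    have "0 < measure stdn {x<..y}" using that by (intro pos) auto
    moreover have "?\<Phi> y - ?\<Phi> x = measure stdn {x<..y}" using that by (rule stdn.cdf_diff_eq)
    ultimately show ?thesis by simp
  qed
  then show mono: "mono ?\<Phi>" by (intro monoI) (auto simp: le_less)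
  show p0: "0 < ?\<Phi> x" for x using strict[of "x - 1" x] stdn.cdf_nonneg[of "x - 1"] by simp
  show p1: "?\<Phi> x < 1" for x using strict[of x "x + 1"] stdn.cdf_bounded_prob[of "x + 1"] by simp
  show m[measurable]: "?\<Phi> \<in> borel_measurable borel" using mono by (rule borel_measurable_mono)
  have cont: "isCont ?\<Phi> x" for x
  proof -
    have "AE y in lborel. y \<in> {x} \<longrightarrow> ennreal (std_normal_density y) = 0"
      using AE_lborel_singleton[of x] by eventually_elim simp
    then have "{x} \<in> null_sets stdn" by (subst null_sets_density_iff) auto
    then have "measure stdn {x} = 0" by (simp add: measure_def null_setsD1)
    then show ?thesis using stdn.isCont_cdf by blast
  qed
  show "distr stdn borel ?\<Phi> = unif"
  proof (rule cdf_unique)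
    show "real_distribution (distr stdn borel ?\<Phi>)" by (intro stdn.real_distribution_distr) auto
    show "cdf (distr stdn borel ?\<Phi>) = cdf unif"
    proof
      fix t
      have e: "cdf (distr stdn borel ?\<Phi>) t = measure stdn {x. ?\<Phi> x \<le> t}"
        unfolding cdf_def[of "distr stdn borel ?\<Phi>"] by (subst measure_distr) (auto simp: vimage_def)
      consider "t \<le> 0" | "0 < t" "t < 1" | "1 \<le> t" by linarith
      then show "cdf (distr stdn borel ?\<Phi>) t = cdf unif t"
      proof cases
        case 1
        then have "{x. ?\<Phi> x \<le> t} = {}" using p0 by (auto simp: not_le intro: le_less_trans)
        then show ?thesis using 1 by (simp add: e cdf_unif)
      next
        case 3
        then have "{x. ?\<Phi> x \<le> t} = UNIV" using p1 by (auto intro: less_imp_le less_le_trans)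
        then show ?thesis using 3 stdn.prob_space by (simp add: e cdf_unif)
      next
        case 2
        have "eventually (\<lambda>x. ?\<Phi> x < t) at_bot" using stdn.cdf_lim_at_bot 2(1) by (rule order_tendstoD)
        then obtain a where a: "?\<Phi> a < t" by (auto simp: eventually_at_bot_linorder)
        have "eventually (\<lambda>x. t < ?\<Phi> x) at_top" using stdn.cdf_lim_at_top_prob 2(2) by (rule order_tendstoD)
        then obtain b where b: "t < ?\<Phi> b" by (auto simp: eventually_at_top_linorder)
        have ab: "a \<le> b" using a b mono by (meson less_trans monoD not_le order.asym order_less_le_trans)
        obtain y where y: "?\<Phi> y = t" using IVT'[of ?\<Phi> a t b] a b ab cont
          by (auto intro: continuous_at_imp_continuous_on)
        have "{x. ?\<Phi> x \<le> t} = {..y}"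
          unfolding y[symmetric] using strict monoD[OF mono] by (auto simp: not_le[symmetric])
        then show ?thesis using 2 y by (simp add: e cdf_unif) (simp add: cdf_def)
      qed
    qed
  qed (rule real_distribution_unif)
qed

text \<open>The integer part of N X is uniform on N values and independent of the uniform Y. This is
  \<open>nn_integral_unif_split\<close> read backwards.\<close>

lemma (in prob_space) indep_uniform_concat:
  assumes ind: "indep_var borel X borel Y" and X: "distr M borel X = unif" and Y: "distr M borel Y = unif" and N: "0 < N"
  shows "distr M borel (\<lambda>\<omega>. (of_int \<lfloor>real N * X \<omega>\<rfloor> + Y \<omega>) / N) = unif"
proof (rule unif_eqI)
  have [measurable]: "X \<in> borel_measurable M" "Y \<in> borel_measurable M" using ind indep_var_rv1 indep_var_rv2 by blast+
  show "(\<lambda>\<omega>. (of_int \<lfloor>real N * X \<omega>\<rfloor> + Y \<omega>) / real N) \<in> borel_measurable M" by measurable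
  interpret P: pair_prob_space unif unif ..
  have joint: "distr M (borel \<Otimes>\<^sub>M borel) (\<lambda>\<omega>. (X \<omega>, Y \<omega>)) = unif \<Otimes>\<^sub>M unif"
    using ind unfolding indep_var_distribution_eq X Y by simp
  fix A :: "real set" assume [measurable]: "A \<in> sets borel"
  have "(\<integral>\<^sup>+\<omega>. indicator A ((of_int \<lfloor>real N * X \<omega>\<rfloor> + Y \<omega>) / N) \<partial>M)
     = (\<integral>\<^sup>+w. indicator A ((of_int \<lfloor>real N * fst w\<rfloor> + snd w) / N) \<partial>distr M (borel \<Otimes>\<^sub>M borel) (\<lambda>\<omega>. (X \<omega>, Y \<omega>)))"
    by (subst nn_integral_distr) auto
  also have "\<dots> = (\<integral>\<^sup>+x. \<integral>\<^sup>+y. indicator A ((of_int \<lfloor>real N * x\<rfloor> + y) / N) \<partial>unif \<partial>unif)"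
    unfolding joint by (subst unif.nn_integral_fst[symmetric]) auto
  also have "\<dots> = (\<Sum>c<N. \<integral>\<^sup>+x. \<integral>\<^sup>+y. indicator A ((of_int \<lfloor>real N * ((real c + x) / N)\<rfloor> + y) / N) \<partial>unif \<partial>unif) * ennreal (1 / N)"
    by (rule nn_integral_unif_split) (use N in auto)
  also have "(\<Sum>c<N. \<integral>\<^sup>+x. \<integral>\<^sup>+y. indicator A ((of_int \<lfloor>real N * ((real c + x) / N)\<rfloor> + y) / N) \<partial>unif \<partial>unif)
     = (\<Sum>c<N. \<integral>\<^sup>+y. indicator A ((real c + y) / N) \<partial>unif)"
  proof (intro sum.cong refl)
    fix c
    have "(\<integral>\<^sup>+x. \<integral>\<^sup>+y. indicator A ((of_int \<lfloor>real N * ((real c + x) / N)\<rfloor> + y) / N) \<partial>unif \<partial>unif)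
      = (\<integral>\<^sup>+x. \<integral>\<^sup>+y. indicator A ((real c + y) / N) \<partial>unif \<partial>unif)"
    proof (rule nn_integral_cong_AE)
      show "AE x in unif. (\<integral>\<^sup>+y. indicator A ((of_int \<lfloor>real N * ((real c + x) / N)\<rfloor> + y) / N) \<partial>unif) = (\<integral>\<^sup>+y. indicator A ((real c + y) / N) \<partial>unif)"
        using AE_unif
      proof eventually_elim
        case (elim x)
        have "real N * ((real c + x) / N) = real c + x" using N by simp
        moreover have "\<lfloor>real c + x\<rfloor> = int c" using elim by (intro floor_unique) auto
        ultimately show ?case by simp
      qed
    qed
    then show "(\<integral>\<^sup>+x. \<integral>\<^sup>+y. indicator A ((of_int \<lfloor>real N * ((real c + x) / N)\<rfloor> + y) / N) \<partial>unif \<partial>unif)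
      = (\<integral>\<^sup>+y. indicator A ((real c + y) / N) \<partial>unif)" using unif.emeasure_space_1 by simp
  qed
  also have "\<dots> * ennreal (1 / N) = (\<integral>\<^sup>+x. indicator A x \<partial>unif)"
    by (rule nn_integral_unif_split[symmetric]) (use N in auto)
  finally show "(\<integral>\<^sup>+\<omega>. indicator A ((of_int \<lfloor>real N * X \<omega>\<rfloor> + Y \<omega>) / N) \<partial>M) = (\<integral>\<^sup>+x. indicator A x \<partial>unif)" .
qed

section \<open>One uniform point from independent uniform blocks\<close>

locale uniform_blocks = prob_space M + radix r for M :: "'a measure" and r :: nat +
  fixes X :: "nat \<Rightarrow> 'a \<Rightarrow> real" and n :: "nat \<Rightarrow> nat"
  assumes indep_X: "indep_vars (\<lambda>_. borel) X UNIV"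
    and distr_X: "\<And>j. distr M borel (X j) = unif"
    and range_X: "\<And>j \<omega>. 0 \<le> X j \<omega> \<and> X j \<omega> < 1"
    and n_0: "n 0 = 0" and mono_n: "mono n" and n_top: "filterlim n at_top sequentially"
begin

lemma measurable_X[measurable]: "X j \<in> borel_measurable M"
  using indep_X unfolding indep_vars_def by blast

definition len :: "nat \<Rightarrow> nat" where "len j = n (Suc j) - n j"

definition base :: "nat \<Rightarrow> nat" where "base j = r ^ len j"

definition digit :: "nat \<Rightarrow> real \<Rightarrow> real" where "digit j y = of_int \<lfloor>real (base j) * y\<rfloor>"

lemma base_pos: "0 < base j" by (simp add: base_def)

text \<open>The digits of k blocks, beginning with block j, are followed by the whole variable of
  the next block and not by zeros. This makes each word exactly uniform.\<close>

primrec word :: "nat \<Rightarrow> nat \<Rightarrow> (nat \<Rightarrow> real) \<Rightarrow> real" where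
  "word 0 j w = w j"
| "word (Suc k) j w = (digit j (w j) + word k (Suc j) w) / real (base j)"

lemma measurable_word: "{j..} \<subseteq> B \<Longrightarrow> word k j \<in> borel_measurable (PiM B (\<lambda>_. borel))"
proof (induction k arbitrary: j)
  case 0
  then have "j \<in> B" by auto
  then show ?case by simp
next
  case (Suc k)
  then have j: "j \<in> B" and "{Suc j..} \<subseteq> B" by auto
  then have IH: "word k (Suc j) \<in> borel_measurable (PiM B (\<lambda>_. borel))" using Suc.IH by blast
  have "word (Suc k) j = (\<lambda>w. (of_int \<lfloor>real (base j) * w j\<rfloor> + word k (Suc j) w) / real (base j))"
    by (simp add: fun_eq_iff digit_def)
  moreover have "(\<lambda>w. real_of_int \<lfloor>real (base j) * w j\<rfloor>) \<in> borel_measurable (PiM B (\<lambda>_. borel))"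
  proof -
    have "(\<lambda>u. real_of_int \<lfloor>c * u\<rfloor>) \<in> borel_measurable borel" for c :: real by measurable
    then show ?thesis by (rule measurable_compose[OF measurable_component_singleton[OF j]])
  qed
  ultimately show ?case using IH
    by (simp only:) (intro borel_measurable_divide borel_measurable_add borel_measurable_const)
qed

lemma word_cong: "(\<And>i. j \<le> i \<Longrightarrow> w i = w' i) \<Longrightarrow> word k j w = word k j w'"
  by (induction k arbitrary: j) auto

definition path :: "'a \<Rightarrow> nat \<Rightarrow> real" where "path \<omega> i = X i \<omega>"

lemma measurable_word_path[measurable]: "(\<lambda>\<omega>. word k j (path \<omega>)) \<in> borel_measurable M"
proof -
  have "(\<lambda>\<omega>. path \<omega>) \<in> M \<rightarrow>\<^sub>M PiM UNIV (\<lambda>_. borel)"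
    unfolding path_def by (rule measurable_PiM_single') auto
  from measurable_compose[OF this measurable_word] show ?thesis by simp
qed

lemma distr_word: "distr M borel (\<lambda>\<omega>. word k j (path \<omega>)) = unif"
proof (induction k arbitrary: j)
  case 0
  then show ?case using distr_X by (simp add: path_def)
next
  case (Suc k)
  have "indep_var (PiM {j} (\<lambda>_. borel)) (\<lambda>\<omega>. restrict (\<lambda>i. X i \<omega>) {j}) (PiM {Suc j..} (\<lambda>_. borel)) (\<lambda>\<omega>. restrict (\<lambda>i. X i \<omega>) {Suc j..})"
    by (rule indep_var_restrict[OF indep_X]) auto
  from indep_var_compose[OF this, of "\<lambda>w. w j" borel "word k (Suc j)" borel]
  have "indep_var borel ((\<lambda>w. w j) \<circ> (\<lambda>\<omega>. restrict (\<lambda>i. X i \<omega>) {j})) borel (word k (Suc j) \<circ> (\<lambda>\<omega>. restrict (\<lambda>i. X i \<omega>) {Suc j..}))"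
    using measurable_word[of "Suc j" "{Suc j..}" k] by simp
  moreover have "(\<lambda>w. w j) \<circ> (\<lambda>\<omega>. restrict (\<lambda>i. X i \<omega>) {j}) = X j" by (simp add: fun_eq_iff)
  moreover have "word k (Suc j) \<circ> (\<lambda>\<omega>. restrict (\<lambda>i. X i \<omega>) {Suc j..}) = (\<lambda>\<omega>. word k (Suc j) (path \<omega>))"
    by (auto simp: fun_eq_iff path_def intro!: word_cong)
  ultimately have "indep_var borel (X j) borel (\<lambda>\<omega>. word k (Suc j) (path \<omega>))" by simp
  from indep_uniform_concat[OF this distr_X Suc.IH base_pos[of j]]
  show ?case by (simp add: digit_def path_def)
qed

definition block_term :: "'a \<Rightarrow> nat \<Rightarrow> nat \<Rightarrow> real" where
  "block_term \<omega> j k = digit (j + k) (X (j + k) \<omega>) * (real r ^ n j / real r ^ n (Suc (j + k)))"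

lemma n_le: "i \<le> j \<Longrightarrow> n i \<le> n j" using mono_n by (rule monoD)

lemma word_eq: "word k j (path \<omega>) = (\<Sum>i<k. block_term \<omega> j i) + real r ^ n j / real r ^ n (j + k) * X (j + k) \<omega>"
proof (induction k arbitrary: j)
  case 0
  then show ?case by (simp add: path_def)
next
  case (Suc k)
  have b: "real (base j) = real r ^ n (Suc j) / real r ^ n j"
    unfolding base_def len_def of_nat_power using n_le[of j "Suc j"] by (simp add: power_diff)
  have "(\<Sum>i<Suc k. block_term \<omega> j i) = block_term \<omega> j 0 + (\<Sum>i<k. block_term \<omega> j (Suc i))" by (rule sum.lessThan_Suc_shift)
  also have "(\<Sum>i<k. block_term \<omega> j (Suc i)) = (\<Sum>i<k. block_term \<omega> (Suc j) i) / base j"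
    unfolding sum_divide_distrib b by (intro sum.cong refl) (simp add: block_term_def)
  also have "block_term \<omega> j 0 = digit j (X j \<omega>) / base j" unfolding b by (simp add: block_term_def)
  finally have S: "(\<Sum>i<Suc k. block_term \<omega> j i) = digit j (X j \<omega>) / base j + (\<Sum>i<k. block_term \<omega> (Suc j) i) / base j" .
  have "real r ^ n (Suc j) / real r ^ n (Suc j + k) * X (Suc j + k) \<omega> / base j = real r ^ n j / real r ^ n (j + Suc k) * X (j + Suc k) \<omega>"
    unfolding b by simp
  then show ?case unfolding S word.simps Suc.IH[of "Suc j"] add_divide_distrib by (simp add: path_def)
qed

lemma digit_nonneg: "0 \<le> digit j (X j \<omega>)"
  using range_X[of j \<omega>] by (simp add: digit_def)

lemma word_range: "0 \<le> word k j (path \<omega>) \<and> word k j (path \<omega>) < 1"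
proof (induction k arbitrary: j)
  case 0
  then show ?case using range_X by (simp add: path_def)
next
  case (Suc k)
  have w: "0 \<le> word k (Suc j) (path \<omega>)" "word k (Suc j) (path \<omega>) < 1" using Suc.IH by auto
  have "real (base j) * X j \<omega> < real (base j)" using range_X[of j \<omega>] base_pos[of j] by simp
  then have "\<lfloor>real (base j) * X j \<omega>\<rfloor> < int (base j)" by (simp add: floor_less_iff)
  then have "\<lfloor>real (base j) * X j \<omega>\<rfloor> + 1 \<le> int (base j)" by simp
  then have "digit j (X j \<omega>) + 1 \<le> real (base j)" unfolding digit_def by (metis of_int_1 of_int_add of_int_le_iff of_int_of_nat_eq)
  then show ?case unfolding word.simps using w digit_nonneg[of j \<omega>] base_pos[of j] by (simp add: path_def[of \<omega> j])
qed

definition point :: "nat \<Rightarrow> 'a \<Rightarrow> real" where "point j \<omega> = (\<Sum>k. block_term \<omega> j k)"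

lemma block_term_nonneg: "0 \<le> block_term \<omega> j k"
  unfolding block_term_def using digit_nonneg by simp

lemma partial_le_1: "(\<Sum>i<k. block_term \<omega> j i) \<le> 1"
proof -
  have "0 \<le> real r ^ n j / real r ^ n (j + k) * X (j + k) \<omega>" using range_X[of "j + k" \<omega>] by simp
  then show ?thesis using word_eq[of k j \<omega>] word_range[of k j \<omega>] by linarith
qed

lemma block_term_summable: "summable (block_term \<omega> j)"
  by (rule summableI_nonneg_bounded[where x=1]) (auto simp: block_term_nonneg partial_le_1)

text \<open>The value 1 is not excluded: all digits may be maximal.\<close>

lemma point_range: "0 \<le> point j \<omega>" "point j \<omega> \<le> 1"
  unfolding point_def
  by (auto intro!: suminf_nonneg suminf_le_const block_term_summable simp: block_term_nonneg partial_le_1)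

lemma word_tendsto: "(\<lambda>k. word k j (path \<omega>)) \<longlonglongrightarrow> point j \<omega>"
proof -
  have "(\<lambda>k. real r ^ n j / real r ^ n (j + k) * X (j + k) \<omega>) \<longlonglongrightarrow> 0"
  proof (rule Lim_null_comparison[of _ "\<lambda>k. real r ^ n j * (1 / real r) ^ n (j + k)"])
    show "\<forall>\<^sub>F k in sequentially. norm (real r ^ n j / real r ^ n (j + k) * X (j + k) \<omega>) \<le> real r ^ n j * (1 / real r) ^ n (j + k)"
    proof (intro always_eventually allI)
      fix k
      have "\<bar>X (j + k) \<omega>\<bar> \<le> 1" using range_X[of "j + k" \<omega>] by simp
      then have "real r ^ n j / real r ^ n (j + k) * \<bar>X (j + k) \<omega>\<bar> \<le> real r ^ n j / real r ^ n (j + k) * 1"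
        by (intro mult_left_mono) auto
      then show "norm (real r ^ n j / real r ^ n (j + k) * X (j + k) \<omega>) \<le> real r ^ n j * (1 / real r) ^ n (j + k)"
        by (simp add: abs_mult power_divide)
    qed
    have nk: "filterlim (\<lambda>k. n (j + k)) at_top sequentially"
      by (rule filterlim_compose[OF n_top]) (simp add: filterlim_add_const_nat_at_top filterlim_sequentially_Suc add.commute[of j])
    have "(\<lambda>m. (1 / real r) ^ m) \<longlonglongrightarrow> 0" using r_ge_2 by (intro LIMSEQ_realpow_zero) auto
    then have "(\<lambda>k. (1 / real r) ^ n (j + k)) \<longlonglongrightarrow> 0" using nk by (rule filterlim_compose)
    then show "(\<lambda>k. real r ^ n j * (1 / real r) ^ n (j + k)) \<longlonglongrightarrow> 0" by (rule tendsto_mult_right_zero)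
  qed
  then have "(\<lambda>k. (\<Sum>i<k. block_term \<omega> j i) + real r ^ n j / real r ^ n (j + k) * X (j + k) \<omega>) \<longlonglongrightarrow> point j \<omega> + 0"
    unfolding point_def by (intro tendsto_add summable_LIMSEQ block_term_summable)
  then show ?thesis by (simp add: word_eq)
qed

lemma measurable_point[measurable]: "point j \<in> borel_measurable M"
  by (rule borel_measurable_LIMSEQ_real[OF word_tendsto]) auto

text \<open>All words are uniform and they converge pointwise to the point, so their common
  characteristic function is also that of the limit.\<close>

lemma distr_point: "distr M borel (point j) = unif"
proof (rule Levy_uniqueness[OF _ real_distribution_unif])
  show "real_distribution (distr M borel (point j))" by (intro real_distribution_distr) auto
  show "char (distr M borel (point j)) = char unif"
  proof
    fix \<theta>
    have e: "(CLINT \<omega>|M. iexp (\<theta> * word k j (path \<omega>))) = char unif \<theta>" for k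
      unfolding distr_word[of k j, symmetric] char_def by (subst integral_distr) auto
    have "(\<lambda>k. CLINT \<omega>|M. iexp (\<theta> * word k j (path \<omega>))) \<longlonglongrightarrow> (CLINT \<omega>|M. iexp (\<theta> * point j \<omega>))"
    proof (rule integral_dominated_convergence[where w="\<lambda>_. 1"])
      show "AE \<omega> in M. (\<lambda>k. iexp (\<theta> * word k j (path \<omega>))) \<longlonglongrightarrow> iexp (\<theta> * point j \<omega>)"
        by (intro AE_I2 tendsto_exp tendsto_mult tendsto_const tendsto_of_real word_tendsto)
    qed auto
    then have "(CLINT \<omega>|M. iexp (\<theta> * point j \<omega>)) = char unif \<theta>"
      unfolding e by (simp add: LIMSEQ_const_iff)
    then show "char (distr M borel (point j)) \<theta> = char unif \<theta>"
      by (simp add: char_def integral_distr)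
  qed
qed

lemma point_rec: "point j \<omega> = (digit j (X j \<omega>) + point (Suc j) \<omega>) / base j"
proof (rule LIMSEQ_unique)
  show "(\<lambda>k. word (Suc k) j (path \<omega>)) \<longlonglongrightarrow> point j \<omega>" using word_tendsto by (rule LIMSEQ_Suc)
  show "(\<lambda>k. word (Suc k) j (path \<omega>)) \<longlonglongrightarrow> (digit j (X j \<omega>) + point (Suc j) \<omega>) / base j"
    unfolding word.simps path_def[of \<omega> j] using base_pos[of j] by (intro tendsto_intros word_tendsto) auto
qed

lemma point_scale: "\<exists>k :: int. real r ^ n j * point 0 \<omega> = of_int k + point j \<omega>"
proof (induction j)
  case 0
  then show ?case using n_0 by (intro exI[of _ 0]) simp
next
  case (Suc j)
  then obtain k :: int where k: "real r ^ n j * point 0 \<omega> = of_int k + point j \<omega>" by blast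
  have "real r ^ n (Suc j) = real (base j) * real r ^ n j"
    unfolding base_def len_def using n_le[of j "Suc j"] by (simp flip: power_add)
  then have "real r ^ n (Suc j) * point 0 \<omega> = real (base j) * (of_int k + point j \<omega>)" by (simp only: mult.assoc k)
  also have "\<dots> = real (base j) * of_int k + (digit j (X j \<omega>) + point (Suc j) \<omega>)"
  proof -
    have "real (base j) * point j \<omega> = digit j (X j \<omega>) + point (Suc j) \<omega>"
      using base_pos[of j] by (subst point_rec[of j]) simp
    then show ?thesis by (simp only: distrib_left)
  qed
  also have "\<dots> = of_int (int (base j) * k + \<lfloor>real (base j) * X j \<omega>\<rfloor>) + point (Suc j) \<omega>"
    by (simp add: digit_def)
  finally show ?case by blast
qed

text \<open>Multiplication by r^(n j) shifts digits up to an integer, and an integer shift moves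
  half-cell indices by an even number. Thus block j of the signs of the final point is read off from
  \<open>point j\<close>.\<close>

lemma sgn_digit_point: "sgn_digit (n j + i) (point 0 \<omega>) = sgn_digit i (point j \<omega>)"
proof -
  obtain k :: int where k: "real r ^ n j * point 0 \<omega> = of_int k + point j \<omega>" using point_scale by blast
  have "2 * real r ^ (n j + i) * point 0 \<omega> = 2 * real r ^ i * (real r ^ n j * point 0 \<omega>)" by (simp add: power_add)
  also have "\<dots> = of_int (2 * (int r ^ i * k)) + 2 * real r ^ i * point j \<omega>" unfolding k by (simp add: distrib_left)
  finally have "cell (n j + i) (point 0 \<omega>) = 2 * (int r ^ i * k) + cell i (point j \<omega>)"
    unfolding cell_def by (metis floor_add_int add.commute)
  then show ?thesis unfolding sgn_digit_def by (simp add: pm1_add) (simp add: pm1_def)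
qed

lemma point_near: "\<bar>point j \<omega> - X j \<omega>\<bar> \<le> 1 / base j"
proof -
  have b: "0 < real (base j)" using base_pos by simp
  have "digit j (X j \<omega>) \<le> real (base j) * X j \<omega>" "real (base j) * X j \<omega> \<le> digit j (X j \<omega>) + 1"
    unfolding digit_def by linarith+
  then have "\<bar>digit j (X j \<omega>) + point (Suc j) \<omega> - real (base j) * X j \<omega>\<bar> \<le> 1"
    using point_range[of "Suc j" \<omega>] by (simp add: abs_le_iff)
  moreover have "point j \<omega> - X j \<omega> = (digit j (X j \<omega>) + point (Suc j) \<omega> - real (base j) * X j \<omega>) / base j"
    using b unfolding point_rec[of j] by (simp add: diff_divide_distrib)
  ultimately show ?thesis using b by (simp add: abs_divide divide_right_mono)
qed

text \<open>\<open>point j\<close> and \<open>X j\<close> share the digits of block j, hence differ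
  by at most r^(-len j). For odd r the half cells straddle cells of digits, so equal digits do not
  imply equal signs; a sign can change only if a kink lies within that distance.\<close>

lemma digit_sum_point_near:
  "\<bar>digit_sum \<alpha> (len j) (point j \<omega>) - digit_sum \<alpha> (len j) (X j \<omega>)\<bar> \<le> kink_sum \<alpha> (len j) (X j \<omega>)"
proof -
  have "\<bar>\<alpha> i * sgn_digit i (point j \<omega>) - \<alpha> i * sgn_digit i (X j \<omega>)\<bar>
     \<le> 2 * \<bar>\<alpha> i\<bar> * indicator {u. dist_int u \<le> 2 * (real r ^ i / real r ^ len j)} (2 * real r ^ i * X j \<omega>)" for i
  proof (cases "dist_int (2 * real r ^ i * X j \<omega>) \<le> 2 * (real r ^ i / real r ^ len j)")
    case True
    have "\<bar>\<alpha> i * sgn_digit i (point j \<omega>) - \<alpha> i * sgn_digit i (X j \<omega>)\<bar> \<le> \<bar>\<alpha> i * sgn_digit i (point j \<omega>)\<bar> + \<bar>\<alpha> i * sgn_digit i (X j \<omega>)\<bar>"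
      by (rule abs_triangle_ineq4)
    then show ?thesis using True by (simp add: abs_mult)
  next
    case False
    define t where "t = 2 * real r ^ i * (point j \<omega> - X j \<omega>)"
    have "\<bar>t\<bar> \<le> 2 * real r ^ i * (1 / base j)" unfolding t_def abs_mult
      by (intro mult_mono point_near) auto
    then have "\<bar>t\<bar> < dist_int (2 * real r ^ i * X j \<omega>)" using False by (simp add: base_def)
    then have "\<lfloor>2 * real r ^ i * X j \<omega> + t\<rfloor> = \<lfloor>2 * real r ^ i * X j \<omega>\<rfloor>" by (rule floor_eq_of_dist_int)
    moreover have "2 * real r ^ i * X j \<omega> + t = 2 * real r ^ i * point j \<omega>" by (simp add: t_def algebra_simps)
    ultimately have "cell i (point j \<omega>) = cell i (X j \<omega>)" by (simp add: cell_def)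
    then show ?thesis by (simp add: sgn_digit_def)
  qed
  then have "\<bar>\<Sum>i<len j. \<alpha> i * sgn_digit i (point j \<omega>) - \<alpha> i * sgn_digit i (X j \<omega>)\<bar> \<le> kink_sum \<alpha> (len j) (X j \<omega>)"
    unfolding kink_sum_def by (intro order_trans[OF sum_abs] sum_mono)
  then show ?thesis by (simp add: digit_sum_def sum_subtractf)
qed

end

context radix
begin

lemma kink_sum_measurable[measurable]: "kink_sum \<alpha> m \<in> borel_measurable borel"
proof -
  have [measurable]: "{u. dist_int u \<le> s} \<in> sets borel" for s unfolding dist_int_def round_def by measurable
  show ?thesis unfolding kink_sum_def by measurable
qed

lemma kink_sum_nonneg: "0 \<le> kink_sum \<alpha> m x" unfolding kink_sum_def by (intro sum_nonneg) auto

lemma kink_indicator_integrable: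
  "integrable unif (\<lambda>x. indicator {u. dist_int u \<le> s} (2 * real r ^ i * x) :: real)"
proof -
  have [measurable]: "{u. dist_int u \<le> s} \<in> sets borel" for s unfolding dist_int_def round_def by measurable
  show ?thesis by (rule unif.integrable_const_bound[of _ 1]) auto
qed

text \<open>The i-th kink event has probability at most 4 r^(i-m), and these powers sum to at most
  1. The bound is independent of m.\<close>

lemma kink_sum_integral:
  assumes b: "\<And>i. i < m \<Longrightarrow> \<bar>\<alpha> i\<bar> \<le> b" "0 \<le> b"
  shows "integrable unif (kink_sum \<alpha> m)" "(LINT x|unif. kink_sum \<alpha> m x) \<le> 8 * b"
proof -
  show i: "integrable unif (kink_sum \<alpha> m)"
    unfolding kink_sum_def by (intro Bochner_Integration.integrable_sum integrable_mult_right kink_indicator_integrable)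
  have "(LINT x|unif. kink_sum \<alpha> m x) = (\<Sum>i<m. 2 * \<bar>\<alpha> i\<bar> * (LINT x|unif. indicator {u. dist_int u \<le> 2 * (real r ^ i / real r ^ m)} (2 * real r ^ i * x)))"
    unfolding kink_sum_def
    by (simp only: Bochner_Integration.integral_sum integrable_mult_right kink_indicator_integrable integral_mult_right_zero)
  also have "\<dots> \<le> (\<Sum>i<m. 2 * b * (2 * (2 * (real r ^ i / real r ^ m))))"
    using b by (intro sum_mono mult_mono near_integer_prob) auto
  also have "\<dots> = 8 * b * (\<Sum>i<m. real r ^ i / real r ^ m)" by (simp add: sum_distrib_left mult_ac)
  also have "\<dots> \<le> 8 * b * 1"
  proof (intro mult_left_mono)
    have "(\<Sum>i<m. real r ^ i) \<le> real r ^ m"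
    proof (induction m)
      case (Suc m)
      have "2 * real r ^ m \<le> real r * real r ^ m" using r_ge_2 by (intro mult_right_mono) auto
      then show ?case using Suc unfolding sum.lessThan_Suc power_Suc by linarith
    qed simp
    then show "(\<Sum>i<m. real r ^ i / real r ^ m) \<le> 1" by (simp add: sum_divide_distrib[symmetric])
  qed (use b in auto)
  finally show "(LINT x|unif. kink_sum \<alpha> m x) \<le> 8 * b" by simp
qed

end

section \<open>Blocks of indices\<close>

locale takagi_coefficients = radix r for r :: nat +
  fixes a :: "nat \<Rightarrow> real" and \<delta> :: real
  assumes \<delta>_pos: "0 < \<delta>" and \<delta>_le_1: "\<delta> \<le> 1"
    and A_top: "filterlim (sum_sq a) at_top sequentially"
    and a_bigo: "(\<lambda>n. (a n)\<^sup>2) \<in> O[sequentially](\<lambda>n. sum_sq a n powr (1 - \<delta>))"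
begin

definition \<alpha> :: "nat \<Rightarrow> real" where "\<alpha> i = a (Suc i)"

abbreviation A :: "nat \<Rightarrow> real" where "A \<equiv> sum_sq a"

definition V :: "nat \<Rightarrow> real" where "V n = digit_var \<alpha> n"

lemma A_eq: "A n = (\<Sum>i<n. (\<alpha> i)\<^sup>2)"
  unfolding sum_sq_def \<alpha>_def
  by (rule sum.reindex_bij_witness[where i="\<lambda>i. Suc i" and j="\<lambda>k. k - 1"]) auto

lemma A_Suc: "A (Suc n) = A n + (\<alpha> n)\<^sup>2" by (simp add: A_eq)

lemma A_nonneg: "0 \<le> A n" unfolding A_eq by (intro sum_nonneg) auto

lemma A_mono: "m \<le> n \<Longrightarrow> A m \<le> A n" unfolding A_eq by (intro sum_mono2) auto

lemma A_le_V: "A n \<le> 4 * V n" unfolding A_eq V_def by (rule digit_var_ge)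

lemma V_nonneg: "0 \<le> V n" using A_le_V[of n] A_nonneg[of n] by simp

lemma eventually_A_ge: "eventually (\<lambda>n. c \<le> A n) sequentially"
  using A_top by (simp add: filterlim_at_top)

text \<open>Monotonicity of A makes the asymptotic bound uniform over all indices before n; the
  finitely many early coefficients are absorbed into C.\<close>

lemma coefficient_bound: "\<exists>C\<ge>1. eventually (\<lambda>n. 1 \<le> A n \<and> (\<forall>i<n. (\<alpha> i)\<^sup>2 \<le> C * A n powr (1 - \<delta>))) sequentially"
proof -
  obtain c where c: "c > 0" "eventually (\<lambda>n. norm ((a n)\<^sup>2) \<le> c * norm (A n powr (1 - \<delta>))) sequentially"
    using a_bigo by (rule landau_o.bigE)
  obtain N where N: "\<And>n. N \<le> n \<Longrightarrow> norm ((a n)\<^sup>2) \<le> c * norm (A n powr (1 - \<delta>)) \<and> 1 \<le> A n"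
    using eventually_conj[OF c(2) eventually_A_ge[of 1]] unfolding eventually_sequentially by blast
  define C where "C = max 1 (max c (A N))"
  have "1 \<le> A n \<and> (\<forall>i<n. (\<alpha> i)\<^sup>2 \<le> C * A n powr (1 - \<delta>))" if n: "N \<le> n" for n
  proof (intro conjI allI impI)
    show A1: "1 \<le> A n" using N n by blast
    have p1: "1 \<le> A n powr (1 - \<delta>)" using A1 \<delta>_le_1 by (intro ge_one_powr_ge_zero) auto
    fix i assume i: "i < n"
    show "(\<alpha> i)\<^sup>2 \<le> C * A n powr (1 - \<delta>)"
    proof (cases "N \<le> Suc i")
      case True
      have "(\<alpha> i)\<^sup>2 \<le> c * A (Suc i) powr (1 - \<delta>)" using N[OF True] by (simp add: \<alpha>_def)
      also have "\<dots> \<le> C * A n powr (1 - \<delta>)"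
        using c(1) i A_nonneg \<delta>_le_1 by (intro mult_mono powr_mono2 A_mono) (auto simp: C_def)
      finally show ?thesis .
    next
      case False
      have "(\<alpha> i)\<^sup>2 \<le> A (Suc i)" using A_nonneg[of i] by (simp add: A_Suc)
      also have "\<dots> \<le> A N" using False by (intro A_mono) auto
      also have "\<dots> \<le> C * 1" by (simp add: C_def)
      also have "\<dots> \<le> C * A n powr (1 - \<delta>)" using p1 by (intro mult_left_mono) (auto simp: C_def)
      finally show ?thesis .
    qed
  qed
  then show ?thesis by (intro exI[of _ C] conjI) (auto simp: C_def eventually_sequentially)
qed

lemma A_doubling: "eventually (\<lambda>n. A (Suc n) \<le> 2 * A n) sequentially"
proof -
  obtain C where C: "C \<ge> 1" "eventually (\<lambda>n. 1 \<le> A n \<and> (\<forall>i<n. (\<alpha> i)\<^sup>2 \<le> C * A n powr (1 - \<delta>))) sequentially"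
    using coefficient_bound by blast
  have 1: "eventually (\<lambda>n. 1 \<le> A (Suc n) \<and> (\<forall>i<Suc n. (\<alpha> i)\<^sup>2 \<le> C * A (Suc n) powr (1 - \<delta>))) sequentially"
    using C(2) by (subst eventually_sequentially_Suc)
  \<comment> \<open>From this threshold on \<open>A powr \<delta>\<close> exceeds 2 C, so a single
    term is at most half of the sum that includes it.\<close>
  have 2: "eventually (\<lambda>n. (2 * C) powr (1 / \<delta>) \<le> A (Suc n)) sequentially"
    using eventually_A_ge by (subst eventually_sequentially_Suc)
  show ?thesis using 1 2
  proof eventually_elim
    case (elim n)
    define B where "B = A (Suc n)"
    have B: "B \<ge> 1" using elim by (simp add: B_def)
    have "2 * C = ((2 * C) powr (1 / \<delta>)) powr \<delta>" using C \<delta>_pos by (simp add: powr_powr)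
    also have "\<dots> \<le> B powr \<delta>" using elim \<delta>_pos unfolding B_def by (intro powr_mono2) auto
    finally have "2 * C * B powr (1 - \<delta>) \<le> B powr \<delta> * B powr (1 - \<delta>)" by (intro mult_right_mono) auto
    also have "\<dots> = B" using B by (simp flip: powr_add)
    finally have "2 * (\<alpha> n)\<^sup>2 \<le> B" using elim by (auto simp: B_def)
    then show ?case using A_Suc[of n] by (simp add: B_def)
  qed
qed

text \<open>By \<open>A_doubling\<close> the bound on |\<alpha>| grows by a factor of at most
  2^((1-\<delta>)/2) <= 3/2 per step, while the denominator grows by r >= 2. The tail is dominated
  by a geometric series of ratio 3/4.\<close>

lemma tail_bound:
  "summable (\<lambda>i. \<bar>\<alpha> i\<bar> / real r ^ i) \<and>
   (\<exists>C>0. eventually (\<lambda>m. (\<Sum>i. \<bar>\<alpha> (i + m)\<bar> / real r ^ (i + m)) \<le> C * A m powr ((1 - \<delta>) / 2) / real r ^ m) sequentially)"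
proof -
  obtain C where C: "C \<ge> 1" "eventually (\<lambda>n. 1 \<le> A n \<and> (\<forall>i<n. (\<alpha> i)\<^sup>2 \<le> C * A n powr (1 - \<delta>))) sequentially"
    using coefficient_bound by blast
  obtain N where N: "\<And>n. N \<le> n \<Longrightarrow> 1 \<le> A n \<and> (\<forall>i<n. (\<alpha> i)\<^sup>2 \<le> C * A n powr (1 - \<delta>)) \<and> A (Suc n) \<le> 2 * A n"
    using eventually_conj[OF C(2) A_doubling] unfolding eventually_sequentially by blast
  define s where "s = (1 - \<delta>) / 2"
  have s: "0 \<le> s" "s \<le> 1/2" using \<delta>_pos \<delta>_le_1 by (auto simp: s_def)
  have dbl: "A (m + i) \<le> 2 ^ i * A m" if m: "N \<le> m" for m i
  proof (induction i)
    case (Suc i)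
    have "A (m + Suc i) \<le> 2 * A (m + i)" using N[of "m + i"] m by simp
    then show ?case using Suc by simp
  qed simp
  have two: "(2::real) powr s \<le> 3/2"
  proof -
    have "(2::real) powr s \<le> 2 powr (1/2)" using s by (intro powr_mono) auto
    also have "\<dots> = sqrt 2" by (simp add: powr_half_sqrt)
    also have "\<dots> \<le> 3/2" by (rule real_le_lsqrt) (auto simp: power2_eq_square)
    finally show ?thesis .
  qed
  have trm: "\<bar>\<alpha> (i + m)\<bar> / real r ^ (i + m) \<le> (sqrt C * A m powr s / real r ^ m * (3/2)) * (3/4) ^ i" if m: "N \<le> m" for m i
  proof -
    have Am: "1 \<le> A m" using N m by blast
    have "(\<alpha> (i + m))\<^sup>2 \<le> C * A (m + Suc i) powr (1 - \<delta>)" using N[of "m + Suc i"] m by (auto simp: add.commute)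
    also have "\<dots> \<le> C * (2 ^ Suc i * A m) powr (1 - \<delta>)"
      using C(1) dbl[OF m, of "Suc i"] A_nonneg \<delta>_le_1 by (intro mult_left_mono powr_mono2) auto
    finally have "\<bar>\<alpha> (i + m)\<bar> \<le> sqrt (C * (2 ^ Suc i * A m) powr (1 - \<delta>))" by (rule real_le_rsqrt[of "\<bar>\<alpha> (i + m)\<bar>", simplified])
    also have "\<dots> = sqrt C * (2 ^ Suc i * A m) powr s"
      using Am by (simp add: real_sqrt_mult powr_half_sqrt[symmetric] powr_powr s_def)
    also have "(2 ^ Suc i * A m) powr s = (2 powr s) ^ Suc i * A m powr s"
      using Am by (simp add: powr_mult powr_power mult.commute powr_realpow[symmetric] powr_powr del: power_Suc)
    also have "sqrt C * ((2 powr s) ^ Suc i * A m powr s) \<le> sqrt C * ((3/2) ^ Suc i * A m powr s)"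
      using C(1) two by (intro mult_left_mono mult_right_mono power_mono) auto
    finally have 1: "\<bar>\<alpha> (i + m)\<bar> \<le> sqrt C * ((3/2) ^ Suc i * A m powr s)" .
    have "\<bar>\<alpha> (i + m)\<bar> / real r ^ (i + m) \<le> sqrt C * ((3/2) ^ Suc i * A m powr s) / real r ^ (i + m)"
      using 1 by (intro divide_right_mono) auto
    also have "\<dots> = (sqrt C * A m powr s / real r ^ m * (3/2)) * ((3/2) ^ i / real r ^ i)" by (simp add: power_add mult_ac)
    also have "\<dots> \<le> (sqrt C * A m powr s / real r ^ m * (3/2)) * (3/4) ^ i"
    proof (intro mult_left_mono)
      have "(3/2 :: real) / real r \<le> 3/4" using r_ge_2 by (simp add: divide_simps)
      then have "((3/2 :: real) / real r) ^ i \<le> (3/4) ^ i" by (intro power_mono) auto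
      then show "(3/2 :: real) ^ i / real r ^ i \<le> (3/4) ^ i" by (simp add: power_divide)
    qed (use C in auto)
    finally show ?thesis .
  qed
  have sg: "summable (\<lambda>i. c * (3/4 :: real) ^ i)" for c by (intro summable_mult summable_geometric) auto
  have sm: "summable (\<lambda>i. \<bar>\<alpha> (i + m)\<bar> / real r ^ (i + m))" if "N \<le> m" for m
  proof (rule summable_comparison_test'[OF sg[of "sqrt C * A m powr s / real r ^ m * (3/2)"], of 0])
    fix i
    have "norm (\<bar>\<alpha> (i + m)\<bar> / real r ^ (i + m)) = \<bar>\<alpha> (i + m)\<bar> / real r ^ (i + m)" by simp
    then show "norm (\<bar>\<alpha> (i + m)\<bar> / real r ^ (i + m)) \<le> (sqrt C * A m powr s / real r ^ m * (3/2)) * (3/4) ^ i"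
      using trm[OF that, of i] by (simp only:)
  qed
  have "summable (\<lambda>i. \<bar>\<alpha> i\<bar> / real r ^ i)" using sm[of N] summable_iff_shift[of "\<lambda>i. \<bar>\<alpha> i\<bar> / real r ^ i" N] by simp
  moreover have "(\<Sum>i. \<bar>\<alpha> (i + m)\<bar> / real r ^ (i + m)) \<le> (6 * sqrt C) * A m powr s / real r ^ m" if m: "N \<le> m" for m
  proof -
    have "(\<Sum>i. \<bar>\<alpha> (i + m)\<bar> / real r ^ (i + m)) \<le> (\<Sum>i. (sqrt C * A m powr s / real r ^ m * (3/2)) * (3/4) ^ i)"
      by (rule suminf_le[OF trm[OF m] sm[OF m] sg])
    also have "\<dots> = (sqrt C * A m powr s / real r ^ m * (3/2)) * 4"
      by (subst suminf_mult) (auto simp: suminf_geometric)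
    finally show ?thesis by (simp add: mult_ac)
  qed
  then have "\<exists>C>0. eventually (\<lambda>m. (\<Sum>i. \<bar>\<alpha> (i + m)\<bar> / real r ^ (i + m)) \<le> C * A m powr s / real r ^ m) sequentially"
    using C(1) by (intro exI[of _ "6 * sqrt C"] conjI) (auto simp: eventually_sequentially)
  ultimately show ?thesis unfolding s_def by blast
qed

text \<open>The terms are increments of A times a decreasing function of A, a discrete version of
  the convergent integral of x^(-1-\<eta>). The mean value theorem compares them with a telescoping
  series.\<close>

lemma summable_sq_over_A:
  assumes "0 < \<eta>"
  shows "summable (\<lambda>i. (\<alpha> i)\<^sup>2 * A (Suc i) powr (- 1 - \<eta>))"
proof -
  obtain N where N: "\<And>n. N \<le> n \<Longrightarrow> 1 \<le> A n" using eventually_A_ge[of 1] unfolding eventually_sequentially by blast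
  define f where "f n = A (n + N) powr (- \<eta>)" for n
  have step: "(\<alpha> (i + N))\<^sup>2 * A (Suc (i + N)) powr (- 1 - \<eta>) \<le> (f i - f (Suc i)) / \<eta>" for i
  proof -
    define x y where "x = A (i + N)" and "y = A (Suc (i + N))"
    have x: "1 \<le> x" using N by (simp add: x_def)
    have xy: "y = x + (\<alpha> (i + N))\<^sup>2" by (simp add: x_def y_def A_Suc)
    have fi: "f i = x powr (- \<eta>)" "f (Suc i) = y powr (- \<eta>)" by (simp_all add: f_def x_def y_def)
    show ?thesis
    proof (cases "x = y")
      case True
      then show ?thesis using xy by (simp add: fi)
    next
      case False
      then have lt: "x < y" using xy by (simp add: less_le)
      have "\<exists>z. x < z \<and> z < y \<and> y powr (- \<eta>) - x powr (- \<eta>) = (y - x) * (- \<eta> * z powr (- \<eta> - 1))"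
        by (rule MVT2[OF lt]) (use x in \<open>auto intro!: derivative_eq_intros\<close>)
      then obtain z where z: "x < z" "z < y" "y powr (- \<eta>) - x powr (- \<eta>) = (y - x) * (- \<eta> * z powr (- \<eta> - 1))" by blast
      have "y powr (- 1 - \<eta>) \<le> z powr (- 1 - \<eta>)" using z x assms by (intro powr_mono2') auto
      then have "(y - x) * y powr (- 1 - \<eta>) \<le> (y - x) * z powr (- 1 - \<eta>)" using lt by (intro mult_left_mono) auto
      also have "\<dots> = (f i - f (Suc i)) / \<eta>" 
      proof -
        have "- \<eta> - 1 = - 1 - \<eta>" by simp
        then show ?thesis using z(3)[unfolded \<open>- \<eta> - 1 = - 1 - \<eta>\<close>] assms by (simp add: fi field_simps)
      qed
      finally show ?thesis using xy by (simp add: y_def[symmetric])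
    qed
  qed
  have sf: "summable (\<lambda>i. (f i - f (Suc i)) / \<eta>)"
  proof (intro summable_divide)
    have "f \<longlonglongrightarrow> 0"
    proof -
      have "filterlim (\<lambda>n. A (n + N)) at_top sequentially" using A_top by (rule filterlim_compose) (rule filterlim_add_const_nat_at_top)
      then show ?thesis unfolding f_def using assms by (intro tendsto_neg_powr) auto
    qed
    then show "summable (\<lambda>i. f i - f (Suc i))" by (rule telescope_summable')
  qed
  have "summable (\<lambda>i. (\<alpha> (i + N))\<^sup>2 * A (Suc (i + N)) powr (- 1 - \<eta>))"
    by (rule summable_comparison_test'[OF sf, of 0]) (use step in auto)
  then show ?thesis using summable_iff_shift[of "\<lambda>i. (\<alpha> i)\<^sup>2 * A (Suc i) powr (- 1 - \<eta>)" N] by simp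
qed

text \<open>This is needed along every index m, not merely at block ends. Fourth powers make it
  work: the coefficients \<open>\<alpha> i ^ 4 / A powr (2 - 4 * l)\<close> are summable by
  \<open>summable_sq_over_A\<close> with \<eta> = \<delta> - 4 l, whereas squares would require l <
  0. The expectation at m is a convolution of these coefficients with a geometric sequence, hence
  summable in m.\<close>

lemma kink_sum_vanishes:
  assumes l: "l < \<delta> / 32"
  shows "AE x in unif. (\<lambda>m. kink_sum \<alpha> m x / A m powr (1/2 - l)) \<longlonglongrightarrow> 0"
proof -
  obtain C where C: "C \<ge> 1" "eventually (\<lambda>n. 1 \<le> A n \<and> (\<forall>i<n. (\<alpha> i)\<^sup>2 \<le> C * A n powr (1 - \<delta>))) sequentially"
    using coefficient_bound by blast
  obtain N where N: "\<And>n. N \<le> n \<Longrightarrow> 1 \<le> A n \<and> (\<forall>i<n. (\<alpha> i)\<^sup>2 \<le> C * A n powr (1 - \<delta>))"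
    using C(2) unfolding eventually_sequentially by blast
  define s where "s = 2 - 4 * l"
  have s: "s > 0" using l \<delta>_le_1 by (simp add: s_def)
  define \<eta> where "\<eta> = \<delta> - 4 * l"
  have \<eta>: "\<eta> > 0" using l \<delta>_pos by (simp add: \<eta>_def)
  define c where "c i = \<alpha> i ^ 4 / A (Suc i) powr s" for i
  have c0: "0 \<le> c i" for i by (simp add: c_def)
  have sc: "summable c"
  proof -
    have "c i \<le> C * ((\<alpha> i)\<^sup>2 * A (Suc i) powr (- 1 - \<eta>))" if i: "N \<le> i" for i
    proof -
      have A1: "1 \<le> A (Suc i)" "(\<alpha> i)\<^sup>2 \<le> C * A (Suc i) powr (1 - \<delta>)" using N[of "Suc i"] i by auto
      have "c i = (\<alpha> i)\<^sup>2 * ((\<alpha> i)\<^sup>2 / A (Suc i) powr s)" by (simp add: c_def power2_eq_square power4_eq_xxxx)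
      also have "\<dots> \<le> (\<alpha> i)\<^sup>2 * (C * A (Suc i) powr (1 - \<delta>) / A (Suc i) powr s)"
        by (intro mult_left_mono divide_right_mono A1) auto
      also have "C * A (Suc i) powr (1 - \<delta>) / A (Suc i) powr s = C * A (Suc i) powr (- 1 - \<eta>)"
        using A1 by (simp add: powr_diff[symmetric] s_def \<eta>_def algebra_simps flip: times_divide_eq_right)
      finally show ?thesis by (simp add: mult_ac)
    qed
    then show ?thesis
      by (intro summable_comparison_test'[OF summable_mult[OF summable_sq_over_A[OF \<eta>], of C], of N]) (auto simp: c0)
  qed
  \<comment> \<open>Half of (10/9)^3: a kink event has probability of order r^(i-m) <= 2^(i-m), and
    the weight \<open>(9/10) ^ (m - i)\<close> enters with its inverse cube.\<close>
  define q :: real where "q = 500/729"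
  have q: "0 < q" "q < 1" by (auto simp: q_def)
  define Y where "Y m x = (\<Sum>i<m. (2 * \<bar>\<alpha> i\<bar>) ^ 4 * indicator {u. dist_int u \<le> 2 * (real r ^ i / real r ^ m)} (2 * real r ^ i * x) / ((9/10) ^ (m - i)) ^ 3) / A m powr s" for m x
  have Ynn: "0 \<le> Y m x" for m x unfolding Y_def by (intro divide_nonneg_nonneg sum_nonneg mult_nonneg_nonneg) auto
  have Yi: "integrable unif (Y m)" for m
    unfolding Y_def by (intro integrable_divide Bochner_Integration.integrable_sum integrable_mult_right kink_indicator_integrable)
  have kY: "(kink_sum \<alpha> m x / A m powr (1/2 - l)) ^ 4 \<le> 1000 * Y m x" for m x
  proof -
    let ?I = "\<lambda>i. indicator {u. dist_int u \<le> 2 * (real r ^ i / real r ^ m)} (2 * real r ^ i * x) :: real"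
    have I4: "?I i ^ 4 = ?I i" for i by (simp add: indicator_def)
    have "kink_sum \<alpha> m x ^ 4 \<le> (\<Sum>i<m. (9/10) ^ (m - i)) ^ 3 * (\<Sum>i<m. (2 * \<bar>\<alpha> i\<bar> * ?I i) ^ 4 / ((9/10) ^ (m - i)) ^ 3)"
      unfolding kink_sum_def by (rule weighted_power_mean_4) auto
    also have "(\<Sum>i<m. (2 * \<bar>\<alpha> i\<bar> * ?I i) ^ 4 / ((9/10) ^ (m - i)) ^ 3) = (\<Sum>i<m. (2 * \<bar>\<alpha> i\<bar>) ^ 4 * ?I i / ((9/10) ^ (m - i)) ^ 3)"
      unfolding power_mult_distrib[of _ "?I _"] I4 ..
    also have "(\<Sum>i<m. (9/10 :: real) ^ (m - i)) ^ 3 * (\<Sum>i<m. (2 * \<bar>\<alpha> i\<bar>) ^ 4 * ?I i / ((9/10) ^ (m - i)) ^ 3)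
       \<le> 10 ^ 3 * (\<Sum>i<m. (2 * \<bar>\<alpha> i\<bar>) ^ 4 * ?I i / ((9/10) ^ (m - i)) ^ 3)"
    proof (intro mult_right_mono power_mono)
      have "(\<Sum>i<m. (9/10 :: real) ^ (m - i)) = (\<Sum>i<m. (9/10) ^ Suc i)"
        by (rule sum.reindex_bij_witness[where i="\<lambda>i. m - Suc i" and j="\<lambda>i. m - Suc i"]) (auto simp: Suc_diff_Suc simp del: power_Suc)
      also have "\<dots> = (9/10) * (\<Sum>i<m. (9/10) ^ i)" by (simp add: sum_distrib_left)
      also have "\<dots> = 9 * (1 - (9/10) ^ m)" by (simp add: sum_gp_strict)
      also have "\<dots> \<le> 10"
      proof -
        have z: "\<And>z :: real. 0 \<le> z \<Longrightarrow> 9 * (1 - z) \<le> 10" by simp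
        show ?thesis by (rule z) simp
      qed
      finally show "(\<Sum>i<m. (9/10 :: real) ^ (m - i)) \<le> 10" .
    qed (auto intro!: sum_nonneg)
    finally have "kink_sum \<alpha> m x ^ 4 / A m powr s \<le> 1000 * Y m x" unfolding Y_def by (simp add: divide_right_mono)
    moreover have "(A m powr (1/2 - l)) ^ 4 = A m powr s"
      by (simp add: s_def power4_eq_xxxx powr_add[symmetric])
    ultimately show ?thesis by (simp add: power_divide)
  qed
  have EY: "(LINT x|unif. Y m x) \<le> 64 * (\<Sum>i<m. c i * q ^ (m - i))" for m
  proof -
    have "(LINT x|unif. Y m x) = (\<Sum>i<m. (2 * \<bar>\<alpha> i\<bar>) ^ 4 * (LINT x|unif. indicator {u. dist_int u \<le> 2 * (real r ^ i / real r ^ m)} (2 * real r ^ i * x)) / ((9/10) ^ (m - i)) ^ 3) / A m powr s"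
      unfolding Y_def by (simp only: integral_divide_zero Bochner_Integration.integral_sum integrable_mult_right integrable_divide kink_indicator_integrable integral_mult_right_zero)
    also have "\<dots> \<le> (\<Sum>i<m. (2 * \<bar>\<alpha> i\<bar>) ^ 4 * (2 * (2 * (real r ^ i / real r ^ m))) / ((9/10) ^ (m - i)) ^ 3) / A m powr s"
      by (intro divide_right_mono sum_mono mult_left_mono near_integer_prob) auto
    also have "\<dots> \<le> (\<Sum>i<m. 64 * (c i * q ^ (m - i)))"
      unfolding sum_divide_distrib
    proof (intro sum_mono)
      fix i assume "i \<in> {..<m}"
      then have i: "i < m" by simp
      have e: "(2 * \<bar>\<alpha> i\<bar>) ^ 4 * (2 * (2 * (real r ^ i / real r ^ m))) / ((9/10) ^ (m - i)) ^ 3 / A m powr s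
         = 64 * ((\<alpha> i ^ 4 / A m powr s) * ((real r ^ i / real r ^ m) / ((9/10) ^ (m - i)) ^ 3))"
        by (simp add: power_mult_distrib)
      have "(real r ^ i / real r ^ m) / ((9/10) ^ (m - i)) ^ 3 \<le> q ^ (m - i)"
      proof -
        have "real r ^ m = real r ^ i * real r ^ (m - i)" using i by (simp flip: power_add)
        moreover have "((9/10 :: real) ^ (m - i)) ^ 3 = ((9/10) ^ 3) ^ (m - i)"
          by (simp only: power_mult[symmetric] mult.commute)
        ultimately have "(real r ^ i / real r ^ m) / ((9/10) ^ (m - i)) ^ 3 = (1 / (real r * (9/10) ^ 3)) ^ (m - i)"
          using r_ge_2 by (simp only: power_mult_distrib power_divide power_one) simp
        also have "\<dots> \<le> q ^ (m - i)"
        proof (rule power_mono)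
          have "1 / (real r * (9/10) ^ 3) \<le> 1 / (2 * (9/10) ^ 3)" using r_ge_2 by (intro divide_left_mono mult_right_mono) auto
          also have "\<dots> = q" by (simp add: q_def power3_eq_cube)
          finally show "1 / (real r * (9/10) ^ 3) \<le> q" .
        qed auto
        finally show ?thesis .
      qed
      moreover have "\<alpha> i ^ 4 / A m powr s \<le> c i"
      proof (cases "\<alpha> i = 0")
        case False
        then have "0 < A (Suc i)" using A_nonneg[of i] by (simp add: A_Suc add_nonneg_pos)
        moreover have "A (Suc i) \<le> A m" using i by (intro A_mono) auto
        ultimately show ?thesis unfolding c_def using s by (intro divide_left_mono powr_mono2 mult_pos_pos) auto
      qed (simp add: c_def)
      ultimately show "(2 * \<bar>\<alpha> i\<bar>) ^ 4 * (2 * (2 * (real r ^ i / real r ^ m))) / ((9/10) ^ (m - i)) ^ 3 / A m powr s \<le> 64 * (c i * q ^ (m - i))"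
        unfolding e using c0 by (intro mult_left_mono mult_mono) auto
    qed
    finally show ?thesis by (simp add: sum_distrib_left)
  qed
  have "summable (\<lambda>m. \<Sum>i\<le>m. c i * q ^ (m - i))"
    using q c0 sc by (intro summable_Cauchy_product) (auto simp: summable_geometric abs_of_nonneg)
  then have sq: "summable (\<lambda>m. 64 * (\<Sum>i\<le>m. c i * q ^ (m - i)))" by (rule summable_mult)
  have "summable (\<lambda>m. LINT x|unif. Y m x)"
  proof (rule summable_comparison_test'[OF sq, of 0])
    fix m
    have "(\<Sum>i<m. c i * q ^ (m - i)) \<le> (\<Sum>i\<le>m. c i * q ^ (m - i))" using c0 q by (intro sum_mono2) auto
    then have "(LINT x|unif. Y m x) \<le> 64 * (\<Sum>i\<le>m. c i * q ^ (m - i))" using EY[of m] by linarith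
    moreover have "0 \<le> (LINT x|unif. Y m x)" by (intro Bochner_Integration.integral_nonneg Ynn)
    ultimately show "norm (LINT x|unif. Y m x) \<le> 64 * (\<Sum>i\<le>m. c i * q ^ (m - i))" by simp
  qed
  from AE_tendsto_0_of_summable_integral[OF Yi Ynn this] show ?thesis
  proof eventually_elim
    case (elim x)
    have "(\<lambda>m. 1000 * Y m x) \<longlonglongrightarrow> 0" using tendsto_mult_left[OF elim, of 1000] by simp
    then have "(\<lambda>m. (kink_sum \<alpha> m x / A m powr (1/2 - l)) ^ 4) \<longlonglongrightarrow> 0"
      by (rule Lim_null_comparison[rotated]) (use kY in auto)
    then show ?case by (simp only: power_tendsto_0_iff zero_less_numeral)
  qed
qed

end

lemma eventually_bound_imp_all:
  fixes f g :: "nat \<Rightarrow> real"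
  assumes ev: "eventually (\<lambda>j. f j \<le> C * g j) sequentially" and g: "\<And>j. 0 < g j"
  shows "\<exists>C'\<ge>0. \<forall>j. f j \<le> C' * g j"
proof -
  obtain N where N: "\<And>j. N \<le> j \<Longrightarrow> f j \<le> C * g j" using ev unfolding eventually_sequentially by blast
  define C' where "C' = max 0 (max C (Max ((\<lambda>j. f j / g j) ` {..N})))"
  have "f j \<le> C' * g j" for j
  proof (cases "N \<le> j")
    case True
    then have "f j \<le> C * g j" by (rule N)
    also have "\<dots> \<le> C' * g j" using g[of j] by (intro mult_right_mono) (auto simp: C'_def)
    finally show ?thesis .
  next
    case False
    then have "f j / g j \<le> Max ((\<lambda>j. f j / g j) ` {..N})" by (intro Max_ge) auto
    also have "\<dots> \<le> C'" unfolding C'_def by (intro max.coboundedI2) (rule order_refl)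
    finally show ?thesis using g[of j] by (simp add: pos_divide_le_eq)
  qed
  then show ?thesis by (intro exI[of _ C']) (auto simp: C'_def)
qed

section \<open>Block ends, block coefficients and block variances\<close>

context takagi_coefficients
begin

text \<open>With block ends at times \<open>T j\<close>, the hypothesis on \<open>a\<close> makes the coefficients of block \<open>j\<close> of order
  \<open>j powr (p/2 - 4)\<close>; the error to beat is \<open>j powr (p/2 - p * l)\<close>, and \<open>l < \<delta> / 32\<close> says \<open>p * l < 1/4\<close>.\<close>

definition p :: real where "p = 8 / \<delta>"

definition T :: "nat \<Rightarrow> real" where "T j = real j powr p"

text \<open>A first passage index. V need not be monotone, so T j is a lower bound for V at n j but
  not necessarily after it.\<close>

definition n :: "nat \<Rightarrow> nat" where "n j = (LEAST m. T j \<le> V m)"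

definition block_coeff :: "nat \<Rightarrow> nat \<Rightarrow> real" where "block_coeff j i = \<alpha> (n j + i)"

definition block_len :: "nat \<Rightarrow> nat" where "block_len j = n (Suc j) - n j"

definition block_var :: "nat \<Rightarrow> real" where "block_var j = digit_var (block_coeff j) (block_len j)"

lemma p_ge: "8 \<le> p" "p * \<delta> = 8" using \<delta>_pos \<delta>_le_1 by (auto simp: p_def field_simps)

lemma T_0: "T 0 = 0" by (simp add: T_def)

lemma T_mono: "strict_mono T"
  unfolding T_def using p_ge by (intro strict_monoI powr_less_mono2) auto

lemma T_top: "filterlim T at_top sequentially"
proof (rule filterlim_at_top_mono[OF filterlim_real_sequentially])
  show "\<forall>\<^sub>F j in sequentially. real j \<le> T j"
    using eventually_ge_at_top[of 1]
  proof eventually_elim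
    case (elim j)
    have "real j powr 1 \<le> real j powr p" using elim p_ge by (intro powr_mono) auto
    then show ?case using elim by (simp add: T_def)
  qed
qed

lemma V_top: "filterlim V at_top sequentially"
proof (rule filterlim_at_top_mono[of "\<lambda>n. (1/4) * A n"])
  show "filterlim (\<lambda>n. (1/4) * A n) at_top sequentially" using A_top by (intro filterlim_tendsto_pos_mult_at_top[of _ "1/4"]) auto
  show "\<forall>\<^sub>F n in sequentially. 1 / 4 * A n \<le> V n" using A_le_V by (intro always_eventually allI) (simp add: mult.commute)
qed

lemma T_le_V_n: "T j \<le> V (n j)"
proof -
  have "eventually (\<lambda>m. T j \<le> V m) sequentially" using V_top by (simp add: filterlim_at_top)
  then obtain m where "T j \<le> V m" by (auto simp: eventually_sequentially)
  then show ?thesis unfolding n_def by (rule LeastI)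
qed

lemma V_less_T: "m < n j \<Longrightarrow> V m < T j"
  unfolding n_def using not_less_Least by fastforce

lemma n_0: "n 0 = 0"
  unfolding n_def T_0 using V_nonneg by (intro Least_equality) auto

lemma mono_n: "mono n"
proof (rule monoI)
  fix i j :: nat assume "i \<le> j"
  then have "T i \<le> T j" using T_mono by (simp add: strict_mono_less_eq)
  then have "T i \<le> V (n j)" using T_le_V_n[of j] by simp
  then show "n i \<le> n j" unfolding n_def[of i] by (rule Least_le)
qed

lemma n_top: "filterlim n at_top sequentially"
  unfolding filterlim_at_top eventually_sequentially
proof
  fix N
  define K where "K = Max (V ` {..N}) + 1"
  obtain J where J: "\<And>j. J \<le> j \<Longrightarrow> K \<le> T j"
    using T_top unfolding filterlim_at_top eventually_sequentially by blast
  have "N \<le> n j" if "J \<le> j" for j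
  proof (rule ccontr)
    assume "\<not> N \<le> n j"
    then have "V (n j) \<le> Max (V ` {..N})" by (intro Max_ge) auto
    then show False using T_le_V_n[of j] J[OF that] by (simp add: K_def)
  qed
  then show "\<exists>J. \<forall>j\<ge>J. N \<le> n j" by blast
qed

lemma V_block:
  assumes "\<And>i. i < n j + m \<Longrightarrow> \<bar>\<alpha> i\<bar> \<le> b"
  shows "\<bar>V (n j + m) - V (n j) - digit_var (block_coeff j) m\<bar> \<le> 2 * b\<^sup>2"
  unfolding V_def block_coeff_def using assms by (rule digit_var_block)

text \<open>One new term contributes at most 3 b^2 by \<open>digit_var_le\<close>, and its
  correlation with the past at most 2 b^2.\<close>

lemma V_step:
  assumes b: "\<And>i. i < Suc m \<Longrightarrow> \<bar>\<alpha> i\<bar> \<le> b"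
  shows "V (Suc m) \<le> V m + 5 * b\<^sup>2"
proof -
  have "\<bar>digit_var \<alpha> (m + 1) - digit_var \<alpha> m - digit_var (\<lambda>i. \<alpha> (m + i)) 1\<bar> \<le> 2 * b\<^sup>2"
    by (rule digit_var_block) (use b in simp)
  moreover have "digit_var (\<lambda>i. \<alpha> (m + i)) 1 \<le> 3 * b\<^sup>2"
    using digit_var_le[of "\<lambda>i. \<alpha> (m + i)" 1] b[of m] power_mono[of "\<bar>\<alpha> m\<bar>" b 2] by simp
  ultimately show ?thesis unfolding V_def by simp
qed

lemma T_diff_bounds:
  assumes "1 \<le> j"
  shows "real j powr (p - 1) \<le> T (Suc j) - T j" "T (Suc j) - T j \<le> p * 2 powr p * real j powr (p - 1)"
proof -
  have lt: "real j < real (Suc j)" by simp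
  have "\<exists>z. real j < z \<and> z < real (Suc j) \<and> real (Suc j) powr p - real j powr p = (real (Suc j) - real j) * (p * z powr (p - 1))"
    by (rule MVT2[OF lt]) (use assms in \<open>auto intro!: derivative_eq_intros\<close>)
  then obtain z where z: "real j < z" "z < real (Suc j)" "T (Suc j) - T j = p * z powr (p - 1)" by (auto simp: T_def)
  have "real j powr (p - 1) \<le> z powr (p - 1)" using z p_ge assms by (intro powr_mono2) auto
  also have "\<dots> \<le> p * z powr (p - 1)" using mult_right_mono[of 1 p "z powr (p - 1)"] p_ge by simp
  finally show "real j powr (p - 1) \<le> T (Suc j) - T j" using z by simp
  have "z powr (p - 1) \<le> (2 * real j) powr (p - 1)" using z p_ge assms by (intro powr_mono2) auto
  also have "\<dots> = 2 powr (p - 1) * real j powr (p - 1)" by (simp add: powr_mult)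
  also have "\<dots> \<le> 2 powr p * real j powr (p - 1)" by (intro mult_right_mono powr_mono) auto
  finally show "T (Suc j) - T j \<le> p * 2 powr p * real j powr (p - 1)" using z(3) p_ge by (simp add: mult.assoc)
qed

text \<open>Just before a block end V is below T, hence A is at most 4 T there and at most 8 T one
  step later. Raising j^p to the power 1 - \<delta> gives j^(p-8), by the choice of p.\<close>

lemma block_coefficient_bound:
  "\<exists>C\<ge>1. eventually (\<lambda>j. \<forall>i<n (Suc j). (\<alpha> i)\<^sup>2 \<le> C * real j powr (p - 8)) sequentially"
proof -
  obtain C where C: "C \<ge> 1" "eventually (\<lambda>n. 1 \<le> A n \<and> (\<forall>i<n. (\<alpha> i)\<^sup>2 \<le> C * A n powr (1 - \<delta>))) sequentially"
    using coefficient_bound by blast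
  have nS: "filterlim (\<lambda>j. n (Suc j)) at_top sequentially" using n_top by (subst filterlim_sequentially_Suc)
  have nS1: "filterlim (\<lambda>j. n (Suc j) - 1) at_top sequentially"
    using filterlim_compose[OF filterlim_minus_const_nat_at_top[of 1] nS] by simp
  have 1: "eventually (\<lambda>j. 1 \<le> A (n (Suc j)) \<and> (\<forall>i<n (Suc j). (\<alpha> i)\<^sup>2 \<le> C * A (n (Suc j)) powr (1 - \<delta>))) sequentially"
    using eventually_compose_filterlim[OF C(2) nS] .
  have 2: "eventually (\<lambda>j. A (Suc (n (Suc j) - 1)) \<le> 2 * A (n (Suc j) - 1)) sequentially"
    using eventually_compose_filterlim[OF A_doubling nS1] .
  have 3: "eventually (\<lambda>j. 1 \<le> n (Suc j)) sequentially" using nS by (simp add: filterlim_at_top)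
  define C' where "C' = C * (8 * 2 powr p)"
  have two: "1 \<le> (2 :: real) powr p" using p_ge by (intro ge_one_powr_ge_zero) auto
  have C': "C' \<ge> 1"
  proof -
    have "1 * 1 \<le> C * (8 * 2 powr p)" using C(1) two by (intro mult_mono) auto
    then show ?thesis by (simp add: C'_def)
  qed
  have "eventually (\<lambda>j. \<forall>i<n (Suc j). (\<alpha> i)\<^sup>2 \<le> C' * real j powr (p - 8)) sequentially"
    using 1 2 3 eventually_ge_at_top[of 1]
  proof eventually_elim
    case (elim j)
    have "A (n (Suc j)) \<le> 2 * A (n (Suc j) - 1)" using elim by simp
    also have "\<dots> \<le> 8 * V (n (Suc j) - 1)" using A_le_V[of "n (Suc j) - 1"] by simp
    also have "\<dots> \<le> 8 * T (Suc j)" using V_less_T[of "n (Suc j) - 1" "Suc j"] elim by simp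
    also have "\<dots> \<le> 8 * (2 * real j) powr p" unfolding T_def using elim p_ge by (intro mult_left_mono powr_mono2) auto
    also have "\<dots> = (8 * 2 powr p) * real j powr p" by (simp add: powr_mult)
    finally have "A (n (Suc j)) powr (1 - \<delta>) \<le> ((8 * 2 powr p) * real j powr p) powr (1 - \<delta>)"
      using A_nonneg \<delta>_le_1 by (intro powr_mono2) auto
    also have "\<dots> = (8 * 2 powr p) powr (1 - \<delta>) * real j powr (p * (1 - \<delta>))" by (simp add: powr_mult powr_powr)
    also have "p * (1 - \<delta>) = p - 8" using p_ge by (simp add: algebra_simps)
    also have "(8 * 2 powr p) powr (1 - \<delta>) * real j powr (p - 8) \<le> (8 * 2 powr p) powr 1 * real j powr (p - 8)"
      using two \<delta>_pos by (intro mult_right_mono powr_mono) auto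
    finally have b: "A (n (Suc j)) powr (1 - \<delta>) \<le> (8 * 2 powr p) * real j powr (p - 8)" by simp
    show ?case
    proof (intro allI impI)
      fix i assume "i < n (Suc j)"
      then have "(\<alpha> i)\<^sup>2 \<le> C * A (n (Suc j)) powr (1 - \<delta>)" using elim by blast
      also have "\<dots> \<le> C * ((8 * 2 powr p) * real j powr (p - 8))" using C(1) by (intro mult_left_mono b) auto
      finally show "(\<alpha> i)\<^sup>2 \<le> C' * real j powr (p - 8)" by (simp add: C'_def mult.assoc)
    qed
  qed
  with C' show ?thesis by blast
qed

text \<open>With M of order j^(p-8), V overshoots T at a block end by at most 5 M
  (\<open>V_step\<close>) and splitting V there costs 2 M (\<open>V_block\<close>); both are small
  against the variance j^(p-1) of the block. Later in the block V can fall at most 2 M below its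
  value at the start.\<close>

lemma block_facts:
  "\<exists>C\<ge>1. eventually (\<lambda>j.
     (\<forall>i<n (Suc j). \<bar>\<alpha> i\<bar> \<le> C * real j powr (p/2 - 4)) \<and>
     \<bar>block_var j - (T (Suc j) - T j)\<bar> \<le> C * real j powr (p - 8) \<and>
     (\<Sum>i<block_len j. (block_coeff j i)\<^sup>2) \<le> C * real j powr (p - 1) \<and>
     block_var j \<le> C * real j powr (p - 1) \<and>
     (\<forall>m. n j \<le> m \<longrightarrow> m < n (Suc j) \<longrightarrow> T j - C * real j powr (p - 8) \<le> V m \<and> V m < T (Suc j))) sequentially"
proof -
  obtain K where K: "K \<ge> 1" "eventually (\<lambda>j. \<forall>i<n (Suc j). (\<alpha> i)\<^sup>2 \<le> K * real j powr (p - 8)) sequentially"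
    using block_coefficient_bound by blast
  define C where "C = 4 * (p * 2 powr p + 7 * K)"
  have p2: "1 \<le> p * 2 powr p"
  proof -
    have "1 * 1 \<le> p * 2 powr p" using p_ge by (intro mult_mono ge_one_powr_ge_zero) auto
    then show ?thesis by simp
  qed
  have CK: "7 * K \<le> C" "1 \<le> C" "p * 2 powr p + 7 * K \<le> C" using K(1) p2 by (auto simp: C_def)
  have nSS: "eventually (\<lambda>j. 1 \<le> n j) sequentially" using n_top by (simp add: filterlim_at_top)
  have "eventually (\<lambda>j.
     (\<forall>i<n (Suc j). \<bar>\<alpha> i\<bar> \<le> C * real j powr (p/2 - 4)) \<and>
     \<bar>block_var j - (T (Suc j) - T j)\<bar> \<le> C * real j powr (p - 8) \<and>
     (\<Sum>i<block_len j. (block_coeff j i)\<^sup>2) \<le> C * real j powr (p - 1) \<and>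
     block_var j \<le> C * real j powr (p - 1) \<and>
     (\<forall>m. n j \<le> m \<longrightarrow> m < n (Suc j) \<longrightarrow> T j - C * real j powr (p - 8) \<le> V m \<and> V m < T (Suc j))) sequentially"
    using K(2) nSS eventually_ge_at_top[of 1]
  proof eventually_elim
    case (elim j)
    define M where "M = K * real j powr (p - 8)"
    define b where "b = sqrt M"
    have M0: "0 \<le> M" using K(1) by (simp add: M_def)
    have b2: "b\<^sup>2 = M" using M0 by (simp add: b_def)
    have ab: "\<bar>\<alpha> i\<bar> \<le> b" if "i < n (Suc j)" for i
      unfolding b_def using elim that real_le_rsqrt[of "\<bar>\<alpha> i\<bar>" M] by (auto simp: M_def)
    have nle: "n j \<le> n (Suc j)" using mono_n by (simp add: monoD)
    have MC: "7 * M \<le> C * real j powr (p - 8)" using mult_right_mono[OF CK(1), of "real j powr (p - 8)"] by (simp add: M_def mult.assoc)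
    have j8: "real j powr (p - 8) \<le> real j powr (p - 1)" using elim by (intro powr_mono) auto
    have over: "V (n k) \<le> T k + 5 * M" if "1 \<le> n k" "n k \<le> n (Suc j)" for k
    proof -
      have "V (Suc (n k - 1)) \<le> V (n k - 1) + 5 * b\<^sup>2" by (rule V_step) (use that ab in auto)
      then show ?thesis using V_less_T[of "n k - 1" k] that by (simp add: b2)
    qed
    have 1: "\<bar>\<alpha> i\<bar> \<le> C * real j powr (p/2 - 4)" if "i < n (Suc j)" for i
    proof -
      have "b = sqrt K * real j powr (p/2 - 4)"
        unfolding b_def M_def by (simp add: real_sqrt_mult powr_half_sqrt[symmetric] powr_powr diff_divide_distrib)
      moreover have "sqrt K \<le> C"
      proof -
        have "sqrt K \<le> K" using K(1) by (intro real_le_lsqrt) (auto simp: power2_eq_square)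
        then show ?thesis using CK(1) K(1) by linarith
      qed
      ultimately show ?thesis using ab[OF that] mult_right_mono[of "sqrt K" C "real j powr (p/2 - 4)"] by simp
    qed
    have vb: "\<bar>V (n (Suc j)) - V (n j) - block_var j\<bar> \<le> 2 * M"
      using V_block[of j "block_len j" b] ab nle by (simp add: block_len_def block_var_def b2)
    have 2: "\<bar>block_var j - (T (Suc j) - T j)\<bar> \<le> 7 * M"
      using vb over[of j] over[of "Suc j"] T_le_V_n[of j] T_le_V_n[of "Suc j"] elim nle by (auto simp: abs_le_iff)
    have 3: "block_var j \<le> (p * 2 powr p + 7 * K) * real j powr (p - 1)"
    proof -
      have "block_var j \<le> (T (Suc j) - T j) + 7 * M" using 2 by (simp add: abs_le_iff)
      also have "\<dots> \<le> p * 2 powr p * real j powr (p - 1) + 7 * (K * real j powr (p - 1))"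
        unfolding M_def using T_diff_bounds(2)[of j] elim j8 K(1) by (intro add_mono mult_left_mono) auto
      finally show ?thesis by (simp add: algebra_simps)
    qed
    have 4: "(\<Sum>i<block_len j. (block_coeff j i)\<^sup>2) \<le> C * real j powr (p - 1)"
      using digit_var_ge[where \<alpha>="block_coeff j" and L="block_len j"] 3 unfolding block_var_def[symmetric] C_def mult.assoc[of 4] by linarith
    have 5: "T j - C * real j powr (p - 8) \<le> V m \<and> V m < T (Suc j)" if m: "n j \<le> m" "m < n (Suc j)" for m
    proof -
      have "\<bar>V (n j + (m - n j)) - V (n j) - digit_var (block_coeff j) (m - n j)\<bar> \<le> 2 * b\<^sup>2"
        by (rule V_block) (use ab m in auto)
      moreover have "0 \<le> digit_var (block_coeff j) (m - n j)" by (simp add: digit_var_def)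
      ultimately have "V (n j) - 2 * M \<le> V m" using m by (simp add: b2 abs_le_iff)
      then show ?thesis using T_le_V_n[of j] MC M0 V_less_T[OF m(2)] by simp
    qed
    show ?case
    proof (intro conjI allI impI)
      show "block_var j \<le> C * real j powr (p - 1)"
        using 3 mult_right_mono[OF CK(3), of "real j powr (p - 1)"] by simp
    qed (use 1 2 MC 4 5 in auto)
  qed
  with CK(2) show ?thesis by blast
qed

end

section \<open>Coupling with Brownian motion\<close>

lemma power4_diff_le: "(x - y) ^ 4 \<le> 8 * (x ^ 4 + y ^ 4)" for x y :: real
proof -
  have 1: "(x - y)\<^sup>2 \<le> 2 * (x\<^sup>2 + y\<^sup>2)" using zero_le_power2[of "x + y"] by (simp add: power2_eq_square algebra_simps)
  have 2: "(x\<^sup>2 + y\<^sup>2)\<^sup>2 \<le> 2 * (x ^ 4 + y ^ 4)"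
    using zero_le_power2[of "x\<^sup>2 - y\<^sup>2"] by (simp add: power2_eq_square power4_eq_xxxx algebra_simps)
  have "(x - y) ^ 4 = ((x - y)\<^sup>2)\<^sup>2" by simp
  also have "\<dots> \<le> (2 * (x\<^sup>2 + y\<^sup>2))\<^sup>2" by (intro power_mono 1) simp
  also have "\<dots> = 4 * (x\<^sup>2 + y\<^sup>2)\<^sup>2" by (simp only: power_mult_distrib) simp
  finally show ?thesis using 2 by linarith
qed

context radix
begin

definition gauss_gap :: "(nat \<Rightarrow> real) \<Rightarrow> nat \<Rightarrow> real \<Rightarrow> (real \<Rightarrow> real) \<Rightarrow> real \<Rightarrow> real" where
  "gauss_gap \<beta> L \<Delta> \<kappa> g = digit_sum \<beta> L (\<kappa> g) - sqrt \<Delta> * g"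

text \<open>The transport bound is kept for all h and b, so that h can be optimised for each block
  afterwards.\<close>

definition gauss_coupling :: "(nat \<Rightarrow> real) \<Rightarrow> nat \<Rightarrow> real \<Rightarrow> (real \<Rightarrow> real) \<Rightarrow> bool" where
  "gauss_coupling \<beta> L \<Delta> \<kappa> \<longleftrightarrow> \<kappa> \<in> borel_measurable borel \<and> (\<forall>g. 0 \<le> \<kappa> g \<and> \<kappa> g < 1) \<and> distr stdn borel \<kappa> = unif \<and>
     (\<forall>b h. 0 < h \<longrightarrow> 0 \<le> b \<longrightarrow> (\<forall>i<L. \<bar>\<beta> i\<bar> \<le> b) \<longrightarrow>
       (LINT g|stdn. \<bar>gauss_gap \<beta> L \<Delta> \<kappa> g\<bar>) \<le> 4 * h + 120 * b * digit_var \<beta> L / h\<^sup>2 + \<bar>digit_var \<beta> L - \<Delta>\<bar> / sqrt \<Delta>)"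

lemma cell_mono_eq: "i \<le> L \<Longrightarrow> cell L x = cell L y \<Longrightarrow> cell i x = cell i y"
proof -
  assume i: "i \<le> L" and e: "cell L x = cell L y"
  obtain k where L: "L = i + k" using i le_Suc_ex by blast
  have "cell i z = cell L z div int r ^ k" for z
  proof -
    have "2 * real r ^ i * z = (2 * real r ^ L * z) / real_of_int (int r ^ k)"
      by (simp add: L power_add)
    then show ?thesis unfolding cell_def by (simp only: floor_divide_real_eq_div zero_le_power of_nat_0_le_iff)
  qed
  then show ?thesis using e by simp
qed

lemma digit_sum_bound: "\<bar>digit_sum \<beta> L x\<bar> \<le> (\<Sum>i<L. \<bar>\<beta> i\<bar>)"
  unfolding digit_sum_def by (rule order_trans[OF sum_abs]) (simp add: abs_mult)

lemma gauss_coupling_integral: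
  assumes c: "gauss_coupling \<beta> L \<Delta> \<kappa>" and f: "f \<in> borel_measurable borel"
  shows "integrable stdn (\<lambda>g. f (\<kappa> g)) \<longleftrightarrow> integrable unif f" "(LINT g|stdn. f (\<kappa> g) :: real) = (LINT x|unif. f x)"
proof -
  have [measurable]: "\<kappa> \<in> borel_measurable borel" and d: "distr stdn borel \<kappa> = unif" using c by (auto simp: gauss_coupling_def)
  show "integrable stdn (\<lambda>g. f (\<kappa> g)) \<longleftrightarrow> integrable unif f" "(LINT g|stdn. f (\<kappa> g)) = (LINT x|unif. f x)"
    unfolding d[symmetric] using f by (auto simp: integrable_distr_eq integral_distr)
qed

lemma gauss_gap_moments:
  assumes c: "gauss_coupling \<beta> L \<Delta> \<kappa>" and \<Delta>: "0 < \<Delta>"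
  shows "gauss_gap \<beta> L \<Delta> \<kappa> \<in> borel_measurable borel"
    "integrable stdn (gauss_gap \<beta> L \<Delta> \<kappa>)" "(LINT g|stdn. gauss_gap \<beta> L \<Delta> \<kappa> g) = 0"
    "integrable stdn (\<lambda>g. (gauss_gap \<beta> L \<Delta> \<kappa> g)\<^sup>2)" "integrable stdn (\<lambda>g. gauss_gap \<beta> L \<Delta> \<kappa> g ^ 4)"
    "(LINT g|stdn. gauss_gap \<beta> L \<Delta> \<kappa> g ^ 4) \<le> 8 * (432 * (\<Sum>i<L. (\<beta> i)\<^sup>2)\<^sup>2 + 3 * \<Delta>\<^sup>2)"
proof -
  let ?D = "gauss_gap \<beta> L \<Delta> \<kappa>"
  have [measurable]: "\<kappa> \<in> borel_measurable borel" using c by (auto simp: gauss_coupling_def)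
  show m[measurable]: "?D \<in> borel_measurable borel" unfolding gauss_gap_def[abs_def] by measurable
  have pi: "integrable unif (\<lambda>x. digit_sum \<beta> L x ^ k)" for k
    by (rule past_integrable[of L]) (rule past_comp[where h="\<lambda>y. y ^ k"], rule past_digit_sum)
  have i: "integrable stdn (\<lambda>g. digit_sum \<beta> L (\<kappa> g) ^ k)" for k
    using gauss_coupling_integral(1)[OF c, of "\<lambda>x. digit_sum \<beta> L x ^ k"] pi[of k] by simp
  have q4: "sqrt \<Delta> ^ 4 = \<Delta>\<^sup>2" using \<Delta> by (simp add: power4_eq_xxxx power2_eq_square)
  have ig: "integrable stdn (\<lambda>g. 8 * (digit_sum \<beta> L (\<kappa> g) ^ 4 + (sqrt \<Delta> * g) ^ 4))"
    unfolding power_mult_distrib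
    by (intro integrable_mult_right Bochner_Integration.integrable_add i stdn_moments)
  have le: "?D g ^ 4 \<le> 8 * (digit_sum \<beta> L (\<kappa> g) ^ 4 + (sqrt \<Delta> * g) ^ 4)" for g
    unfolding gauss_gap_def by (rule power4_diff_le)
  show i4: "integrable stdn (\<lambda>g. ?D g ^ 4)"
    by (rule Bochner_Integration.integrable_bound[OF ig]) (use le in \<open>auto intro!: AE_I2 order_trans[OF le]\<close>)
  show "integrable stdn (\<lambda>g. (?D g)\<^sup>2)"
  proof (rule Bochner_Integration.integrable_bound[where f="\<lambda>g. 1 + ?D g ^ 4"])
    show "integrable stdn (\<lambda>g. 1 + ?D g ^ 4)" using i4 by simp
    have "y\<^sup>2 \<le> 1 + y ^ 4" for y :: real
    proof -
      have "y ^ 4 = (y\<^sup>2)\<^sup>2" by simp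
      moreover have "0 \<le> (y\<^sup>2)\<^sup>2 - 2 * y\<^sup>2 + 1" using zero_le_power2[of "y\<^sup>2 - 1"] by (simp only: power2_diff) simp
      ultimately show ?thesis using zero_le_power2[of y] by linarith
    qed
    then show "AE g in stdn. norm ((?D g)\<^sup>2) \<le> norm (1 + ?D g ^ 4)" by (intro AE_I2) simp
  qed simp
  have i1: "integrable stdn (\<lambda>g. digit_sum \<beta> L (\<kappa> g))" using i[of 1] by simp
  have i2: "integrable stdn (\<lambda>g. sqrt \<Delta> * g)" by (intro integrable_mult_right stdn_moments)
  show "integrable stdn ?D" unfolding gauss_gap_def[abs_def] by (intro Bochner_Integration.integrable_diff i1 i2)
  show "(LINT g|stdn. ?D g) = 0"
    unfolding gauss_gap_def
    by (simp only: Bochner_Integration.integral_diff[OF i1 i2] gauss_coupling_integral(2)[OF c measurable_digit_sum] digit_sum_mean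
        integral_mult_right_zero stdn_moments)
  have "(LINT g|stdn. ?D g ^ 4) \<le> (LINT g|stdn. 8 * (digit_sum \<beta> L (\<kappa> g) ^ 4 + (sqrt \<Delta> * g) ^ 4))"
    by (rule integral_mono[OF i4 ig le])
  also have "\<dots> = 8 * ((LINT g|stdn. digit_sum \<beta> L (\<kappa> g) ^ 4) + \<Delta>\<^sup>2 * 3)"
    unfolding power_mult_distrib q4
    by (simp only: integral_mult_right_zero Bochner_Integration.integral_add i integrable_mult_right stdn_moments)
  also have "(LINT g|stdn. digit_sum \<beta> L (\<kappa> g) ^ 4) = (LINT x|unif. digit_sum \<beta> L x ^ 4)"
    using gauss_coupling_integral(2)[OF c, of "\<lambda>x. digit_sum \<beta> L x ^ 4"] by simp
  finally show "(LINT g|stdn. ?D g ^ 4) \<le> 8 * (432 * (\<Sum>i<L. (\<beta> i)\<^sup>2)\<^sup>2 + 3 * \<Delta>\<^sup>2)"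
    using digit_sum_moment4[of \<beta> L] by simp
qed

text \<open>Let \<kappa> be the normal distribution function followed by the sorting rearrangement.
  Then the digit sum and \<open>sqrt \<Delta> * g\<close> are both monotone in g, and the potential
  turns their mean distance into a difference of expectations of one Lipschitz function, to which
  the normal approximation applies.\<close>

lemma ex_gauss_coupling:
  assumes \<Delta>: "0 < \<Delta>"
  shows "\<exists>\<kappa>. gauss_coupling \<beta> L \<Delta> \<kappa>"
proof -
  let ?F = "digit_sum \<beta> L"
  have F: "?F x = ?F y" if "\<lfloor>real (2 * r ^ L) * x\<rfloor> = \<lfloor>real (2 * r ^ L) * y\<rfloor>" for x y
  proof -
    have "cell L x = cell L y" using that by (simp add: cell_def)
    then have "\<forall>k<L. cell k x = cell k y" using cell_mono_eq[of _ L x y] by (auto intro: less_imp_le)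
    then show ?thesis using past_digit_sum[of L \<beta>] unfolding past_def by blast
  qed
  have "0 < 2 * r ^ L" by simp
  from ex_monotone_rearrangement[where F="?F", OF this F] obtain R where Rm[measurable]: "R \<in> borel_measurable borel" and Rr: "\<And>v. 0 \<le> v \<Longrightarrow> v < 1 \<Longrightarrow> 0 \<le> R v \<and> R v < 1"
    and Rd: "distr unif borel R = unif" and Rmono: "\<And>u v. 0 \<le> u \<Longrightarrow> u \<le> v \<Longrightarrow> v < 1 \<Longrightarrow> ?F (R u) \<le> ?F (R v)"
    by blast
  define \<kappa> where "\<kappa> g = R (cdf stdn g)" for g
  have cm[measurable]: "cdf stdn \<in> borel_measurable borel" by (rule normal_cdf_uniform)
  have km[measurable]: "\<kappa> \<in> borel_measurable borel" unfolding \<kappa>_def[abs_def] by measurable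
  have kr: "0 \<le> \<kappa> g \<and> \<kappa> g < 1" for g unfolding \<kappa>_def using normal_cdf_uniform(2,3)[of g] by (intro Rr) auto
  have kd: "distr stdn borel \<kappa> = unif"
  proof -
    have "distr stdn borel \<kappa> = distr (distr stdn borel (cdf stdn)) borel R"
      unfolding \<kappa>_def[abs_def] by (subst distr_distr) (auto simp: comp_def)
    then show ?thesis unfolding normal_cdf_uniform(5) Rd .
  qed
  have pm: "mono (\<lambda>g. ?F (\<kappa> g))"
  proof (rule monoI)
    fix x y :: real assume "x \<le> y"
    then have "cdf stdn x \<le> cdf stdn y" using normal_cdf_uniform(1) by (simp add: monoD)
    then show "?F (\<kappa> x) \<le> ?F (\<kappa> y)" unfolding \<kappa>_def using normal_cdf_uniform(2,3) by (intro Rmono) (auto intro: less_imp_le)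
  qed
  have qm: "mono (\<lambda>g. sqrt \<Delta> * g)" using \<Delta> by (intro monoI mult_left_mono) auto
  obtain f where lip: "\<And>x y. \<bar>f x - f y\<bar> \<le> \<bar>x - y\<bar>" and f: "\<And>g. f (?F (\<kappa> g)) - f (sqrt \<Delta> * g) = \<bar>?F (\<kappa> g) - sqrt \<Delta> * g\<bar>"
    using monotone_coupling_potential[OF pm qm] by blast
  have fm[measurable]: "f \<in> borel_measurable borel"
  proof (rule borel_measurable_continuous_onI)
    have "1-lipschitz_on UNIV f" using lip by (auto simp: lipschitz_on_def dist_real_def)
    then show "continuous_on UNIV f" by (rule lipschitz_on_continuous_on)
  qed
  have fg: "\<bar>f x\<bar> \<le> \<bar>f 0\<bar> + \<bar>x\<bar>" for x using lip[of x 0] by simp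
  have I1: "integrable stdn (\<lambda>g. f (?F (\<kappa> g)))"
  proof (rule stdn.integrable_const_bound[where B="\<bar>f 0\<bar> + (\<Sum>i<L. \<bar>\<beta> i\<bar>)"])
    show "AE g in stdn. norm (f (?F (\<kappa> g))) \<le> \<bar>f 0\<bar> + (\<Sum>i<L. \<bar>\<beta> i\<bar>)"
    proof (rule AE_I2)
      fix g
      show "norm (f (?F (\<kappa> g))) \<le> \<bar>f 0\<bar> + (\<Sum>i<L. \<bar>\<beta> i\<bar>)"
        using fg[of "?F (\<kappa> g)"] digit_sum_bound[of \<beta> L "\<kappa> g"] unfolding real_norm_def by linarith
    qed
  qed simp
  have I2: "integrable stdn (\<lambda>g. f (sqrt \<Delta> * g))"
  proof (rule Bochner_Integration.integrable_bound[where f="\<lambda>g. \<bar>f 0\<bar> + sqrt \<Delta> * \<bar>g\<bar>"])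
    show "integrable stdn (\<lambda>g. \<bar>f 0\<bar> + sqrt \<Delta> * \<bar>g\<bar>)" using stdn_moments(7) by simp
    show "AE g in stdn. norm (f (sqrt \<Delta> * g)) \<le> norm (\<bar>f 0\<bar> + sqrt \<Delta> * \<bar>g\<bar>)"
    proof (rule AE_I2)
      fix g
      have "\<bar>sqrt \<Delta> * g\<bar> = sqrt \<Delta> * \<bar>g\<bar>" using \<Delta> by (simp add: abs_mult)
      then show "norm (f (sqrt \<Delta> * g)) \<le> norm (\<bar>f 0\<bar> + sqrt \<Delta> * \<bar>g\<bar>)" using fg[of "sqrt \<Delta> * g"] \<Delta> by simp
    qed
  qed simp
  have "(LINT g|stdn. \<bar>gauss_gap \<beta> L \<Delta> \<kappa> g\<bar>) = (LINT x|unif. f (?F x)) - gauss_avg \<Delta> f 0"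
  proof -
    have "(LINT g|stdn. \<bar>gauss_gap \<beta> L \<Delta> \<kappa> g\<bar>) = (LINT g|stdn. f (?F (\<kappa> g)) - f (sqrt \<Delta> * g))"
      unfolding gauss_gap_def f ..
    also have "\<dots> = (LINT g|stdn. f (?F (\<kappa> g))) - (LINT g|stdn. f (sqrt \<Delta> * g))" by (rule Bochner_Integration.integral_diff[OF I1 I2])
    also have "(LINT g|stdn. f (?F (\<kappa> g))) = (LINT x|unif. f (?F x))"
      unfolding kd[symmetric] by (subst integral_distr) auto
    finally show ?thesis by (simp add: gauss_avg_def)
  qed
  then have "(LINT g|stdn. \<bar>gauss_gap \<beta> L \<Delta> \<kappa> g\<bar>) \<le> 4 * h + 120 * b * digit_var \<beta> L / h\<^sup>2 + \<bar>digit_var \<beta> L - \<Delta>\<bar> / sqrt \<Delta>"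
    if "0 < h" "0 \<le> b" "\<forall>i<L. \<bar>\<beta> i\<bar> \<le> b" for b h
    using lipschitz_digit_sum_gauss[of f h \<Delta> L \<beta> b] lip that \<Delta> by (simp add: abs_le_iff)
  then show ?thesis using km kr kd unfolding gauss_coupling_def by blast
qed

end

section \<open>Almost sure bounds from polynomial moment bounds\<close>

lemma summable_Suc_powr: "x < -1 \<Longrightarrow> summable (\<lambda>j. real (Suc j) powr x)"
  using summable_real_powr_iff[of x] summable_Suc_iff[of "\<lambda>j. real j powr x"] by simp

lemma AE_powr_negligible:
  fixes Y :: "nat \<Rightarrow> 'a \<Rightarrow> real"
  assumes i: "\<And>j. integrable M (Y j)" and nn: "\<And>j \<omega>. 0 \<le> Y j \<omega>"
    and e: "\<And>j. (LINT \<omega>|M. Y j \<omega>) \<le> C * real (Suc j) powr x" and xy: "x - y < -1"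
  shows "AE \<omega> in M. (\<lambda>j. Y j \<omega> / real (Suc j) powr y) \<longlonglongrightarrow> 0"
proof (rule AE_tendsto_0_of_summable_integral)
  have E: "(LINT \<omega>|M. Y j \<omega> / real (Suc j) powr y) = (LINT \<omega>|M. Y j \<omega>) / real (Suc j) powr y" for j by simp
  show "summable (\<lambda>j. LINT \<omega>|M. Y j \<omega> / real (Suc j) powr y)"
    unfolding E
  proof (rule summable_comparison_test'[of "\<lambda>j. C * real (Suc j) powr (x - y)" 0])
    show "summable (\<lambda>j. C * real (Suc j) powr (x - y))" by (intro summable_mult summable_Suc_powr xy)
    fix j
    have "(LINT \<omega>|M. Y j \<omega>) / real (Suc j) powr y \<le> C * real (Suc j) powr x / real (Suc j) powr y" by (intro divide_right_mono e) simp
    moreover have "0 \<le> (LINT \<omega>|M. Y j \<omega>)" by (intro Bochner_Integration.integral_nonneg nn)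
    ultimately show "norm ((LINT \<omega>|M. Y j \<omega>) / real (Suc j) powr y) \<le> C * real (Suc j) powr (x - y)"
      by (simp add: powr_diff)
  qed
qed (use i nn in auto)

lemma summable_square_geometric:
  assumes x: "x < 0"
  shows "summable (\<lambda>i. (real (Suc i))\<^sup>2 * (2 ^ i) powr x)"
proof -
  \<comment> \<open>Estimating Suc i by a multiple of 2^(e (i+1)) costs, after squaring, half of the
    decay 2^(x i); the other half is the geometric ratio.\<close>
  define e where "e = - x / 4"
  define c where "c = e * ln 2"
  have e: "e > 0" using x by (simp add: e_def)
  then have c: "c > 0" by (simp add: c_def)
  have "(2 :: real) powr (x / 2) < 2 powr 0" using x by (intro powr_less_mono) auto
  then have s: "summable (\<lambda>i. (1 / c)\<^sup>2 * 2 powr (2 * e) * (2 powr (x / 2)) ^ i)"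
    by (intro summable_mult summable_geometric) simp
  show ?thesis
  proof (rule summable_comparison_test'[OF s, of 0])
    fix i
    have "c * real (Suc i) \<le> exp (c * real (Suc i))" using exp_ge_add_one_self[of "c * real (Suc i)"] by linarith
    also have "\<dots> = 2 powr (e * real (Suc i))" by (simp add: powr_def c_def mult_ac)
    finally have "real (Suc i) \<le> (1 / c) * 2 powr (e * real (Suc i))" using c by (simp add: field_simps)
    then have "(real (Suc i))\<^sup>2 \<le> ((1 / c) * 2 powr (e * real (Suc i)))\<^sup>2" by (intro power_mono) auto
    also have "\<dots> = (1 / c)\<^sup>2 * 2 powr (2 * e * real (Suc i))"
      unfolding power_mult_distrib by (simp add: power2_eq_square powr_add[symmetric] mult.assoc)
    finally have "(real (Suc i))\<^sup>2 * (2 ^ i) powr x \<le> (1 / c)\<^sup>2 * 2 powr (2 * e * real (Suc i)) * (2 ^ i) powr x"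
      by (intro mult_right_mono) auto
    also have "\<dots> = (1 / c)\<^sup>2 * (2 powr (2 * e * real (Suc i)) * (2 powr real i) powr x)" by (simp add: powr_realpow)
    also have "2 powr (2 * e * real (Suc i)) * (2 powr real i) powr x = 2 powr (2 * e * real (Suc i) + real i * x)" by (simp add: powr_powr powr_add)
    also have "2 * e * real (Suc i) + real i * x = 2 * e + (x / 2) * real i" by (simp add: e_def algebra_simps)
    also have "2 powr (2 * e + (x / 2) * real i) = 2 powr (2 * e) * (2 powr (x / 2)) ^ i" unfolding powr_add powr_powr[symmetric] by (simp add: powr_realpow)
    finally show "norm ((real (Suc i))\<^sup>2 * (2 ^ i) powr x) \<le> (1 / c)\<^sup>2 * 2 powr (2 * e) * (2 powr (x / 2)) ^ i" by (simp add: mult.assoc)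
  qed
qed

section \<open>Coupling all blocks with one Gaussian family\<close>

locale strong_approximation = takagi_coefficients r a \<delta> + gaussian_family M G
  for r :: nat and a :: "nat \<Rightarrow> real" and \<delta> :: real and M :: "'a measure" and G :: "nat \<times> nat \<times> nat \<Rightarrow> 'a \<Rightarrow> real"
begin

sublocale clock: gaussian_clock M G T
  by unfold_locales (rule T_0 T_mono T_top)+

definition \<kappa> :: "nat \<Rightarrow> real \<Rightarrow> real" where
  "\<kappa> j = (SOME k. gauss_coupling (block_coeff j) (block_len j) (clock.\<Delta> j) k)"

lemma coupling_\<kappa>: "gauss_coupling (block_coeff j) (block_len j) (clock.\<Delta> j) (\<kappa> j)"
proof -
  have "\<exists>k. gauss_coupling (block_coeff j) (block_len j) (clock.\<Delta> j) k" by (rule ex_gauss_coupling[OF clock.\<Delta>_pos])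
  then show ?thesis unfolding \<kappa>_def by (rule someI_ex)
qed

text \<open>Only the increment over block j is used, so these variables are independent and the
  finer Schauder coefficients stay free.\<close>

definition X :: "nat \<Rightarrow> 'a \<Rightarrow> real" where "X j \<omega> = \<kappa> j (G (j, 0, 0) \<omega>)"

definition gap :: "nat \<Rightarrow> real \<Rightarrow> real" where "gap j = gauss_gap (block_coeff j) (block_len j) (clock.\<Delta> j) (\<kappa> j)"

lemma \<kappa>_measurable[measurable]: "\<kappa> j \<in> borel_measurable borel"
  using coupling_\<kappa>[of j] by (simp add: gauss_coupling_def)

lemma indep_blocks:
  assumes "\<And>j. f j \<in> borel_measurable borel"
  shows "indep_vars (\<lambda>_. borel) (\<lambda>j \<omega>. f j (G (j, 0, 0) \<omega>) :: real) UNIV"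
proof -
  have "indep_vars (\<lambda>j. PiM {(j, 0, 0)} (\<lambda>_. borel)) (\<lambda>j \<omega>. restrict (\<lambda>x. G x \<omega>) {(j, 0, 0)}) (UNIV :: nat set)"
    by (rule indep_vars_restrict[OF indep_G]) (auto simp: disjoint_family_on_def)
  from indep_vars_compose2[OF this, of "\<lambda>j w. f j (w (j, 0, 0))" "\<lambda>_. borel"]
  show ?thesis using assms measurable_component_singleton
    by (simp add: measurable_compose[OF measurable_component_singleton])
qed

sublocale blocks: uniform_blocks M r X n
proof unfold_locales
  show "indep_vars (\<lambda>_. borel) X UNIV"
    using indep_blocks[of \<kappa>] unfolding X_def[abs_def] by simp
  show "distr M borel (X j) = unif" for j
  proof -
    have "distr M borel (X j) = distr (distr M borel (G (j, 0, 0))) borel (\<kappa> j)"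
      unfolding X_def[abs_def] by (subst distr_distr) (auto simp: comp_def)
    then show ?thesis using coupling_\<kappa>[of j] unfolding distr_G gauss_coupling_def by simp
  qed
  show "0 \<le> X j \<omega> \<and> X j \<omega> < 1" for j \<omega> using coupling_\<kappa>[of j] unfolding X_def gauss_coupling_def by blast
qed (rule n_0 mono_n n_top)+

lemma len_eq: "blocks.len j = block_len j" by (simp add: blocks.len_def block_len_def)

definition d :: "nat \<Rightarrow> 'a \<Rightarrow> real" where "d j \<omega> = gap j (G (j, 0, 0) \<omega>)"

lemma d_eq: "d j \<omega> = digit_sum (block_coeff j) (block_len j) (X j \<omega>) - sqrt (clock.\<Delta> j) * G (j, 0, 0) \<omega>"
  by (simp add: d_def gap_def gauss_gap_def X_def)

lemmas gap_moments = gauss_gap_moments[OF coupling_\<kappa> clock.\<Delta>_pos, folded gap_def]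

lemma gap_measurable[measurable]: "gap j \<in> borel_measurable borel" by (rule gap_moments)

text \<open>Gaps of distinct blocks are independent and centred; the resulting orthogonality is the
  hypothesis of \<open>dyadic_energy_expectation\<close>.\<close>

lemma d_products:
  shows "integrable M (\<lambda>\<omega>. d j \<omega> * d k \<omega>)" "j \<noteq> k \<Longrightarrow> (LINT \<omega>|M. d j \<omega> * d k \<omega>) = 0"
    "(LINT \<omega>|M. (d j \<omega>)\<^sup>2) = (LINT g|stdn. (gap j g)\<^sup>2)"
proof -
  have i1: "integrable M (d j)" for j unfolding d_def[abs_def] by (subst integrable_G) (auto intro: gap_moments)
  have i2: "integrable M (\<lambda>\<omega>. (d j \<omega>)\<^sup>2)" for j
    unfolding d_def[abs_def] using integrable_G[of "\<lambda>g. (gap j g)\<^sup>2" "(j, 0, 0)"] gap_moments(4)[of j] by simp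
  have e1: "(LINT \<omega>|M. d j \<omega>) = 0" for j unfolding d_def[abs_def] by (subst integral_G) (auto simp: gap_moments)
  have ind: "indep_var borel (d j) borel (d k)" if "j \<noteq> k"
  proof -
    have "indep_var (PiM {(j, 0, 0)} (\<lambda>_. borel)) (\<lambda>\<omega>. restrict (\<lambda>x. G x \<omega>) {(j, 0, 0)}) (PiM {(k, 0, 0)} (\<lambda>_. borel)) (\<lambda>\<omega>. restrict (\<lambda>x. G x \<omega>) {(k, 0, 0)})"
      by (rule indep_var_restrict[OF indep_G]) (use that in auto)
    from indep_var_compose[OF this, of "\<lambda>w. gap j (w (j, 0, 0))" borel "\<lambda>w. gap k (w (k, 0, 0))" borel]
    show ?thesis by (simp add: comp_def d_def[abs_def] measurable_compose[OF measurable_component_singleton])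
  qed
  show "integrable M (\<lambda>\<omega>. d j \<omega> * d k \<omega>)"
    using i2 indep_var_integrable[OF ind i1 i1] by (cases "j = k") (auto simp: power2_eq_square)
  show "(LINT \<omega>|M. d j \<omega> * d k \<omega>) = 0" if "j \<noteq> k"
    using indep_var_lebesgue_integral[OF ind[OF that] i1 i1] by (simp add: e1)
  show "(LINT \<omega>|M. (d j \<omega>)\<^sup>2) = (LINT g|stdn. (gap j g)\<^sup>2)"
    unfolding d_def[abs_def] using integral_G[of "\<lambda>g. (gap j g)\<^sup>2" "(j, 0, 0)"] by simp
qed

end

lemma eventually_powr_bound_imp_all:
  fixes f :: "nat \<Rightarrow> real"
  assumes ev: "eventually (\<lambda>j. f j \<le> C * real j powr x) sequentially" and C: "0 \<le> C" and x: "0 \<le> x"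
  shows "\<exists>C'\<ge>0. \<forall>j. f j \<le> C' * real (Suc j) powr x"
proof (rule eventually_bound_imp_all)
  show "eventually (\<lambda>j. f j \<le> C * real (Suc j) powr x) sequentially"
    using ev
  proof eventually_elim
    case (elim j)
    have "C * real j powr x \<le> C * real (Suc j) powr x" using C x by (intro mult_left_mono powr_mono2) auto
    with elim show ?case by linarith
  qed
qed simp

context strong_approximation
begin

lemma \<Delta>_bounds:
  assumes "1 \<le> j"
  shows "real j powr (p - 1) \<le> clock.\<Delta> j" "clock.\<Delta> j \<le> p * 2 powr p * real j powr (p - 1)"
  using T_diff_bounds[OF assms] by (simp_all add: clock.\<Delta>_def)

lemma \<Delta>_bound: "\<exists>C\<ge>0. \<forall>j. clock.\<Delta> j \<le> C * real (Suc j) powr (p - 1)"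
proof (rule eventually_powr_bound_imp_all)
  show "eventually (\<lambda>j. clock.\<Delta> j \<le> (p * 2 powr p) * real j powr (p - 1)) sequentially"
    using eventually_ge_at_top[of 1] by eventually_elim (rule \<Delta>_bounds)
qed (use p_ge in auto)

lemma block_sq_bound: "\<exists>C\<ge>0. \<forall>j. (\<Sum>i<block_len j. (block_coeff j i)\<^sup>2) \<le> C * real (Suc j) powr (p - 1)"
proof -
  from block_facts obtain C where "C \<ge> 1" and "eventually (\<lambda>j. (\<Sum>i<block_len j. (block_coeff j i)\<^sup>2) \<le> C * real j powr (p - 1)) sequentially"
    by (elim exE conjE) (rule that, assumption, erule eventually_mono, blast)
  then show ?thesis using p_ge by (intro eventually_powr_bound_imp_all[of _ C]) auto
qed

lemma block_coeff_bound:
  assumes "\<forall>i<n (Suc j). \<bar>\<alpha> i\<bar> \<le> b" "i < block_len j"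
  shows "\<bar>block_coeff j i\<bar> \<le> b"
  using assms unfolding block_coeff_def block_len_def by auto

lemma kink_mean_bound: "\<exists>C\<ge>0. \<forall>j. (LINT x|unif. kink_sum (block_coeff j) (block_len j) x) \<le> C * real (Suc j) powr (p/2 - 4)"
proof -
  from block_facts obtain C where C: "C \<ge> 1" and ev: "eventually (\<lambda>j. \<forall>i<n (Suc j). \<bar>\<alpha> i\<bar> \<le> C * real j powr (p/2 - 4)) sequentially"
    by (elim exE conjE) (rule that, assumption, erule eventually_mono, blast)
  have "eventually (\<lambda>j. (LINT x|unif. kink_sum (block_coeff j) (block_len j) x) \<le> (8 * C) * real j powr (p/2 - 4)) sequentially"
    using ev
  proof eventually_elim
    case (elim j)
    then have "(LINT x|unif. kink_sum (block_coeff j) (block_len j) x) \<le> 8 * (C * real j powr (p/2 - 4))"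
      by (intro kink_sum_integral block_coeff_bound) (use C in auto)
    then show ?case by simp
  qed
  then show ?thesis using p_ge C by (intro eventually_powr_bound_imp_all[of _ "8 * C"]) auto
qed

text \<open>The transport bound controls only the first absolute moment of the gap. Interpolation
  with the fourth moment yields the second moment, in which orthogonality can be used.\<close>

lemma gap_sq_bound: "\<exists>C\<ge>0. \<forall>j. (LINT g|stdn. (gap j g)\<^sup>2) \<le> C * real (Suc j) powr (p - 16/9)"
proof -
  from block_facts obtain C where C: "C \<ge> 1" and ev: "eventually (\<lambda>j.
      (\<forall>i<n (Suc j). \<bar>\<alpha> i\<bar> \<le> C * real j powr (p/2 - 4)) \<and> \<bar>block_var j - (T (Suc j) - T j)\<bar> \<le> C * real j powr (p - 8) \<and>
      (\<Sum>i<block_len j. (block_coeff j i)\<^sup>2) \<le> C * real j powr (p - 1) \<and> block_var j \<le> C * real j powr (p - 1)) sequentially"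
    by (elim exE conjE) (rule that, assumption, erule eventually_mono, blast)
  define K where "K = 4 + 120 * C\<^sup>2 + C"
  define D where "D = p * 2 powr p"
  define K' where "K' = 8 * (432 * C\<^sup>2 + 3 * D\<^sup>2)"
  have "eventually (\<lambda>j. (LINT g|stdn. (gap j g)\<^sup>2) \<le> (K + K') * real j powr (p - 16/9)) sequentially"
    using ev eventually_ge_at_top[of 1]
  proof eventually_elim
    case (elim j)
    let ?j = "real j"
    have j: "1 \<le> ?j" "1 \<le> j" using elim by auto
    have pos: "0 < ?j powr x" for x using j by simp
    \<comment> \<open>Balances the smoothing error h against the third-moment error
      \<open>j powr (p/2 - 4) * j powr (p - 1) / h\<^sup>2\<close>. The variance mismatch is of
      smaller order.\<close>
    define h where "h = ?j powr (p/2 - 5/3)"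
    \<comment> \<open>Truncation level of the interpolation: it balances c h against
      \<open>j powr (2 * p - 2) / c\<^sup>2\<close>.\<close>
    define c where "c = ?j powr (p/2 - 1/9)"
    define b where "b = C * ?j powr (p/2 - 4)"
    have h: "0 < h" and c: "0 < c" and b: "0 \<le> b" using pos C by (auto simp: h_def c_def b_def)
    have "\<forall>i<block_len j. \<bar>block_coeff j i\<bar> \<le> b" unfolding b_def using elim block_coeff_bound by blast
    then have G: "(LINT g|stdn. \<bar>gap j g\<bar>) \<le> 4 * h + 120 * b * block_var j / h\<^sup>2 + \<bar>block_var j - clock.\<Delta> j\<bar> / sqrt (clock.\<Delta> j)"
      using coupling_\<kappa>[of j] h b unfolding gauss_coupling_def gap_def block_var_def by blast
    have 1: "120 * b * block_var j / h\<^sup>2 \<le> 120 * C\<^sup>2 * h"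
    proof -
      have "120 * b * block_var j / h\<^sup>2 \<le> 120 * b * (C * ?j powr (p - 1)) / h\<^sup>2"
        using elim b h by (intro divide_right_mono mult_left_mono) auto
      also have "\<dots> = 120 * C\<^sup>2 * (?j powr (p/2 - 4) * ?j powr (p - 1) / (h * h))" by (simp add: b_def power2_eq_square)
      also have "?j powr (p/2 - 4) * ?j powr (p - 1) / (h * h) = h"
        unfolding h_def powr_add[symmetric] powr_diff[symmetric] by simp
      finally show ?thesis .
    qed
    have 2: "\<bar>block_var j - clock.\<Delta> j\<bar> / sqrt (clock.\<Delta> j) \<le> C * h"
    proof -
      have "sqrt (?j powr (p - 1)) \<le> sqrt (clock.\<Delta> j)" using \<Delta>_bounds(1)[OF j(2)] by simp
      then have s: "?j powr ((p - 1) / 2) \<le> sqrt (clock.\<Delta> j)" by (simp add: powr_half_sqrt[symmetric] powr_powr)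
      have "\<bar>block_var j - clock.\<Delta> j\<bar> / sqrt (clock.\<Delta> j) \<le> C * ?j powr (p - 8) / ?j powr ((p - 1) / 2)"
        using elim s pos[of "(p - 1) / 2"] C unfolding clock.\<Delta>_def by (intro frac_le) auto
      also have "\<dots> = C * (?j powr (p - 8) / ?j powr ((p - 1) / 2))" by simp
      also have "?j powr (p - 8) / ?j powr ((p - 1) / 2) = ?j powr (p/2 - 15/2)" unfolding powr_diff[symmetric] by (simp add: field_simps)
      also have "C * ?j powr (p/2 - 15/2) \<le> C * h" unfolding h_def using j C by (intro mult_left_mono powr_mono) auto
      finally show ?thesis .
    qed
    have m1: "(LINT g|stdn. \<bar>gap j g\<bar>) \<le> K * h" using G 1 2 by (simp add: K_def algebra_simps)
    have m4: "(LINT g|stdn. gap j g ^ 4) \<le> K' * (?j powr (p - 1))\<^sup>2"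
    proof -
      have "(LINT g|stdn. gap j g ^ 4) \<le> 8 * (432 * (\<Sum>i<block_len j. (block_coeff j i)\<^sup>2)\<^sup>2 + 3 * (clock.\<Delta> j)\<^sup>2)" by (rule gap_moments)
      also have "\<dots> \<le> 8 * (432 * (C * ?j powr (p - 1))\<^sup>2 + 3 * (D * ?j powr (p - 1))\<^sup>2)"
        using elim \<Delta>_bounds(2)[OF j(2)] clock.\<Delta>_pos[of j] unfolding D_def
        by (intro mult_left_mono add_mono power_mono sum_nonneg) auto
      finally show ?thesis by (simp add: K'_def power_mult_distrib algebra_simps)
    qed
    have ig: "integrable stdn (\<lambda>g. c * \<bar>gap j g\<bar> + gap j g ^ 4 / c\<^sup>2)"
      by (intro Bochner_Integration.integrable_add integrable_mult_right integrable_divide gap_moments integrable_abs)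
    have le: "y\<^sup>2 \<le> c * \<bar>y\<bar> + y ^ 4 / c\<^sup>2" for y :: real
    proof (cases "\<bar>y\<bar> \<le> c")
      case True
      have "y\<^sup>2 = \<bar>y\<bar> * \<bar>y\<bar>" by (simp add: power2_eq_square)
      also have "\<dots> \<le> c * \<bar>y\<bar>" using True by (intro mult_right_mono) auto
      finally show ?thesis using c by (simp add: add_increasing2)
    next
      case False
      have "c\<^sup>2 \<le> \<bar>y\<bar>\<^sup>2" using False c by (intro power_mono) auto
      then have "c\<^sup>2 * y\<^sup>2 \<le> y\<^sup>2 * y\<^sup>2" by (intro mult_right_mono) auto
      then have "y\<^sup>2 \<le> y ^ 4 / c\<^sup>2" using c by (simp add: pos_le_divide_eq power4_eq_xxxx power2_eq_square mult_ac)
      then show ?thesis using c by (simp add: add_increasing)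
    qed
    have "(LINT g|stdn. (gap j g)\<^sup>2) \<le> (LINT g|stdn. c * \<bar>gap j g\<bar> + gap j g ^ 4 / c\<^sup>2)"
      by (rule integral_mono[OF gap_moments(4) ig le])
    also have "\<dots> = c * (LINT g|stdn. \<bar>gap j g\<bar>) + (LINT g|stdn. gap j g ^ 4) / c\<^sup>2"
      by (simp only: Bochner_Integration.integral_add integral_mult_right_zero integral_divide_zero integrable_mult_right integrable_divide gap_moments integrable_abs)
    also have "\<dots> \<le> c * (K * h) + K' * (?j powr (p - 1))\<^sup>2 / c\<^sup>2"
      using c by (intro add_mono mult_left_mono divide_right_mono m1 m4) auto
    also have "\<dots> = K * (c * h) + K' * ((?j powr (p - 1) * ?j powr (p - 1)) / (c * c))" by (simp add: power2_eq_square)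
    also have "c * h = ?j powr (p - 16/9)" unfolding c_def h_def powr_add[symmetric] by simp
    also have "(?j powr (p - 1) * ?j powr (p - 1)) / (c * c) = ?j powr (p - 16/9)"
      unfolding c_def powr_add[symmetric] powr_diff[symmetric] by simp
    finally show ?case by (simp add: algebra_simps)
  qed
  then show ?thesis using p_ge C by (intro eventually_powr_bound_imp_all[of _ "K + K'"]) (auto simp: K_def K'_def)
qed

end

section \<open>Error terms along the blocks\<close>

context strong_approximation
begin

text \<open>Exponent of the tolerated error \<open>V powr (1/2 - l)\<close> in terms of the block
  number, as V is of order j^p in block j.\<close>

definition scale :: "real \<Rightarrow> real" where "scale l = p * (1/2 - l)"

lemma scale_gt: "l < \<delta> / 32 \<Longrightarrow> p/2 - 1/4 < scale l"
proof -
  assume "l < \<delta> / 32"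
  then have "p * l < p * (\<delta> / 32)" using p_ge by (intro mult_strict_left_mono) auto
  also have "p * (\<delta> / 32) = (p * \<delta>) / 32" by simp
  finally have "p * l < 1/4" unfolding p_ge(2) by simp
  then show ?thesis unfolding scale_def right_diff_distrib by simp
qed

definition drift :: "nat \<Rightarrow> 'a \<Rightarrow> real" where
  "drift j \<omega> = (\<Sum>i<j. kink_sum (block_coeff i) (block_len i) (X i \<omega>))"

lemma drift_nonneg: "0 \<le> drift j \<omega>" unfolding drift_def by (intro sum_nonneg kink_sum_nonneg)

text \<open>Means of order j^(p/2-4) add up to j^(p/2-3). This is so far below the tolerated
  j^(p/2-1/4) that no cancellation among the carries is needed.\<close>

lemma drift_vanishes:
  assumes l: "l < \<delta> / 32"
  shows "AE \<omega> in M. (\<lambda>j. drift j \<omega> / real (Suc j) powr scale l) \<longlonglongrightarrow> 0"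
proof -
  obtain C where C: "C \<ge> 0" and K: "\<And>i. (LINT x|unif. kink_sum (block_coeff i) (block_len i) x) \<le> C * real (Suc i) powr (p/2 - 4)"
    using kink_mean_bound by blast
  have k: "integrable M (\<lambda>\<omega>. kink_sum \<beta> L (X i \<omega>))" "(LINT \<omega>|M. kink_sum \<beta> L (X i \<omega>)) = (LINT x|unif. kink_sum \<beta> L x)" for i \<beta> L
  proof -
    have m: "kink_sum \<beta> L \<in> borel_measurable borel" by (rule kink_sum_measurable)
    have "integrable unif (kink_sum \<beta> L)" by (rule kink_sum_integral[where b="\<Sum>i<L. \<bar>\<beta> i\<bar>"]) (auto intro: member_le_sum sum_nonneg)
    then show "integrable M (\<lambda>\<omega>. kink_sum \<beta> L (X i \<omega>))" "(LINT \<omega>|M. kink_sum \<beta> L (X i \<omega>)) = (LINT x|unif. kink_sum \<beta> L x)"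
      unfolding blocks.distr_X[of i, symmetric] using m by (auto simp: integrable_distr_eq integral_distr)
  qed
  show ?thesis
  proof (rule AE_powr_negligible[where C=C and x="p/2 - 3"])
    show "integrable M (drift j)" for j unfolding drift_def[abs_def] by (intro Bochner_Integration.integrable_sum k)
    show "(LINT \<omega>|M. drift j \<omega>) \<le> C * real (Suc j) powr (p/2 - 3)" for j
    proof -
      have "(LINT \<omega>|M. drift j \<omega>) = (\<Sum>i<j. LINT x|unif. kink_sum (block_coeff i) (block_len i) x)"
        unfolding drift_def by (simp only: Bochner_Integration.integral_sum k)
      also have "\<dots> \<le> (\<Sum>i<j. C * real (Suc j) powr (p/2 - 4))"
      proof (rule sum_mono)
        fix i assume "i \<in> {..<j}"
        then have "C * real (Suc i) powr (p/2 - 4) \<le> C * real (Suc j) powr (p/2 - 4)"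
          using C p_ge by (intro mult_left_mono powr_mono2) auto
        with K[of i] show "(LINT x|unif. kink_sum (block_coeff i) (block_len i) x) \<le> C * real (Suc j) powr (p/2 - 4)" by linarith
      qed
      also have "\<dots> = C * (real j * real (Suc j) powr (p/2 - 4))" by simp
      also have "\<dots> \<le> C * (real (Suc j) powr 1 * real (Suc j) powr (p/2 - 4))" using C by (intro mult_left_mono mult_right_mono) auto
      also have "real (Suc j) powr 1 * real (Suc j) powr (p/2 - 4) = real (Suc j) powr (p/2 - 3)" unfolding powr_add[symmetric] by simp
      finally show ?thesis .
    qed
    show "p/2 - 3 - scale l < - 1" using scale_gt[OF l] by simp
  qed (rule drift_nonneg)
qed

text \<open>Up to block 2^i the squared gaps have total mean of order 2^(i (p - 7/9)), and the
  maximal inequality adds the factor (i+1)^2. As 2 * scale l exceeds p - 1/2, the quotient is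
  summable over the dyadic levels i.\<close>

lemma gap_sums_vanish:
  assumes l: "l < \<delta> / 32"
  shows "AE \<omega> in M. (\<lambda>j. (\<Sum>k<j. d k \<omega>) / real (Suc j) powr scale l) \<longlonglongrightarrow> 0"
proof -
  let ?q = "scale l"
  have q: "0 \<le> ?q" "2 * ?q > p - 1/2" using scale_gt[OF l] p_ge by auto
  obtain C where C: "C \<ge> 0" and D: "\<And>j. (LINT g|stdn. (gap j g)\<^sup>2) \<le> C * real (Suc j) powr (p - 16/9)"
    using gap_sq_bound by blast
  define E where "E i \<omega> = dyadic_energy (\<lambda>j. d j \<omega>) i 0" for i \<omega>
  define Y where "Y i \<omega> = real (Suc i) * E i \<omega> / (2 ^ i) powr (2 * ?q)" for i \<omega>
  have Ei: "integrable M (E i)" and Ee: "(LINT \<omega>|M. E i \<omega>) \<le> real (Suc i) * (\<Sum>k=0..<0 + 2 ^ i. LINT \<omega>|M. (d k \<omega>)\<^sup>2)" for i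
    unfolding E_def[abs_def] by (rule dyadic_energy_expectation[OF d_products(1,2)]; assumption)+
  have E0: "0 \<le> E i \<omega>" for i \<omega> unfolding E_def by (rule dyadic_energy_nonneg)
  define x where "x = p - 7/9 - 2 * ?q"
  have x: "x < 0" using q by (simp add: x_def)
  have "AE \<omega> in M. (\<lambda>i. Y i \<omega>) \<longlonglongrightarrow> 0"
  proof (rule AE_tendsto_0_of_summable_integral)
    show "integrable M (Y i)" for i unfolding Y_def[abs_def] by (intro integrable_divide integrable_mult_right Ei)
    show Y0: "0 \<le> Y i \<omega>" for i \<omega> unfolding Y_def by (intro divide_nonneg_nonneg mult_nonneg_nonneg E0) auto
    show "summable (\<lambda>i. LINT \<omega>|M. Y i \<omega>)"
    proof (rule summable_comparison_test'[of "\<lambda>i. C * ((real (Suc i))\<^sup>2 * (2 ^ i) powr x)" 0])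
      show "summable (\<lambda>i. C * ((real (Suc i))\<^sup>2 * (2 ^ i) powr x))" by (intro summable_mult summable_square_geometric x)
      fix i
      have "(\<Sum>k=0..<0 + 2 ^ i. LINT \<omega>|M. (d k \<omega>)\<^sup>2) \<le> (\<Sum>k=0..<0 + 2 ^ i :: nat. C * (2 ^ i) powr (p - 16/9))"
      proof (rule sum_mono)
        fix k assume "k \<in> {0..<0 + 2 ^ i :: nat}"
        then have "Suc k \<le> 2 ^ i" by simp
        then have "real (Suc k) \<le> 2 ^ i" by (metis of_nat_le_iff of_nat_numeral of_nat_power)
        then have "C * real (Suc k) powr (p - 16/9) \<le> C * (2 ^ i) powr (p - 16/9)"
          using C p_ge by (intro mult_left_mono powr_mono2) auto
        with D[of k] show "(LINT \<omega>|M. (d k \<omega>)\<^sup>2) \<le> C * (2 ^ i) powr (p - 16/9)" unfolding d_products(3) by linarith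
      qed
      also have "\<dots> = C * ((2 ^ i) powr 1 * (2 ^ i) powr (p - 16/9))" by simp
      also have "(2 ^ i) powr 1 * (2 ^ i) powr (p - 16/9) = ((2 :: real) ^ i) powr (p - 7/9)" unfolding powr_add[symmetric] by simp
      finally have S: "(\<Sum>k=0..<0 + 2 ^ i. LINT \<omega>|M. (d k \<omega>)\<^sup>2) \<le> C * (2 ^ i) powr (p - 7/9)" .
      have "(LINT \<omega>|M. Y i \<omega>) = real (Suc i) * (LINT \<omega>|M. E i \<omega>) / (2 ^ i) powr (2 * ?q)" unfolding Y_def by simp
      also have "\<dots> \<le> real (Suc i) * (real (Suc i) * (C * (2 ^ i) powr (p - 7/9))) / (2 ^ i) powr (2 * ?q)"
        by (intro divide_right_mono mult_left_mono order_trans[OF Ee] S) auto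
      also have "\<dots> = C * ((real (Suc i))\<^sup>2 * ((2 ^ i) powr (p - 7/9) / (2 ^ i) powr (2 * ?q)))" by (simp only: power2_eq_square times_divide_eq_right mult_ac)
      also have "(2 ^ i) powr (p - 7/9) / (2 ^ i) powr (2 * ?q) = ((2 :: real) ^ i) powr x" unfolding x_def powr_diff ..
      finally have "(LINT \<omega>|M. Y i \<omega>) \<le> C * ((real (Suc i))\<^sup>2 * (2 ^ i) powr x)" .
      moreover have "0 \<le> (LINT \<omega>|M. Y i \<omega>)" by (intro Bochner_Integration.integral_nonneg Y0)
      ultimately show "norm (LINT \<omega>|M. Y i \<omega>) \<le> C * ((real (Suc i))\<^sup>2 * (2 ^ i) powr x)" by simp
    qed
  qed
  then show ?thesis
  proof eventually_elim
    case (elim \<omega>)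
    \<comment> \<open>The first dyadic level that covers j; it overshoots by a factor of at most 2,
      which costs the constant 2 powr (2 * scale l).\<close>
    define I where "I j = (LEAST i. Suc j \<le> 2 ^ i)" for j :: nat
    have "\<exists>i. Suc j \<le> 2 ^ i" for j :: nat using less_exp[of "Suc j"] by (intro exI[of _ "Suc j"]) simp
    then have I: "Suc j \<le> 2 ^ I j" for j unfolding I_def by (rule LeastI_ex)
    have I2: "(2 :: real) ^ I j \<le> 2 * real (Suc j)" for j
    proof (cases "I j")
      case (Suc k)
      then have "k < I j" by simp
      then have "\<not> Suc j \<le> 2 ^ k" unfolding I_def by (rule not_less_Least)
      then have "2 ^ k \<le> Suc j" by simp
      then have "(2 :: real) ^ k \<le> real (Suc j)" by (metis of_nat_le_iff of_nat_numeral of_nat_power)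
      then show ?thesis unfolding Suc by simp
    qed simp
    have "filterlim I at_top sequentially"
      unfolding filterlim_at_top eventually_sequentially
    proof (intro allI exI impI)
      fix m j :: nat assume "2 ^ m \<le> j"
      then have "(2 :: nat) ^ m < 2 ^ I j" using I[of j] by linarith
      then show "m \<le> I j" by simp
    qed
    then have lim: "(\<lambda>j. 2 powr (2 * ?q) * Y (I j) \<omega>) \<longlonglongrightarrow> 0"
      using filterlim_compose[OF elim] by (intro tendsto_mult_right_zero)
    have "((\<Sum>k<j. d k \<omega>) / real (Suc j) powr ?q)\<^sup>2 \<le> 2 powr (2 * ?q) * Y (I j) \<omega>" for j
    proof -
      have z: "(2 * z) powr (2 * ?q) = 2 powr (2 * ?q) * (z powr ?q)\<^sup>2" if "0 \<le> z" for z :: real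
        using that by (simp add: powr_mult power2_eq_square powr_add[symmetric])
      have "j \<le> 2 ^ I j" using I[of j] by simp
      then have "(\<Sum>k=0..<0 + j. d k \<omega>)\<^sup>2 \<le> real (Suc (I j)) * E (I j) \<omega>" unfolding E_def by (rule partial_sum_le_dyadic_energy)
      also have "\<dots> = Y (I j) \<omega> * (2 ^ I j) powr (2 * ?q)" by (simp add: Y_def)
      also have "\<dots> \<le> Y (I j) \<omega> * (2 * real (Suc j)) powr (2 * ?q)"
        using q E0 by (intro mult_left_mono powr_mono2 I2) (auto simp: Y_def)
      also have "Y (I j) \<omega> * (2 * real (Suc j)) powr (2 * ?q) = 2 powr (2 * ?q) * Y (I j) \<omega> * (real (Suc j) powr ?q)\<^sup>2"
        unfolding z[OF of_nat_0_le_iff] by (simp only: mult_ac)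
      finally have "(\<Sum>k<j. d k \<omega>)\<^sup>2 \<le> 2 powr (2 * ?q) * Y (I j) \<omega> * (real (Suc j) powr ?q)\<^sup>2" by (simp add: atLeast0LessThan)
      then show ?thesis unfolding power_divide by (subst pos_divide_le_eq) auto
    qed
    then have "(\<lambda>j. ((\<Sum>k<j. d k \<omega>) / real (Suc j) powr ?q)\<^sup>2) \<longlonglongrightarrow> 0"
      by (intro Lim_null_comparison[OF _ lim] always_eventually allI) simp
    then show ?case by (simp only: power_tendsto_0_iff zero_less_numeral)
  qed
qed

text \<open>This controls the oscillation of the Brownian path inside a block. The expectation is of
  order j^(2p-2), and 4 * scale l > 2p - 1 is exactly what summability demands, so l < \<delta>/32
  is used in full.\<close>

lemma bridge_vanishes:
  assumes l: "l < \<delta> / 32"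
  shows "AE \<omega> in M. (\<lambda>j. (clock.\<Delta> j)\<^sup>2 * \<bar>bridge_moment j \<omega>\<bar> / real (Suc j) powr (4 * scale l)) \<longlonglongrightarrow> 0"
proof -
  obtain C where C: "C \<ge> 0" and D: "\<And>j. clock.\<Delta> j \<le> C * real (Suc j) powr (p - 1)" using \<Delta>_bound by blast
  show ?thesis
  proof (rule AE_powr_negligible[where C="C\<^sup>2 * \<bar>moment_const\<bar>" and x="2 * p - 2"])
    show "integrable M (\<lambda>\<omega>. (clock.\<Delta> j)\<^sup>2 * \<bar>bridge_moment j \<omega>\<bar>)" for j
      by (intro integrable_mult_right integrable_abs bridge_moment_integral)
    show "(LINT \<omega>|M. (clock.\<Delta> j)\<^sup>2 * \<bar>bridge_moment j \<omega>\<bar>) \<le> C\<^sup>2 * \<bar>moment_const\<bar> * real (Suc j) powr (2 * p - 2)" for j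
    proof -
      have "(LINT \<omega>|M. \<bar>bridge_moment j \<omega>\<bar>) = (LINT \<omega>|M. bridge_moment j \<omega>)"
      proof (rule integral_cong_AE)
        show "AE \<omega> in M. \<bar>bridge_moment j \<omega>\<bar> = bridge_moment j \<omega>"
          using AE_regular by eventually_elim (simp add: bridge_moment_nonneg)
      qed (intro borel_measurable_integrable integrable_abs bridge_moment_integral)+
      moreover have "0 \<le> (LINT \<omega>|M. \<bar>bridge_moment j \<omega>\<bar>)" by (intro Bochner_Integration.integral_nonneg) simp
      ultimately have mc: "(LINT \<omega>|M. \<bar>bridge_moment j \<omega>\<bar>) = moment_const" "0 \<le> moment_const"
        by (simp_all add: bridge_moment_integral(2))
      have "(LINT \<omega>|M. (clock.\<Delta> j)\<^sup>2 * \<bar>bridge_moment j \<omega>\<bar>) = (clock.\<Delta> j)\<^sup>2 * moment_const"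
        by (simp add: mc(1))
      also have "\<dots> \<le> (C * real (Suc j) powr (p - 1))\<^sup>2 * \<bar>moment_const\<bar>"
        using clock.\<Delta>_pos[of j] mc(2) by (intro mult_mono power_mono D) auto
      also have "\<dots> = C\<^sup>2 * \<bar>moment_const\<bar> * (real (Suc j) powr (p - 1) * real (Suc j) powr (p - 1))"
        by (simp only: power_mult_distrib power2_eq_square mult_ac)
      also have "real (Suc j) powr (p - 1) * real (Suc j) powr (p - 1) = real (Suc j) powr (2 * p - 2)" unfolding powr_add[symmetric] by simp
      finally show ?thesis .
    qed
    show "2 * p - 2 - 4 * scale l < - 1" using scale_gt[OF l] by simp
  qed simp
qed

lemma ex_block_maximal:
  "\<exists>W. integrable unif W \<and> (\<forall>x. 0 \<le> W x) \<and> (\<forall>m x. m \<le> L \<longrightarrow> digit_sum \<beta> m x ^ 4 \<le> W x) \<and>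
     (LINT x|unif. W x) \<le> 4000 * 432 * (\<Sum>i<L. (\<beta> i)\<^sup>2)\<^sup>2"
proof -
  have e: "(\<Sum>k=i..<j. \<beta> k * sgn_digit k x) = digit_sum (\<lambda>k. if i \<le> k then \<beta> k else 0) j x" for i j x
    unfolding digit_sum_def by (rule sum.mono_neutral_cong_left) auto
  have s: "(\<Sum>k=i..<j. (\<beta> k)\<^sup>2) = (\<Sum>k<j. (if i \<le> k then \<beta> k else 0)\<^sup>2)" for i j
    by (rule sum.mono_neutral_cong_left) auto
  have i4: "integrable unif (\<lambda>x. (\<Sum>k=i..<j. \<beta> k * sgn_digit k x) ^ 4)" for i j
    unfolding e by (rule past_integrable[of j]) (rule past_comp[where h="\<lambda>y. y ^ 4"], rule past_digit_sum)
  have m4: "(LINT x|unif. (\<Sum>k=i..<j. \<beta> k * sgn_digit k x) ^ 4) \<le> 432 * (\<Sum>k=i..<j. (\<beta> k)\<^sup>2)\<^sup>2" for i j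
    unfolding e s by (rule digit_sum_moment4)
  have "\<exists>W. integrable unif W \<and> (\<forall>x. 0 \<le> W x) \<and> (\<forall>m x. 0 \<le> m \<longrightarrow> m \<le> L \<longrightarrow> (\<Sum>k=0..<m. \<beta> k * sgn_digit k x) ^ 4 \<le> W x) \<and>
     (LINT x|unif. W x) \<le> 4000 * 432 * (\<Sum>k=0..<L. (\<beta> k)\<^sup>2)\<^sup>2"
    by (rule moment4_maximal[where \<xi>="\<lambda>k x. \<beta> k * sgn_digit k x"]) (use i4 m4 in auto)
  then show ?thesis by (simp add: digit_sum_def atLeast0LessThan)
qed

text \<open>The maximal function is evaluated at \<open>point j\<close>, which carries the true
  digits of the final point in block j and is itself uniform. Partial sums inside a block thus need
  no correction for carries.\<close>

lemma block_maximal_vanishes: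
  "\<exists>W :: nat \<Rightarrow> 'a \<Rightarrow> real. (\<forall>j \<omega>. 0 \<le> W j \<omega>) \<and>
     (\<forall>j m \<omega>. m \<le> block_len j \<longrightarrow> digit_sum (block_coeff j) m (blocks.point j \<omega>) ^ 4 \<le> W j \<omega>) \<and>
     (\<forall>l<\<delta>/32. AE \<omega> in M. (\<lambda>j. W j \<omega> / real (Suc j) powr (4 * scale l)) \<longlonglongrightarrow> 0)"
proof -
  have "\<forall>j. \<exists>W. integrable unif W \<and> (\<forall>x. 0 \<le> W x) \<and> (\<forall>m x. m \<le> block_len j \<longrightarrow> digit_sum (block_coeff j) m x ^ 4 \<le> W x) \<and>
     (LINT x|unif. W x) \<le> 4000 * 432 * (\<Sum>i<block_len j. (block_coeff j i)\<^sup>2)\<^sup>2"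
    by (intro allI ex_block_maximal)
  from choice[OF this] obtain W where W: "\<And>j. integrable unif (W j)" "\<And>j x. 0 \<le> W j x"
    "\<And>j m x. m \<le> block_len j \<Longrightarrow> digit_sum (block_coeff j) m x ^ 4 \<le> W j x"
    "\<And>j. (LINT x|unif. W j x) \<le> 4000 * 432 * (\<Sum>i<block_len j. (block_coeff j i)\<^sup>2)\<^sup>2"
    by blast
  obtain C where C: "C \<ge> 0" and S: "\<And>j. (\<Sum>i<block_len j. (block_coeff j i)\<^sup>2) \<le> C * real (Suc j) powr (p - 1)"
    using block_sq_bound by blast
  have m: "W j \<in> borel_measurable borel" for j using borel_measurable_integrable[OF W(1)[of j]] by simp
  have i: "integrable M (\<lambda>\<omega>. W j (blocks.point j \<omega>))" "(LINT \<omega>|M. W j (blocks.point j \<omega>)) = (LINT x|unif. W j x)" for j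
    using W(1)[of j] m[of j] unfolding blocks.distr_point[of j, symmetric] by (auto simp: integrable_distr_eq integral_distr)
  have "AE \<omega> in M. (\<lambda>j. W j (blocks.point j \<omega>) / real (Suc j) powr (4 * scale l)) \<longlonglongrightarrow> 0" if l: "l < \<delta> / 32" for l
  proof (rule AE_powr_negligible[where C="4000 * 432 * C\<^sup>2" and x="2 * p - 2"])
    show "(LINT \<omega>|M. W j (blocks.point j \<omega>)) \<le> 4000 * 432 * C\<^sup>2 * real (Suc j) powr (2 * p - 2)" for j
    proof -
      have "(LINT \<omega>|M. W j (blocks.point j \<omega>)) \<le> 4000 * 432 * (C * real (Suc j) powr (p - 1))\<^sup>2"
        unfolding i(2) by (rule order_trans[OF W(4)]) (intro mult_left_mono power_mono S sum_nonneg; simp)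
      also have "\<dots> = 4000 * 432 * C\<^sup>2 * (real (Suc j) powr (p - 1) * real (Suc j) powr (p - 1))"
        by (simp only: power_mult_distrib power2_eq_square mult_ac)
      also have "real (Suc j) powr (p - 1) * real (Suc j) powr (p - 1) = real (Suc j) powr (2 * p - 2)" unfolding powr_add[symmetric] by simp
      finally show ?thesis .
    qed
    show "2 * p - 2 - 4 * scale l < - 1" using scale_gt[OF l] by simp
  qed (rule i W)+
  with W(2,3) show ?thesis by (intro exI[of _ "\<lambda>j \<omega>. W j (blocks.point j \<omega>)"] conjI allI impI)
qed

end

lemma abs_le_root4: "x ^ 4 \<le> y \<Longrightarrow> \<bar>x\<bar> \<le> root 4 y" for x y :: real
proof -
  assume "x ^ 4 \<le> y"
  then have "root 4 (x ^ 4) \<le> root 4 y" by simp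
  moreover have "\<bar>root 4 (x ^ 4)\<bar> = \<bar>x\<bar>" by (rule root_abs_power) simp
  moreover have "0 \<le> root 4 (x ^ 4)" by simp
  ultimately show ?thesis by linarith
qed

lemma root4_negligible:
  fixes Y :: "nat \<Rightarrow> real"
  assumes "(\<lambda>j. Y j / real (Suc j) powr (4 * q)) \<longlonglongrightarrow> 0"
  shows "(\<lambda>j. root 4 (Y j) / real (Suc j) powr q) \<longlonglongrightarrow> 0"
proof -
  have e: "root 4 (Y j) / real (Suc j) powr q = root 4 (Y j / real (Suc j) powr (4 * q))" for j
  proof -
    have "real (Suc j) powr (4 * q) = (real (Suc j) powr q) ^ 4" by (simp add: power4_eq_xxxx powr_add[symmetric])
    moreover have "root 4 ((real (Suc j) powr q) ^ 4) = real (Suc j) powr q" by (rule real_root_power_cancel) auto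
    ultimately show ?thesis unfolding real_root_divide by simp
  qed
  show ?thesis unfolding e using tendsto_real_root[OF assms, of 4] by simp
qed

section \<open>From block ends to all indices\<close>

context strong_approximation
begin

text \<open>Inside block j the variance may fall below T j, but only by order j^(p-8), which is less
  than the preceding time step of order j^(p-1). The last bound makes V comparable with
  (j+1)^p.\<close>

lemma V_in_block:
  "eventually (\<lambda>j. 1 \<le> j \<and> (\<forall>m. n j \<le> m \<longrightarrow> m < n (Suc j) \<longrightarrow>
     T (j - 1) \<le> V m \<and> V m < T (Suc j) \<and> real (Suc j) powr p / (2 * 2 powr p) \<le> V m)) sequentially"
proof -
  from block_facts obtain C where C: "C \<ge> 1" and ev: "eventually (\<lambda>j. \<forall>m. n j \<le> m \<longrightarrow> m < n (Suc j) \<longrightarrow>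
       T j - C * real j powr (p - 8) \<le> V m \<and> V m < T (Suc j)) sequentially"
    by (elim exE conjE) (rule that, assumption, erule eventually_mono, blast)
  \<comment> \<open>Beyond N the possible drop C j^(p-8) is at most T j / 2 and at most T j - T
    (j-1).\<close>
  obtain N :: nat where N: "2 * C * 2 powr p \<le> real N" using real_arch_simple by blast
  show ?thesis
    using ev eventually_ge_at_top[of N] eventually_ge_at_top[of 2]
  proof eventually_elim
    case (elim j)
    let ?j = "real j"
    have j: "2 \<le> ?j" "2 * C * 2 powr p \<le> ?j" using elim N by auto
    have pw: "1 \<le> (2 :: real) powr p" using p_ge by (intro ge_one_powr_ge_zero) auto
    have big: "2 * C * 2 powr p \<le> ?j powr x" if "1 \<le> x" for x
    proof -
      have "?j powr 1 \<le> ?j powr x" using j that by (intro powr_mono) auto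
      then show ?thesis using j by simp
    qed
    have C2: "2 * C \<le> 2 * C * 2 powr p" using mult_left_mono[OF pw, of "2 * C"] C by simp
    have half: "C * ?j powr (p - 8) \<le> T j / 2"
    proof -
      have "C * ?j powr (p - 8) \<le> (?j powr 8 / 2) * ?j powr (p - 8)" using big[of 8] C2 by (intro mult_right_mono) auto
      also have "\<dots> = (?j powr 8 * ?j powr (p - 8)) / 2" by simp
      also have "?j powr 8 * ?j powr (p - 8) = T j" unfolding powr_add[symmetric] T_def by simp
      finally show ?thesis .
    qed
    have step: "C * ?j powr (p - 8) \<le> T j - T (j - 1)"
    proof -
      have "0 \<le> C * 2 powr p" using C by simp
      then have "C * 2 powr p \<le> ?j powr 7" using big[of 7] by linarith
      then have "C * 2 powr p * ?j powr (p - 8) \<le> ?j powr 7 * ?j powr (p - 8)" by (rule mult_right_mono) simp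
      also have "?j powr 7 * ?j powr (p - 8) = ?j powr (p - 1)" unfolding powr_add[symmetric] by simp
      also have "?j powr (p - 1) \<le> (2 * real (j - 1)) powr (p - 1)" using elim p_ge by (intro powr_mono2) auto
      also have "\<dots> = 2 powr (p - 1) * real (j - 1) powr (p - 1)" by (simp add: powr_mult)
      also have "\<dots> \<le> 2 powr p * (T j - T (j - 1))"
      proof (intro mult_mono powr_mono)
        have "real (j - 1) powr (p - 1) \<le> T (Suc (j - 1)) - T (j - 1)" by (rule T_diff_bounds) (use elim in simp)
        then show "real (j - 1) powr (p - 1) \<le> T j - T (j - 1)" using elim by simp
      qed auto
      finally have "2 powr p * (C * ?j powr (p - 8)) \<le> 2 powr p * (T j - T (j - 1))" by (simp only: mult_ac)
      then show ?thesis using pw by simp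
    qed
    have low: "real (Suc j) powr p / (2 * 2 powr p) \<le> T j / 2"
    proof -
      have "real (Suc j) powr p \<le> (2 * ?j) powr p" using elim p_ge by (intro powr_mono2) auto
      also have "\<dots> = 2 powr p * T j" by (simp add: powr_mult T_def)
      finally show ?thesis using pw by (simp add: field_simps)
    qed
    show ?case
    proof (intro conjI allI impI)
      fix m assume m: "n j \<le> m" "m < n (Suc j)"
      then have V: "T j - C * ?j powr (p - 8) \<le> V m" and "V m < T (Suc j)" using elim by blast+
      then show "V m < T (Suc j)" by simp
      show "T (j - 1) \<le> V m" using V step by linarith
      show "real (Suc j) powr p / (2 * 2 powr p) \<le> V m" using V half low by linarith
    qed (use elim in simp)
  qed
qed

definition block_of :: "nat \<Rightarrow> nat" where "block_of m = (LEAST j. m < n (Suc j))"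

lemma block_of: "m < n (Suc (block_of m))" "n (block_of m) \<le> m"
proof -
  have "eventually (\<lambda>j. Suc m \<le> n j) sequentially" using n_top by (simp add: filterlim_at_top)
  then obtain N where N: "\<And>j. N \<le> j \<Longrightarrow> Suc m \<le> n j" unfolding eventually_sequentially by blast
  have "m < n (Suc N)" using N[of "Suc N"] by simp
  then show "m < n (Suc (block_of m))" unfolding block_of_def by (rule LeastI)
  show "n (block_of m) \<le> m"
  proof (cases "block_of m")
    case (Suc k)
    then have "k < block_of m" by simp
    then have "\<not> m < n (Suc k)" unfolding block_of_def by (rule not_less_Least)
    then show ?thesis unfolding Suc by simp
  qed (simp add: n_0)
qed

lemma block_of_top: "filterlim block_of at_top sequentially"
  unfolding filterlim_at_top eventually_sequentially
proof (intro allI exI impI)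
  fix K m assume "n (Suc K) \<le> m"
  show "K \<le> block_of m"
  proof (rule ccontr)
    assume "\<not> K \<le> block_of m"
    then have "n (Suc (block_of m)) \<le> n (Suc K)" by (intro monoD[OF mono_n]) simp
    then show False using block_of(1)[of m] \<open>n (Suc K) \<le> m\<close> by linarith
  qed
qed

text \<open>The absolute value keeps the radicand nonnegative also off the regular event, where the
  series defining the moment may diverge.\<close>

definition osc :: "nat \<Rightarrow> 'a \<Rightarrow> real" where
  "osc j \<omega> = root 4 (1000 * ((clock.\<Delta> j)\<^sup>2 * \<bar>bridge_moment j \<omega>\<bar>))"

lemma brown_osc:
  assumes "regular \<omega>" "T j \<le> t" "t \<le> T (Suc j)"
  shows "\<bar>clock.brown t \<omega> - clock.brown (T j) \<omega>\<bar> \<le> osc j \<omega>"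
  unfolding osc_def
  using clock.brown_oscillation[OF assms] bridge_moment_nonneg[OF assms(1), of j] by (intro abs_le_root4) (simp add: mult.assoc)

text \<open>Since t may lie in the preceding time interval, the path is compared through T (j-1),
  and the oscillation of that block is paid twice.\<close>

lemma brown_osc_adjacent:
  assumes reg: "regular \<omega>" and j: "1 \<le> j" and t: "T (j - 1) \<le> t" "t \<le> T (Suc j)"
  shows "\<bar>clock.brown (T j) \<omega> - clock.brown t \<omega>\<bar> \<le> osc j \<omega> + 2 * osc (j - 1) \<omega>"
proof -
  have o: "0 \<le> osc i \<omega>" for i by (simp add: osc_def)
  have S: "Suc (j - 1) = j" using j by simp
  show ?thesis
  proof (cases "T j \<le> t")
    case True
    then show ?thesis using brown_osc[OF reg True t(2)] o[of "j - 1"] by (simp add: abs_minus_commute)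
  next
    case False
    have 1: "\<bar>clock.brown t \<omega> - clock.brown (T (j - 1)) \<omega>\<bar> \<le> osc (j - 1) \<omega>" using brown_osc[OF reg t(1)] False S by simp
    have 2: "\<bar>clock.brown (T j) \<omega> - clock.brown (T (j - 1)) \<omega>\<bar> \<le> osc (j - 1) \<omega>"
      using brown_osc[OF reg, of "j - 1" "T j"] S clock.T_le_iff[of "j - 1" j] by simp
    have "\<bar>x - y\<bar> \<le> \<bar>y - z\<bar> + \<bar>x - z\<bar>" for x y z :: real by linarith
    from this[of "clock.brown (T j) \<omega>" "clock.brown t \<omega>" "clock.brown (T (j - 1)) \<omega>"]
    show ?thesis using 1 2 o[of j] by linarith
  qed
qed

lemma digit_sum_blocks:
  "digit_sum \<alpha> (n j + m) (blocks.point 0 \<omega>)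
     = (\<Sum>i<j. digit_sum (block_coeff i) (block_len i) (blocks.point i \<omega>)) + digit_sum (block_coeff j) m (blocks.point j \<omega>)"
proof -
  have split: "digit_sum \<alpha> (n j + m) (blocks.point 0 \<omega>) = digit_sum \<alpha> (n j) (blocks.point 0 \<omega>) + digit_sum (block_coeff j) m (blocks.point j \<omega>)" for j m
    unfolding digit_sum_add by (simp only: blocks.sgn_digit_point digit_sum_def block_coeff_def)
  have "digit_sum \<alpha> (n j) (blocks.point 0 \<omega>) = (\<Sum>i<j. digit_sum (block_coeff i) (block_len i) (blocks.point i \<omega>))" for j
  proof (induction j)
    case 0
    then show ?case by (simp add: n_0 digit_sum_def)
  next
    case (Suc j)
    have "n (Suc j) = n j + block_len j" using monoD[OF mono_n, of j "Suc j"] by (simp add: block_len_def)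
    then show ?case using split[of j "block_len j"] Suc by simp
  qed
  then show ?thesis unfolding split by simp
qed

text \<open>At a block end the Brownian path is a sum of block digit sums of the X i minus their
  gaps. What remains is the unfinished block, the carries between X and the true digits, and the sum
  of the gaps.\<close>

lemma digit_sum_brown:
  "\<bar>digit_sum \<alpha> (n j + m) (blocks.point 0 \<omega>) - clock.brown (T j) \<omega>\<bar>
     \<le> \<bar>digit_sum (block_coeff j) m (blocks.point j \<omega>)\<bar> + drift j \<omega> + \<bar>\<Sum>i<j. d i \<omega>\<bar>"
proof -
  let ?P = "\<lambda>i. digit_sum (block_coeff i) (block_len i) (blocks.point i \<omega>)"
  let ?X = "\<lambda>i. digit_sum (block_coeff i) (block_len i) (X i \<omega>)"
  have "clock.brown (T j) \<omega> = (\<Sum>i<j. ?X i - d i \<omega>)" unfolding clock.brown_T d_eq by simp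
  then have e: "digit_sum \<alpha> (n j + m) (blocks.point 0 \<omega>) - clock.brown (T j) \<omega>
     = digit_sum (block_coeff j) m (blocks.point j \<omega>) + (\<Sum>i<j. ?P i - ?X i) + (\<Sum>i<j. d i \<omega>)"
    unfolding digit_sum_blocks by (simp add: sum_subtractf)
  have "\<bar>\<Sum>i<j. ?P i - ?X i\<bar> \<le> drift j \<omega>"
    unfolding drift_def using blocks.digit_sum_point_near[of "block_coeff i" i \<omega> for i]
    by (intro order_trans[OF sum_abs] sum_mono) (simp add: len_eq)
  moreover have "\<bar>x + y + z\<bar> \<le> \<bar>x\<bar> + \<bar>y\<bar> + \<bar>z\<bar>" for x y z :: real by linarith
  note this[of "digit_sum (block_coeff j) m (blocks.point j \<omega>)" "\<Sum>i<j. ?P i - ?X i" "\<Sum>i<j. d i \<omega>"]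
  ultimately show ?thesis unfolding e by linarith
qed

lemma digit_sum_close_to_brown:
  assumes l: "l < \<delta> / 32"
  shows "AE \<omega> in M. (\<lambda>m. \<bar>digit_sum \<alpha> m (blocks.point 0 \<omega>) - clock.brown (V m) \<omega>\<bar> / V m powr (1/2 - l)) \<longlonglongrightarrow> 0"
proof -
  let ?q = "scale l"
  obtain W :: "nat \<Rightarrow> 'a \<Rightarrow> real" where W: "\<And>j \<omega>. 0 \<le> W j \<omega>"
    "\<And>j m \<omega>. m \<le> block_len j \<Longrightarrow> digit_sum (block_coeff j) m (blocks.point j \<omega>) ^ 4 \<le> W j \<omega>"
    and WA: "\<And>l. l < \<delta> / 32 \<Longrightarrow> AE \<omega> in M. (\<lambda>j. W j \<omega> / real (Suc j) powr (4 * scale l)) \<longlonglongrightarrow> 0"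
    using block_maximal_vanishes by blast
  \<comment> \<open>Converts the normalisation by (j+1)^(scale l) into one by
    \<open>V m powr (1/2 - l)\<close>, through the last bound of \<open>V_in_block\<close>.\<close>
  define c where "c = (1 / (2 * 2 powr p)) powr (1/2 - l)"
  have c: "0 < c" by (simp add: c_def)
  have l2: "0 \<le> 1/2 - l" using l \<delta>_le_1 by simp
  show ?thesis
    using WA[OF l] drift_vanishes[OF l] gap_sums_vanish[OF l] bridge_vanishes[OF l] AE_regular
  proof eventually_elim
    case (elim \<omega>)
    define Z where "Z j = root 4 (W j \<omega>) + drift j \<omega> + \<bar>\<Sum>i<j. d i \<omega>\<bar> + osc j \<omega> + 2 * osc (j - 1) \<omega>" for j
    have o: "(\<lambda>j. osc j \<omega> / real (Suc j) powr ?q) \<longlonglongrightarrow> 0"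
      unfolding osc_def
    proof (rule root4_negligible)
      show "(\<lambda>j. 1000 * ((clock.\<Delta> j)\<^sup>2 * \<bar>bridge_moment j \<omega>\<bar>) / real (Suc j) powr (4 * ?q)) \<longlonglongrightarrow> 0"
        using tendsto_mult_right_zero[OF elim(4), of 1000] by simp
    qed
    have q: "0 \<le> ?q" using scale_gt[OF l] p_ge by simp
    have o': "(\<lambda>j. osc (j - 1) \<omega> / real (Suc j) powr ?q) \<longlonglongrightarrow> 0"
    proof (rule Lim_null_comparison)
      show "(\<lambda>j. osc (j - 1) \<omega> / real (Suc (j - 1)) powr ?q) \<longlonglongrightarrow> 0"
        by (rule filterlim_compose[OF o filterlim_minus_const_nat_at_top])
      have "osc (j - 1) \<omega> / real (Suc j) powr ?q \<le> osc (j - 1) \<omega> / real (Suc (j - 1)) powr ?q" for j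
        using q by (intro divide_left_mono powr_mono2) (auto simp: osc_def)
      moreover have "0 \<le> osc (j - 1) \<omega> / real (Suc j) powr ?q" for j by (simp add: osc_def)
      ultimately show "\<forall>\<^sub>F j in sequentially. norm (osc (j - 1) \<omega> / real (Suc j) powr ?q) \<le> osc (j - 1) \<omega> / real (Suc (j - 1)) powr ?q"
        unfolding real_norm_def by (intro always_eventually allI) (simp only: abs_of_nonneg)
    qed
    have s: "(\<lambda>j. \<bar>\<Sum>i<j. d i \<omega>\<bar> / real (Suc j) powr ?q) \<longlonglongrightarrow> 0"
      using tendsto_rabs_zero[OF elim(3)] by simp
    have ZS: "(\<lambda>j. Z j / real (Suc j) powr ?q) \<longlonglongrightarrow> 0"
      using tendsto_add_zero[OF tendsto_add_zero[OF tendsto_add_zero[OF tendsto_add_zero[OF root4_negligible[OF elim(1)] elim(2)] s] o]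
          tendsto_mult_right_zero[OF o', of 2]]
      by (simp add: Z_def add_divide_distrib)
    have lim: "(\<lambda>m. (1 / c) * (Z (block_of m) / real (Suc (block_of m)) powr ?q)) \<longlonglongrightarrow> 0"
      by (intro tendsto_mult_right_zero filterlim_compose[OF ZS block_of_top])
    have "\<forall>\<^sub>F m in sequentially. norm (\<bar>digit_sum \<alpha> m (blocks.point 0 \<omega>) - clock.brown (V m) \<omega>\<bar> / V m powr (1/2 - l))
        \<le> (1 / c) * (Z (block_of m) / real (Suc (block_of m)) powr ?q)"
      using eventually_compose_filterlim[OF V_in_block block_of_top]
    proof eventually_elim
      case (elim m)
      let ?j = "block_of m"
      have j: "1 \<le> ?j" "T (?j - 1) \<le> V m" "V m < T (Suc ?j)" "real (Suc ?j) powr p / (2 * 2 powr p) \<le> V m"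
        using elim block_of[of m] by auto
      have m: "n ?j + (m - n ?j) = m" "m - n ?j \<le> block_len ?j" using block_of[of m] by (auto simp: block_len_def)
      have 1: "\<bar>digit_sum \<alpha> m (blocks.point 0 \<omega>) - clock.brown (T ?j) \<omega>\<bar> \<le> root 4 (W ?j \<omega>) + drift ?j \<omega> + \<bar>\<Sum>i<?j. d i \<omega>\<bar>"
        using digit_sum_brown[of ?j "m - n ?j" \<omega>] abs_le_root4[OF W(2)[OF m(2), of \<omega>]] unfolding m(1) by linarith
      have 2: "\<bar>clock.brown (T ?j) \<omega> - clock.brown (V m) \<omega>\<bar> \<le> osc ?j \<omega> + 2 * osc (?j - 1) \<omega>"
        using j by (intro brown_osc_adjacent \<open>regular \<omega>\<close>) auto
      have "\<bar>x - z\<bar> \<le> \<bar>x - y\<bar> + \<bar>y - z\<bar>" for x y z :: real by linarith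
      from this[of "digit_sum \<alpha> m (blocks.point 0 \<omega>)" "clock.brown (V m) \<omega>" "clock.brown (T ?j) \<omega>"]
      have ZZ: "\<bar>digit_sum \<alpha> m (blocks.point 0 \<omega>) - clock.brown (V m) \<omega>\<bar> \<le> Z ?j" unfolding Z_def using 1 2 by linarith
      have "c * real (Suc ?j) powr ?q = (real (Suc ?j) powr p / (2 * 2 powr p)) powr (1/2 - l)"
        unfolding c_def scale_def powr_powr[symmetric] by (subst powr_mult[symmetric]) auto
      also have "\<dots> \<le> V m powr (1/2 - l)" using j(4) l2 by (intro powr_mono2) auto
      finally have v: "c * real (Suc ?j) powr ?q \<le> V m powr (1/2 - l)" .
      have "\<bar>digit_sum \<alpha> m (blocks.point 0 \<omega>) - clock.brown (V m) \<omega>\<bar> / V m powr (1/2 - l) \<le> Z ?j / (c * real (Suc ?j) powr ?q)"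
        using ZZ v c by (intro frac_le) auto
      then show ?case by simp
    qed
    with lim show ?case by (rule Lim_null_comparison[rotated])
  qed
qed

end

section \<open>Increments of the function and transfer to the torus\<close>

lemma measurable_to_torus[measurable]: "to_torus \<in> borel_measurable borel"
  by (rule borel_measurable_continuous_onI) (simp add: continuous_on_open_vimage open_torus_def)

lemma distr_unif_to_torus: "distr unif borel to_torus = torus_measure"
proof (rule measure_eqI)
  fix S assume "S \<in> sets (distr unif borel to_torus)"
  then have S: "S \<in> sets borel" by simp
  then have P[measurable]: "to_torus -` S \<in> sets borel" using measurable_sets[OF measurable_to_torus S] by simp
  have m: "to_torus \<in> measurable (restrict_space lborel {0..<1}) borel"
    by (rule measurable_restrict_space1) simp
  have "emeasure (distr unif borel to_torus) S = emeasure unif (to_torus -` S)" using S by (simp add: emeasure_distr)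
  also have "\<dots> = (\<integral>\<^sup>+x. indicator {0..<1} x * indicator (to_torus -` S) x \<partial>lborel)"
    unfolding unif_def by (rule emeasure_density) auto
  also have "\<dots> = (\<integral>\<^sup>+x. indicator (to_torus -` S \<inter> {0..<1}) x \<partial>lborel)"
    by (intro nn_integral_cong) (auto simp: indicator_def)
  also have "\<dots> = emeasure lborel (to_torus -` S \<inter> {0..<1})" by (rule nn_integral_indicator) simp
  also have "\<dots> = emeasure (restrict_space lborel {0..<1}) (to_torus -` S \<inter> {0..<1})" by (rule emeasure_restrict_space[symmetric]) auto
  also have "\<dots> = emeasure torus_measure S" unfolding torus_measure_def using S m by (simp add: emeasure_distr space_restrict_space)
  finally show "emeasure (distr unif borel to_torus) S = emeasure torus_measure S" .
qed (simp add: torus_measure_def)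

lemma takagi_to_torus: "takagi r a (to_torus u + to_torus h) = takagi_real r a (u + h)" "takagi r a (to_torus u) = takagi_real r a u"
  by (simp_all add: plus_torus.abs_eq takagi.abs_eq)

context radix
begin

text \<open>The first bound is the hypothesis of \<open>takagi_increment\<close>; the second turns
  the factor r^(-m) in the tail of the series into a multiple of |h|.\<close>

lemma log_scale_bounds:
  assumes "0 < \<bar>h\<bar>" "\<bar>h\<bar> < 1"
  shows "\<bar>h\<bar> \<le> 1 / real r ^ log_scale r h" "1 / real r ^ log_scale r h \<le> real r * \<bar>h\<bar>"
proof -
  let ?L = "log (real r) (1 / \<bar>h\<bar>)" and ?m = "log_scale r h"
  have r: "1 < real r" using r_ge_2 by simp
  have L0: "0 \<le> ?L" using assms r by (simp add: zero_le_log_cancel_iff)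
  have m: "real ?m \<le> ?L" "?L \<le> real ?m + 1" unfolding log_scale_def using L0 by linarith+
  have hp: "real r powr ?L = 1 / \<bar>h\<bar>" using assms r by (intro powr_log_cancel) auto
  have "real r powr real ?m \<le> real r powr ?L" using m r by (intro powr_mono) auto
  then have 1: "real r ^ ?m \<le> 1 / \<bar>h\<bar>" unfolding hp using r by (simp add: powr_realpow)
  have "real r powr ?L \<le> real r powr (real ?m + 1)" using m r by (intro powr_mono) auto
  then have 2: "1 / \<bar>h\<bar> \<le> real r ^ ?m * real r" unfolding hp using r by (simp add: powr_realpow powr_add)
  have rp: "0 < real r ^ ?m" using r by simp
  show "\<bar>h\<bar> \<le> 1 / real r ^ ?m" using 1 rp assms by (simp add: field_simps)
  show "1 / real r ^ ?m \<le> real r * \<bar>h\<bar>" using 2 rp assms by (simp add: field_simps)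
qed

lemma log_scale_top: "filterlim (log_scale r) at_top (at 0)"
  unfolding filterlim_at_top
proof
  fix Z :: nat
  have r: "1 < real r" using r_ge_2 by simp
  have "eventually (\<lambda>h :: real. dist h 0 < 1 / real r ^ Z) (at 0)"
    unfolding eventually_at by (intro exI[of _ "1 / real r ^ Z"]) (use r in auto)
  moreover have "eventually (\<lambda>h :: real. h \<noteq> 0) (at 0)" by (simp add: eventually_at_filter)
  ultimately show "eventually (\<lambda>h. Z \<le> log_scale r h) (at 0)"
  proof eventually_elim
    case (elim h)
    have h: "0 < \<bar>h\<bar>" "\<bar>h\<bar> < 1 / real r ^ Z" using elim by auto
    have "1 / real r ^ Z \<le> 1" using r by (simp add: one_le_power)
    have "real r powr real Z \<le> 1 / \<bar>h\<bar>" using h r by (simp add: powr_realpow field_simps)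
    then have "real Z \<le> log (real r) (1 / \<bar>h\<bar>)" using h r by (subst le_log_iff) auto
    then show ?case unfolding log_scale_def by linarith
  qed
qed

end

context strong_approximation
begin

text \<open>The tail term divided by \<open>A powr (1/2 - l)\<close> is of order
  \<open>A powr (l - \<delta> / 2)\<close>, a negative power. Normalisation by A passes to V through
  A <= 4 V, because 1/2 - l is nonnegative.\<close>

lemma increment_error_vanishes:
  assumes l: "l < \<delta> / 32"
  shows "AE \<omega> in M. (\<lambda>m. (kink_sum \<alpha> m (blocks.point 0 \<omega>) + K * A m powr ((1 - \<delta>) / 2)
     + \<bar>digit_sum \<alpha> m (blocks.point 0 \<omega>) - clock.brown (V m) \<omega>\<bar>) / V m powr (1/2 - l)) \<longlonglongrightarrow> 0"
proof -
  have "AE x in distr M borel (blocks.point 0). (\<lambda>m. kink_sum \<alpha> m x / A m powr (1/2 - l)) \<longlonglongrightarrow> 0"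
    unfolding blocks.distr_point by (rule kink_sum_vanishes[OF l])
  then have kink: "AE \<omega> in M. (\<lambda>m. kink_sum \<alpha> m (blocks.point 0 \<omega>) / A m powr (1/2 - l)) \<longlonglongrightarrow> 0"
    by (rule AE_distrD[rotated]) (rule blocks.measurable_point)
  have tail: "(\<lambda>m. A m powr (l - \<delta> / 2)) \<longlonglongrightarrow> 0"
    using l \<delta>_pos by (intro tendsto_neg_powr A_top) auto
  have l2: "0 \<le> 1/2 - l" using l \<delta>_le_1 by simp
  show ?thesis
    using kink digit_sum_close_to_brown[OF l]
  proof eventually_elim
    case (elim \<omega>)
    let ?k = "\<lambda>m. kink_sum \<alpha> m (blocks.point 0 \<omega>)"
    have AV: "\<forall>\<^sub>F m in sequentially. 0 < A m \<and> 0 < V m \<and> A m powr (1/2 - l) / 4 powr (1/2 - l) \<le> V m powr (1/2 - l)"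
      using eventually_A_ge[of 1]
    proof eventually_elim
      case (elim m)
      have "A m powr (1/2 - l) \<le> (4 * V m) powr (1/2 - l)" using elim l2 A_le_V by (intro powr_mono2) auto
      also have "\<dots> = 4 powr (1/2 - l) * V m powr (1/2 - l)" using V_nonneg by (simp add: powr_mult)
      finally show ?case using elim A_le_V[of m] by (simp add: field_simps)
    qed
    have cmp: "(\<lambda>m. f m / V m powr (1/2 - l)) \<longlonglongrightarrow> 0" if f: "(\<lambda>m. f m / A m powr (1/2 - l)) \<longlonglongrightarrow> 0" for f :: "nat \<Rightarrow> real"
    proof (rule Lim_null_comparison)
      show "(\<lambda>m. 4 powr (1/2 - l) * \<bar>f m / A m powr (1/2 - l)\<bar>) \<longlonglongrightarrow> 0"
        by (intro tendsto_mult_right_zero tendsto_rabs_zero f)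
      show "\<forall>\<^sub>F m in sequentially. norm (f m / V m powr (1/2 - l)) \<le> 4 powr (1/2 - l) * \<bar>f m / A m powr (1/2 - l)\<bar>"
        using AV
      proof eventually_elim
        case (elim m)
        have "\<bar>f m\<bar> / V m powr (1/2 - l) \<le> \<bar>f m\<bar> / (A m powr (1/2 - l) / 4 powr (1/2 - l))"
          using elim by (intro divide_left_mono mult_pos_pos) auto
        then show ?case by (simp add: mult.commute)
      qed
    qed
    have t: "(\<lambda>m. K * A m powr ((1 - \<delta>) / 2) / A m powr (1/2 - l)) \<longlonglongrightarrow> 0"
    proof -
      have e: "(1 - \<delta>) / 2 - (1/2 - l) = l - \<delta> / 2" by (simp add: diff_divide_distrib)
      have "A m powr ((1 - \<delta>) / 2) / A m powr (1/2 - l) = A m powr (l - \<delta> / 2)" for m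
        unfolding powr_diff[symmetric] e ..
      then show ?thesis
        unfolding times_divide_eq_right[symmetric] by (simp only:) (intro tendsto_mult_right_zero tail)
    qed
    show ?case
      using tendsto_add_zero[OF tendsto_add_zero[OF cmp[OF elim(1)] cmp[OF t]] elim(2)] by (simp add: add_divide_distrib)
  qed
qed

text \<open>The errors from kinks, from the tail of the series and from the digit sum are all
  multiples of |h|; \<open>R\<close> collects the factors, evaluated at the index m belonging to
  h.\<close>

lemma takagi_approximation:
  assumes l: "l < \<delta> / 32"
  shows "AE \<omega> in M. (\<lambda>h. takagi_real r a (blocks.point 0 \<omega> + h) - takagi_real r a (blocks.point 0 \<omega>)
       - h * clock.brown (V (log_scale r h)) \<omega>) \<in> o[at 0](\<lambda>h. h * V (log_scale r h) powr (1/2 - l))"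
proof -
  have sm: "summable (\<lambda>i. \<bar>\<alpha> i\<bar> / real r ^ i)" using tail_bound by blast
  obtain C where C: "C > 0" "eventually (\<lambda>m. (\<Sum>i. \<bar>\<alpha> (i + m)\<bar> / real r ^ (i + m)) \<le> C * A m powr ((1 - \<delta>) / 2) / real r ^ m) sequentially"
    using tail_bound by blast
  show ?thesis
    using increment_error_vanishes[OF l, of "real r * C"]
  proof eventually_elim
    case (elim \<omega>)
    define u where "u = blocks.point 0 \<omega>"
    define R where "R m = kink_sum \<alpha> m u + real r * C * A m powr ((1 - \<delta>) / 2) + \<bar>digit_sum \<alpha> m u - clock.brown (V m) \<omega>\<bar>" for m
    have R: "(\<lambda>m. R m / V m powr (1/2 - l)) \<longlonglongrightarrow> 0" using elim unfolding R_def u_def .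
    have f: "takagi_real r a y = (\<Sum>i. \<alpha> i / real r ^ i * dist_int (real r ^ i * y))" for y
      unfolding takagi_real_def \<alpha>_def ..
    have "(\<lambda>h. takagi_real r a (u + h) - takagi_real r a u - h * clock.brown (V (log_scale r h)) \<omega>)
        \<in> o[at 0](\<lambda>h. h * V (log_scale r h) powr (1/2 - l))"
    proof (rule landau_o.smallI)
      fix c :: real assume c: "0 < c"
      have "\<forall>\<^sub>F m in sequentially. R m / V m powr (1/2 - l) < c" using order_tendstoD(2)[OF R c] .
      then have "\<forall>\<^sub>F m in sequentially. R m \<le> c * V m powr (1/2 - l) \<and> (\<Sum>i. \<bar>\<alpha> (i + m)\<bar> / real r ^ (i + m)) \<le> C * A m powr ((1 - \<delta>) / 2) / real r ^ m"
        using C(2) eventually_A_ge[of 1]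
      proof eventually_elim
        case (elim m)
        have "0 < V m" using elim A_le_V[of m] by simp
        then have "0 < V m powr (1/2 - l)" by simp
        then show ?case using elim by (simp add: pos_divide_less_eq)
      qed
      from eventually_compose_filterlim[OF this log_scale_top]
      have "\<forall>\<^sub>F h in at 0. R (log_scale r h) \<le> c * V (log_scale r h) powr (1/2 - l) \<and>
          (\<Sum>i. \<bar>\<alpha> (i + log_scale r h)\<bar> / real r ^ (i + log_scale r h)) \<le> C * A (log_scale r h) powr ((1 - \<delta>) / 2) / real r ^ log_scale r h" .
      moreover have "\<forall>\<^sub>F h :: real in at 0. dist h 0 < 1" unfolding eventually_at by (intro exI[of _ 1]) auto
      moreover have "\<forall>\<^sub>F h :: real in at 0. h \<noteq> 0" by (simp add: eventually_at_filter)
      ultimately show "\<forall>\<^sub>F h in at 0. norm (takagi_real r a (u + h) - takagi_real r a u - h * clock.brown (V (log_scale r h)) \<omega>)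
           \<le> c * norm (h * V (log_scale r h) powr (1/2 - l))"
      proof eventually_elim
        case (elim h)
        define m where "m = log_scale r h"
        have h: "0 < \<bar>h\<bar>" "\<bar>h\<bar> < 1" using elim by auto
        have hb: "\<bar>h\<bar> \<le> 1 / real r ^ m" "1 / real r ^ m \<le> real r * \<bar>h\<bar>" unfolding m_def by (rule log_scale_bounds[OF h])+
        let ?D = "takagi_real r a (u + h) - takagi_real r a u" and ?w = "digit_sum \<alpha> m u" and ?B = "clock.brown (V m) \<omega>"
        have 1: "\<bar>?D - h * ?w\<bar> \<le> \<bar>h\<bar> * kink_sum \<alpha> m u + (\<Sum>i. \<bar>\<alpha> (i + m)\<bar> / real r ^ (i + m))"
          unfolding f by (rule takagi_increment[OF sm hb(1)])
        have "(\<Sum>i. \<bar>\<alpha> (i + m)\<bar> / real r ^ (i + m)) \<le> C * A m powr ((1 - \<delta>) / 2) * (1 / real r ^ m)" using elim unfolding m_def by simp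
        also have "\<dots> \<le> C * A m powr ((1 - \<delta>) / 2) * (real r * \<bar>h\<bar>)" using C hb(2) by (intro mult_left_mono) auto
        finally have 2: "(\<Sum>i. \<bar>\<alpha> (i + m)\<bar> / real r ^ (i + m)) \<le> \<bar>h\<bar> * (real r * C * A m powr ((1 - \<delta>) / 2))" by (simp only: mult_ac)
        have "\<bar>x - h * z\<bar> \<le> \<bar>x - h * y\<bar> + \<bar>h\<bar> * \<bar>y - z\<bar>" for x y z
          unfolding abs_mult[symmetric] right_diff_distrib by linarith
        from this[of ?D ?B ?w] have "\<bar>?D - h * ?B\<bar> \<le> \<bar>h\<bar> * kink_sum \<alpha> m u + \<bar>h\<bar> * (real r * C * A m powr ((1 - \<delta>) / 2)) + \<bar>h\<bar> * \<bar>?w - ?B\<bar>"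
          using 1 2 by linarith
        also have "\<dots> = \<bar>h\<bar> * R m" unfolding R_def distrib_left ..
        also have "\<dots> \<le> \<bar>h\<bar> * (c * V m powr (1/2 - l))" using elim unfolding m_def by (intro mult_left_mono) auto
        finally show ?case unfolding m_def by (simp add: abs_mult mult_ac)
      qed
    qed
    then show ?case unfolding u_def .
  qed
qed

end

theorem theorem2p1:
  fixes r :: nat and a :: "nat \<Rightarrow> real" and \<delta> :: real
  assumes "r \<ge> 2"
    and "0 < \<delta>" and "\<delta> \<le> 1"
    and "filterlim (sum_sq a) at_top sequentially"
    and "(\<lambda>n. (a n)\<^sup>2) \<in> O[sequentially](\<lambda>n. sum_sq a n powr (1 - \<delta>))"
  shows "\<exists>(\<nu> :: (torus \<times> real) measure) (U :: torus \<times> real \<Rightarrow> torus)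
            (B :: real \<Rightarrow> torus \<times> real \<Rightarrow> real).
    prob_space \<nu> \<and>
    sets \<nu> = sets ((borel :: torus measure) \<Otimes>\<^sub>M restrict_space (borel :: real measure) {0..<1}) \<and>
    U \<in> measurable \<nu> borel \<and> distr \<nu> borel U = torus_measure \<and>
    standard_brownian_motion \<nu> B \<and>
    (\<forall>l < \<delta> / 32. AE \<omega> in \<nu>.
      (\<lambda>h. takagi r a (U \<omega> + to_torus h) - takagi r a (U \<omega>) - h * B (takagi_V r a (log_scale r h)) \<omega>)
        \<in> o[at 0](\<lambda>h. h * takagi_V r a (log_scale r h) powr (1/2 - l)))"
proof -
  obtain \<nu> :: "(torus \<times> real) measure" and G where sets: "sets \<nu> = sets ((borel :: torus measure) \<Otimes>\<^sub>M restrict_space (borel :: real measure) {0..<1})"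
    and G: "gaussian_family \<nu> G"
    using ex_gaussian_family by blast
  interpret gaussian_family \<nu> G by (rule G)
  interpret strong_approximation r a \<delta> \<nu> G
    by unfold_locales (use assms in auto)
  \<comment> \<open>U is built from the block increments of the Gaussian family alone, while the
    Brownian path uses all its coefficients.\<close>
  define U where "U \<omega> = to_torus (blocks.point 0 \<omega>)" for \<omega>
  have Um: "U \<in> measurable \<nu> borel"
    unfolding U_def by (rule measurable_compose[OF blocks.measurable_point measurable_to_torus])
  have "distr \<nu> borel U = distr (distr \<nu> borel (blocks.point 0)) borel to_torus"
    unfolding U_def[abs_def] by (subst distr_distr) (auto simp: comp_def)
  then have Ud: "distr \<nu> borel U = torus_measure" unfolding blocks.distr_point distr_unif_to_torus .
  have TV: "takagi_V r a n = V n" for n unfolding takagi_V_eq V_def \<alpha>_def[abs_def] ..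
  have "AE \<omega> in \<nu>. (\<lambda>h. takagi r a (U \<omega> + to_torus h) - takagi r a (U \<omega>) - h * clock.brown (takagi_V r a (log_scale r h)) \<omega>)
        \<in> o[at 0](\<lambda>h. h * takagi_V r a (log_scale r h) powr (1/2 - l))" if "l < \<delta> / 32" for l
    unfolding U_def takagi_to_torus TV by (rule takagi_approximation[OF that])
  then show ?thesis
    using prob_space_axioms sets Um Ud clock.standard_brownian_motion_brown by blast
qed

end
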